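(* Let $\varepsilon>0$, $\gamma\ge1$, $T>0$, and let $\mu_0^\varepsilon\in\mathcal{C}_c^\infty(\mathbb{R}^d\times\mathbb{R}^d)$ be a probability density with $\mathsf{Ent}(\mu_0^\varepsilon|\Gamma^{-\gamma}_\#\mathscr{N}^{2d})<\infty$. Let $(\mu_t^\varepsilon)_{t\in[0,T]}\subset\mathcal{P}(\mathbb{R}^d\times\mathbb{R}^d)$ be a solution of \[\partial_t\mu_t^\varepsilon+\gamma v\cdot\nabla_x\mu_t^\varepsilon+\gamma\mathsf{F}^\varepsilon(\cdot,\rho_t^\varepsilon)\cdot\nabla_v\mu_t^\varepsilon=\gamma^2\nabla_v\cdot(\nabla_v\mu_t^\varepsilon+v\mu_t^\varepsilon),\qquad\rho_t^\varepsilon=\pi^x_\#\mu_t^\varepsilon,\] with initial datum $\mu_0^\varepsilon$, satisfying $(1+|x|^2+|v|^2)(|\mu_t^\varepsilon|+|\nabla\mu_t^\varepsilon|)\in(L^1\cap L^\infty)(\mathbb{R}^d\times\mathbb{R}^d)$ for all $t\in[0,T]$. Further assume $\sup_{t\in[0,T]}|\mathsf{F}^\varepsilon(x,\rho_t^\varepsilon)|\le c_\Phi(1+|x|)+c_0$ for all $x$, for constants $c_\Phi,c_0>0$ independent of $\varepsilon>0$ and $\gamma>0$. Then for every $t\in[0,T]$, \[\mathsf{Ent}(\mu_t^\varepsilon|\Gamma^{-\gamma}_\#\mathscr{N}^{2d})+\alpha\gamma^2\int_0^t\mathcal{D}(\mu_r^\varepsilon)\,dr\le\mathsf{Ent}(\mu_0^\varepsilon|\Gamma^{-\gamma}_\#\mathscr{N}^{2d})e^{\lambda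 t}+\frac\beta\lambda(e^{\lambda t}-1)\] for some constants $\alpha,\beta,\lambda>0$ independent of $\varepsilon>0$ and $\gamma\ge1$. In particular, $\nabla_v\mu_t^\varepsilon+v\mu_t^\varepsilon\ll\mu_t^\varepsilon$ for almost every $t\in(0,T)$.
   Context: $\Gamma^\gamma(x,v)=(x+v/\gamma,v)$, $\Gamma^{-\gamma}(x,v)=(x-v/\gamma,v)$, $\pi^x(x,v)=x$, $\mathscr{N}^{2d}$ the standard Gaussian on $\mathbb{R}^{2d}$. $\mathsf{Ent}(\mu|\nu)=\int(d\mu/d\nu)\log(d\mu/d\nu)d\nu$ if $\mu\ll\nu$, else $+\infty$. $\mathcal{D}(\mu)=\iint_{\{\mu>0\}}\frac{|\nabla_v\mu+v\mu|^2}{\mu}dxdv$ if $\nabla_v\mu+v\mu\ll\mu$, and $+\infty$ otherwise. $\Phi:\mathbb{R}^d\to[0,\infty)$ locally Lipschitz with $|\nabla\Phi(x)|\le c_\Phi(1+|x|)$, $\nabla\Phi$ Lipschitz, and $\sup_x|\nabla\Phi|^re^{-\Phi}<\infty$ for $r\ge1$; $K$ an interaction potential. With $\delta_\varepsilon$ the standard mollifier, $\Phi^\varepsilon=\Phi\star\delta_\varepsilon$, $K^\varepsilon=K\star\delta_\varepsilon$ and $\mathsf{F}^\varepsilon(x,\rho)=-\nabla\Phi^\varepsilon(x)-(\nabla K^\varepsilon\star\rho)(x)$. *)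

theory Defs
  imports "HOL-Analysis.Analysis"
begin

definition pd :: "('a::euclidean_space \<Rightarrow> real) \<Rightarrow> 'a \<Rightarrow> 'a \<Rightarrow> real" where
  "pd f e z = frechet_derivative f (at z) e"

definition grad :: "('a::euclidean_space \<Rightarrow> real) \<Rightarrow> 'a \<Rightarrow> 'a" where
  "grad f z = (\<Sum>i\<in>Basis. pd f i z *\<^sub>R i)"

primrec Ck :: "nat \<Rightarrow> ('a::euclidean_space \<Rightarrow> real) \<Rightarrow> bool" where
  "Ck 0 f = continuous_on UNIV f"
| "Ck (Suc k) f = ((\<forall>x. f differentiable (at x)) \<and> (\<forall>e\<in>Basis. Ck k (\<lambda>x. pd f e x)))"

definition smooth :: "('a::euclidean_space \<Rightarrow> real) \<Rightarrow> bool" where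
  "smooth f \<longleftrightarrow> (\<forall>k. Ck k f)"

definition test_fun :: "('a::euclidean_space \<Rightarrow> real) \<Rightarrow> bool" where
  "test_fun f \<longleftrightarrow> smooth f \<and> bounded {x. f x \<noteq> 0}"

definition loc_int :: "('a::euclidean_space \<Rightarrow> 'b::{banach,second_countable_topology}) \<Rightarrow> bool" where
  "loc_int f \<longleftrightarrow> (\<forall>K. compact K \<longrightarrow> set_integrable lborel K f)"

definition weak_grad :: "('a::euclidean_space \<Rightarrow> real) \<Rightarrow> ('a \<Rightarrow> 'a) \<Rightarrow> bool" where
  "weak_grad f G \<longleftrightarrow> loc_int f \<and> loc_int G \<and>
     (\<forall>\<phi>. test_fun \<phi> \<longrightarrow> (\<forall>e\<in>Basis.
        (\<integral>z. f z * pd \<phi> e z \<partial>lborel) = - (\<integral>z. (G z \<bullet> e) * \<phi> z \<partial>lborel)))"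

type_synonym 'd ps = "(real^'d) \<times> (real^'d)"

definition grad_x :: "('d::finite ps \<Rightarrow> real) \<Rightarrow> 'd ps \<Rightarrow> real^'d" where
  "grad_x f z = (\<Sum>i\<in>Basis. pd f (i, 0) z *\<^sub>R i)"

definition grad_v :: "('d::finite ps \<Rightarrow> real) \<Rightarrow> 'd ps \<Rightarrow> real^'d" where
  "grad_v f z = (\<Sum>i\<in>Basis. pd f (0, i) z *\<^sub>R i)"

definition lap_v :: "('d::finite ps \<Rightarrow> real) \<Rightarrow> 'd ps \<Rightarrow> real" where
  "lap_v f z = (\<Sum>i\<in>Basis. pd (\<lambda>w. pd f (0, i) w) (0, i) z)"

definition Gamma_minus :: "real \<Rightarrow> 'd::finite ps \<Rightarrow> 'd ps" where
  "Gamma_minus \<gamma> z = (fst z - (1/\<gamma>) *\<^sub>R snd z, snd z)"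

definition gauss2d :: "'d::finite ps measure" where
  "gauss2d = density lborel
     (\<lambda>z. ennreal ((2*pi) powr (- real CARD('d)) * exp (- (norm z)\<^sup>2 / 2)))"

definition dens :: "('a::euclidean_space \<Rightarrow> real) \<Rightarrow> 'a measure" where
  "dens f = density lborel (\<lambda>z. ennreal (f z))"

definition Ent :: "'a measure \<Rightarrow> 'a measure \<Rightarrow> ereal" where
  "Ent M N = (if absolutely_continuous N M \<and> sets M = sets N then
      (let f = (\<lambda>z. enn2real (RN_deriv N M z)) in
        enn2ereal (\<integral>\<^sup>+z. ennreal (f z * ln (f z)) \<partial>N)
        - enn2ereal (\<integral>\<^sup>+z. ennreal (- (f z * ln (f z))) \<partial>N))
    else \<infinity>)"

text \<open>h is (the Lebesgue density of) the distribution grad_v mu + v mu.\<close>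
definition fp_flux :: "('d::finite ps \<Rightarrow> real) \<Rightarrow> ('d ps \<Rightarrow> real^'d) \<Rightarrow> bool" where
  "fp_flux \<mu> h \<longleftrightarrow> loc_int h \<and>
     (\<forall>\<phi>. test_fun \<phi> \<longrightarrow> (\<forall>i\<in>(Basis :: (real^'d) set).
        (\<integral>z. (h z \<bullet> i) * \<phi> z \<partial>lborel)
          = (\<integral>z. \<mu> z * (- pd \<phi> (0, i) z + (snd z \<bullet> i) * \<phi> z) \<partial>lborel)))"

text \<open>grad_v mu + v mu << mu (as measures): it is a measure with Lebesgue density h
  vanishing a.e. on {mu = 0}.\<close>
definition flux_ac :: "('d::finite ps \<Rightarrow> real) \<Rightarrow> bool" where
  "flux_ac \<mu> \<longleftrightarrow> (\<exists>h. fp_flux \<mu> h \<and> (AE z in lborel. \<mu> z = 0 \<longrightarrow> h z = 0))"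

definition Dfish :: "('d::finite ps \<Rightarrow> real) \<Rightarrow> ennreal" where
  "Dfish \<mu> = (if flux_ac \<mu> then
      (let h = (SOME h. fp_flux \<mu> h \<and> (AE z in lborel. \<mu> z = 0 \<longrightarrow> h z = 0)) in
        \<integral>\<^sup>+z\<in>{z. \<mu> z > 0}. ennreal ((norm (h z))\<^sup>2 / \<mu> z) \<partial>lborel)
    else \<infinity>)"

definition conv :: "('a::euclidean_space \<Rightarrow> real) \<Rightarrow> ('a \<Rightarrow> real) \<Rightarrow> 'a \<Rightarrow> real" where
  "conv f g x = (\<integral>y. f (x - y) * g y \<partial>lborel)"

definition bump :: "real^'d \<Rightarrow> real" where
  "bump x = (if norm x < 1 then exp (1 / ((norm x)\<^sup>2 - 1)) else 0)"

definition moll :: "real \<Rightarrow> real^'d::finite \<Rightarrow> real" where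
  "moll \<epsilon> x = \<epsilon> powr (- real CARD('d)) * bump (x /\<^sub>R \<epsilon>) / (\<integral>y. bump (y::real^'d) \<partial>lborel)"

definition Feps :: "real \<Rightarrow> (real^'d::finite \<Rightarrow> real) \<Rightarrow> (real^'d \<Rightarrow> real)
    \<Rightarrow> real^'d \<Rightarrow> (real^'d) measure \<Rightarrow> real^'d" where
  "Feps \<epsilon> \<Phi> K x \<rho> = - grad (conv \<Phi> (moll \<epsilon>)) x
      - (\<integral>y. grad (conv K (moll \<epsilon>)) (x - y) \<partial>\<rho>)"

definition prob_dens :: "('a::euclidean_space \<Rightarrow> real) \<Rightarrow> bool" where
  "prob_dens f \<longleftrightarrow> f \<in> borel_measurable lborel \<and> (\<forall>z. f z \<ge> 0)
     \<and> integrable lborel f \<and> (\<integral>z. f z \<partial>lborel) = 1"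

text \<open>Weak (distributional) solution on [0,T] of
  d_t mu + gamma v.grad_x mu + gamma F(.,rho).grad_v mu = gamma^2 div_v(grad_v mu + v mu),
  rho_t = (pi^x)_# mu_t, with initial datum mu0.\<close>
definition kfp_solution :: "real \<Rightarrow> real \<Rightarrow> (real^'d::finite \<Rightarrow> real) \<Rightarrow> (real^'d \<Rightarrow> real)
    \<Rightarrow> real \<Rightarrow> ('d ps \<Rightarrow> real) \<Rightarrow> (real \<Rightarrow> 'd ps \<Rightarrow> real) \<Rightarrow> bool" where
  "kfp_solution \<epsilon> \<gamma> \<Phi> K T \<mu>0 \<mu> \<longleftrightarrow>
     \<mu> 0 = \<mu>0 \<and> (\<forall>t\<in>{0..T}. prob_dens (\<mu> t)) \<and>
     (\<forall>\<phi>. test_fun \<phi> \<longrightarrow> (\<forall>t\<in>{0..T}.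
        (let g = (\<lambda>r z. \<mu> r z *
            (\<gamma> * (snd z \<bullet> grad_x \<phi> z)
             + \<gamma> * (Feps \<epsilon> \<Phi> K (fst z) (distr (dens (\<mu> r)) lborel fst) \<bullet> grad_v \<phi> z)
             + \<gamma>\<^sup>2 * (lap_v \<phi> z - snd z \<bullet> grad_v \<phi> z))) in
         (\<forall>r\<in>{0..T}. integrable lborel (g r)) \<and>
         set_integrable lborel {0..t} (\<lambda>r. \<integral>z. g r z \<partial>lborel) \<and>
         (\<integral>z. \<phi> z * \<mu> t z \<partial>lborel) = (\<integral>z. \<phi> z * \<mu>0 z \<partial>lborel)
            + (\<integral>r\<in>{0..t}. (\<integral>z. g r z \<partial>lborel) \<partial>lborel))))"

end

theory Submission imports Defs begin

text \<open>
  The reference density is \<open>(2 * pi) powr - d * exp (- h)\<close> with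
  \<open>h z = (norm (x + v / \<gamma>)\<^sup>2 + (norm v)\<^sup>2) / 2\<close>. Formally the entropy satisfies
  \<open>Ent' = - \<gamma>\<^sup>2 * D\<close> plus terms that come from the force and from the transport of \<open>h\<close>. Since \<open>x + v / \<gamma>\<close> is,
  up to noise, moved by the force only, these terms stay bounded in \<open>\<gamma>\<close>: Young's inequality absorbs them in half of
  the dissipation and in a multiple of the integral of \<open>h\<close>, which the entropy controls; Gronwall's inequality then
  gives the claim. Only the linear growth of the force enters, not its structure.

  The solution is merely weak, so this is done for \<open>cv (\<mu> t) k\<close> with a product kernel \<open>k\<close>. The transport term
  produces a commutator of size (velocity radius of \<open>k\<close>) times (\<open>L\<^sup>1\<close> norm of the position derivatives of \<open>k\<close>), which
  is made small by choosing the velocity radius after the position factor. The logarithm is regularised by a shift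
  \<open>\<kappa>\<close>; the resulting error vanishes with \<open>\<kappa>\<close> because the flux vanishes where the mollified density does. Fatou's
  lemma removes the mollification, and finiteness of the limiting dissipation gives the absolute continuity of the flux.
\<close>

section \<open>Smooth functions and test functions\<close>

text \<open>What keeps the bounds uniform in \<gamma> is a cancellation. Along transport, half of |x
  + v/\<gamma>|^2 changes at rate \<gamma> (x + v/\<gamma>) . v; the friction -\<gamma>^2 v changes
  it at exactly the opposite rate, so only the force and a noise term equal to the dimension
  survive. The commutators caused by mollification enter with the bound 1 and end up in \<beta>; the
  error that has to vanish is the one of the shifted logarithm.

  Two obstacles shape the rest. Integrability is assumed at each time without uniformity, so
  integrals over time and exchanges with space integrals rest on a fourth moment derived from the
  equation: a cubic weight dominates the entropy variable, and a velocity or a force costs one more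
  power. And the equation holds only in the weak sense, so it is tested with the kernel centred at
  z; this gives an integral equation in time at each z, a chain rule at each z, and integration in z
  only afterwards. The weak gradient identifies the limit of the mollified flux.\<close>

lemma pd_eq: "(f has_derivative f') (at z) \<Longrightarrow> pd f e z = f' e"
  unfolding pd_def using frechet_derivative_at by metis

lemma Ck_SucI:
  assumes "\<And>x. (f has_derivative f' x) (at x)" "\<And>e. e \<in> Basis \<Longrightarrow> Ck k (\<lambda>x. f' x e)"
  shows "Ck (Suc k) f"
  using assms by (auto simp: pd_eq[OF assms(1)] differentiable_def)

lemma Ck_Suc_has_derivative:
  assumes "Ck (Suc k) f"
  shows "(f has_derivative (\<lambda>h. pd f h x)) (at x)"
  using assms unfolding pd_def by (auto simp: frechet_derivative_works[symmetric] eta_contract_eq)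

lemma Ck_Suc_imp: "Ck (Suc k) f \<Longrightarrow> Ck k f"
proof (induction k arbitrary: f)
  case 0
  then show ?case
    by (auto intro!: differentiable_imp_continuous_on simp: differentiable_on_def intro: differentiable_at_withinI)
next
  case (Suc k)
  have "Ck (Suc k) (\<lambda>x. pd f e x)" if "e \<in> Basis" for e
    using Suc.prems that by (subst (asm) Ck.simps(2)) blast
  then have "Ck k (\<lambda>x. pd f e x)" if "e \<in> Basis" for e
    using Suc.IH that by blast
  then show ?case using Suc.prems by simp
qed

lemma Ck_const: "Ck k (\<lambda>_. c)"
proof (induction k arbitrary: c)
  case (Suc k)
  show ?case by (rule Ck_SucI[where f'="\<lambda>_ _. 0"]) (use Suc in auto)
qed auto

lemma Ck_add: "Ck k f \<Longrightarrow> Ck k g \<Longrightarrow> Ck k (\<lambda>x. f x + g x)"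
proof (induction k arbitrary: f g)
  case (Suc k)
  note d = Suc.prems[THEN Ck_Suc_has_derivative]
  show ?case
    by (rule Ck_SucI[OF has_derivative_add[OF d]]) (use Suc in auto)
qed (auto intro: continuous_intros)

lemma Ck_mult: "Ck k f \<Longrightarrow> Ck k g \<Longrightarrow> Ck k (\<lambda>x. f x * g x)"
proof (induction k arbitrary: f g)
  case (Suc k)
  note d = Suc.prems[THEN Ck_Suc_has_derivative]
  have "Ck k f" "Ck k g" using Suc.prems Ck_Suc_imp by blast+
  with Suc show ?case
    by (intro Ck_SucI[OF has_derivative_mult[OF d]] Ck_add) auto
qed (auto intro: continuous_intros)

lemma Ck_sum: "(\<And>i. i \<in> I \<Longrightarrow> Ck k (f i)) \<Longrightarrow> Ck k (\<lambda>x. \<Sum>i\<in>I. f i x)"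
  by (induction I rule: infinite_finite_induct) (auto intro: Ck_const Ck_add)

lemma Ck_linear:
  assumes "bounded_linear f" shows "Ck k f"
proof (cases k)
  case 0
  then show ?thesis using assms by (simp add: linear_continuous_on)
next
  case (Suc j)
  have "(f has_derivative f) (at x)" for x
    using assms by (simp add: bounded_linear_imp_has_derivative)
  then show ?thesis unfolding Suc
    by (rule Ck_SucI) (rule Ck_const)
qed

text \<open>Formulas for higher derivatives of a composition are avoided by inducting over a class
  \<open>G\<close> of outer functions that contains a derivative of each of its members: one use of
  the chain rule leaves a product of a member of \<open>G\<close> composed with \<open>q\<close> and
  a derivative of \<open>q\<close>.\<close>

lemma Ck_compose_real:
  assumes "\<And>g. g \<in> G \<Longrightarrow> \<exists>g'\<in>G. \<forall>s. (g has_real_derivative g' s) (at s)"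
    and "\<And>k. Ck k q" "g \<in> G"
  shows "Ck k (\<lambda>x. g (q x))"
  using \<open>g \<in> G\<close>
proof (induction k arbitrary: g)
  case 0
  obtain g' where "\<forall>s. (g has_real_derivative g' s) (at s)" using assms(1) 0 by blast
  then have "continuous_on UNIV g"
    by (meson DERIV_isCont continuous_at_imp_continuous_on)
  moreover have "continuous_on UNIV q" using assms(2)[of 0] by simp
  ultimately show ?case
    using continuous_on_compose2 by (metis Ck.simps(1) subset_UNIV)
next
  case (Suc k)
  obtain g' where g': "g' \<in> G" "\<And>s. (g has_real_derivative g' s) (at s)"
    using assms(1) Suc.prems by blast
  have "((\<lambda>x. g (q x)) has_derivative (\<lambda>h. g' (q x) * pd q h x)) (at x)" for x
    using has_derivative_compose[OF Ck_Suc_has_derivative[OF assms(2)]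
        g'(2)[unfolded has_field_derivative_def]] by simp
  then show ?case
  proof (rule Ck_SucI)
    fix e :: 'a assume "e \<in> Basis"
    then show "Ck k (\<lambda>x. g' (q x) * pd q e x)"
      using assms(2)[of "Suc k"] Suc.IH[OF g'(1)] by (intro Ck_mult) auto
  qed
qed

lemma Ck_reflect: "Ck k f \<Longrightarrow> Ck k (\<lambda>x. f (c - x))"
proof (induction k arbitrary: f)
  case 0
  then show ?case
    by (auto intro!: continuous_on_compose2[of UNIV f] continuous_intros)
next
  case (Suc k)
  have "((-) c has_derivative uminus) (at x)" for x :: 'a
    by (auto intro!: derivative_eq_intros)
  then have "((\<lambda>x. f (c - x)) has_derivative (\<lambda>h. pd f (-h) (c - x))) (at x)" for x
    using has_derivative_compose[OF _ Ck_Suc_has_derivative[OF Suc.prems], of "\<lambda>x. c - x" uminus x UNIV]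
    by blast
  then show ?case
  proof (rule Ck_SucI)
    fix e :: 'a assume e: "e \<in> Basis"
    have "pd f (-e) (c - x) = -1 * pd f e (c - x)" for x
      using linear_neg[OF has_derivative_linear[OF Ck_Suc_has_derivative[OF Suc.prems]], of e] by simp
    moreover have "Ck k (\<lambda>x. -1 * pd f e (c - x))"
      using Suc.IH[of "pd f e"] Suc.prems e by (intro Ck_mult Ck_const) (auto simp: eta_contract_eq)
    ultimately show "Ck k (\<lambda>x. pd f (- e) (c - x))" by simp
  qed
qed

text \<open>For n = 0 this is the classical function that is smooth but not analytic at 0. The
  powers of 1/s are built in because differentiation of exp(-1/s) produces them; they do not spoil
  the flatness at 0.\<close>

definition expinv :: "nat \<Rightarrow> real \<Rightarrow> real" where
  "expinv n s = (if s > 0 then exp (-1/s) / s^n else 0)"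

lemma expinv_nonneg: "0 \<le> expinv n s"
  by (simp add: expinv_def)

lemma expinv_pos: "0 < s \<Longrightarrow> 0 < expinv n s"
  by (simp add: expinv_def)

text \<open>A single term of the exponential series at 1/s, the one of index n + k, already beats
  the factor 1/s^n and leaves s^k. The free exponent k is taken as 2 for the derivative at 0 and as
  0 for the uniform bound n!.\<close>

lemma expinv_le:
  assumes "0 \<le> s" shows "expinv n s \<le> fact (n + k) * s^k"
proof (cases "s > 0")
  case True
  have "(1/s)^(n+k) / fact (n+k) \<le> exp (1/s)"
    using sum_le_suminf[OF summable_exp_generic[of "1/s"], of "{n+k}"] True
    unfolding exp_def by (simp add: divide_inverse mult.commute)
  moreover have "exp (-1/s) * exp (1/s) = 1" by (simp flip: exp_add)
  ultimately have "exp (-1/s) * ((1/s)^(n+k) / fact (n+k)) \<le> 1"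
    by (metis exp_ge_zero mult_left_mono)
  then have "exp (-1/s) \<le> fact (n+k) * s^(n+k)"
    using True by (simp add: field_simps power_one_over)
  then show ?thesis using True by (simp add: expinv_def field_simps power_add)
qed (use assms in \<open>auto simp: expinv_def\<close>)

lemma expinv_le_fact: "expinv n s \<le> fact n"
  using expinv_le[of s n 0] by (cases "s \<ge> 0") (auto simp: expinv_def)

text \<open>Only s = 0 needs the flatness: there the difference quotient is at most (n+2)! times the
  absolute value of the increment. Away from 0 the function agrees near s with an explicit formula
  or with 0.\<close>

lemma expinv_deriv:
  "(expinv n has_real_derivative (expinv (n+2) s - real n * expinv (n+1) s)) (at s)"
proof (cases "s = 0")
  case True
  have "((\<lambda>y. (expinv n y - expinv n 0) / (y - 0)) \<longlongrightarrow> 0) (at 0)"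
  proof (rule Lim_null_comparison)
    show "\<forall>\<^sub>F y in at 0. norm ((expinv n y - expinv n 0) / (y - 0)) \<le> fact (n+2) * \<bar>y\<bar>"
    proof (intro always_eventually allI)
      fix y :: real
      show "norm ((expinv n y - expinv n 0) / (y - 0)) \<le> fact (n+2) * \<bar>y\<bar>"
      proof (cases "y > 0")
        case True
        then show ?thesis using expinv_le[of y n 2] expinv_nonneg[of n y]
          by (simp add: expinv_def[of n 0] divide_le_eq power2_eq_square mult.assoc)
      next
        case False
        then have "expinv n y = 0" "expinv n 0 = 0" by (simp_all add: expinv_def)
        then show ?thesis by simp
      qed
    qed
    show "((\<lambda>y. fact (n + 2) * \<bar>y\<bar>) \<longlongrightarrow> 0) (at (0::real))"
      by (auto intro!: tendsto_eq_intros)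
  qed
  then show ?thesis using True by (simp add: has_field_derivative_iff expinv_def)
next
  case False
  show ?thesis
  proof (cases "s > 0")
    case True
    have "((\<lambda>s. exp (-1/s) / s^n) has_real_derivative (expinv (n+2) s - real n * expinv (n+1) s)) (at s)"
    proof -
      have 1: "((\<lambda>s. exp (-1/s)) has_real_derivative exp (-1/s) / s\<^sup>2) (at s)"
        using True by (auto intro!: derivative_eq_intros simp: power2_eq_square divide_simps)
      have "((\<lambda>s. exp (-1/s) / s^n) has_real_derivative
          (exp (-1/s) / s\<^sup>2 * s^n - exp (-1/s) * (real n * s^(n-1))) / (s^n * s^n)) (at s)"
        using DERIV_divide[OF 1 DERIV_pow[of n s UNIV]] True by simp
      moreover have "(exp (-1/s) / s\<^sup>2 * s^n - exp (-1/s) * (real n * s^(n-1))) / (s^n * s^n)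
          = expinv (n+2) s - real n * expinv (n+1) s"
        using True by (cases n) (simp_all add: expinv_def field_simps power2_eq_square)
      ultimately show ?thesis by simp
    qed
    moreover have "eventually (\<lambda>y. expinv n y = exp (-1/y) / y^n) (nhds s)"
      using eventually_nhds_in_open[of "{0<..}" s] True
      by (auto elim!: eventually_mono simp: expinv_def)
    ultimately show ?thesis by (simp add: DERIV_cong_ev)
  next
    case False
    with \<open>s \<noteq> 0\<close> have "eventually (\<lambda>y. expinv n y = 0) (nhds s)"
      using eventually_nhds_in_open[of "{..<0}" s]
      by (auto elim!: eventually_mono simp: expinv_def)
    then have "(expinv n has_real_derivative 0) (at s)" by (simp add: DERIV_cong_ev)
    then show ?thesis using False by (simp add: expinv_def)
  qed
qed

lemma Ck_expinv:
  assumes "\<And>k. Ck k q" shows "Ck k (\<lambda>x. expinv n (q x))"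
proof -
  \<comment> \<open>Linear combinations of the \<open>expinv n\<close> are coded as coefficient
    lists, and \<open>dl\<close> is their formal derivative. They form the class closed under
    differentiation that the chain rule induction asks for.\<close>
  define lc where "lc xs s = (\<Sum>(c, n)\<leftarrow>xs. c * expinv n s)" for xs :: "(real \<times> nat) list" and s
  define dl where "dl = (\<lambda>xs :: (real \<times> nat) list. concat (map (\<lambda>(c, n). [(c, n+2), (- c * real n, n+1)]) xs))"
  have "(lc xs has_real_derivative lc (dl xs) s) (at s)" for xs s
  proof (induction xs)
    case (Cons p xs)
    obtain c n where p: "p = (c, n)" by (cases p)
    have "((\<lambda>s. c * expinv n s + lc xs s) has_real_derivative
        c * (expinv (n+2) s - real n * expinv (n+1) s) + lc (dl xs) s) (at s)"
      by (intro DERIV_add DERIV_cmult expinv_deriv Cons)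
    moreover have "lc (p # xs) = (\<lambda>s. c * expinv n s + lc xs s)"
      by (simp add: lc_def p fun_eq_iff)
    moreover have "lc (dl (p # xs)) s = c * (expinv (n+2) s - real n * expinv (n+1) s) + lc (dl xs) s"
      by (simp add: lc_def dl_def p right_diff_distrib)
    ultimately show ?case by simp
  qed (simp add: lc_def dl_def)
  then have "\<exists>g'\<in>range lc. \<forall>s. (g has_real_derivative g' s) (at s)" if "g \<in> range lc" for g
    using that by blast
  moreover have "expinv n \<in> range lc"
    by (rule image_eqI[of _ _ "[(1, n)]"]) (simp_all add: lc_def fun_eq_iff)
  ultimately show ?thesis using Ck_compose_real[of "range lc" q "expinv n" k] assms by blast
qed

lemma smooth_const: "smooth (\<lambda>_. c)" by (simp add: smooth_def Ck_const)
lemma smooth_add: "smooth f \<Longrightarrow> smooth g \<Longrightarrow> smooth (\<lambda>x. f x + g x)" by (simp add: smooth_def Ck_add)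
lemma smooth_mult: "smooth f \<Longrightarrow> smooth g \<Longrightarrow> smooth (\<lambda>x. f x * g x)" by (simp add: smooth_def Ck_mult)
lemma smooth_sum: "(\<And>i. i \<in> I \<Longrightarrow> smooth (f i)) \<Longrightarrow> smooth (\<lambda>x. \<Sum>i\<in>I. f i x)"
  by (simp add: smooth_def Ck_sum)
lemma smooth_linear: "bounded_linear f \<Longrightarrow> smooth f" by (simp add: smooth_def Ck_linear)
lemma smooth_reflect: "smooth f \<Longrightarrow> smooth (\<lambda>x. f (c - x))" by (simp add: smooth_def Ck_reflect)
lemma smooth_expinv: "smooth q \<Longrightarrow> smooth (\<lambda>x. expinv n (q x))" by (simp add: smooth_def Ck_expinv)
lemma smooth_diff: "smooth f \<Longrightarrow> smooth g \<Longrightarrow> smooth (\<lambda>x. f x - g x)"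
  using smooth_add[OF _ smooth_mult[OF smooth_const[of "-1"]], of f g] by simp
lemma smooth_power: "smooth f \<Longrightarrow> smooth (\<lambda>x. f x ^ n)"
  by (induction n) (auto intro: smooth_const smooth_mult)

lemma smooth_norm2:
  assumes "bounded_linear g"
  shows "smooth (\<lambda>x. (norm (g x :: 'b::euclidean_space))\<^sup>2)"
proof -
  have "smooth (\<lambda>x. g x \<bullet> b)" for b
    using smooth_linear[OF bounded_linear_compose[OF bounded_linear_inner_left assms]] .
  then have "smooth (\<lambda>x. \<Sum>b\<in>Basis. (g x \<bullet> b)^2)" by (intro smooth_sum smooth_power)
  moreover have "(norm (g x))\<^sup>2 = (\<Sum>b\<in>Basis. (g x \<bullet> b)^2)" for x
    unfolding power2_norm_eq_inner by (subst euclidean_inner) (simp add: power2_eq_square)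
  ultimately show ?thesis by simp
qed

lemma smooth_pd:
  assumes "smooth f" "e \<in> Basis" shows "smooth (pd f e)"
proof -
  have "Ck (Suc k) f" for k using assms(1) unfolding smooth_def by blast
  then show ?thesis using assms(2) unfolding smooth_def by (simp add: eta_contract_eq)
qed

lemma smooth_has_derivative: "smooth f \<Longrightarrow> (f has_derivative (\<lambda>h. pd f h x)) (at x)"
  unfolding smooth_def using Ck_Suc_has_derivative by blast

lemma smooth_continuous: "smooth f \<Longrightarrow> continuous_on UNIV f"
  unfolding smooth_def using Ck.simps(1) by metis

lemma smooth_pd_reflect:
  assumes "smooth f" shows "pd (\<lambda>w. f (c - w)) e x = - pd f e (c - x)"
proof -
  have "((-) c has_derivative uminus) (at x)"
    by (auto intro!: derivative_eq_intros)
  then have "((\<lambda>x. f (c - x)) has_derivative (\<lambda>h. pd f (-h) (c - x))) (at x)"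
    using has_derivative_compose[OF _ smooth_has_derivative[OF assms], of "\<lambda>x. c - x" uminus x UNIV]
    by blast
  then have "pd (\<lambda>w. f (c - w)) e x = pd f (-e) (c - x)" by (rule pd_eq)
  also have "\<dots> = - pd f e (c - x)"
    using linear_neg[OF has_derivative_linear[OF smooth_has_derivative[OF assms]]] .
  finally show ?thesis .
qed

lemma smooth_pd_sum:
  assumes "smooth f" shows "pd f h x = (\<Sum>b\<in>Basis. pd f b x * (h \<bullet> b))"
proof -
  have l: "linear (\<lambda>h. pd f h x)"
    using has_derivative_linear[OF smooth_has_derivative[OF assms]] .
  have "pd f h x = pd f (\<Sum>b\<in>Basis. (h \<bullet> b) *\<^sub>R b) x" by (simp add: euclidean_representation)
  also have "\<dots> = (\<Sum>b\<in>Basis. pd f b x * (h \<bullet> b))"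
    by (simp add: linear_sum[OF l] linear_scale[OF l] mult.commute)
  finally show ?thesis .
qed

section \<open>Test functions: support, uniform bounds and second-order remainder\<close>

lemma test_fun_smooth: "test_fun f \<Longrightarrow> smooth f" by (simp add: test_fun_def)

lemma test_fun_support:
  assumes "test_fun f"
  obtains R where "R > 0" "\<And>z. norm z > R \<Longrightarrow> f z = 0"
proof -
  obtain R where "\<forall>z\<in>{x. f x \<noteq> 0}. norm z \<le> R" using assms unfolding test_fun_def bounded_iff by blast
  then show ?thesis by (intro that[of "max R 1"]) (auto simp: not_le[symmetric])
qed

lemma test_funI:
  assumes "smooth f" "\<And>z. norm z > R \<Longrightarrow> f z = 0" shows "test_fun f"
proof -
  have "norm z \<le> R" if "f z \<noteq> 0" for z using assms(2)[of z] that by (meson not_le)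
  then show ?thesis using assms(1) unfolding test_fun_def bounded_iff by blast
qed

lemma pd_zero_outside:
  assumes "\<And>z. norm z > R \<Longrightarrow> f z = 0" "norm z > R"
  shows "pd f e z = 0"
proof -
  have "(f has_derivative (\<lambda>_. 0)) (at z)"
  proof (rule has_derivative_transform_within_open[where f="\<lambda>_. 0"])
    show "open {z. norm z > R}" by (intro open_Collect_less continuous_intros)
  qed (use assms in auto)
  then show ?thesis by (rule pd_eq)
qed

lemma test_fun_pd: "test_fun f \<Longrightarrow> e \<in> Basis \<Longrightarrow> test_fun (pd f e)"
  by (metis pd_zero_outside smooth_pd test_funI test_fun_smooth test_fun_support)

lemma test_fun_mult:
  assumes "test_fun f" "smooth g" shows "test_fun (\<lambda>z. g z * f z)"
proof -
  obtain R where "\<And>z. norm z > R \<Longrightarrow> f z = 0" using test_fun_support[OF assms(1)] by blast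
  then show ?thesis
    using assms by (intro test_funI[where R=R] smooth_mult) (auto simp: test_fun_def)
qed

lemma test_fun_reflect:
  assumes "test_fun f" shows "test_fun (\<lambda>w. f (c - w))"
proof -
  obtain R where R: "\<And>z. norm z > R \<Longrightarrow> f z = 0" using test_fun_support[OF assms(1)] by blast
  show ?thesis
  proof (rule test_funI[where R="R + norm c"])
    show "f (c - z) = 0" if "R + norm c < norm z" for z
      using R[of "c - z"] that norm_triangle_sub[of z c] norm_minus_commute[of z c] by linarith
  qed (use assms in \<open>auto intro: smooth_reflect test_fun_smooth\<close>)
qed

lemma test_fun_bounded:
  assumes "test_fun f" obtains C where "C > 0" "\<And>z. \<bar>f z\<bar> \<le> C"
proof -
  obtain R where R: "R > 0" "\<And>z. norm z > R \<Longrightarrow> f z = 0" using test_fun_support[OF assms(1)] by blast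
  have "bounded (f ` cball 0 R)"
    by (intro compact_imp_bounded compact_continuous_image)
      (use smooth_continuous[OF test_fun_smooth[OF assms]] continuous_on_subset in auto)
  then obtain C where "\<forall>z\<in>cball 0 R. \<bar>f z\<bar> \<le> C" unfolding bounded_iff by auto
  then have C: "\<And>z. norm z \<le> R \<Longrightarrow> \<bar>f z\<bar> \<le> C" by auto
  have "\<bar>f z\<bar> \<le> max C 1" for z
    using R(2)[of z] C[of z] by (cases "norm z \<le> R") auto
  then show ?thesis using that[of "max C 1"] by simp
qed

lemma test_fun_integrable:
  assumes "test_fun f" shows "integrable lborel f"
proof -
  obtain R where R: "R > 0" "\<And>z. norm z > R \<Longrightarrow> f z = 0" using test_fun_support[OF assms(1)] by blast
  have "integrable lborel (\<lambda>x. indicator (cball 0 R) x *\<^sub>R f x)"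
    by (rule borel_integrable_compact)
      (use smooth_continuous[OF test_fun_smooth[OF assms]] continuous_on_subset in auto)
  moreover have "(\<lambda>x. indicator (cball 0 R) x *\<^sub>R f x) = f"
    using R by (auto simp: indicator_def fun_eq_iff)
  ultimately show ?thesis by simp
qed

lemma test_fun_pd_bounded:
  assumes "test_fun f" obtains C where "C > 0" "\<And>h z. \<bar>pd f h z\<bar> \<le> C * norm h"
proof -
  have "\<exists>C. \<forall>z. \<bar>pd f e z\<bar> \<le> C" if "e \<in> Basis" for e
    using test_fun_bounded[OF test_fun_pd[OF assms that]] by metis
  then obtain C where C: "\<And>e z. e \<in> Basis \<Longrightarrow> \<bar>pd f e z\<bar> \<le> C e" by metis
  have *: "\<bar>pd f h z\<bar> \<le> (\<Sum>e\<in>Basis. \<bar>C e\<bar>) * norm h" for h z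
  proof -
    have "\<bar>pd f h z\<bar> \<le> (\<Sum>b\<in>Basis. \<bar>pd f b z * (h \<bullet> b)\<bar>)"
      unfolding smooth_pd_sum[OF test_fun_smooth[OF assms], of h] by (rule sum_abs)
    also have "\<dots> \<le> (\<Sum>b\<in>Basis. \<bar>C b\<bar> * norm h)"
      unfolding abs_mult using order_trans[OF C abs_ge_self] Basis_le_norm
      by (intro sum_mono mult_mono) auto
    finally show ?thesis by (simp add: sum_distrib_right)
  qed
  show ?thesis
  proof (rule that[of "(\<Sum>e\<in>Basis. \<bar>C e\<bar>) + 1"])
    show "\<bar>pd f h z\<bar> \<le> ((\<Sum>e\<in>Basis. \<bar>C e\<bar>) + 1) * norm h" for h z
      using *[of h z] norm_ge_zero[of h] unfolding distrib_right by linarith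
  qed (simp add: add_nonneg_pos sum_nonneg)
qed

lemma test_fun_Lipschitz:
  assumes "test_fun f" obtains C where "C > 0" "\<And>x y. \<bar>f x - f y\<bar> \<le> C * norm (x - y)"
proof -
  obtain C where C: "C > 0" "\<And>h z. \<bar>pd f h z\<bar> \<le> C * norm h" using test_fun_pd_bounded[OF assms] by metis
  have "norm (f x - f y) \<le> C * norm (x - y)" for x y
  proof (rule differentiable_bound[where S=UNIV and f'="\<lambda>x h. pd f h x"])
    show "onorm (\<lambda>h. pd f h x) \<le> C" for x
      by (rule onorm_bound) (use C in auto)
  qed (use smooth_has_derivative[OF test_fun_smooth[OF assms]] in auto)
  then show ?thesis using that[of C] C by auto
qed

text \<open>The mean value inequality is applied to f minus its linearisation at z on the ball of
  radius |h|, where the derivative of the difference is at most L |h| because the partial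
  derivatives of a test function are Lipschitz. The constant does not depend on z, which later
  permits differentiation under a convolution integral.\<close>

lemma test_fun_Taylor:
  assumes "test_fun f"
  obtains C where "C > 0" "\<And>z h. \<bar>f (z + h) - f z - pd f h z\<bar> \<le> C * (norm h)\<^sup>2"
proof -
  have "\<exists>C>0. \<forall>x y. \<bar>pd f e x - pd f e y\<bar> \<le> C * norm (x - y)" if "e \<in> Basis" for e
    using test_fun_Lipschitz[OF test_fun_pd[OF assms that]] by metis
  then obtain C where C: "\<And>e. e \<in> Basis \<Longrightarrow> C e > 0"
    "\<And>e x y. e \<in> Basis \<Longrightarrow> \<bar>pd f e x - pd f e y\<bar> \<le> C e * norm (x - y)" by metis
  define L where "L = (\<Sum>e\<in>Basis. C e)"
  have L: "L > 0" unfolding L_def by (rule sum_pos) (use C in auto)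
  have D: "\<bar>pd f h x - pd f h y\<bar> \<le> L * norm (x - y) * norm h" for h x y
  proof -
    have "pd f h x - pd f h y = (\<Sum>b\<in>Basis. (pd f b x - pd f b y) * (h \<bullet> b))"
      unfolding smooth_pd_sum[OF test_fun_smooth[OF assms], of h] sum_subtractf[symmetric]
      by (simp add: left_diff_distrib)
    also have "\<bar>\<dots>\<bar> \<le> (\<Sum>b\<in>Basis. \<bar>(pd f b x - pd f b y) * (h \<bullet> b)\<bar>)" by (rule sum_abs)
    also have "\<dots> \<le> (\<Sum>b\<in>Basis. (C b * norm (x - y)) * norm h)"
      unfolding abs_mult using C Basis_le_norm
      by (intro sum_mono mult_mono) (auto simp: less_imp_le)
    finally show ?thesis by (simp add: sum_distrib_right L_def)
  qed
  show ?thesis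
  proof (rule that[of L])
    fix z h
    define g where "g w = f w - pd f w z" for w
    note fd = smooth_has_derivative[OF test_fun_smooth[OF assms]]
    have lin: "bounded_linear (\<lambda>h. pd f h z)" using has_derivative_bounded_linear[OF fd] .
    have "norm (g (z + h) - g z) \<le> (L * norm h) * norm (z + h - z)"
    proof (rule differentiable_bound[where S="cball z (norm h)" and f'="\<lambda>x h. pd f h x - pd f h z"])
      show "(g has_derivative (\<lambda>h. pd f h x - pd f h z)) (at x within cball z (norm h))" for x
        unfolding g_def by (intro has_derivative_diff has_derivative_at_withinI[OF fd]
            bounded_linear_imp_has_derivative lin)
      show "onorm (\<lambda>h. pd f h x - pd f h z) \<le> L * norm h" if "x \<in> cball z (norm h)" for x
      proof (rule onorm_bound)
        show "norm (pd f k x - pd f k z) \<le> L * norm h * norm k" for k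
        proof -
          have "L * norm (x - z) * norm k \<le> L * norm h * norm k"
            using that L by (intro mult_right_mono mult_left_mono) (auto simp: dist_norm norm_minus_commute)
          with D[of k x z] show ?thesis by simp
        qed
      qed (use L in auto)
    qed (auto simp: dist_norm)
    moreover have "g (z + h) - g z = f (z + h) - f z - pd f h z"
      unfolding g_def using linear_add[OF bounded_linear.linear[OF lin], of z h] by simp
    ultimately show "\<bar>f (z + h) - f z - pd f h z\<bar> \<le> L * (norm h)\<^sup>2" by (simp add: power2_eq_square mult.assoc)
  qed (rule L)
qed

section \<open>Translations and integration by parts\<close>

lemma lborel_distr_minus: "distr lborel borel (\<lambda>z. c - z) = (lborel :: 'a::euclidean_space measure)"
  using lborel_affine[of "-1" c] by (simp add: density_1)

lemma lborel_distr_plus': "distr lborel borel (\<lambda>z. z + c) = (lborel :: 'a::euclidean_space measure)"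
  using lborel_distr_plus[of c] by (simp add: add.commute[of _ c])

lemma nn_integral_lborel_translate:
  fixes f :: "'a::euclidean_space \<Rightarrow> ennreal"
  assumes [measurable]: "f \<in> borel_measurable borel"
  shows "(\<integral>\<^sup>+z. f (z + c) \<partial>lborel) = (\<integral>\<^sup>+z. f z \<partial>lborel)"
  by (subst (2) lborel_distr_plus'[of c, symmetric]) (simp add: nn_integral_distr)

lemma nn_integral_lborel_minus:
  fixes f :: "'a::euclidean_space \<Rightarrow> ennreal"
  assumes [measurable]: "f \<in> borel_measurable borel"
  shows "(\<integral>\<^sup>+z. f (c - z) \<partial>lborel) = (\<integral>\<^sup>+z. f z \<partial>lborel)"
  by (subst (2) lborel_distr_minus[of c, symmetric]) (simp add: nn_integral_distr)

lemma integrable_lborel_translate: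
  fixes f :: "'a::euclidean_space \<Rightarrow> 'b::{banach, second_countable_topology}"
  assumes f: "integrable lborel f"
  shows "integrable lborel (\<lambda>z. f (z + c))"
proof -
  have [measurable]: "f \<in> borel_measurable borel" using f by auto
  have "integrable (distr lborel borel (\<lambda>z. z + c)) f" using f by (simp add: lborel_distr_plus')
  then show ?thesis by (simp add: integrable_distr_eq)
qed

lemma integral_lborel_translate:
  fixes f :: "'a::euclidean_space \<Rightarrow> 'b::{banach, second_countable_topology}"
  assumes [measurable]: "f \<in> borel_measurable borel"
  shows "(\<integral>z. f (z + c) \<partial>lborel) = (\<integral>z. f z \<partial>lborel)"
  by (subst (2) lborel_distr_plus'[of c, symmetric]) (simp add: integral_distr)

lemma integrable_lborel_minus:
  fixes f :: "'a::euclidean_space \<Rightarrow> 'b::{banach, second_countable_topology}"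
  assumes f: "integrable lborel f"
  shows "integrable lborel (\<lambda>z. f (c - z))"
proof -
  have [measurable]: "f \<in> borel_measurable borel" using f by auto
  have "integrable (distr lborel borel (\<lambda>z. c - z)) f" using f by (simp add: lborel_distr_minus)
  then show ?thesis by (simp add: integrable_distr_eq)
qed

lemma integral_lborel_minus:
  fixes f :: "'a::euclidean_space \<Rightarrow> 'b::{banach, second_countable_topology}"
  assumes [measurable]: "f \<in> borel_measurable borel"
  shows "(\<integral>z. f (c - z) \<partial>lborel) = (\<integral>z. f z \<partial>lborel)"
  by (subst (2) lborel_distr_minus[of c, symmetric]) (simp add: integral_distr)

text \<open>Translation invariance replaces boundary terms: g(z + e) - g(z) has integral 0, and by
  the fundamental theorem it is the average of the derivative over the segment from z to z + e.
  Exchanging the integrals and translating back gives the integral of the derivative itself, so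
  integrability takes the place of decay at infinity.\<close>

lemma integral_directional_derivative_0:
  fixes g g' :: "'a::euclidean_space \<Rightarrow> real"
  assumes d: "\<And>z. (g has_derivative (\<lambda>h. D h z)) (at z)"
    and c: "continuous_on UNIV (D e)"
    and i: "integrable lborel g" "integrable lborel (D e)"
  shows "(\<integral>z. D e z \<partial>lborel) = 0"
proof -
  have [measurable]: "D e \<in> borel_measurable borel"
    using c by (rule borel_measurable_continuous_onI)
  have dt: "((\<lambda>t. g (z + t *\<^sub>R e)) has_real_derivative D e (z + t *\<^sub>R e)) (at t)" for z t
  proof -
    have "((\<lambda>t. z + t *\<^sub>R e) has_derivative (\<lambda>h. h *\<^sub>R e)) (at t)"
      by (auto intro!: derivative_eq_intros)
    then have "((\<lambda>t. g (z + t *\<^sub>R e)) has_derivative (\<lambda>h. D (h *\<^sub>R e) (z + t *\<^sub>R e))) (at t)"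
      using has_derivative_compose[OF _ d] by blast
    moreover have "D (h *\<^sub>R e) (z + t *\<^sub>R e) = D e (z + t *\<^sub>R e) * h" for h
      using linear_scale[OF has_derivative_linear[OF d]] by (simp add: mult.commute)
    ultimately show ?thesis by (simp add: has_field_derivative_def)
  qed
  have cont: "isCont (\<lambda>t. D e (z + t *\<^sub>R e)) t" for z t
    by (intro continuous_intros continuous_on_interior[OF c, THEN isCont_o2[rotated]]) auto
  have ftc: "(\<integral>t. D e (z + t *\<^sub>R e) * indicator {0..1} t \<partial>lborel) = g (z + e) - g z" for z
    using integral_FTC_Icc_real[of 0 1 "\<lambda>t. g (z + t *\<^sub>R e)" "\<lambda>t. D e (z + t *\<^sub>R e)"] dt cont by simp
  have int: "integrable (lborel \<Otimes>\<^sub>M lborel) (\<lambda>(t, z). D e (z + t *\<^sub>R e) * indicator {0..1::real} t)"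
  proof (rule lborel_pair.Fubini_integrable)
    have n: "(\<integral>z. norm (D e (z + t *\<^sub>R e)) \<partial>lborel) = (\<integral>z. norm (D e z) \<partial>lborel)" for t
      by (rule integral_lborel_translate[of "\<lambda>z. norm (D e z)"]) measurable
    have "integrable lborel (\<lambda>t. (\<integral>z. norm (D e z) \<partial>lborel) * indicator {0..1::real} t)"
      by simp
    then show "integrable lborel (\<lambda>t. \<integral>z. norm (case (t, z) of (t, z) \<Rightarrow> D e (z + t *\<^sub>R e) * indicator {0..1::real} t) \<partial>lborel)"
      by (simp add: abs_mult n[simplified])
    show "AE t in lborel. integrable lborel (\<lambda>z. case (t, z) of (t, z) \<Rightarrow> D e (z + t *\<^sub>R e) * indicator {0..1::real} t)"
      using integrable_lborel_translate[OF i(2)] by simp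
  qed measurable
  have "0 = (\<integral>z. g (z + e) - g z \<partial>lborel)"
    using i integral_lborel_translate[of g e] integrable_lborel_translate[OF i(1)]
    by (subst Bochner_Integration.integral_diff) auto
  also have "\<dots> = (\<integral>z. \<integral>t. D e (z + t *\<^sub>R e) * indicator {0..1} t \<partial>lborel \<partial>lborel)"
    by (simp add: ftc)
  also have "\<dots> = (\<integral>t. \<integral>z. D e (z + t *\<^sub>R e) * indicator {0..1} t \<partial>lborel \<partial>lborel)"
    using lborel_pair.Fubini_integral[OF int] by simp
  also have "\<dots> = (\<integral>t. (\<integral>z. D e z \<partial>lborel) * indicator {0..1::real} t \<partial>lborel)"
    by (simp add: integral_lborel_translate)
  also have "\<dots> = (\<integral>z. D e z \<partial>lborel)" by simp
  finally show ?thesis by simp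
qed

lemma integration_by_parts:
  fixes p q :: "'a::euclidean_space \<Rightarrow> real"
  assumes dp: "\<And>z. (p has_derivative (\<lambda>h. P h z)) (at z)" and dq: "\<And>z. (q has_derivative (\<lambda>h. Q h z)) (at z)"
    and c: "continuous_on UNIV (P e)" "continuous_on UNIV (Q e)"
    and i: "integrable lborel (\<lambda>z. p z * q z)" "integrable lborel (\<lambda>z. P e z * q z)" "integrable lborel (\<lambda>z. p z * Q e z)"
  shows "(\<integral>z. p z * Q e z \<partial>lborel) = - (\<integral>z. P e z * q z \<partial>lborel)"
proof -
  have cpq: "continuous_on UNIV p" "continuous_on UNIV q"
    using dp dq by (auto intro!: continuous_at_imp_continuous_on has_derivative_continuous)
  have "(\<integral>z. p z * Q e z + P e z * q z \<partial>lborel) = 0"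
    by (rule integral_directional_derivative_0[where g="\<lambda>z. p z * q z" and D="\<lambda>h z. p z * Q h z + P h z * q z"])
      (use c cpq i in \<open>auto intro!: has_derivative_mult[OF dp dq] continuous_intros\<close>)
  then show ?thesis using i by (simp add: Bochner_Integration.integral_add)
qed

text \<open>The functions for which translation is continuous in the mean are closed under L1
  limits: of three errors below e/4, the two approximation errors are equal by translation
  invariance. This lets indicators of measurable sets be approximated by indicators of open
  sets.\<close>

lemma L1_translation_close:
  fixes f :: "'a::euclidean_space \<Rightarrow> 'b::{banach, second_countable_topology}"
  assumes f: "integrable lborel f"
    and ap: "\<And>e. 0 < e \<Longrightarrow> \<exists>g. integrable lborel g \<and> (\<integral>z. norm (f z - g z) \<partial>lborel) \<le> e \<and>
         (\<lambda>n. \<integral>z. norm (g (z + w n) - g z) \<partial>lborel) \<longlonglongrightarrow> 0"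
  shows "(\<lambda>n. \<integral>z. norm (f (z + w n) - f z) \<partial>lborel) \<longlonglongrightarrow> 0"
proof (rule LIMSEQ_I)
  fix e :: real assume "0 < e"
  then obtain g where g: "integrable lborel g" "(\<integral>z. norm (f z - g z) \<partial>lborel) \<le> e / 4"
    "(\<lambda>n. \<integral>z. norm (g (z + w n) - g z) \<partial>lborel) \<longlonglongrightarrow> 0"
    using ap[of "e/4"] by auto
  obtain N where N: "\<And>n. n \<ge> N \<Longrightarrow> norm (\<integral>z. norm (g (z + w n) - g z) \<partial>lborel) < e / 4"
    using LIMSEQ_D[OF g(3), of "e/4"] \<open>0 < e\<close> by auto
  have [measurable]: "f \<in> borel_measurable borel" "g \<in> borel_measurable borel" using f g by auto
  have "norm ((\<integral>z. norm (f (z + w n) - f z) \<partial>lborel) - 0) < e" if "n \<ge> N" for n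
  proof -
    note ft = integrable_lborel_translate[OF f, of "w n"] integrable_lborel_translate[OF g(1), of "w n"]
    have "(\<integral>z. norm (f (z + w n) - f z) \<partial>lborel) \<le>
        (\<integral>z. norm (f (z + w n) - g (z + w n)) + norm (g (z + w n) - g z) + norm (f z - g z) \<partial>lborel)"
    proof (rule integral_mono)
      show "norm (f (z + w n) - f z) \<le> norm (f (z + w n) - g (z + w n)) + norm (g (z + w n) - g z) + norm (f z - g z)" for z
        using norm_triangle_ineq[of "f (z + w n) - g (z + w n)" "g (z + w n) - f z"]
          norm_triangle_ineq[of "g (z + w n) - g z" "g z - f z"] norm_minus_commute[of "g z" "f z"] by simp
    qed (use f g ft in \<open>auto intro!: Bochner_Integration.integrable_add integrable_norm Bochner_Integration.integrable_diff\<close>)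
    also have "\<dots> = (\<integral>z. norm (f (z + w n) - g (z + w n)) \<partial>lborel) + (\<integral>z. norm (g (z + w n) - g z) \<partial>lborel)
         + (\<integral>z. norm (f z - g z) \<partial>lborel)"
      using f g ft by simp
    also have "(\<integral>z. norm (f (z + w n) - g (z + w n)) \<partial>lborel) = (\<integral>z. norm (f z - g z) \<partial>lborel)"
      by (rule integral_lborel_translate[of "\<lambda>z. norm (f z - g z)"]) measurable
    also have "(\<integral>z. norm (f z - g z) \<partial>lborel) + (\<integral>z. norm (g (z + w n) - g z) \<partial>lborel) + (\<integral>z. norm (f z - g z) \<partial>lborel) < e"
      using g(2) N[OF that] \<open>0 < e\<close> by auto
    finally show ?thesis by simp
  qed
  then show "\<exists>N. \<forall>n\<ge>N. norm ((\<integral>z. norm (f (z + w n) - f z) \<partial>lborel) - 0) < e" by blast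
qed

text \<open>Indicators of open sets are lower semicontinuous, so the positive part of 1_U(z) - 1_U(z
  + w) is controlled pointwise: it tends to 0 and is dominated by 1_U. The negative part has the
  same integral, because U and its translate have the same measure; hence the factor 2.\<close>

lemma L1_translation_open:
  fixes U :: "'a::euclidean_space set"
  assumes U: "open U" "emeasure lborel U < \<infinity>" and w: "w \<longlonglongrightarrow> 0"
  shows "(\<lambda>n. \<integral>z. \<bar>indicator U (z + w n) - indicator U z\<bar> \<partial>lborel :: real) \<longlonglongrightarrow> 0"
proof -
  have [measurable]: "U \<in> sets borel" using U by auto
  have iU: "integrable lborel (indicator U :: 'a \<Rightarrow> real)"
    using U by (auto intro!: integrable_real_indicator)
  note it = integrable_lborel_translate[OF iU]
  have eq: "(\<integral>z. \<bar>indicator U (z + w n) - indicator U z\<bar> \<partial>lborel :: real)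
      = 2 * (\<integral>z. max 0 (indicator U z - indicator U (z + w n)) \<partial>lborel)" for n
  proof -
    have "(\<integral>z. \<bar>indicator U (z + w n) - indicator U z\<bar> \<partial>lborel :: real)
      = (\<integral>z. 2 * max 0 (indicator U z - indicator U (z + w n)) + (indicator U (z + w n) - indicator U z) \<partial>lborel)"
      by (intro Bochner_Integration.integral_cong) (auto simp: max_def)
    also have "\<dots> = 2 * (\<integral>z. max 0 (indicator U z - indicator U (z + w n)) \<partial>lborel) +
        ((\<integral>z. indicator U (z + w n) \<partial>lborel) - (\<integral>z. indicator U z \<partial>lborel))"
      using iU it by (subst Bochner_Integration.integral_add)
        (auto intro!: integrable_max Bochner_Integration.integrable_diff simp: Bochner_Integration.integral_diff)
    also have "(\<integral>z. indicator U (z + w n) \<partial>lborel) = (\<integral>z. indicator U z \<partial>lborel :: real)"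
      by (rule integral_lborel_translate) measurable
    finally show ?thesis by simp
  qed
  have "(\<lambda>n. \<integral>z. max 0 (indicator U z - indicator U (z + w n)) \<partial>lborel) \<longlonglongrightarrow> (\<integral>z. 0 \<partial>(lborel::'a measure) :: real)"
  proof (rule integral_dominated_convergence[where w="indicator U"])
    show "AE z in lborel. (\<lambda>n. max 0 (indicator U z - indicator U (z + w n))) \<longlonglongrightarrow> (0::real)"
    proof (rule AE_I2, cases)
      fix z assume z: "z \<in> U"
      have "(\<lambda>n. z + w n) \<longlonglongrightarrow> z" using tendsto_add[OF tendsto_const w, of z] by simp
      then have "eventually (\<lambda>n. z + w n \<in> U) sequentially"
        using topological_tendstoD U(1) z by blast
      then show "(\<lambda>n. max 0 (indicator U z - indicator U (z + w n))) \<longlonglongrightarrow> (0::real)"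
        by (intro tendsto_eventually) (auto elim!: eventually_mono simp: z)
    next
      fix z assume z: "z \<notin> U"
      have "max 0 (indicator U z - indicator U (z + w n)) = (0::real)" for n
        using z by (simp add: max_def indicator_def)
      then show "(\<lambda>n. max 0 (indicator U z - indicator U (z + w n))) \<longlonglongrightarrow> (0::real)" by simp
    qed
  qed (use iU in \<open>auto split: split_indicator\<close>)
  then have "(\<lambda>n. 2 * (\<integral>z. max 0 (indicator U z - indicator U (z + w n)) \<partial>lborel)) \<longlonglongrightarrow> (0::real)"
    using tendsto_mult_right_zero by force
  then show ?thesis by (simp add: eq)
qed

lemma L1_translation:
  fixes f :: "'a::euclidean_space \<Rightarrow> 'b::{banach, second_countable_topology}"
  assumes "integrable lborel f" and w: "w \<longlonglongrightarrow> 0"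
  shows "(\<lambda>n. \<integral>z. norm (f (z + w n) - f z) \<partial>lborel) \<longlonglongrightarrow> 0"
  using assms(1)
proof (induction f)
  case (base A c)
  then have [measurable]: "A \<in> sets borel" by simp
  have iA: "integrable lborel (\<lambda>z. indicator A z *\<^sub>R c)"
    using base by (auto intro!: integrable_scaleR_left integrable_real_indicator)
  show ?case
  proof (rule L1_translation_close[OF iA])
    fix e :: real assume "0 < e"
    \<comment> \<open>The 1 in the denominator covers c = 0. Outer regularity then provides an open
      set whose excess over A costs at most e in L1.\<close>
    define e' where "e' = e / (norm c + 1)"
    have e': "e' > 0" using \<open>0 < e\<close> by (simp add: e'_def add_nonneg_pos)
    obtain U where U: "open U" "A \<subseteq> U" "emeasure lborel (U - A) < e'"
      using outer_regular_lborel[of A e'] base e' by auto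
    then have [measurable]: "U \<in> sets borel" by auto
    have "emeasure lborel U \<le> emeasure lborel A + emeasure lborel (U - A)"
      using emeasure_subadditive[of A lborel "U - A"] U(2) by (simp add: Un_absorb1)
    also have "\<dots> < \<infinity>" 
    proof -
      have "emeasure lborel (U - A) < \<infinity>" using U(3) by (rule less_trans) simp
      then show ?thesis using base(2) by (simp add: less_top[symmetric])
    qed
    finally have fU: "emeasure lborel U < \<infinity>" .
    have "integrable lborel (\<lambda>z. indicator U z *\<^sub>R c)"
      using fU by (auto intro!: integrable_scaleR_left integrable_real_indicator)
    moreover have "(\<integral>z. norm (indicator A z *\<^sub>R c - indicator U z *\<^sub>R c) \<partial>lborel) \<le> e"
    proof -
      have "(\<integral>z. norm (indicator A z *\<^sub>R c - indicator U z *\<^sub>R c) \<partial>lborel) = (\<integral>z. norm c * indicator (U - A) z \<partial>lborel)"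
        using U(2) by (intro Bochner_Integration.integral_cong) (auto split: split_indicator)
      also have "\<dots> = norm c * measure lborel (U - A)" by simp
      also have "\<dots> \<le> norm c * e'"
        using U(3) e' unfolding measure_def
        by (intro mult_left_mono enn2real_leI) (auto simp: less_imp_le)
      also have "\<dots> \<le> e"
        using \<open>0 < e\<close> add_nonneg_pos[OF norm_ge_zero[of c] zero_less_one] by (simp add: e'_def field_simps)
      finally show ?thesis .
    qed
    moreover have "(\<lambda>n. \<integral>z. norm (indicator U (z + w n) *\<^sub>R c - indicator U z *\<^sub>R c) \<partial>lborel) \<longlonglongrightarrow> 0"
      using tendsto_mult_left_zero[OF L1_translation_open[OF U(1) fU w], of "norm c"]
      by (simp add: scaleR_left_diff_distrib[symmetric] mult.commute)
    ultimately show "\<exists>g. integrable lborel g \<and> (\<integral>z. norm (indicator A z *\<^sub>R c - g z) \<partial>lborel) \<le> e \<and>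
         (\<lambda>n. \<integral>z. norm (g (z + w n) - g z) \<partial>lborel) \<longlonglongrightarrow> 0" by blast
  qed
next
  case (add f g)
  have "(\<lambda>n. \<integral>z. norm ((f (z + w n) + g (z + w n)) - (f z + g z)) \<partial>lborel) \<longlonglongrightarrow> 0"
  proof (rule Lim_null_comparison)
    show "\<forall>\<^sub>F n in sequentially. norm (\<integral>z. norm ((f (z + w n) + g (z + w n)) - (f z + g z)) \<partial>lborel)
        \<le> (\<integral>z. norm (f (z + w n) - f z) \<partial>lborel) + (\<integral>z. norm (g (z + w n) - g z) \<partial>lborel)"
    proof (intro always_eventually allI)
      fix n
      note ft = integrable_lborel_translate[OF add(1), of "w n"] integrable_lborel_translate[OF add(2), of "w n"]
      have "(\<integral>z. norm ((f (z + w n) + g (z + w n)) - (f z + g z)) \<partial>lborel)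
          \<le> (\<integral>z. norm (f (z + w n) - f z) + norm (g (z + w n) - g z) \<partial>lborel)"
        by (rule integral_mono)
          (use add ft in \<open>auto simp: norm_diff_triangle_ineq intro!: Bochner_Integration.integrable_add integrable_norm Bochner_Integration.integrable_diff\<close>)
      also have "\<dots> = (\<integral>z. norm (f (z + w n) - f z) \<partial>lborel) + (\<integral>z. norm (g (z + w n) - g z) \<partial>lborel)"
        using add ft by simp
      finally show "norm (\<integral>z. norm ((f (z + w n) + g (z + w n)) - (f z + g z)) \<partial>lborel) \<le> \<dots>" by simp
    qed
    show "(\<lambda>n. (\<integral>z. norm (f (z + w n) - f z) \<partial>lborel) + (\<integral>z. norm (g (z + w n) - g z) \<partial>lborel)) \<longlonglongrightarrow> 0"
      using tendsto_add[OF add(3) add(4)] by simp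
  qed
  then show ?case .
next
  case (lim f s)
  show ?case
  proof (rule L1_translation_close[OF lim(4)])
    fix e :: real assume "0 < e"
    have [measurable]: "f \<in> borel_measurable borel" "s i \<in> borel_measurable borel" for i
      using lim(1)[of i] lim(4) by auto
    have "(\<lambda>i. \<integral>z. norm (f z - s i z) \<partial>lborel) \<longlonglongrightarrow> (\<integral>z. 0 \<partial>(lborel :: 'a measure))"
    proof (rule integral_dominated_convergence[where w="\<lambda>z. 3 * norm (f z)"])
      show "AE z in lborel. (\<lambda>i. norm (f z - s i z)) \<longlonglongrightarrow> 0"
      proof (rule AE_I2)
        fix z
        have "(\<lambda>i. s i z) \<longlonglongrightarrow> f z" using lim(2) by simp
        from tendsto_norm[OF tendsto_diff[OF tendsto_const[of "f z"] this]]
        show "(\<lambda>i. norm (f z - s i z)) \<longlonglongrightarrow> 0" by simp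
      qed
      show "AE z in lborel. norm (norm (f z - s i z)) \<le> 3 * norm (f z)" for i
      proof (rule AE_I2)
        fix z
        show "norm (norm (f z - s i z)) \<le> 3 * norm (f z)"
          using norm_triangle_ineq4[of "f z" "s i z"] lim(3)[of z i] by simp
      qed
    qed (use lim(4) in auto)
    then have "(\<lambda>i. \<integral>z. norm (f z - s i z) \<partial>lborel) \<longlonglongrightarrow> 0" by simp
    from LIMSEQ_D[OF this \<open>0 < e\<close>] obtain i where "\<bar>\<integral>z. norm (f z - s i z) \<partial>lborel\<bar> < e" by auto
    then show "\<exists>g. integrable lborel g \<and> (\<integral>z. norm (f z - g z) \<partial>lborel) \<le> e \<and>
         (\<lambda>n. \<integral>z. norm (g (z + w n) - g z) \<partial>lborel) \<longlonglongrightarrow> 0"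
      using lim(1,5) by (intro exI[of _ "s i"]) auto
  qed
qed

section \<open>Mollification\<close>

lemma integrable_le:
  fixes f :: "'a \<Rightarrow> 'b::{banach, second_countable_topology}"
  assumes "integrable M g" "f \<in> borel_measurable M" "\<And>x. norm (f x) \<le> (g x :: real)"
  shows "integrable M f"
  by (rule Bochner_Integration.integrable_bound[OF assms(1,2)])
    (use assms(3) order_trans[OF assms(3) abs_ge_self] in auto)

lemma norm_integral_le:
  fixes f :: "'a \<Rightarrow> 'b::{banach, second_countable_topology}"
  assumes "integrable M g" "\<And>x. norm (f x) \<le> (g x :: real)"
  shows "norm (\<integral>x. f x \<partial>M) \<le> (\<integral>x. g x \<partial>M)"
  by (rule order_trans[OF integral_norm_bound integral_mono'[OF assms(1)]])
    (use assms(2) order_trans[OF norm_ge_zero assms(2)] in auto)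

lemma Ck_compose_linear:
  fixes L :: "'a::euclidean_space \<Rightarrow> 'b::euclidean_space"
  assumes L: "bounded_linear L" shows "Ck k f \<Longrightarrow> Ck k (\<lambda>x. f (L x))"
proof (induction k arbitrary: f)
  case 0
  then show ?case
    using continuous_on_compose2[of UNIV f UNIV L] linear_continuous_on[OF L] by auto
next
  case (Suc k)
  have d: "((\<lambda>x. f (L x)) has_derivative (\<lambda>h. pd f (L h) (L x))) (at x)" for x
    using has_derivative_compose[OF bounded_linear_imp_has_derivative[OF L] Ck_Suc_has_derivative[OF Suc.prems]] .
  show ?case
  proof (rule Ck_SucI[OF d])
    fix e :: 'a assume e: "e \<in> Basis"
    have "linear (\<lambda>h. pd f h y)" for y
      using has_derivative_linear[OF Ck_Suc_has_derivative[OF Suc.prems]] .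
    then have "pd f (L e) y = (\<Sum>b\<in>Basis. (L e \<bullet> b) * pd f b y)" for y
      using linear_sum[of "\<lambda>h. pd f h y" "\<lambda>b. (L e \<bullet> b) *\<^sub>R b" Basis]
        linear_scale[of "\<lambda>h. pd f h y"] by (simp add: euclidean_representation)
    moreover have "Ck k (\<lambda>x. \<Sum>b\<in>Basis. (L e \<bullet> b) * pd f b (L x))"
      using Suc by (intro Ck_sum Ck_mult Ck_const) auto
    ultimately show "Ck k (\<lambda>x. pd f (L e) (L x))" by simp
  qed
qed

lemma smooth_compose_linear: "smooth f \<Longrightarrow> bounded_linear L \<Longrightarrow> smooth (\<lambda>x. f (L x))"
  by (simp add: smooth_def Ck_compose_linear)

lemma smooth_borel_measurable: "smooth f \<Longrightarrow> f \<in> borel_measurable borel"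
  by (intro borel_measurable_continuous_onI smooth_continuous)

lemma bump_kernel_exists:
  assumes "d > 0"
  obtains k :: "'a::euclidean_space \<Rightarrow> real"
  where "test_fun k" "\<And>z. 0 \<le> k z" "(\<integral>z. k z \<partial>lborel) = 1" "\<And>z. d \<le> norm z \<Longrightarrow> k z = 0"
proof -
  define g :: "'a \<Rightarrow> real" where "g z = expinv 0 (d\<^sup>2 - (norm z)\<^sup>2)" for z
  have g0: "g z = 0" if "d \<le> norm z" for z
  proof -
    have "d\<^sup>2 \<le> (norm z)\<^sup>2" using that assms by (intro power_mono) auto
    then show ?thesis by (simp add: g_def expinv_def)
  qed
  have "smooth (\<lambda>z::'a. (norm z)\<^sup>2)" by (rule smooth_norm2[OF bounded_linear_ident])
  then have sg: "smooth g"
    unfolding g_def by (intro smooth_expinv smooth_diff smooth_const)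
  have tg: "test_fun g" by (rule test_funI[OF sg, of d]) (simp add: g0)
  have ng: "0 \<le> g z" for z by (simp add: g_def expinv_nonneg)
  have pg: "0 < g z" if "z \<in> ball 0 d" for z
  proof -
    have "(norm z)\<^sup>2 < d\<^sup>2" using that assms by (intro power_strict_mono) auto
    then show ?thesis by (simp add: g_def expinv_pos)
  qed
  have "(\<integral>z. g z \<partial>lborel) \<noteq> 0"
  proof
    assume "(\<integral>z. g z \<partial>lborel) = 0"
    then have "AE z in lborel. g z = 0"
      using integral_nonneg_eq_0_iff_AE[OF test_fun_integrable[OF tg]] ng by simp
    then have "AE z in lborel. z \<notin> ball (0::'a) d"
      by eventually_elim (use pg in force)
    then have "emeasure lborel (ball (0::'a) d) = 0"
      by (subst (asm) AE_iff_measurable[of "ball 0 d"]) auto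
    then show False using content_ball_pos[OF assms, of "0::'a"] by (simp add: measure_def)
  qed
  moreover have "(\<integral>z. g z \<partial>lborel) \<ge> 0" using ng by simp
  ultimately have p: "(\<integral>z. g z \<partial>lborel) > 0" by simp
  define c where "c = 1 / (\<integral>z. g z \<partial>lborel)"
  show ?thesis
  proof (rule that[of "\<lambda>z. c * g z"])
    show "test_fun (\<lambda>z. c * g z)" by (rule test_fun_mult[OF tg smooth_const])
  qed (use p ng g0 in \<open>auto simp: c_def\<close>)
qed

lemma integrable_fst_snd:
  fixes f :: "'a::euclidean_space \<Rightarrow> real" and g :: "'b::euclidean_space \<Rightarrow> real"
  assumes "integrable lborel f" "integrable lborel g"
  shows "integrable lborel (\<lambda>z. f (fst z) * g (snd z))"
    and "(\<integral>z. f (fst z) * g (snd z) \<partial>lborel) = (\<integral>x. f x \<partial>lborel) * (\<integral>y. g y \<partial>lborel)"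
proof -
  have [measurable]: "f \<in> borel_measurable borel" "g \<in> borel_measurable borel" using assms by auto
  have i: "integrable (lborel \<Otimes>\<^sub>M lborel) (\<lambda>z. f (fst z) * g (snd z))"
    by (rule lborel_pair.Fubini_integrable) (use assms in \<open>auto simp: abs_mult\<close>)
  then show "integrable lborel (\<lambda>z. f (fst z) * g (snd z))" by (simp add: lborel_prod)
  show "(\<integral>z. f (fst z) * g (snd z) \<partial>lborel) = (\<integral>x. f x \<partial>lborel) * (\<integral>y. g y \<partial>lborel)"
    using lborel_pair.integral_fst'[OF i] by (simp add: lborel_prod)
qed

text \<open>Anisotropic kernels: the second support radius \<open>s\<close> is chosen after the first factor, so that it
  beats the \<open>L\<^sup>1\<close> norm of the derivatives in the first variable.\<close>
lemma product_kernel_exists: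
  fixes M d :: real
  assumes "d > 0" "M > 0"
  obtains k :: "'a::euclidean_space \<times> 'b::euclidean_space \<Rightarrow> real" and s :: real
  where "test_fun k" "\<And>z. 0 \<le> k z" "(\<integral>z. k z \<partial>lborel) = 1"
    "\<And>z. k z \<noteq> 0 \<Longrightarrow> norm (fst z) \<le> d \<and> norm (snd z) \<le> s"
    "0 < s" "M * s * (1 + (\<Sum>i\<in>Basis. \<integral>z. \<bar>pd k (i, 0) z\<bar> \<partial>lborel)) \<le> d"
proof -
  obtain k1 :: "'a \<Rightarrow> real" where k1: "test_fun k1" "\<And>z. 0 \<le> k1 z" "(\<integral>z. k1 z \<partial>lborel) = 1" "\<And>z. d \<le> norm z \<Longrightarrow> k1 z = 0"
    using bump_kernel_exists[OF assms(1)] by metis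
  define S where "S = (\<Sum>i\<in>Basis. \<integral>z. \<bar>pd k1 i z\<bar> \<partial>lborel)"
  have S: "S \<ge> 0" unfolding S_def by (intro sum_nonneg) auto
  \<comment> \<open>\<open>S\<close> is the L1 norm of the derivatives of \<open>k1\<close> alone.
    Since \<open>k2\<close> has mass 1 for every radius, the x-derivatives of the product have this
    same norm, so choosing \<open>s\<close> from \<open>S\<close> is not circular.\<close>
  define s where "s = d / (M * (1 + S))"
  have s: "s > 0" unfolding s_def using assms S by (intro divide_pos_pos mult_pos_pos) auto
  obtain k2 :: "'b \<Rightarrow> real" where k2: "test_fun k2" "\<And>z. 0 \<le> k2 z" "(\<integral>z. k2 z \<partial>lborel) = 1" "\<And>z. s \<le> norm z \<Longrightarrow> k2 z = 0"
    using bump_kernel_exists[OF s] by metis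
  define k where "k = (\<lambda>z. k1 (fst z) * k2 (snd z))"
  have supp: "norm (fst z) \<le> d \<and> norm (snd z) \<le> s" if "k z \<noteq> 0" for z
    using that k1(4)[of "fst z"] k2(4)[of "snd z"] unfolding k_def by fastforce
  have sm: "smooth k" unfolding k_def
    by (rule smooth_mult[OF smooth_compose_linear[OF test_fun_smooth[OF k1(1)] bounded_linear_fst]
          smooth_compose_linear[OF test_fun_smooth[OF k2(1)] bounded_linear_snd]])
  have pdk: "pd k (i, 0) z = pd k1 i (fst z) * k2 (snd z)" for i z
  proof -
    have "((\<lambda>z. k1 (fst z)) has_derivative (\<lambda>h. pd k1 (fst h) (fst z))) (at z)"
      using has_derivative_compose[OF bounded_linear_imp_has_derivative[OF bounded_linear_fst] smooth_has_derivative[OF test_fun_smooth[OF k1(1)]]] .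
    moreover have "((\<lambda>z. k2 (snd z)) has_derivative (\<lambda>h. pd k2 (snd h) (snd z))) (at z)"
      using has_derivative_compose[OF bounded_linear_imp_has_derivative[OF bounded_linear_snd] smooth_has_derivative[OF test_fun_smooth[OF k2(1)]]] .
    ultimately have "(k has_derivative (\<lambda>h. k1 (fst z) * pd k2 (snd h) (snd z) + pd k1 (fst h) (fst z) * k2 (snd z))) (at z)"
      unfolding k_def by (rule has_derivative_mult)
    from pd_eq[OF this, of "(i, 0)"] show ?thesis
      using linear_0[OF has_derivative_linear[OF smooth_has_derivative[OF test_fun_smooth[OF k2(1)]]]] by simp
  qed
  show ?thesis
  proof (rule that)
    show "test_fun k"
    proof (rule test_funI[OF sm, of "d + s"])
      show "k z = 0" if "d + s < norm z" for z
        using supp[of z] that norm_Pair_le[of "fst z" "snd z"] by fastforce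
    qed
    show "0 \<le> k z" for z using k1(2) k2(2) by (simp add: k_def)
    show "(\<integral>z. k z \<partial>lborel) = 1"
      unfolding k_def using integrable_fst_snd(2)[OF test_fun_integrable[OF k1(1)] test_fun_integrable[OF k2(1)]] k1 k2 by simp
    have "(\<integral>z. \<bar>pd k (i, 0) z\<bar> \<partial>lborel) = (\<integral>z. \<bar>pd k1 i z\<bar> \<partial>lborel)" if "i \<in> Basis" for i
      using integrable_fst_snd(2)[OF integrable_abs[OF test_fun_integrable[OF test_fun_pd[OF k1(1) that]]] test_fun_integrable[OF k2(1)]]
        k2 by (simp add: pdk abs_mult)
    then have "(\<Sum>i\<in>Basis. \<integral>z. \<bar>pd k (i, 0) z\<bar> \<partial>lborel) = S"
      unfolding S_def by simp
    then show "M * s * (1 + (\<Sum>i\<in>Basis. \<integral>z. \<bar>pd k (i, 0) z\<bar> \<partial>lborel)) \<le> d"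
      using S assms by (simp add: s_def)
  qed (use supp s in auto)
qed

section \<open>Convolution of integrable densities with test kernels\<close>

definition cv :: "('a::euclidean_space \<Rightarrow> 'b::euclidean_space) \<Rightarrow> ('a \<Rightarrow> real) \<Rightarrow> 'a \<Rightarrow> 'b" where
  "cv \<sigma> k z = (\<integral>y. k (z - y) *\<^sub>R \<sigma> y \<partial>lborel)"

lemma cv_integrable_kernel:
  fixes \<sigma> :: "'a::euclidean_space \<Rightarrow> 'b::euclidean_space"
  assumes \<sigma>: "integrable lborel \<sigma>" and k[measurable]: "k \<in> borel_measurable borel" and b: "\<And>z. \<bar>k z\<bar> \<le> C"
  shows "integrable lborel (\<lambda>y. k (z - y) *\<^sub>R \<sigma> y)"
proof -
  have [measurable]: "\<sigma> \<in> borel_measurable borel" using \<sigma> by auto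
  show ?thesis
  proof (rule integrable_le)
    show "(\<lambda>y. k (z - y) *\<^sub>R \<sigma> y) \<in> borel_measurable lborel" by measurable
    show "integrable lborel (\<lambda>y. C * norm (\<sigma> y))" using \<sigma> by auto
    show "norm (k (z - y) *\<^sub>R \<sigma> y) \<le> C * norm (\<sigma> y)" for y
      using b by (auto intro!: mult_right_mono)
  qed
qed

lemma test_fun_measurable[measurable_dest]: "test_fun k \<Longrightarrow> k \<in> borel_measurable borel"
  by (intro smooth_borel_measurable test_fun_smooth)

lemma cv_test_integrable:
  fixes \<sigma> :: "'a::euclidean_space \<Rightarrow> 'b::euclidean_space"
  assumes "integrable lborel \<sigma>" "test_fun k"
  shows "integrable lborel (\<lambda>y. k (z - y) *\<^sub>R \<sigma> y)"
  using test_fun_bounded[OF assms(2)] cv_integrable_kernel[OF assms(1) test_fun_measurable[OF assms(2)]] by metis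

lemma cv_Lipschitz:
  fixes \<sigma> :: "'a::euclidean_space \<Rightarrow> 'b::euclidean_space"
  assumes \<sigma>: "integrable lborel \<sigma>" and k: "test_fun k"
  shows "\<exists>C\<ge>0. \<forall>z z'. norm (cv \<sigma> k z - cv \<sigma> k z') \<le> C * norm (z - z')"
proof -
  obtain C where C: "C > 0" "\<And>x y. \<bar>k x - k y\<bar> \<le> C * norm (x - y)" using test_fun_Lipschitz[OF k] by metis
  have "norm (cv \<sigma> k z - cv \<sigma> k z') \<le> (C * (\<integral>y. norm (\<sigma> y) \<partial>lborel)) * norm (z - z')" for z z'
  proof -
    have "cv \<sigma> k z - cv \<sigma> k z' = (\<integral>y. (k (z - y) - k (z' - y)) *\<^sub>R \<sigma> y \<partial>lborel)"
      unfolding cv_def using cv_test_integrable[OF \<sigma> k] by (simp add: scaleR_left_diff_distrib)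
    also have "norm \<dots> \<le> (\<integral>y. (C * norm (z - z')) * norm (\<sigma> y) \<partial>lborel)"
    proof (rule norm_integral_le)
      show "norm ((k (z - y) - k (z' - y)) *\<^sub>R \<sigma> y) \<le> (C * norm (z - z')) * norm (\<sigma> y)" for y
        using C(2)[of "z - y" "z' - y"] by (auto intro!: mult_right_mono)
    qed (use \<sigma> in auto)
    finally show ?thesis by (simp add: mult_ac)
  qed
  then show ?thesis using C by (intro exI[of _ "C * (\<integral>y. norm (\<sigma> y) \<partial>lborel)"]) auto
qed

lemma cv_continuous:
  fixes \<sigma> :: "'a::euclidean_space \<Rightarrow> 'b::euclidean_space"
  assumes \<sigma>: "integrable lborel \<sigma>" and k: "test_fun k"
  shows "continuous_on UNIV (cv \<sigma> k)"
proof -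
  obtain C where C: "0 \<le> C" "\<And>z z'. norm (cv \<sigma> k z - cv \<sigma> k z') \<le> C * norm (z - z')"
    using cv_Lipschitz[OF assms] by metis
  have "C-lipschitz_on UNIV (cv \<sigma> k)"
    using C by (intro lipschitz_onI) (auto simp: dist_norm)
  then show ?thesis by (rule lipschitz_on_continuous_on)
qed

lemma cv_measurable:
  "integrable lborel \<sigma> \<Longrightarrow> test_fun k \<Longrightarrow> cv \<sigma> k \<in> borel_measurable borel"
  by (intro borel_measurable_continuous_onI cv_continuous)

lemma cv_bounded:
  fixes \<sigma> :: "'a::euclidean_space \<Rightarrow> 'b::euclidean_space"
  assumes \<sigma>: "integrable lborel \<sigma>" and k: "test_fun k" and C: "\<And>z. \<bar>k z\<bar> \<le> C"
  shows "norm (cv \<sigma> k z) \<le> C * (\<integral>y. norm (\<sigma> y) \<partial>lborel)"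
proof -
  have "norm (cv \<sigma> k z) \<le> (\<integral>y. C * norm (\<sigma> y) \<partial>lborel)"
    unfolding cv_def
  proof (rule norm_integral_le)
    show "norm (k (z - y) *\<^sub>R \<sigma> y) \<le> C * norm (\<sigma> y)" for y
      using C by (auto intro!: mult_right_mono)
  qed (use \<sigma> in auto)
  then show ?thesis by simp
qed

lemma cv_inner:
  fixes \<sigma> :: "'a::euclidean_space \<Rightarrow> 'b::euclidean_space"
  assumes \<sigma>: "integrable lborel \<sigma>" and k: "test_fun k"
  shows "cv \<sigma> k z \<bullet> i = cv (\<lambda>y. \<sigma> y \<bullet> i) k z"
  unfolding cv_def using cv_test_integrable[OF assms] by (subst integral_inner_left[symmetric]) auto

text \<open>The Taylor remainder of the kernel is bounded by a multiple of |h|^2 uniformly in its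
  argument, so integrating it against an integrable \<sigma> keeps the quadratic order. All
  regularity is taken from the kernel.\<close>

lemma cv_has_derivative:
  fixes \<sigma> :: "'a::euclidean_space \<Rightarrow> real"
  assumes \<sigma>: "integrable lborel \<sigma>" and k: "test_fun k"
  shows "(cv \<sigma> k has_derivative (\<lambda>h. cv \<sigma> (pd k h) z)) (at z)"
proof -
  obtain C where C: "C > 0" "\<And>z h. \<bar>k (z + h) - k z - pd k h z\<bar> \<le> C * (norm h)\<^sup>2" using test_fun_Taylor[OF k] by metis
  have int: "integrable lborel (\<lambda>y. pd k h (z - y) *\<^sub>R \<sigma> y)" for h z
  proof -
    have "integrable lborel (\<lambda>y. \<Sum>b\<in>Basis. (h \<bullet> b) * (pd k b (z - y) *\<^sub>R \<sigma> y))"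
      using cv_test_integrable[OF \<sigma> test_fun_pd[OF k]] by (intro Bochner_Integration.integrable_sum) auto
    moreover have "(\<Sum>b\<in>Basis. (h \<bullet> b) * (pd k b (z - y) *\<^sub>R \<sigma> y)) = pd k h (z - y) *\<^sub>R \<sigma> y" for y
      unfolding smooth_pd_sum[OF test_fun_smooth[OF k], of h] by (simp add: sum_distrib_right sum_distrib_left mult_ac)
    ultimately show ?thesis by simp
  qed
  have L: "cv \<sigma> (pd k h) z = (\<Sum>b\<in>Basis. (h \<bullet> b) *\<^sub>R cv \<sigma> (pd k b) z)" for h
  proof -
    have "pd k h (z - y) *\<^sub>R \<sigma> y = (\<Sum>b\<in>Basis. (h \<bullet> b) *\<^sub>R (pd k b (z - y) *\<^sub>R \<sigma> y))" for y
      unfolding smooth_pd_sum[OF test_fun_smooth[OF k], of h] by (simp add: sum_distrib_right sum_distrib_left mult_ac)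
    then show ?thesis
      unfolding cv_def using int by (simp add: Bochner_Integration.integral_sum)
  qed
  have "(\<lambda>h. cv \<sigma> (pd k h) z) = (\<lambda>h. \<Sum>b\<in>Basis. (h \<bullet> b) *\<^sub>R cv \<sigma> (pd k b) z)"
    by (rule ext) (rule L)
  moreover have "bounded_linear (\<lambda>h. \<Sum>b\<in>Basis. (h \<bullet> b) *\<^sub>R cv \<sigma> (pd k b) z)"
    by (rule bounded_linear_sum) (rule bounded_linear_scaleR_const[OF bounded_linear_inner_left])
  ultimately have bl: "bounded_linear (\<lambda>h. cv \<sigma> (pd k h) z)" by (simp only:)
  define K where "K = C * (\<integral>y. norm (\<sigma> y) \<partial>lborel)"
  have err: "norm (cv \<sigma> k (z + h) - cv \<sigma> k z - cv \<sigma> (pd k h) z) \<le> K * (norm h)\<^sup>2" for h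
  proof -
    have "cv \<sigma> k (z + h) - cv \<sigma> k z - cv \<sigma> (pd k h) z
        = (\<integral>y. (k (z + h - y) - k (z - y) - pd k h (z - y)) *\<^sub>R \<sigma> y \<partial>lborel)"
      unfolding cv_def using cv_test_integrable[OF \<sigma> k] int by (simp add: left_diff_distrib)
    also have "norm \<dots> \<le> (\<integral>y. (C * (norm h)\<^sup>2) * norm (\<sigma> y) \<partial>lborel)"
    proof (rule norm_integral_le)
      show "norm ((k (z + h - y) - k (z - y) - pd k h (z - y)) *\<^sub>R \<sigma> y) \<le> (C * (norm h)\<^sup>2) * norm (\<sigma> y)" for y
        using mult_right_mono[OF C(2)[of "z - y" h] abs_ge_zero[of "\<sigma> y"]] by (simp add: abs_mult diff_add_eq)
    qed (use \<sigma> in auto)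
    finally show ?thesis by (simp add: mult_ac K_def)
  qed
  have "((\<lambda>h. norm (cv \<sigma> k (z + h) - cv \<sigma> k z - cv \<sigma> (pd k h) z) / norm h) \<longlongrightarrow> 0) (at 0)"
  proof (rule Lim_null_comparison)
    show "\<forall>\<^sub>F h in at 0. norm (norm (cv \<sigma> k (z + h) - cv \<sigma> k z - cv \<sigma> (pd k h) z) / norm h) \<le> K * norm h"
      unfolding eventually_at_filter
    proof (intro always_eventually allI impI)
      fix h :: 'a assume "h \<noteq> 0"
      then show "norm (norm (cv \<sigma> k (z + h) - cv \<sigma> k z - cv \<sigma> (pd k h) z) / norm h) \<le> K * norm h"
        using err[of h] by (simp add: divide_le_eq power2_eq_square mult.assoc)
    qed
    show "((\<lambda>h. K * norm h) \<longlongrightarrow> 0) (at (0::'a))" by (auto intro!: tendsto_eq_intros)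
  qed
  then show ?thesis using bl by (simp add: has_derivative_at)
qed

text \<open>A weighted form of Young's convolution inequality: over the support of the kernel the
  weight changes by at most the factor C, so it can be moved from z to y, and Tonelli's theorem
  separates kernel and density.\<close>

lemma nn_integral_cv_weighted:
  fixes \<sigma> :: "'a::euclidean_space \<Rightarrow> 'b::euclidean_space"
  assumes [measurable]: "\<sigma> \<in> borel_measurable borel" "k \<in> borel_measurable borel" "w \<in> borel_measurable borel"
    and w0: "\<And>z. 0 \<le> w z" and C: "0 \<le> C" and w: "\<And>z y. k (z - y) \<noteq> 0 \<Longrightarrow> w z \<le> C * w y"
  shows "(\<integral>\<^sup>+z. ennreal (w z * norm (cv \<sigma> k z)) \<partial>lborel)
    \<le> ennreal C * (\<integral>\<^sup>+z. ennreal \<bar>k z\<bar> \<partial>lborel) * (\<integral>\<^sup>+z. ennreal (w z * norm (\<sigma> z)) \<partial>lborel)"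
proof -
  have "(\<integral>\<^sup>+z. ennreal (w z * norm (cv \<sigma> k z)) \<partial>lborel)
      \<le> (\<integral>\<^sup>+z. \<integral>\<^sup>+y. ennreal (C * \<bar>k (z - y)\<bar> * (w y * norm (\<sigma> y))) \<partial>lborel \<partial>lborel)"
  proof (rule nn_integral_mono)
    fix z :: 'a
    have "ennreal (w z * norm (cv \<sigma> k z)) = ennreal (w z) * ennreal (norm (cv \<sigma> k z))"
      using w0 by (simp add: ennreal_mult)
    also have "\<dots> \<le> ennreal (w z) * (\<integral>\<^sup>+y. ennreal (norm (k (z - y) *\<^sub>R \<sigma> y)) \<partial>lborel)"
    \<comment> \<open>Without integrability the Bochner integral defining \<open>cv\<close> is 0 by
      convention, and the bound holds trivially.\<close>
    proof (cases "integrable lborel (\<lambda>y. k (z - y) *\<^sub>R \<sigma> y)")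
      case True
      then show ?thesis unfolding cv_def by (intro mult_left_mono integral_norm_bound_ennreal) auto
    next
      case False
      then show ?thesis by (simp add: cv_def not_integrable_integral_eq)
    qed
    also have "\<dots> = (\<integral>\<^sup>+y. ennreal (w z * norm (k (z - y) *\<^sub>R \<sigma> y)) \<partial>lborel)"
      using w0 by (subst nn_integral_cmult[symmetric]) (auto simp: ennreal_mult)
    also have "\<dots> \<le> (\<integral>\<^sup>+y. ennreal (C * \<bar>k (z - y)\<bar> * (w y * norm (\<sigma> y))) \<partial>lborel)"
    proof (intro nn_integral_mono ennreal_leI)
      fix y
      show "w z * norm (k (z - y) *\<^sub>R \<sigma> y) \<le> C * \<bar>k (z - y)\<bar> * (w y * norm (\<sigma> y))"
      proof (cases "k (z - y) = 0")
        case False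
        have "w z * (\<bar>k (z - y)\<bar> * norm (\<sigma> y)) \<le> (C * w y) * (\<bar>k (z - y)\<bar> * norm (\<sigma> y))"
          using w[OF False] by (intro mult_right_mono) auto
        then show ?thesis by (simp add: mult_ac)
      qed simp
    qed
    finally show "ennreal (w z * norm (cv \<sigma> k z)) \<le> (\<integral>\<^sup>+y. ennreal (C * \<bar>k (z - y)\<bar> * (w y * norm (\<sigma> y))) \<partial>lborel)" .
  qed
  also have "\<dots> = (\<integral>\<^sup>+y. \<integral>\<^sup>+z. ennreal (C * \<bar>k (z - y)\<bar> * (w y * norm (\<sigma> y))) \<partial>lborel \<partial>lborel)"
    by (rule lborel_pair.Fubini'[symmetric]) measurable
  also have "\<dots> = (\<integral>\<^sup>+y. ennreal C * (\<integral>\<^sup>+z. ennreal \<bar>k z\<bar> \<partial>lborel) * ennreal (w y * norm (\<sigma> y)) \<partial>lborel)"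
  proof (rule nn_integral_cong)
    fix y
    have "(\<integral>\<^sup>+z. ennreal (C * \<bar>k (z - y)\<bar> * (w y * norm (\<sigma> y))) \<partial>lborel)
        = (\<integral>\<^sup>+z. ennreal (C * \<bar>k (z + (-y))\<bar> * (w y * norm (\<sigma> y))) \<partial>lborel)" by simp
    also have "\<dots> = (\<integral>\<^sup>+z. ennreal (C * \<bar>k z\<bar> * (w y * norm (\<sigma> y))) \<partial>lborel)"
      by (rule nn_integral_lborel_translate[of "\<lambda>z. ennreal (C * \<bar>k z\<bar> * (w y * norm (\<sigma> y)))"]) measurable
    also have "\<dots> = (\<integral>\<^sup>+z. ennreal C * ennreal \<bar>k z\<bar> * ennreal (w y * norm (\<sigma> y)) \<partial>lborel)"
      using C w0 by (simp add: ennreal_mult)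
    also have "\<dots> = ennreal C * (\<integral>\<^sup>+z. ennreal \<bar>k z\<bar> \<partial>lborel) * ennreal (w y * norm (\<sigma> y))"
      by (subst nn_integral_multc, measurable) (subst nn_integral_cmult, auto)
    finally show "(\<integral>\<^sup>+z. ennreal (C * \<bar>k (z - y)\<bar> * (w y * norm (\<sigma> y))) \<partial>lborel) = \<dots>" .
  qed
  also have "\<dots> = ennreal C * (\<integral>\<^sup>+z. ennreal \<bar>k z\<bar> \<partial>lborel) * (\<integral>\<^sup>+z. ennreal (w z * norm (\<sigma> z)) \<partial>lborel)"
    by (subst nn_integral_cmult) auto
  finally show ?thesis .
qed

lemma cv_weighted:
  fixes \<sigma> :: "'a::euclidean_space \<Rightarrow> 'b::euclidean_space"
  assumes \<sigma>: "integrable lborel \<sigma>" and k: "test_fun k" and [measurable]: "w \<in> borel_measurable borel"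
    and w0: "\<And>z. 0 \<le> w z" and C: "0 \<le> C" and w: "\<And>z y. k (z - y) \<noteq> 0 \<Longrightarrow> w z \<le> C * w y"
    and i: "integrable lborel (\<lambda>z. w z * norm (\<sigma> z))"
  shows "integrable lborel (\<lambda>z. w z * norm (cv \<sigma> k z))"
    and "(\<integral>z. w z * norm (cv \<sigma> k z) \<partial>lborel) \<le> C * (\<integral>z. \<bar>k z\<bar> \<partial>lborel) * (\<integral>z. w z * norm (\<sigma> z) \<partial>lborel)"
proof -
  have [measurable]: "\<sigma> \<in> borel_measurable borel" "k \<in> borel_measurable borel" "cv \<sigma> k \<in> borel_measurable borel"
    using \<sigma> k cv_measurable[OF \<sigma> k] by auto
  have eq: "(\<integral>\<^sup>+z. ennreal \<bar>k z\<bar> \<partial>lborel) = ennreal (\<integral>z. \<bar>k z\<bar> \<partial>lborel)"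
    "(\<integral>\<^sup>+z. ennreal (w z * norm (\<sigma> z)) \<partial>lborel) = ennreal (\<integral>z. w z * norm (\<sigma> z) \<partial>lborel)"
    using test_fun_integrable[OF k] i w0 by (auto intro!: nn_integral_eq_integral)
  have b: "(\<integral>\<^sup>+z. ennreal (w z * norm (cv \<sigma> k z)) \<partial>lborel) \<le> ennreal (C * (\<integral>z. \<bar>k z\<bar> \<partial>lborel) * (\<integral>z. w z * norm (\<sigma> z) \<partial>lborel))"
    using nn_integral_cv_weighted[of \<sigma> k w C] w0 C w unfolding eq
    by (simp add: ennreal_mult Bochner_Integration.integral_nonneg)
  show 1: "integrable lborel (\<lambda>z. w z * norm (cv \<sigma> k z))"
  proof (rule integrableI_bounded)
    have "(\<integral>\<^sup>+z. ennreal (norm (w z * norm (cv \<sigma> k z))) \<partial>lborel) = (\<integral>\<^sup>+z. ennreal (w z * norm (cv \<sigma> k z)) \<partial>lborel)"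
      using w0 by (simp add: abs_mult)
    also have "\<dots> < \<infinity>" using b by (rule le_less_trans) simp
    finally show "(\<integral>\<^sup>+z. ennreal (norm (w z * norm (cv \<sigma> k z))) \<partial>lborel) < \<infinity>" .
  qed measurable
  show "(\<integral>z. w z * norm (cv \<sigma> k z) \<partial>lborel) \<le> C * (\<integral>z. \<bar>k z\<bar> \<partial>lborel) * (\<integral>z. w z * norm (\<sigma> z) \<partial>lborel)"
    using b w0 C nn_integral_eq_integral[OF 1]
    by (simp add: Bochner_Integration.integral_nonneg ennreal_le_iff)
qed

lemma cv_integrable:
  fixes \<sigma> :: "'a::euclidean_space \<Rightarrow> 'b::euclidean_space"
  assumes \<sigma>: "integrable lborel \<sigma>" and k: "test_fun k"
  shows "integrable lborel (cv \<sigma> k)"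
proof -
  have "integrable lborel (\<lambda>z. 1 * norm (cv \<sigma> k z))"
    by (rule cv_weighted(1)[OF \<sigma> k, where C=1]) (use \<sigma> in auto)
  then show ?thesis using cv_measurable[OF \<sigma> k] integrable_norm_cancel by force
qed

lemma cv_integral:
  fixes \<sigma> :: "'a::euclidean_space \<Rightarrow> real"
  assumes \<sigma>: "integrable lborel \<sigma>" and k: "test_fun k"
  shows "(\<integral>z. cv \<sigma> k z \<partial>lborel) = (\<integral>z. k z \<partial>lborel) * (\<integral>z. \<sigma> z \<partial>lborel)"
proof -
  have [measurable]: "\<sigma> \<in> borel_measurable borel" "k \<in> borel_measurable borel" using \<sigma> k by auto
  have tr: "(\<integral>z. g (z - y) \<partial>lborel) = (\<integral>z. g z \<partial>lborel)" if "g \<in> borel_measurable borel" for g :: "'a \<Rightarrow> real" and y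
    using integral_lborel_translate[OF that, of "-y"] by simp
  have int: "integrable (lborel \<Otimes>\<^sub>M lborel) (\<lambda>(y, z). k (z - y) * \<sigma> y)"
  proof (rule lborel_pair.Fubini_integrable)
    show "integrable lborel (\<lambda>y. \<integral>z. norm (case (y, z) of (y, z) \<Rightarrow> k (z - y) * \<sigma> y) \<partial>lborel)"
      using \<sigma> tr[of "\<lambda>z. \<bar>k z\<bar>"] by (simp add: abs_mult)
    show "AE y in lborel. integrable lborel (\<lambda>z. case (y, z) of (y, z) \<Rightarrow> k (z - y) * \<sigma> y)"
      using integrable_lborel_translate[OF test_fun_integrable[OF k], of "- _"] by simp
  qed measurable
  have "(\<integral>z. cv \<sigma> k z \<partial>lborel) = (\<integral>y. \<integral>z. k (z - y) * \<sigma> y \<partial>lborel \<partial>lborel)"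
    using lborel_pair.Fubini_integral[OF int] by (simp add: cv_def)
  also have "\<dots> = (\<integral>z. k z \<partial>lborel) * (\<integral>z. \<sigma> z \<partial>lborel)" by (simp add: tr)
  finally show ?thesis .
qed

lemma cv_reflect:
  fixes \<sigma> :: "'a::euclidean_space \<Rightarrow> 'b::euclidean_space"
  assumes [measurable]: "\<sigma> \<in> borel_measurable borel" "k \<in> borel_measurable borel"
  shows "cv \<sigma> k z = (\<integral>w. k w *\<^sub>R \<sigma> (z - w) \<partial>lborel)"
  unfolding cv_def using integral_lborel_minus[of "\<lambda>w. k w *\<^sub>R \<sigma> (z - w)" z] by simp

lemma L1_translation_unif:
  fixes f :: "'a::euclidean_space \<Rightarrow> 'b::{banach, second_countable_topology}"
  assumes f: "integrable lborel f" and "e > 0"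
  obtains d where "d > 0" "\<And>w. norm w < d \<Longrightarrow> (\<integral>z. norm (f (z - w) - f z) \<partial>lborel) < e"
proof (rule ccontr)
  assume "\<not> thesis"
  then have "\<forall>d>0. \<exists>w. norm w < d \<and> \<not> (\<integral>z. norm (f (z - w) - f z) \<partial>lborel) < e"
    using that by blast
  then have "\<forall>n. \<exists>w. norm w < 1 / real (Suc n) \<and> \<not> (\<integral>z. norm (f (z - w) - f z) \<partial>lborel) < e"
    by simp
  then obtain w where w: "\<And>n. norm (w n) < 1 / real (Suc n)" "\<And>n. \<not> (\<integral>z. norm (f (z - w n) - f z) \<partial>lborel) < e"
    by metis
  have "w \<longlonglongrightarrow> 0"
    by (rule Lim_null_comparison[OF _ lim_1_over_n[THEN LIMSEQ_Suc]])
      (use w(1) less_imp_le in \<open>auto intro!: always_eventually\<close>)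
  from tendsto_minus[OF this] have "(\<lambda>n. \<integral>z. norm (f (z + - w n) - f z) \<partial>lborel) \<longlonglongrightarrow> 0"
    by (intro L1_translation[OF f]) simp
  from LIMSEQ_D[OF this \<open>e > 0\<close>] show False using w(2) by (auto simp: not_less)
qed

text \<open>The mollified function minus the original is an average of translation differences over
  the support of the kernel, so its L1 norm is at most the worst translation error. The kernels are
  not rescalings of one profile: nonnegativity, unit mass and shrinking supports suffice, which
  admits anisotropic kernels.\<close>

lemma mollify_L1:
  fixes \<sigma> :: "'a::euclidean_space \<Rightarrow> 'b::euclidean_space"
  assumes \<sigma>: "integrable lborel \<sigma>" and k: "\<And>n. test_fun (k n)" "\<And>n z. 0 \<le> k n z" "\<And>n. (\<integral>z. k n z \<partial>lborel) = 1"
    and supp: "\<And>n z. k n z \<noteq> 0 \<Longrightarrow> norm z \<le> r n" and r: "r \<longlonglongrightarrow> (0::real)"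
  shows "(\<lambda>n. \<integral>z. norm (cv \<sigma> (k n) z - \<sigma> z) \<partial>lborel) \<longlonglongrightarrow> 0"
proof (rule LIMSEQ_I)
  fix e :: real assume "e > 0"
  obtain d where d: "d > 0" "\<And>w. norm w < d \<Longrightarrow> (\<integral>z. norm (\<sigma> (z - w) - \<sigma> z) \<partial>lborel) < e/2"
    using L1_translation_unif[OF \<sigma>, of "e/2"] \<open>e > 0\<close> by auto
  obtain N where N: "\<And>n. n \<ge> N \<Longrightarrow> \<bar>r n\<bar> < d" using LIMSEQ_D[OF r d(1)] by auto
  have [measurable]: "\<sigma> \<in> borel_measurable borel" using \<sigma> by auto
  have "norm ((\<integral>z. norm (cv \<sigma> (k n) z - \<sigma> z) \<partial>lborel) - 0) < e" if "n \<ge> N" for n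
  proof -
    have [measurable]: "k n \<in> borel_measurable borel" "cv \<sigma> (k n) \<in> borel_measurable borel"
      using k(1)[of n] cv_measurable[OF \<sigma> k(1)] by auto
    note ik = test_fun_integrable[OF k(1)[of n]]
    have it: "integrable lborel (\<lambda>z. norm (\<sigma> (z - w) - \<sigma> z))" for w
      using integrable_lborel_translate[OF \<sigma>, of "-w"] \<sigma> by simp
    have "(\<integral>\<^sup>+z. ennreal (norm (cv \<sigma> (k n) z - \<sigma> z)) \<partial>lborel)
        \<le> (\<integral>\<^sup>+z. \<integral>\<^sup>+w. ennreal (k n w * norm (\<sigma> (z - w) - \<sigma> z)) \<partial>lborel \<partial>lborel)"
    proof (rule nn_integral_mono)
      fix z
      have i1: "integrable lborel (\<lambda>w. k n w *\<^sub>R \<sigma> (z - w))"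
        using integrable_lborel_minus[OF cv_test_integrable[OF \<sigma> k(1)[of n]], of z z] by simp
      have i2: "integrable lborel (\<lambda>w. k n w *\<^sub>R \<sigma> z)" using ik by simp
      have "cv \<sigma> (k n) z - \<sigma> z = (\<integral>w. k n w *\<^sub>R \<sigma> (z - w) \<partial>lborel) - (\<integral>w. k n w *\<^sub>R \<sigma> z \<partial>lborel)"
        using ik k(3) by (subst cv_reflect) auto
      also have "\<dots> = (\<integral>w. k n w *\<^sub>R (\<sigma> (z - w) - \<sigma> z) \<partial>lborel)"
        using i1 i2 by (simp add: scaleR_right_diff_distrib)
      finally have eq: "cv \<sigma> (k n) z - \<sigma> z = (\<integral>w. k n w *\<^sub>R (\<sigma> (z - w) - \<sigma> z) \<partial>lborel)" .
      have "integrable lborel (\<lambda>w. k n w *\<^sub>R (\<sigma> (z - w) - \<sigma> z))"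
        using i1 i2 by (simp add: scaleR_right_diff_distrib)
      from integral_norm_bound_ennreal[OF this]
      show "ennreal (norm (cv \<sigma> (k n) z - \<sigma> z)) \<le> (\<integral>\<^sup>+w. ennreal (k n w * norm (\<sigma> (z - w) - \<sigma> z)) \<partial>lborel)"
        unfolding eq using k(2) by simp
    qed
    also have "\<dots> = (\<integral>\<^sup>+w. \<integral>\<^sup>+z. ennreal (k n w * norm (\<sigma> (z - w) - \<sigma> z)) \<partial>lborel \<partial>lborel)"
      by (rule lborel_pair.Fubini'[symmetric]) measurable
    also have "\<dots> \<le> (\<integral>\<^sup>+w. ennreal (k n w * (e/2)) \<partial>lborel)"
    proof (rule nn_integral_mono)
      fix w
      have "(\<integral>\<^sup>+z. ennreal (k n w * norm (\<sigma> (z - w) - \<sigma> z)) \<partial>lborel)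
          = ennreal (\<integral>z. k n w * norm (\<sigma> (z - w) - \<sigma> z) \<partial>lborel)"
        using it k(2) by (intro nn_integral_eq_integral) auto
      also have "\<dots> \<le> ennreal (k n w * (e/2))"
      proof (cases "k n w = 0")
        case False
        then have "norm w < d" using supp[of n w] N[OF that] by auto
        from d(2)[OF this] have "k n w * (\<integral>z. norm (\<sigma> (z - w) - \<sigma> z) \<partial>lborel) \<le> k n w * (e/2)"
          using k(2) by (intro mult_left_mono) auto
        then show ?thesis by (intro ennreal_leI) simp
      qed simp
      finally show "(\<integral>\<^sup>+z. ennreal (k n w * norm (\<sigma> (z - w) - \<sigma> z)) \<partial>lborel) \<le> ennreal (k n w * (e/2))" .
    qed
    also have "\<dots> = ennreal (e/2)"
      using ik k(2,3) \<open>e > 0\<close> by (subst nn_integral_eq_integral) auto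
    finally have "(\<integral>\<^sup>+z. ennreal (norm (cv \<sigma> (k n) z - \<sigma> z)) \<partial>lborel) \<le> ennreal (e/2)" .
    moreover have "(\<integral>\<^sup>+z. ennreal (norm (cv \<sigma> (k n) z - \<sigma> z)) \<partial>lborel) = ennreal (\<integral>z. norm (cv \<sigma> (k n) z - \<sigma> z) \<partial>lborel)"
      using cv_integrable[OF \<sigma> k(1)] \<sigma> by (intro nn_integral_eq_integral) auto
    ultimately have "(\<integral>z. norm (cv \<sigma> (k n) z - \<sigma> z) \<partial>lborel) \<le> e/2"
      using \<open>e > 0\<close> by (simp add: ennreal_le_iff)
    then show ?thesis using \<open>e > 0\<close> by simp
  qed
  then show "\<exists>N. \<forall>n\<ge>N. norm ((\<integral>z. norm (cv \<sigma> (k n) z - \<sigma> z) \<partial>lborel) - 0) < e" by blast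
qed

section \<open>Weakly vanishing densities and joint measurability\<close>

lemma integrable_test_mult:
  fixes \<sigma> :: "'a::euclidean_space \<Rightarrow> 'b::euclidean_space"
  assumes l: "loc_int \<sigma>" and \<phi>: "test_fun \<phi>"
  shows "integrable lborel (\<lambda>z. \<phi> z *\<^sub>R \<sigma> z)"
proof -
  obtain R where R: "\<And>z. norm z > R \<Longrightarrow> \<phi> z = 0" using test_fun_support[OF \<phi>] by metis
  obtain C where C: "C > 0" "\<And>z. \<bar>\<phi> z\<bar> \<le> C" using test_fun_bounded[OF \<phi>] by metis
  have i: "integrable lborel (\<lambda>z. indicator (cball 0 R) z *\<^sub>R \<sigma> z)"
    using l unfolding loc_int_def set_integrable_def by auto
  have [measurable]: "\<phi> \<in> borel_measurable borel" using \<phi> by auto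
  have [measurable]: "(\<lambda>z. indicator (cball 0 R) z *\<^sub>R \<sigma> z) \<in> borel_measurable borel" using i by auto
  have "integrable lborel (\<lambda>z. \<phi> z *\<^sub>R (indicator (cball 0 R) z *\<^sub>R \<sigma> z))"
  proof (rule integrable_le)
    show "integrable lborel (\<lambda>z. C * norm (indicator (cball 0 R) z *\<^sub>R \<sigma> z))"
      by (intro integrable_mult_right integrable_norm i)
    show "norm (\<phi> z *\<^sub>R (indicator (cball 0 R) z *\<^sub>R \<sigma> z)) \<le> C * norm (indicator (cball 0 R) z *\<^sub>R \<sigma> z)" for z
      by (subst norm_scaleR) (rule mult_right_mono[OF C(2) norm_ge_zero])
  qed measurable
  moreover have "(\<lambda>z. \<phi> z *\<^sub>R (indicator (cball 0 R) z *\<^sub>R \<sigma> z)) = (\<lambda>z. \<phi> z *\<^sub>R \<sigma> z)"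
  proof
    show "\<phi> z *\<^sub>R (indicator (cball 0 R) z *\<^sub>R \<sigma> z) = \<phi> z *\<^sub>R \<sigma> z" for z
      using R[of z] by (cases "norm z > R") auto
  qed
  ultimately show ?thesis by (simp only:)
qed

text \<open>The fundamental lemma of the calculus of variations. A smooth function that is positive
  on a ball and 0 outside turns \<sigma> into an integrable density; testing with this function
  times the reflected kernel shows that all its mollifications vanish, while they converge in L1 to
  the cut density.\<close>

lemma AE_zero_if_weakly_zero:
  fixes \<sigma> :: "'a::euclidean_space \<Rightarrow> 'b::euclidean_space"
  assumes l: "loc_int \<sigma>" and z: "\<And>\<phi> i. test_fun \<phi> \<Longrightarrow> i \<in> Basis \<Longrightarrow> (\<integral>z. (\<sigma> z \<bullet> i) * \<phi> z \<partial>lborel) = 0"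
  shows "AE z in lborel. \<sigma> z = 0"
proof -
  have "\<exists>k :: 'a \<Rightarrow> real. test_fun k \<and> (\<forall>z. 0 \<le> k z) \<and> (\<integral>z. k z \<partial>lborel) = 1 \<and> (\<forall>z. 1 / real (Suc n) \<le> norm z \<longrightarrow> k z = 0)" for n
    using bump_kernel_exists[of "1 / real (Suc n)"] by (metis of_nat_0_less_iff zero_less_Suc zero_less_divide_1_iff)
  then obtain k :: "nat \<Rightarrow> 'a \<Rightarrow> real" where k: "\<And>n. test_fun (k n)" "\<And>n z. 0 \<le> k n z" "\<And>n. (\<integral>z. k n z \<partial>lborel) = 1"
     "\<And>n z. 1 / real (Suc n) \<le> norm z \<Longrightarrow> k n z = 0" by metis
  have "AE z in lborel. norm z < real m \<longrightarrow> \<sigma> z = 0" for m :: nat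
  proof -
    define cut :: "'a \<Rightarrow> real" where "cut z = expinv 0 ((real m)\<^sup>2 - (norm z)\<^sup>2)" for z
    have "smooth (\<lambda>z::'a. (norm z)\<^sup>2)" by (rule smooth_norm2[OF bounded_linear_ident])
    then have s: "smooth cut" unfolding cut_def by (intro smooth_expinv smooth_diff smooth_const)
    have cut: "test_fun cut"
    proof (rule test_funI[OF s, of "real m"])
      show "cut z = 0" if "real m < norm z" for z
      proof -
        have "(real m)\<^sup>2 \<le> (norm z)\<^sup>2" using that by (intro power_mono) auto
        then have "\<not> 0 < (real m)\<^sup>2 - (norm z)\<^sup>2" by linarith
        then show ?thesis by (simp only: cut_def expinv_def if_False)
      qed
    qed
    have p: "cut z > 0" if "norm z < real m" for z
      using power_strict_mono[of "norm z" "real m" 2] that unfolding cut_def by (intro expinv_pos) auto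
    note i = integrable_test_mult[OF l cut]
    have "cv (\<lambda>z. cut z *\<^sub>R \<sigma> z) (k n) z = 0" for n z
    proof (rule euclidean_eqI)
      fix b :: 'b assume b: "b \<in> Basis"
      have "cv (\<lambda>z. cut z *\<^sub>R \<sigma> z) (k n) z \<bullet> b = (\<integral>y. (\<sigma> y \<bullet> b) * (cut y * k n (z - y)) \<partial>lborel)"
        by (subst cv_inner[OF i k(1)]) (simp add: cv_def mult_ac)
      also have "\<dots> = 0"
        by (intro z b test_fun_mult test_fun_reflect k s)
      finally show "cv (\<lambda>z. cut z *\<^sub>R \<sigma> z) (k n) z \<bullet> b = 0 \<bullet> b" by simp
    qed
    moreover have "(\<lambda>n. \<integral>z. norm (cv (\<lambda>z. cut z *\<^sub>R \<sigma> z) (k n) z - cut z *\<^sub>R \<sigma> z) \<partial>lborel) \<longlonglongrightarrow> 0"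
    proof (rule mollify_L1[OF i k(1,2,3)])
      show "norm z \<le> 1 / real (Suc n)" if "k n z \<noteq> 0" for n z using k(4)[of n z] that by linarith
      show "(\<lambda>n. 1 / real (Suc n)) \<longlonglongrightarrow> 0" by (rule lim_1_over_n[THEN LIMSEQ_Suc])
    qed
    ultimately have "(\<integral>z. norm (cut z *\<^sub>R \<sigma> z) \<partial>lborel) = 0" by (simp add: LIMSEQ_const_iff)
    then have "AE z in lborel. norm (cut z *\<^sub>R \<sigma> z) = 0"
      using integral_nonneg_eq_0_iff_AE[OF integrable_norm[OF i]] by simp
    then show ?thesis by eventually_elim (use p in force)
  qed
  then have "AE z in lborel. \<forall>m. norm z < real m \<longrightarrow> \<sigma> z = 0" by (subst AE_all_countable) blast
  then show ?thesis by eventually_elim (use reals_Archimedean2 in blast)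
qed

text \<open>The space variable is replaced by simple functions converging to it. They take finitely
  many values, so measurability in r for each fixed point suffices, and continuity in space passes
  to the limit.\<close>

lemma Caratheodory_measurable:
  fixes g :: "'r \<Rightarrow> 'a::euclidean_space \<Rightarrow> real"
  assumes m: "\<And>z. (\<lambda>r. g r z) \<in> borel_measurable M" and c: "\<And>r. continuous_on UNIV (g r)"
  shows "(\<lambda>(r, z). g r z) \<in> borel_measurable (M \<Otimes>\<^sub>M borel)"
proof -
  obtain F :: "nat \<Rightarrow> 'a \<Rightarrow> 'a" where F: "\<And>i. simple_function borel (F i)" "\<And>x. (\<lambda>i. F i x) \<longlonglongrightarrow> x"
    using borel_measurable_implies_sequence_metric[of "\<lambda>x. x" "borel :: 'a measure" 0] by auto
  have "(\<lambda>x. g (fst x) (F i (snd x))) \<in> borel_measurable (M \<Otimes>\<^sub>M borel)" for i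
  proof (rule measurable_compose_countable'[where I="range (F i)" and f="\<lambda>y x. g (fst x) y" and g="\<lambda>x. F i (snd x)"])
    show "(\<lambda>x. g (fst x) y) \<in> borel_measurable (M \<Otimes>\<^sub>M borel)" for y
      using m by measurable
    show co: "countable (range (F i))"
      using F(1)[of i] unfolding simple_function_def by (simp add: countable_finite)
    have "F i \<in> measurable borel (count_space (range (F i)))"
      unfolding measurable_count_space_eq_countable[OF co]
      using F(1)[of i] unfolding simple_function_def by auto
    then show "(\<lambda>x. F i (snd x)) \<in> measurable (M \<Otimes>\<^sub>M borel) (count_space (range (F i)))"
      by measurable
  qed
  then show ?thesis unfolding case_prod_unfold
  proof (rule borel_measurable_LIMSEQ_real[rotated])
    show "(\<lambda>i. g (fst x) (F i (snd x))) \<longlonglongrightarrow> g (fst x) (snd x)" for x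
      using c[of "fst x"] F(2)[of "snd x"] by (metis UNIV_I continuous_on_tendsto_compose eventually_sequentiallyI)
  qed
qed

section \<open>Chain rule and Gronwall inequality for absolutely continuous paths\<close>

lemma set_integrable_initial:
  fixes g :: "real \<Rightarrow> real"
  assumes "set_integrable lborel {0..T} g" "t \<le> T"
  shows "set_integrable lborel {0..t} g"
  by (rule set_integrable_subset[OF assms(1)]) (use assms(2) in auto)

lemma integral_initial_eq:
  fixes g :: "real \<Rightarrow> real"
  assumes "set_integrable lborel {0..T} g" "t \<le> T"
  shows "(LINT r:{0..t}|lborel. g r) = integral {0..t} g"
  using set_borel_integral_eq_integral(2)[OF set_integrable_initial[OF assms]] .

lemma integral_increment_bound:
  fixes g :: "real \<Rightarrow> real"
  assumes g: "set_integrable lborel {0..T} g" and st: "0 \<le> s" "s \<le> t" "t \<le> T"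
    and b: "\<And>r. s \<le> r \<Longrightarrow> r \<le> t \<Longrightarrow> \<bar>g r\<bar> \<le> B"
  shows "\<bar>(LINT r:{0..t}|lborel. g r) - (LINT r:{0..s}|lborel. g r)\<bar> \<le> B * (t - s)"
proof -
  have i: "g integrable_on {0..t}" using set_borel_integral_eq_integral(1)[OF set_integrable_initial[OF g st(3)]] .
  then have i2: "g integrable_on {s..t}" by (rule integrable_on_subinterval) (use st in auto)
  have "(LINT r:{0..t}|lborel. g r) - (LINT r:{0..s}|lborel. g r) = integral {s..t} g"
    using Henstock_Kurzweil_Integration.integral_combine[OF st(1,2) i] st g by (simp add: integral_initial_eq)
  moreover have "norm (integral {s..t} g) \<le> integral {s..t} (\<lambda>_. B)"
    by (rule Henstock_Kurzweil_Integration.integral_norm_bound_integral[OF i2]) (use b in auto)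
  ultimately show ?thesis using st by (simp add: mult.commute)
qed

lemma constant_if_quadratic_increments:
  fixes D :: "real \<Rightarrow> real"
  assumes D: "\<And>s t. 0 \<le> s \<Longrightarrow> s \<le> t \<Longrightarrow> t \<le> T \<Longrightarrow> \<bar>D t - D s\<bar> \<le> K * (t - s)\<^sup>2"
    and t: "0 \<le> t" "t \<le> T"
  shows "D t = D 0"
proof -
  have D': "\<bar>D y - D x\<bar> \<le> K * (y - x)\<^sup>2" if "x \<in> {0..T}" "y \<in> {0..T}" for x y
    using D[of x y] D[of y x] that by (cases "x \<le> y") (auto simp: abs_minus_commute power2_commute)
  have "(D has_derivative (\<lambda>h. 0)) (at x within {0..T})" if x: "x \<in> {0..T}" for x
    unfolding has_derivative_iff_norm
  proof (intro conjI)
    show "((\<lambda>y. norm (D y - D x - 0) / norm (y - x)) \<longlongrightarrow> 0) (at x within {0..T})"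
    proof (rule Lim_null_comparison)
      show "\<forall>\<^sub>F y in at x within {0..T}. norm (norm (D y - D x - 0) / norm (y - x)) \<le> K * \<bar>y - x\<bar>"
        unfolding eventually_at_filter
      proof (intro always_eventually allI impI)
        fix y assume "y \<noteq> x" "y \<in> {0..T}"
        then show "norm (norm (D y - D x - 0) / norm (y - x)) \<le> K * \<bar>y - x\<bar>"
          using D'[OF x, of y] by (simp add: divide_le_eq power2_eq_square mult.assoc flip: abs_mult)
      qed
      have "((\<lambda>y. K * \<bar>y - x\<bar>) \<longlongrightarrow> K * \<bar>x - x\<bar>) (at x within {0..T})" by (intro tendsto_intros)
      then show "((\<lambda>y. K * \<bar>y - x\<bar>) \<longlongrightarrow> 0) (at x within {0..T})" by simp
    qed
  qed auto
  then obtain c where "\<forall>x\<in>{0..T}. D x = c"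
    using has_derivative_zero_constant[of "{0..T}" D] by auto
  then show ?thesis using t by auto
qed

text \<open>The path \<open>y\<close> is only absolutely continuous. The difference of the two sides of the chain rule has
  increments of second order, so it is constant.\<close>
lemma integral_chain_rule:
  fixes a y G G' :: "real \<Rightarrow> real"
  assumes T: "0 \<le> T" and a: "set_integrable lborel {0..T} a"
    and bd: "\<And>r. r \<in> {0..T} \<Longrightarrow> \<bar>a r\<bar> \<le> C"
    and y: "\<And>t. t \<in> {0..T} \<Longrightarrow> y t = y 0 + (LINT r:{0..t}|lborel. a r)"
    and y0: "\<And>t. t \<in> {0..T} \<Longrightarrow> 0 \<le> y t"
    and G: "\<And>s. 0 \<le> s \<Longrightarrow> (G has_real_derivative G' s) (at s)"
    and L: "\<And>s s'. 0 \<le> s \<Longrightarrow> 0 \<le> s' \<Longrightarrow> \<bar>G' s - G' s'\<bar> \<le> L * \<bar>s - s'\<bar>"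
  shows "set_integrable lborel {0..T} (\<lambda>r. G' (y r) * a r)"
    and "t \<in> {0..T} \<Longrightarrow> G (y t) - G (y 0) = (LINT r:{0..t}|lborel. G' (y r) * a r)"
proof -
  have C: "0 \<le> C" using bd[of 0] T by auto
  have L0: "0 \<le> L" using L[of 1 0] by auto
  have yd: "\<bar>y t - y s\<bar> \<le> C * (t - s)" if "0 \<le> s" "s \<le> t" "t \<le> T" for s t
    using integral_increment_bound[OF a that, of C] bd that y[of s] y[of t] by auto
  have yL: "\<bar>y t - y s\<bar> \<le> C * \<bar>t - s\<bar>" if "s \<in> {0..T}" "t \<in> {0..T}" for s t
    using yd[of s t] yd[of t s] that by (cases "s \<le> t") (auto simp: abs_minus_commute)
  have "(L * C)-lipschitz_on {0..T} (\<lambda>r. G' (y r))"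
  proof (rule lipschitz_onI)
    fix s t assume st: "s \<in> {0..T}" "t \<in> {0..T}"
    have "\<bar>G' (y s) - G' (y t)\<bar> \<le> L * \<bar>y s - y t\<bar>" using L y0 st by auto
    also have "\<dots> \<le> L * (C * \<bar>s - t\<bar>)" using yL[OF st(2,1)] L0 by (intro mult_left_mono)
    finally show "dist (G' (y s)) (G' (y t)) \<le> L * C * dist s t" by (simp add: dist_real_def)
  qed (use C L0 in auto)
  then have cont: "continuous_on {0..T} (\<lambda>r. G' (y r))" by (rule lipschitz_on_continuous_on)
  have am: "(\<lambda>r. indicator {0..T} r *\<^sub>R a r) \<in> borel_measurable lborel"
    using a unfolding set_integrable_def by auto
  obtain M where "\<forall>x\<in>{0..T}. \<bar>G' (y x)\<bar> \<le> M"
    using compact_imp_bounded[OF compact_continuous_image[OF cont]] unfolding bounded_iff by auto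
  then have M: "\<And>r. r \<in> {0..T} \<Longrightarrow> \<bar>G' (y r)\<bar> \<le> M" by blast
  show si: "set_integrable lborel {0..T} (\<lambda>r. G' (y r) * a r)"
    unfolding set_integrable_def
  proof (rule integrable_le)
    have "integrable lborel (indicator {0..T} :: real \<Rightarrow> real)" by (rule integrable_real_indicator) (use T in auto)
    then show "integrable lborel (\<lambda>r. indicator {0..T} r * (M * C) :: real)" by simp
    have "(\<lambda>r. (indicator {0..T} r *\<^sub>R G' (y r)) * (indicator {0..T} r *\<^sub>R a r)) \<in> borel_measurable lborel"
      using am borel_measurable_continuous_on_indicator[OF _ cont] by measurable
    moreover have "(\<lambda>r. (indicator {0..T} r *\<^sub>R G' (y r)) * (indicator {0..T} r *\<^sub>R a r)) =
        (\<lambda>r. indicator {0..T} r *\<^sub>R (G' (y r) * a r))" by (auto split: split_indicator)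
    ultimately show "(\<lambda>r. indicator {0..T} r *\<^sub>R (G' (y r) * a r)) \<in> borel_measurable lborel" by simp
    show "norm (indicator {0..T} r *\<^sub>R (G' (y r) * a r)) \<le> indicator {0..T} r * (M * C)" for r
      using mult_mono[OF M[of r] bd[of r]] M[of r]
      by (auto split: split_indicator simp: abs_mult)
  qed
  define D where "D t = G (y t) - (LINT r:{0..t}|lborel. G' (y r) * a r)" for t
  \<comment> \<open>One L C^2 comes from the Taylor remainder of G between y s and y t, the other
    from freezing the factor G'(y r) at r = s.\<close>
  have D: "\<bar>D t - D s\<bar> \<le> (2 * L * C^2) * (t - s)\<^sup>2" if st: "0 \<le> s" "s \<le> t" "t \<le> T" for s t
  proof -
    have stT: "s \<in> {0..T}" "t \<in> {0..T}" using st by auto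
    have 1: "\<bar>G (y t) - G (y s) - G' (y s) * (y t - y s)\<bar> \<le> L * \<bar>y t - y s\<bar> * \<bar>y t - y s\<bar>"
    proof -
      define g where "g u = G u - G' (y s) * u" for u
      \<comment> \<open>The segment between two nonnegative values stays in the half-line where G is
        known to be differentiable.\<close>
      define S where "S = closed_segment (y s) (y t)"
      have S: "0 \<le> u" "\<bar>u - y s\<bar> \<le> \<bar>y t - y s\<bar>" if "u \<in> S" for u
        using that y0[OF stT(1)] y0[OF stT(2)] unfolding S_def closed_segment_eq_real_ivl by (auto split: if_splits)
      have "norm (g (y t) - g (y s)) \<le> (L * \<bar>y t - y s\<bar>) * norm (y t - y s)"
      proof (rule field_differentiable_bound[where S=S and f'="\<lambda>u. G' u - G' (y s)"])
        show "(g has_field_derivative G' u - G' (y s)) (at u within S)" if "u \<in> S" for u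
          unfolding g_def using G[OF S(1)[OF that]]
          by (auto intro!: derivative_eq_intros intro: has_field_derivative_at_within)
        show "norm (G' u - G' (y s)) \<le> L * \<bar>y t - y s\<bar>" if "u \<in> S" for u
          using L[OF S(1)[OF that] y0[OF stT(1)]] mult_left_mono[OF S(2)[OF that] L0] by simp
      qed (auto simp: S_def)
      then show ?thesis by (simp add: g_def algebra_simps)
    qed
    have si2: "set_integrable lborel {0..T} (\<lambda>r. (G' (y r) - G' (y s)) * a r)"
      using set_integral_diff(1)[OF si set_integrable_mult_right[of "G' (y s)" lborel "{0..T}" a]] a
      by (simp add: left_diff_distrib)
    have split: "(LINT r:{0..u}|lborel. G' (y r) * a r) = (LINT r:{0..u}|lborel. (G' (y r) - G' (y s)) * a r)
        + G' (y s) * (LINT r:{0..u}|lborel. a r)" if "u \<le> T" for u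
    proof -
      have "(LINT r:{0..u}|lborel. (G' (y r) - G' (y s)) * a r) + (LINT r:{0..u}|lborel. G' (y s) * a r)
          = (LINT r:{0..u}|lborel. (G' (y r) - G' (y s)) * a r + G' (y s) * a r)"
        using set_integrable_initial[OF si2 that] set_integrable_initial[OF a that]
        by (intro set_integral_add(2)[symmetric]) auto
      then show ?thesis by (simp add: algebra_simps)
    qed
    have 2: "\<bar>(LINT r:{0..t}|lborel. (G' (y r) - G' (y s)) * a r) - (LINT r:{0..s}|lborel. (G' (y r) - G' (y s)) * a r)\<bar>
        \<le> (L * (C * (t - s)) * C) * (t - s)"
    proof (rule integral_increment_bound[OF si2 st])
      fix r assume r: "s \<le> r" "r \<le> t"
      have "\<bar>G' (y r) - G' (y s)\<bar> \<le> L * \<bar>y r - y s\<bar>" using L y0 r st by auto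
      also have "\<dots> \<le> L * (C * (t - s))"
        using order_trans[OF yd[of s r] mult_left_mono[of "r - s" "t - s" C]] r st L0 C by (intro mult_left_mono) auto
      finally show "\<bar>(G' (y r) - G' (y s)) * a r\<bar> \<le> L * (C * (t - s)) * C"
        unfolding abs_mult using bd[of r] r st C L0 by (intro mult_mono) auto
    qed
    have yt: "y t - y s = (LINT r:{0..t}|lborel. a r) - (LINT r:{0..s}|lborel. a r)"
      using y[OF stT(1)] y[OF stT(2)] by simp
    \<comment> \<open>The two frozen linear terms cancel, because y t - y s is itself the integral
      of a over the interval.\<close>
    have "D t - D s = (G (y t) - G (y s) - G' (y s) * (y t - y s))
        - ((LINT r:{0..t}|lborel. (G' (y r) - G' (y s)) * a r) - (LINT r:{0..s}|lborel. (G' (y r) - G' (y s)) * a r))"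
      unfolding D_def split[OF st(3)] split[OF order_trans[OF st(2,3)]] yt by (simp add: algebra_simps)
    also have "\<bar>\<dots>\<bar> \<le> L * \<bar>y t - y s\<bar> * \<bar>y t - y s\<bar> + (L * (C * (t - s)) * C) * (t - s)"
      using 1 2 by linarith
    also have "L * \<bar>y t - y s\<bar> * \<bar>y t - y s\<bar> \<le> L * (C * (t - s)) * (C * (t - s))"
      using yd[OF st] L0 C st by (intro mult_mono mult_left_mono) auto
    finally show ?thesis by (simp add: power2_eq_square algebra_simps)
  qed
  show "G (y t) - G (y 0) = (LINT r:{0..t}|lborel. G' (y r) * a r)" if "t \<in> {0..T}"
  proof -
    have "D t = D 0" by (rule constant_if_quadratic_increments[OF D]) (use that in auto)
    moreover have "(LINT r:{0..0}|lborel. G' (y r) * a r) = 0"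
      using integral_initial_eq[OF si, of 0] T by simp
    ultimately show ?thesis by (simp add: D_def)
  qed
qed

text \<open>V is only continuous, so the integrating factor is applied to the right-hand side of the
  integral inequality, which is differentiable. Adding \<beta>/lam absorbs the constant
  forcing.\<close>

lemma Gronwall_integral:
  fixes V :: "real \<Rightarrow> real"
  assumes lam: "lam > 0" and V: "continuous_on {0..T} V"
    and ineq: "\<And>t. t \<in> {0..T} \<Longrightarrow> V t \<le> c + \<beta> * t + lam * integral {0..t} V"
    and t: "t \<in> {0..T}"
  shows "V t \<le> c * exp (lam * t) + \<beta> / lam * (exp (lam * t) - 1)"
proof -
  define R where "R s = c + \<beta> * s + lam * integral {0..s} V" for s
  define Z where "Z s = exp (- lam * s) * (R s + \<beta> / lam)" for s
  have d: "((\<lambda>x. integral {0..x} V) has_real_derivative V s) (at s within {0..T})" if "s \<in> {0..T}" for s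
    by (rule integral_has_real_derivative[OF V that])
  have Zd: "(Z has_real_derivative exp (- lam * s) * (\<beta> + lam * V s - lam * (R s + \<beta> / lam))) (at s within {0..T})"
    if "s \<in> {0..T}" for s
    unfolding Z_def R_def
    by (auto intro!: derivative_eq_intros d[OF that] simp: algebra_simps)
  have dec: "\<exists>y. (Z has_real_derivative y) (at x) \<and> y \<le> 0" if x: "0 < x" "x < t" for x
    proof -
      have xT: "x \<in> {0..T}" "x \<in> interior {0..T}" using x t by auto
      have "(Z has_real_derivative exp (- lam * x) * (\<beta> + lam * V x - lam * (R x + \<beta> / lam))) (at x)"
        using Zd[OF xT(1)] at_within_interior[OF xT(2)] by simp
      moreover have "exp (- lam * x) * (\<beta> + lam * V x - lam * (R x + \<beta> / lam)) \<le> 0"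
      proof -
        have "\<beta> + lam * V x - lam * (R x + \<beta> / lam) = lam * (V x - R x)"
          using lam by (simp add: field_simps)
        also have "\<dots> \<le> 0" using ineq[OF xT(1)] lam by (simp add: R_def mult_nonneg_nonpos)
        finally show ?thesis by (simp add: mult_nonneg_nonpos)
      qed
      ultimately show ?thesis by blast
    qed
  have "continuous_on {0..T} Z"
    using Zd by (rule DERIV_continuous_on)
  then have "continuous_on {0..t} Z" by (rule continuous_on_subset) (use t in auto)
  then have "Z 0 \<ge> Z t"
    using DERIV_nonpos_imp_decreasing_open[of 0 t Z] dec t by auto
  then have "R t + \<beta> / lam \<le> exp (lam * t) * (c + \<beta> / lam)"
    by (simp add: Z_def R_def exp_minus field_simps)
  then show ?thesis using ineq[OF t] by (simp add: R_def algebra_simps)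
qed

text \<open>Gronwall's inequality is applied to Y plus the dissipation accumulated so far. As p is
  nonnegative, lam Y is at most lam times this sum, so the dissipation stays on the left in full and
  without an exponential factor. The error e enters through its total integral, which is added to
  the initial value.\<close>

lemma Gronwall_dissipation:
  fixes Y S p e :: "real \<Rightarrow> real"
  assumes lam: "lam > 0" and t: "t \<in> {0..T}"
    and Y: "\<And>t. t \<in> {0..T} \<Longrightarrow> Y t = Y 0 + (LINT r:{0..t}|lborel. S r)"
    and i: "set_integrable lborel {0..T} S" "set_integrable lborel {0..T} p" "set_integrable lborel {0..T} e"
    and pe: "\<And>r. r \<in> {0..T} \<Longrightarrow> 0 \<le> p r" "\<And>r. r \<in> {0..T} \<Longrightarrow> 0 \<le> e r"
    and S: "\<And>r. r \<in> {0..T} \<Longrightarrow> S r \<le> lam * Y r + \<beta> + e r - p r"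
  shows "Y t + (LINT r:{0..t}|lborel. p r)
    \<le> (Y 0 + (LINT r:{0..T}|lborel. e r)) * exp (lam * t) + \<beta> / lam * (exp (lam * t) - 1)"
proof -
  note eq = i[THEN integral_initial_eq] 
  note hk = i[THEN set_borel_integral_eq_integral(1)]
  define V where "V t = Y t + integral {0..t} p" for t
  have hks: "g integrable_on {0..s}" if "g integrable_on {0..T}" "s \<in> {0..T}" for g :: "real \<Rightarrow> real" and s
    using integrable_on_subinterval[OF that(1)] that(2) by auto
  have Yeq: "Y t = Y 0 + integral {0..t} S" if "t \<in> {0..T}" for t
    using Y[OF that] eq(1)[of t] that by auto
  have contY: "continuous_on {0..T} Y"
    using continuous_on_add[OF continuous_on_const indefinite_integral_continuous_1[OF hk(1)], of "Y 0"] Yeq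
      continuous_on_cong[of "{0..T}" "{0..T}" Y "\<lambda>t. Y 0 + integral {0..t} S"] by blast
  have contV: "continuous_on {0..T} V"
    unfolding V_def by (intro continuous_on_add contY indefinite_integral_continuous_1 hk)
  have ineq: "V t \<le> (Y 0 + integral {0..T} e) + \<beta> * t + lam * integral {0..t} V" if t: "t \<in> {0..T}" for t
  proof -
    have "integral {0..t} S + integral {0..t} p = integral {0..t} (\<lambda>r. S r + p r)"
      using hks[OF hk(1) t] hks[OF hk(2) t] by (simp add: Henstock_Kurzweil_Integration.integral_add)
    also have "\<dots> \<le> integral {0..t} (\<lambda>r. lam * V r + \<beta> + e r)"
    proof (rule integral_le)
      show "(\<lambda>r. S r + p r) integrable_on {0..t}"
        using hks[OF hk(1) t] hks[OF hk(2) t] by (rule integrable_add)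
      have "V integrable_on {0..t}"
        by (rule integrable_continuous_real) (use contV t in \<open>auto intro: continuous_on_subset\<close>)
      then show "(\<lambda>r. lam * V r + \<beta> + e r) integrable_on {0..t}"
        using hks[OF hk(3) t] by (intro integrable_add integrable_on_mult_right) auto
      fix r assume r: "r \<in> {0..t}"
      then have rT: "r \<in> {0..T}" using t by auto
      have "0 \<le> integral {0..r} p"
        by (rule Henstock_Kurzweil_Integration.integral_nonneg[OF hks[OF hk(2) rT]]) (use pe(1) rT in auto)
      then have "lam * Y r \<le> lam * V r" using lam by (simp add: V_def)
      then show "S r + p r \<le> lam * V r + \<beta> + e r" using S[OF rT] by linarith
    qed
    also have "\<dots> = lam * integral {0..t} V + \<beta> * t + integral {0..t} e"
    proof -
      have iV: "V integrable_on {0..t}"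
        by (rule integrable_continuous_real) (use contV t in \<open>auto intro: continuous_on_subset\<close>)
      have "((\<lambda>r. lam * V r + \<beta> + e r) has_integral (lam * integral {0..t} V + (t - 0) *\<^sub>R \<beta> + integral {0..t} e)) {0..t}"
        using t iV hks[OF hk(3) t]
        by (intro has_integral_add has_integral_mult_right integrable_integral)
          (use has_integral_const_real[of \<beta> 0 t] in auto)
      then show ?thesis by (simp add: integral_unique mult.commute)
    qed
    also have "integral {0..t} e \<le> integral {0..T} e"
      by (rule integral_subset_le) (use t hk(3) hks[OF hk(3) t] pe(2) in auto)
    finally have "integral {0..t} S + integral {0..t} p \<le> lam * integral {0..t} V + \<beta> * t + integral {0..T} e"
      by simp
    moreover have "V t = Y 0 + integral {0..t} S + integral {0..t} p" using Yeq[OF t] by (simp add: V_def)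
    ultimately show ?thesis by linarith
  qed
  from Gronwall_integral[OF lam contV ineq t] show ?thesis
    using eq(2)[of t] eq(3)[of T] t by (simp add: V_def)
qed

section \<open>Mollified densities at a fixed time\<close>

definition hpot :: "real \<Rightarrow> 'd::finite ps \<Rightarrow> real" where
  "hpot \<gamma> z = ((norm (fst z + (1/\<gamma>) *\<^sub>R snd z))\<^sup>2 + (norm (snd z))\<^sup>2) / 2"

text \<open>The operator dual to the equation, acting on test functions. The force is a given field
  F here, so the analysis sees a linear equation.\<close>

definition kgen :: "real \<Rightarrow> ('d::finite ps \<Rightarrow> real^'d) \<Rightarrow> ('d ps \<Rightarrow> real) \<Rightarrow> 'd ps \<Rightarrow> real" where
  "kgen \<gamma> F \<phi> z = \<gamma> * (snd z \<bullet> grad_x \<phi> z) + \<gamma> * (F z \<bullet> grad_v \<phi> z) + \<gamma>\<^sup>2 * (lap_v \<phi> z - snd z \<bullet> grad_v \<phi> z)"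

text \<open>The cube dominates the quadratic potential \<open>hpot\<close>. With one further linear
  factor, from a velocity or a force, it becomes the fourth power whose moment is bounded
  later.\<close>

definition wt :: "'a::real_normed_vector \<Rightarrow> real" where "wt z = (1 + norm z)^3"

lemma wt_ge1: "1 \<le> wt z" unfolding wt_def by (rule one_le_power) simp
lemma wt_nonneg: "0 \<le> wt z" using wt_ge1[of z] by linarith
lemma wt_measurable[measurable]: "wt \<in> borel_measurable borel" unfolding wt_def by measurable
lemma norm_le_wt: "1 + norm z \<le> wt z" "(1 + norm z)\<^sup>2 \<le> wt z"
proof -
  show "1 + norm z \<le> wt z" unfolding wt_def by (rule self_le_power) auto
  show "(1 + norm z)\<^sup>2 \<le> wt z" unfolding wt_def by (rule power_increasing) auto
qed

section \<open>Integrability with the cubic weight\<close>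

definition wint :: "('a::euclidean_space \<Rightarrow> 'b::euclidean_space) \<Rightarrow> bool" where
  "wint g \<longleftrightarrow> g \<in> borel_measurable borel \<and> integrable lborel (\<lambda>z. wt z * norm (g z))"

lemma wint_measurable: "wint g \<Longrightarrow> g \<in> borel_measurable borel" by (simp add: wint_def)

lemma wint_mult:
  fixes g :: "'a::euclidean_space \<Rightarrow> 'b::euclidean_space" and p :: "'a \<Rightarrow> real"
  assumes g: "wint g" and p[measurable]: "p \<in> borel_measurable borel" and b: "\<And>z. \<bar>p z\<bar> \<le> C * wt z"
  shows "integrable lborel (\<lambda>z. p z *\<^sub>R g z)"
proof (rule integrable_le)
  have [measurable]: "g \<in> borel_measurable borel" using g by (rule wint_measurable)
  show "integrable lborel (\<lambda>z. C * (wt z * norm (g z)))" using g by (simp add: wint_def)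
  show "(\<lambda>z. p z *\<^sub>R g z) \<in> borel_measurable lborel" by measurable
  show "norm (p z *\<^sub>R g z) \<le> C * (wt z * norm (g z))" for z
    using mult_right_mono[OF b[of z] norm_ge_zero[of "g z"]] by (simp add: mult.assoc)
qed

lemma wint_mult_real:
  fixes g p :: "'a::euclidean_space \<Rightarrow> real"
  assumes "wint g" "p \<in> borel_measurable borel" "\<And>z. \<bar>p z\<bar> \<le> C * wt z"
  shows "integrable lborel (\<lambda>z. p z * g z)"
  using wint_mult[OF assms] by simp

lemma wint_integrable:
  assumes "wint g" shows "integrable lborel g"
proof -
  have "integrable lborel (\<lambda>z. 1 *\<^sub>R g z)"
    by (rule wint_mult[OF assms, where C=1]) (auto simp: wt_ge1)
  then show ?thesis by simp
qed

lemma wint_le: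
  fixes g :: "'a::euclidean_space \<Rightarrow> 'b::euclidean_space" and g' :: "'a \<Rightarrow> 'c::euclidean_space"
  assumes g: "wint g" and m[measurable]: "g' \<in> borel_measurable borel" and b: "\<And>z. norm (g' z) \<le> C * norm (g z)"
  shows "wint g'"
  unfolding wint_def
proof (intro conjI m, rule integrable_le)
  show "integrable lborel (\<lambda>z. C * (wt z * norm (g z)))" using g by (simp add: wint_def)
  show "(\<lambda>z. wt z * norm (g' z)) \<in> borel_measurable lborel" by measurable
  show "norm (wt z * norm (g' z)) \<le> C * (wt z * norm (g z))" for z
    using mult_left_mono[OF b[of z] wt_nonneg[of z]] wt_nonneg[of z] by (simp add: abs_mult mult_ac)
qed

lemma wint_add:
  fixes g g' :: "'a::euclidean_space \<Rightarrow> 'b::euclidean_space"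
  assumes "wint g" "wint g'" shows "wint (\<lambda>z. g z + g' z)"
  unfolding wint_def
proof (intro conjI, goal_cases)
  case 1
  show ?case using assms[THEN wint_measurable] by measurable
next
  case 2
  note [measurable] = assms[THEN wint_measurable]
  show ?case
  proof (rule integrable_le)
    show "integrable lborel (\<lambda>z. wt z * norm (g z) + wt z * norm (g' z))" using assms by (simp add: wint_def)
    show "(\<lambda>z. wt z * norm (g z + g' z)) \<in> borel_measurable lborel" by measurable
    show "norm (wt z * norm (g z + g' z)) \<le> wt z * norm (g z) + wt z * norm (g' z)" for z
      using mult_left_mono[OF norm_triangle_ineq[of "g z" "g' z"] wt_nonneg[of z]] wt_nonneg[of z]
      by (simp add: abs_mult distrib_left)
  qed
qed

lemma wint_sum:
  fixes g :: "'i \<Rightarrow> 'a::euclidean_space \<Rightarrow> 'b::euclidean_space"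
  assumes "\<And>i. i \<in> I \<Longrightarrow> wint (g i)" shows "wint (\<lambda>z. \<Sum>i\<in>I. g i z)"
  using assms
proof (induction I rule: infinite_finite_induct)
  case (insert i I)
  then have "wint (\<lambda>z. g i z + (\<Sum>i\<in>I. g i z))" by (intro wint_add) auto
  then show ?case using insert by simp
qed (auto simp: wint_def)

lemma wint_scale:
  fixes g :: "'a::euclidean_space \<Rightarrow> real"
  assumes "wint g" shows "wint (\<lambda>z. c * g z)"
proof (rule wint_le[OF assms, where C="\<bar>c\<bar>"])
  show "(\<lambda>z. c * g z) \<in> borel_measurable borel" using wint_measurable[OF assms] by measurable
qed (simp add: abs_mult)

text \<open>The mollifying kernels live in the ball of radius 3/2, below the 2 allowed here. Then 1
  + |z| is at most 3 (1 + |y|), and 27 is the cube of 3.\<close>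

lemma wt_shift:
  fixes z y :: "'a::real_normed_vector"
  assumes "norm (z - y) \<le> 2" shows "wt z \<le> 27 * wt y"
proof -
  have "norm z \<le> norm y + 2" using norm_triangle_sub[of z y] assms by simp
  also have "\<dots> \<le> 3 * norm y + 2" by simp
  finally have "1 + norm z \<le> 3 * (1 + norm y)" by simp
  then have "(1 + norm z)^3 \<le> (3 * (1 + norm y))^3" by (intro power_mono) auto
  moreover have "(3 * (1 + norm y))^3 = 27 * (1 + norm y)^3" unfolding power_mult_distrib by simp
  ultimately show ?thesis unfolding wt_def by (simp only:)
qed

lemma wint_cv:
  fixes \<sigma> :: "'a::euclidean_space \<Rightarrow> 'b::euclidean_space"
  assumes \<sigma>: "wint \<sigma>" and k: "test_fun k" and s: "\<And>z. norm z > 2 \<Longrightarrow> k z = 0"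
  shows "wint (cv \<sigma> k)"
    and "(\<integral>z. wt z * norm (cv \<sigma> k z) \<partial>lborel) \<le> 27 * (\<integral>z. \<bar>k z\<bar> \<partial>lborel) * (\<integral>z. wt z * norm (\<sigma> z) \<partial>lborel)"
proof -
  have w: "wt z \<le> 27 * wt y" if "k (z - y) \<noteq> 0" for z y :: 'a
    by (rule wt_shift) (use s[of "z - y"] that in \<open>force simp: not_less[symmetric]\<close>)
  have c27: "0 \<le> (27::real)" by simp
  note * = cv_weighted[OF wint_integrable[OF \<sigma>] k wt_measurable wt_nonneg c27 w]
  show "wint (cv \<sigma> k)"
    using *(1) \<sigma> cv_measurable[OF wint_integrable[OF \<sigma>] k] by (simp add: wint_def)
  show "(\<integral>z. wt z * norm (cv \<sigma> k z) \<partial>lborel) \<le> 27 * (\<integral>z. \<bar>k z\<bar> \<partial>lborel) * (\<integral>z. wt z * norm (\<sigma> z) \<partial>lborel)"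
    using *(2) \<sigma> by (simp add: wint_def)
qed

lemma integration_by_parts_cv:
  fixes \<sigma> p :: "'a::euclidean_space \<Rightarrow> real"
  assumes \<sigma>: "wint \<sigma>" and k: "test_fun k" and s: "\<And>z. norm z > 2 \<Longrightarrow> k z = 0" and e: "e \<in> Basis"
    and d: "\<And>z. (p has_derivative (\<lambda>h. P h z)) (at z)" and c: "continuous_on UNIV (P e)"
    and b: "\<And>z. \<bar>p z\<bar> \<le> C * wt z" "\<And>z. \<bar>P e z\<bar> \<le> C' * wt z"
  shows "(\<integral>z. p z * cv \<sigma> (pd k e) z \<partial>lborel) = - (\<integral>z. P e z * cv \<sigma> k z \<partial>lborel)"
proof (rule integration_by_parts[OF d])
  note i = wint_integrable[OF \<sigma>]
  note k' = test_fun_pd[OF k e]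
  have s': "pd k e z = 0" if "norm z > 2" for z using pd_zero_outside[OF s that] .
  have [measurable]: "p \<in> borel_measurable borel"
    using d by (intro borel_measurable_continuous_onI continuous_at_imp_continuous_on ballI has_derivative_continuous)
  have [measurable]: "P e \<in> borel_measurable borel" using c by (rule borel_measurable_continuous_onI)
  show "(cv \<sigma> k has_derivative (\<lambda>h. cv \<sigma> (pd k h) z)) (at z)" for z by (rule cv_has_derivative[OF i k])
  show "continuous_on UNIV (cv \<sigma> (pd k e))" by (rule cv_continuous[OF i k'])
  show "integrable lborel (\<lambda>z. p z * cv \<sigma> k z)" by (rule wint_mult_real[OF wint_cv(1)[OF \<sigma> k s]]) (auto intro: b)
  show "integrable lborel (\<lambda>z. P e z * cv \<sigma> k z)" by (rule wint_mult_real[OF wint_cv(1)[OF \<sigma> k s]]) (auto intro: b)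
  show "integrable lborel (\<lambda>z. p z * cv \<sigma> (pd k e) z)" by (rule wint_mult_real[OF wint_cv(1)[OF \<sigma> k' s']]) (auto intro: b)
qed (rule c)

text \<open>In the application H is the mollified flux, B the mollified force density and e the
  error of commuting the velocity with the mollification. The left factor is the velocity gradient
  of ln(f + \<kappa>) plus v, rewritten through H. Young's inequality spends a quarter of \<gamma>^2
  |H|^2 on the force and a quarter on e, which leaves half of the dissipation; the other terms carry
  f^2, and f^2/(f + \<kappa>) is at most f. Terms with a factor \<kappa> are kept as an
  error.\<close>

lemma flux_pointwise:
  fixes H e B v :: "'b::euclidean_space" and f \<kappa> s \<gamma> b :: real
  assumes f: "0 \<le> f" and \<kappa>: "0 < \<kappa>" and s: "0 \<le> s" "s \<le> 1/2" and g: "1 \<le> \<gamma>" "\<gamma>\<^sup>2 * s \<le> 1" and b: "0 \<le> b"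
    and e: "norm e \<le> s * f" and B: "norm B \<le> b * f"
  shows "((1 / (f + \<kappa>)) *\<^sub>R (H + e + \<kappa> *\<^sub>R v)) \<bullet> (\<gamma> *\<^sub>R B - \<gamma>\<^sup>2 *\<^sub>R H)
    \<le> - (\<gamma>\<^sup>2 / 2) * ((norm H)\<^sup>2 / (f + \<kappa>)) + f * (3/2 + 2 * b\<^sup>2)
      + \<kappa> * (\<gamma>\<^sup>2 * norm v * norm H + \<gamma> * b * norm v * f) / (f + \<kappa>)"
proof -
  define S where "S = f + \<kappa>"
  have S: "S > 0" "f \<le> S" using f \<kappa> by (auto simp: S_def)
  define n where "n = norm H"
  have n: "0 \<le> n" by (simp add: n_def)
  have cs: "H \<bullet> B \<le> n * (b * f)" "- (e \<bullet> H) \<le> (s * f) * n" "e \<bullet> B \<le> (s * f) * (b * f)" "v \<bullet> B \<le> norm v * (b * f)"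
    "- (v \<bullet> H) \<le> norm v * n"
  proof -
    show "H \<bullet> B \<le> n * (b * f)"
      using norm_cauchy_schwarz[of H B] mult_left_mono[OF B norm_ge_zero[of H]] by (simp add: n_def)
    show "- (e \<bullet> H) \<le> (s * f) * n"
      using Cauchy_Schwarz_ineq2[of e H] mult_right_mono[OF e norm_ge_zero[of H]] by (simp add: n_def)
    show "e \<bullet> B \<le> (s * f) * (b * f)"
      using norm_cauchy_schwarz[of e B] mult_mono[OF e B] f s by (simp add: mult_nonneg_nonneg)
    show "v \<bullet> B \<le> norm v * (b * f)"
      using norm_cauchy_schwarz[of v B] mult_left_mono[OF B norm_ge_zero[of v]] by simp
    show "- (v \<bullet> H) \<le> norm v * n"
      using Cauchy_Schwarz_ineq2[of v H] by (simp add: n_def)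
  qed
  have g0: "0 \<le> \<gamma>" using g by simp
  have gs: "\<gamma> * s \<le> 1"
    using mult_right_mono[OF self_le_power[of \<gamma> 2] s(1)] g by simp
  have "(H + e + \<kappa> *\<^sub>R v) \<bullet> (\<gamma> *\<^sub>R B - \<gamma>\<^sup>2 *\<^sub>R H)
      = - \<gamma>\<^sup>2 * n\<^sup>2 + \<gamma> * (H \<bullet> B) + \<gamma>\<^sup>2 * (- (e \<bullet> H)) + \<gamma> * (e \<bullet> B) + \<kappa> * (\<gamma> * (v \<bullet> B) + \<gamma>\<^sup>2 * (- (v \<bullet> H)))"
    unfolding n_def power2_norm_eq_inner by (simp add: inner_simps algebra_simps inner_commute)
  also have "\<dots> \<le> - \<gamma>\<^sup>2 * n\<^sup>2 + \<gamma> * (n * (b * f)) + \<gamma>\<^sup>2 * ((s * f) * n) + \<gamma> * ((s * f) * (b * f))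
      + \<kappa> * (\<gamma> * (norm v * (b * f)) + \<gamma>\<^sup>2 * (norm v * n))"
  proof -
    have "\<gamma> * (v \<bullet> B) + \<gamma>\<^sup>2 * (- (v \<bullet> H)) \<le> \<gamma> * (norm v * (b * f)) + \<gamma>\<^sup>2 * (norm v * n)"
      by (rule add_mono[OF mult_left_mono[OF cs(4) g0] mult_left_mono[OF cs(5) zero_le_power2]])
    from mult_left_mono[OF this less_imp_le[OF \<kappa>]] show ?thesis
      using mult_left_mono[OF cs(1) g0] mult_left_mono[OF cs(2) zero_le_power2[of \<gamma>]] mult_left_mono[OF cs(3) g0]
      by linarith
  qed
  also have "\<dots> \<le> - (\<gamma>\<^sup>2 / 2) * n\<^sup>2 + f\<^sup>2 * (3/2 + 2 * b\<^sup>2)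
      + \<kappa> * (\<gamma> * (norm v * (b * f)) + \<gamma>\<^sup>2 * (norm v * n))"
  proof -
    have 1: "\<gamma> * (n * (b * f)) \<le> \<gamma>\<^sup>2 * n\<^sup>2 / 4 + b\<^sup>2 * f\<^sup>2"
      using zero_le_power2[of "\<gamma> * n / 2 - b * f"] by (simp add: power2_eq_square algebra_simps)
    have "\<gamma>\<^sup>2 * ((s * f) * n) \<le> \<gamma>\<^sup>2 * s * ((f\<^sup>2 + n\<^sup>2) / 2)"
      using mult_left_mono[of "f * n" "(f\<^sup>2 + n\<^sup>2) / 2" "\<gamma>\<^sup>2 * s"] sum_squares_bound[of f n] s by (simp add: mult_ac)
    also have "\<dots> = (\<gamma>\<^sup>2 * s) * (f\<^sup>2 / 2) + s * (\<gamma>\<^sup>2 * n\<^sup>2 / 2)" by (simp add: algebra_simps)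
    \<comment> \<open>The condition that s is at most 1/2 makes the |H|^2 part a quarter, and the
      one that \<gamma>^2 s is at most 1 frees the f^2 part from \<gamma>.\<close>
    also have "\<dots> \<le> 1 * (f\<^sup>2 / 2) + (1/2) * (\<gamma>\<^sup>2 * n\<^sup>2 / 2)"
      using g s by (intro add_mono mult_right_mono) auto
    finally have 2: "\<gamma>\<^sup>2 * ((s * f) * n) \<le> f\<^sup>2 / 2 + \<gamma>\<^sup>2 * n\<^sup>2 / 4" by simp
    have "\<gamma> * ((s * f) * (b * f)) = (\<gamma> * s) * (b * f\<^sup>2)" by (simp add: power2_eq_square mult_ac)
    also have "\<dots> \<le> 1 * (b * f\<^sup>2)" using gs b by (intro mult_right_mono) auto
    also have "1 * (b * f\<^sup>2) \<le> (1 + b\<^sup>2) * f\<^sup>2"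
    proof -
      have "b \<le> 1 + b\<^sup>2" using sum_squares_bound[of b 1] b by simp
      then show ?thesis by (simp add: mult_right_mono)
    qed
    finally have 3: "\<gamma> * ((s * f) * (b * f)) \<le> (1 + b\<^sup>2) * f\<^sup>2" by simp
    show ?thesis using 1 2 3 by (simp add: algebra_simps)
  qed
  finally have main: "(H + e + \<kappa> *\<^sub>R v) \<bullet> (\<gamma> *\<^sub>R B - \<gamma>\<^sup>2 *\<^sub>R H) \<le> \<dots>" .
  have ff: "f\<^sup>2 / S \<le> f" using S f by (simp add: divide_le_eq power2_eq_square mult_left_mono)
  have "((1 / S) *\<^sub>R (H + e + \<kappa> *\<^sub>R v)) \<bullet> (\<gamma> *\<^sub>R B - \<gamma>\<^sup>2 *\<^sub>R H) = (H + e + \<kappa> *\<^sub>R v) \<bullet> (\<gamma> *\<^sub>R B - \<gamma>\<^sup>2 *\<^sub>R H) / S"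
    by simp
  also have "\<dots> \<le> (- (\<gamma>\<^sup>2 / 2) * n\<^sup>2 + f\<^sup>2 * (3/2 + 2 * b\<^sup>2)
      + \<kappa> * (\<gamma> * (norm v * (b * f)) + \<gamma>\<^sup>2 * (norm v * n))) / S"
    using main S by (intro divide_right_mono) auto
  also have "\<dots> = - (\<gamma>\<^sup>2 / 2) * (n\<^sup>2 / S) + (f\<^sup>2 / S) * (3/2 + 2 * b\<^sup>2)
      + \<kappa> * (\<gamma>\<^sup>2 * norm v * n + \<gamma> * b * norm v * f) / S"
  proof -
    have X: "\<kappa> * (\<gamma> * (norm v * (b * f)) + \<gamma>\<^sup>2 * (norm v * n)) = \<kappa> * (\<gamma>\<^sup>2 * norm v * n + \<gamma> * b * norm v * f)"
      by (simp add: mult_ac)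
    show ?thesis unfolding X add_divide_distrib times_divide_eq_right times_divide_eq_left ..
  qed
  also have "\<dots> \<le> - (\<gamma>\<^sup>2 / 2) * (n\<^sup>2 / S) + f * (3/2 + 2 * b\<^sup>2)
      + \<kappa> * (\<gamma>\<^sup>2 * norm v * n + \<gamma> * b * norm v * f) / S"
    using mult_right_mono[OF ff, of "3/2 + 2 * b\<^sup>2"] by simp
  finally show ?thesis by (simp add: S_def n_def)
qed

text \<open>The mollification of grad_v \<rho> + v \<rho>, with the derivative put on the kernel so
  that it makes sense for a density without derivatives.\<close>

definition fluxH :: "('d::finite ps \<Rightarrow> real) \<Rightarrow> ('d ps \<Rightarrow> real) \<Rightarrow> 'd ps \<Rightarrow> real^'d" where
  "fluxH k \<rho> z = (\<Sum>i\<in>Basis. cv \<rho> (pd k (0, i)) z *\<^sub>R i) + cv (\<lambda>y. \<rho> y *\<^sub>R snd y) k z"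

text \<open>The time derivative of the mollified density at z: the dual operator applied to the
  reflected kernel centred at z.\<close>

definition rate :: "real \<Rightarrow> ('d::finite ps \<Rightarrow> real^'d) \<Rightarrow> ('d ps \<Rightarrow> real) \<Rightarrow> ('d ps \<Rightarrow> real) \<Rightarrow> 'd ps \<Rightarrow> real" where
  "rate \<gamma> F k \<rho> z = (\<integral>y. \<rho> y * kgen \<gamma> F (\<lambda>w. k (z - w)) y \<partial>lborel)"

lemma Basis_pair [simp]:
  "(i, 0) \<in> (Basis :: ('a::euclidean_space \<times> 'b::euclidean_space) set) \<longleftrightarrow> i \<in> Basis"
  "(0, j) \<in> (Basis :: ('a \<times> 'b) set) \<longleftrightarrow> j \<in> Basis"
  by (auto simp: Basis_prod_def)

lemma kgen_reflect:
  fixes k :: "'d::finite ps \<Rightarrow> real"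
  assumes k: "smooth k"
  shows "kgen \<gamma> F (\<lambda>w. k (z - w)) y = (\<Sum>i\<in>Basis. - \<gamma> * (snd y \<bullet> i) * pd k (i, 0) (z - y)
     - \<gamma> * (F y \<bullet> i) * pd k (0, i) (z - y)
     + \<gamma>\<^sup>2 * (pd (pd k (0, i)) (0, i) (z - y) + (snd y \<bullet> i) * pd k (0, i) (z - y)))"
proof -
  have 1: "pd (\<lambda>w. k (z - w)) e = (\<lambda>w. - pd k e (z - w))" for e
    by (rule ext) (rule smooth_pd_reflect[OF k])
  have 2: "pd (\<lambda>w. - pd k (0, i) (z - w)) (0, i) y = pd (pd k (0, i)) (0, i) (z - y)" if "i \<in> Basis" for i
  proof -
    have s: "smooth (pd k (0, i))" using smooth_pd[OF k] that by simp
    have "((\<lambda>w. - pd k (0, i) (z - w)) has_derivative (\<lambda>h. - pd (\<lambda>w. pd k (0, i) (z - w)) h y)) (at y)"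
      by (intro has_derivative_minus smooth_has_derivative smooth_reflect s)
    from pd_eq[OF this] show ?thesis using smooth_pd_reflect[OF s] by simp
  qed
  show ?thesis
    unfolding kgen_def grad_x_def grad_v_def lap_v_def 1
    by (simp add: inner_sum_right 2 sum_distrib_left sum.distrib[symmetric] sum_negf[symmetric] sum_subtractf[symmetric] algebra_simps)
qed

lemma norm_fst_le': "norm (fst z) \<le> norm z" and norm_snd_le': "norm (snd z) \<le> norm z"
  for z :: "'a::euclidean_space \<times> 'b::euclidean_space"
  using norm_fst_le[of "fst z" "snd z"] norm_snd_le[of "snd z" "fst z"] by auto

lemma wint_inner:
  assumes "wint \<sigma>" shows "wint (\<lambda>y. \<sigma> y \<bullet> i)"
proof (rule wint_le[OF assms, where C="norm i"])
  show "(\<lambda>y. \<sigma> y \<bullet> i) \<in> borel_measurable borel" using wint_measurable[OF assms] by measurable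
  show "norm (\<sigma> z \<bullet> i) \<le> norm i * norm (\<sigma> z)" for z
    using Cauchy_Schwarz_ineq2[of "\<sigma> z" i] by (simp add: mult.commute)
qed

text \<open>Everything at one fixed time. Measurability is assumed of \<rho> F, because this is what
  the weak formulation can deliver. The last condition bounds two commutators with the
  mollification: that of the velocity, of size s, and that of transport, of size s times the L1 norm
  of the x-derivatives of the kernel.\<close>

locale snapshot =
  fixes \<gamma> c c0 s M :: real and \<rho> :: "'d::finite ps \<Rightarrow> real" and F :: "'d ps \<Rightarrow> real^'d" and k :: "'d ps \<Rightarrow> real"
  assumes gam: "1 \<le> \<gamma>" and cc: "0 \<le> c" "0 \<le> c0"
    and rho: "\<rho> \<in> borel_measurable borel" "\<And>z. 0 \<le> \<rho> z" "integrable lborel \<rho>" "(\<integral>z. \<rho> z \<partial>lborel) = 1"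
    and mom: "integrable lborel (\<lambda>z. (1 + norm z)^4 * \<rho> z)" "(\<integral>z. (1 + norm z)^4 * \<rho> z \<partial>lborel) \<le> M"
    and Fm: "(\<lambda>z. \<rho> z *\<^sub>R F z) \<in> borel_measurable borel" and Fb: "\<And>z. norm (F z) \<le> c * (1 + norm (fst z)) + c0"
    and k: "test_fun k" and k0: "\<And>z. 0 \<le> k z" and k1: "(\<integral>z. k z \<partial>lborel) = 1"
    and ks: "\<And>z. k z \<noteq> 0 \<Longrightarrow> norm (fst z) \<le> 1 \<and> norm (snd z) \<le> s"
    and s: "0 < s" "s \<le> 1/2" "\<gamma>\<^sup>2 * s * (1 + (\<Sum>i\<in>Basis. \<integral>z. \<bar>pd k (i, 0) z\<bar> \<partial>lborel)) \<le> 1"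
begin

abbreviation "f \<equiv> cv \<rho> k"
abbreviation "A \<equiv> cv (\<lambda>y. \<rho> y *\<^sub>R snd y) k"
abbreviation "B \<equiv> cv (\<lambda>y. \<rho> y *\<^sub>R F y) k"
abbreviation "H \<equiv> fluxH k \<rho>"
abbreviation "bb (z :: 'd ps) \<equiv> c * (2 + norm (fst z)) + c0"
abbreviation "xi (z :: 'd ps) \<equiv> fst z + (1/\<gamma>) *\<^sub>R snd z"

lemma k_supp: "norm z > 2 \<Longrightarrow> k z = 0"
  using ks[of z] s norm_Pair_le[of "fst z" "snd z"] by (cases "k z = 0") auto

lemma pdk_supp: "norm z > 2 \<Longrightarrow> pd k e z = 0"
  using pd_zero_outside[OF k_supp] .

lemma wint_dom:
  fixes \<sigma> :: "'d ps \<Rightarrow> 'b::euclidean_space"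
  assumes m[measurable]: "\<sigma> \<in> borel_measurable borel" and b: "\<And>z. norm (\<sigma> z) \<le> C * ((1 + norm z) * \<rho> z)"
  shows "wint \<sigma>" and "(\<integral>z. wt z * norm (\<sigma> z) \<partial>lborel) \<le> C * (\<integral>z. (1 + norm z)^4 * \<rho> z \<partial>lborel)"
proof -
  have le: "wt z * norm (\<sigma> z) \<le> C * ((1 + norm z)^4 * \<rho> z)" for z
  proof -
    have "wt z * norm (\<sigma> z) \<le> wt z * (C * ((1 + norm z) * \<rho> z))" by (rule mult_left_mono[OF b wt_nonneg])
    also have "\<dots> = C * ((1 + norm z)^4 * \<rho> z)" by (simp add: wt_def power4_eq_xxxx power3_eq_cube mult_ac)
    finally show ?thesis .
  qed
  have i: "integrable lborel (\<lambda>z. C * ((1 + norm z)^4 * \<rho> z))" using mom by simp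
  show 1: "wint \<sigma>" unfolding wint_def
  proof (intro conjI m, rule integrable_le[OF i])
    show "norm (wt z * norm (\<sigma> z)) \<le> C * ((1 + norm z)^4 * \<rho> z)" for z using le[of z] wt_nonneg[of z] by simp
  qed measurable
  have "(\<integral>z. wt z * norm (\<sigma> z) \<partial>lborel) \<le> (\<integral>z. C * ((1 + norm z)^4 * \<rho> z) \<partial>lborel)"
    by (rule integral_mono) (use 1 i le in \<open>auto simp: wint_def\<close>)
  then show "(\<integral>z. wt z * norm (\<sigma> z) \<partial>lborel) \<le> C * (\<integral>z. (1 + norm z)^4 * \<rho> z \<partial>lborel)" by simp
qed

lemma wrho: "wint \<rho>"
  by (rule wint_dom(1)[where C=1]) (use rho mult_right_mono[of 1 "1 + norm z" "\<rho> z" for z] in auto)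

lemma sA_bound: "norm (\<rho> z *\<^sub>R snd z) \<le> 1 * ((1 + norm z) * \<rho> z)"
  using mult_right_mono[of "norm (snd z)" "1 + norm z" "\<rho> z"] norm_snd_le'[of z] rho(2)[of z] by (simp add: mult.commute)

lemma sB_bound: "norm (\<rho> z *\<^sub>R F z) \<le> (c + c0) * ((1 + norm z) * \<rho> z)"
proof -
  have "c * (1 + norm (fst z)) + c0 * 1 \<le> c * (1 + norm z) + c0 * (1 + norm z)"
    using norm_fst_le'[of z] cc by (intro add_mono mult_left_mono) auto
  then have "norm (F z) \<le> (c + c0) * (1 + norm z)" using Fb[of z] by (simp add: algebra_simps)
  from mult_right_mono[OF this rho(2)[of z]] show ?thesis using rho(2)[of z] by (simp add: mult_ac)
qed

lemma sA_measurable: "(\<lambda>y. \<rho> y *\<^sub>R snd y) \<in> borel_measurable borel"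
  using rho(1) by (intro borel_measurable_scaleR borel_measurable_continuous_onI[OF continuous_on_snd]) auto

lemma wsA: "wint (\<lambda>y. \<rho> y *\<^sub>R snd y)" by (rule wint_dom(1)[OF sA_measurable sA_bound])
lemma wsB: "wint (\<lambda>y. \<rho> y *\<^sub>R F y)" by (rule wint_dom(1)[OF Fm sB_bound])

lemma wsAi: "wint (\<lambda>y. \<rho> y * (snd y \<bullet> i))" using wint_inner[OF wsA, of i] by simp
lemma wsBi: "wint (\<lambda>y. \<rho> y * (F y \<bullet> i))" using wint_inner[OF wsB, of i] by simp

lemma A_inner: "A z \<bullet> i = cv (\<lambda>y. \<rho> y * (snd y \<bullet> i)) k z"
  using cv_inner[OF wint_integrable[OF wsA] k] by simp
lemma B_inner: "B z \<bullet> i = cv (\<lambda>y. \<rho> y * (F y \<bullet> i)) k z"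
  using cv_inner[OF wint_integrable[OF wsB] k] by simp

lemma rate_eq:
  "rate \<gamma> F k \<rho> z = (\<Sum>i\<in>Basis. - \<gamma> * cv (\<lambda>y. \<rho> y * (snd y \<bullet> i)) (pd k (i, 0)) z
     - \<gamma> * cv (\<lambda>y. \<rho> y * (F y \<bullet> i)) (pd k (0, i)) z
     + \<gamma>\<^sup>2 * (cv \<rho> (pd (pd k (0, i)) (0, i)) z + cv (\<lambda>y. \<rho> y * (snd y \<bullet> i)) (pd k (0, i)) z))"
proof -
  note ti = cv_test_integrable[OF wint_integrable]
  have i: "integrable lborel (\<lambda>y. pd k (i, 0) (z - y) * (\<rho> y * (snd y \<bullet> i)))"
    "integrable lborel (\<lambda>y. pd k (0, i) (z - y) * (\<rho> y * (F y \<bullet> i)))"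
    "integrable lborel (\<lambda>y. pd (pd k (0, i)) (0, i) (z - y) * \<rho> y)"
    "integrable lborel (\<lambda>y. pd k (0, i) (z - y) * (\<rho> y * (snd y \<bullet> i)))" if "i \<in> Basis" for i
    using ti[OF wsAi test_fun_pd[OF k, of "(i, 0)"]] ti[OF wsBi test_fun_pd[OF k, of "(0, i)"]]
      ti[OF wrho test_fun_pd[OF test_fun_pd[OF k], of "(0, i)" "(0, i)"]] ti[OF wsAi test_fun_pd[OF k, of "(0, i)"]] that
    by simp_all
  have "rate \<gamma> F k \<rho> z = (\<integral>y. (\<Sum>i\<in>Basis. - \<gamma> * (pd k (i, 0) (z - y) * (\<rho> y * (snd y \<bullet> i)))
     - \<gamma> * (pd k (0, i) (z - y) * (\<rho> y * (F y \<bullet> i)))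
     + \<gamma>\<^sup>2 * (pd (pd k (0, i)) (0, i) (z - y) * \<rho> y + pd k (0, i) (z - y) * (\<rho> y * (snd y \<bullet> i)))) \<partial>lborel)"
    unfolding rate_def kgen_reflect[OF test_fun_smooth[OF k]] sum_distrib_left
    by (intro Bochner_Integration.integral_cong sum.cong refl) (simp add: algebra_simps)
  also have "\<dots> = (\<Sum>i\<in>Basis. (\<integral>y. - \<gamma> * (pd k (i, 0) (z - y) * (\<rho> y * (snd y \<bullet> i)))
     - \<gamma> * (pd k (0, i) (z - y) * (\<rho> y * (F y \<bullet> i)))
     + \<gamma>\<^sup>2 * (pd (pd k (0, i)) (0, i) (z - y) * \<rho> y + pd k (0, i) (z - y) * (\<rho> y * (snd y \<bullet> i))) \<partial>lborel))"
    by (rule Bochner_Integration.integral_sum)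
      (intro Bochner_Integration.integrable_add Bochner_Integration.integrable_diff integrable_mult_right i)
  also have "\<dots> = (\<Sum>i\<in>Basis. - \<gamma> * cv (\<lambda>y. \<rho> y * (snd y \<bullet> i)) (pd k (i, 0)) z
     - \<gamma> * cv (\<lambda>y. \<rho> y * (F y \<bullet> i)) (pd k (0, i)) z
     + \<gamma>\<^sup>2 * (cv \<rho> (pd (pd k (0, i)) (0, i)) z + cv (\<lambda>y. \<rho> y * (snd y \<bullet> i)) (pd k (0, i)) z))"
    unfolding cv_def real_scaleR_def
    by (rule sum.cong[OF refl]) (simp only: i Bochner_Integration.integral_add Bochner_Integration.integral_diff
        Bochner_Integration.integrable_add Bochner_Integration.integrable_diff integrable_mult_right integral_mult_right_zero)
  finally show ?thesis .
qed

lemma wint_kernels: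
  assumes "i \<in> Basis"
  shows "wint (cv (\<lambda>y. \<rho> y * (snd y \<bullet> i)) (pd k (i, 0)))" "wint (cv (\<lambda>y. \<rho> y * (F y \<bullet> i)) (pd k (0, i)))"
    "wint (cv \<rho> (pd (pd k (0, i)) (0, i)))" "wint (cv (\<lambda>y. \<rho> y * (snd y \<bullet> i)) (pd k (0, i)))"
    "wint (cv \<rho> (pd k (i, 0)))" "wint (cv \<rho> (pd k (0, i)))"
  using assms pd_zero_outside[OF pdk_supp]
  by (auto intro!: wint_cv(1) wsAi wsBi wrho test_fun_pd k pdk_supp)

lemma wf: "wint f" by (rule wint_cv(1)[OF wrho k k_supp])
lemma wA: "wint A" by (rule wint_cv(1)[OF wsA k k_supp])
lemma wB: "wint B" by (rule wint_cv(1)[OF wsB k k_supp])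

lemma wgv: "wint (\<lambda>z. \<Sum>i\<in>Basis. cv \<rho> (pd k (0, i)) z *\<^sub>R i)"
proof (rule wint_sum)
  fix i :: "real^'d" assume i: "i \<in> Basis"
  show "wint (\<lambda>z. cv \<rho> (pd k (0, i)) z *\<^sub>R i)"
    by (rule wint_le[OF wint_kernels(6)[OF i], where C=1])
      (use wint_measurable[OF wint_kernels(6)[OF i]] i in \<open>auto intro!: borel_measurable_scaleR\<close>)
qed

lemma wH: "wint H"
  unfolding fluxH_def[abs_def] by (rule wint_add[OF wgv wA])

lemma rate_wint: "wint (rate \<gamma> F k \<rho>)"
  unfolding rate_eq[abs_def] diff_conv_add_uminus minus_mult_left
  by (intro wint_sum wint_add wint_scale wint_kernels)

lemma f_nonneg: "0 \<le> f z"
  unfolding cv_def using k0 rho(2) by (intro Bochner_Integration.integral_nonneg) auto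

lemma f_integral: "(\<integral>z. f z \<partial>lborel) = 1"
  using cv_integral[OF rho(3) k] k1 rho(4) by simp

text \<open>The difference averages v - v' over the kernel, whose velocity radius is s.\<close>

lemma A_bound: "norm (f z *\<^sub>R snd z - A z) \<le> s * f z"
proof -
  have i: "integrable lborel (\<lambda>y. k (z - y) * \<rho> y)" using cv_test_integrable[OF rho(3) k] by simp
  have i2: "integrable lborel (\<lambda>y. k (z - y) *\<^sub>R (\<rho> y *\<^sub>R snd y))" using cv_test_integrable[OF wint_integrable[OF wsA] k] .
  have "f z *\<^sub>R snd z - A z = (\<integral>y. (k (z - y) * \<rho> y) *\<^sub>R snd z \<partial>lborel) - (\<integral>y. k (z - y) *\<^sub>R (\<rho> y *\<^sub>R snd y) \<partial>lborel)"
    using i by (simp add: cv_def)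
  also have "\<dots> = (\<integral>y. (k (z - y) * \<rho> y) *\<^sub>R snd z - k (z - y) *\<^sub>R (\<rho> y *\<^sub>R snd y) \<partial>lborel)"
    by (rule Bochner_Integration.integral_diff[symmetric]) (use i i2 in auto)
  also have "norm \<dots> \<le> (\<integral>y. s * (k (z - y) * \<rho> y) \<partial>lborel)"
  proof (rule norm_integral_le)
    show "integrable lborel (\<lambda>y. s * (k (z - y) * \<rho> y))" using i by simp
    fix y
    have "norm ((k (z - y) * \<rho> y) *\<^sub>R snd z - k (z - y) *\<^sub>R (\<rho> y *\<^sub>R snd y)) = norm ((k (z - y) * \<rho> y) *\<^sub>R snd (z - y))"
      by (simp add: scaleR_right_diff_distrib)
    also have "\<dots> = norm (snd (z - y)) * (k (z - y) * \<rho> y)"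
      using k0 rho(2) by (simp add: abs_mult)
    also have "\<dots> \<le> s * (k (z - y) * \<rho> y)"
      using ks[of "z - y"] k0 rho(2) by (cases "k (z - y) = 0") (simp, intro mult_right_mono mult_nonneg_nonneg k0 rho(2), simp)
    finally show "norm ((k (z - y) * \<rho> y) *\<^sub>R snd z - k (z - y) *\<^sub>R (\<rho> y *\<^sub>R snd y)) \<le> s * (k (z - y) * \<rho> y)" .
  qed
  also have "\<dots> = s * f z" by (simp add: cv_def)
  finally show ?thesis .
qed

lemma bb_nonneg: "0 \<le> bb z" using cc by (intro add_nonneg_nonneg mult_nonneg_nonneg) auto

text \<open>The growth bound is evaluated at positions that differ from x by at most 1; this turns 1
  + |x| into 2 + |x|.\<close>

lemma B_bound: "norm (B z) \<le> bb z * f z"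
proof -
  have i: "integrable lborel (\<lambda>y. k (z - y) * \<rho> y)" using cv_test_integrable[OF rho(3) k] by simp
  have "norm (B z) \<le> (\<integral>y. bb z * (k (z - y) * \<rho> y) \<partial>lborel)"
    unfolding cv_def
  proof (rule norm_integral_le)
    show "integrable lborel (\<lambda>y. bb z * (k (z - y) * \<rho> y))" using i by simp
    fix y
    have "norm (k (z - y) *\<^sub>R (\<rho> y *\<^sub>R F y)) = norm (F y) * (k (z - y) * \<rho> y)"
      using k0 rho(2) by (simp add: abs_mult)
    also have "\<dots> \<le> bb z * (k (z - y) * \<rho> y)"
    proof (cases "k (z - y) = 0")
      case False
      then have "norm (fst z - fst y) \<le> 1" using ks[of "z - y"] by simp
      then have "norm (fst y) \<le> 1 + norm (fst z)"
        using norm_triangle_sub[of "fst y" "fst z"] by (simp add: norm_minus_commute)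
      then have "c * (1 + norm (fst y)) + c0 \<le> bb z" using cc by (intro add_right_mono mult_left_mono) auto
      then show ?thesis using Fb[of y] k0 rho(2) by (intro mult_right_mono) auto
    qed simp
    finally show "norm (k (z - y) *\<^sub>R (\<rho> y *\<^sub>R F y)) \<le> bb z * (k (z - y) * \<rho> y)" .
  qed
  also have "\<dots> = bb z * f z" by (simp add: cv_def)
  finally show ?thesis .
qed

text \<open>At a zero the nonnegative mollified density has a minimum, so its gradient vanishes; the
  mollified momentum vanishes by the commutator bound. This is what makes the error of the shifted
  logarithm disappear with the shift.\<close>

lemma H_zero: assumes "f z = 0" shows "H z = 0"
proof -
  have "A z = 0" using A_bound[of z] assms by simp
  moreover have "cv \<rho> (pd k e) z = 0" for e
  proof -
    have "(\<lambda>h. cv \<rho> (pd k h) z) = (\<lambda>h. 0)"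
      by (rule differential_zero_maxmin[OF _ open_UNIV cv_has_derivative[OF rho(3) k]])
        (use f_nonneg assms in auto)
    then show ?thesis by metis
  qed
  ultimately show ?thesis by (simp add: fluxH_def)
qed

lemma f_bounded: obtains m where "m > 0" "\<And>z. f z \<le> m"
proof -
  obtain C where C: "C > 0" "\<And>z. \<bar>k z\<bar> \<le> C" using test_fun_bounded[OF k] by metis
  have "f z \<le> C" for z using cv_bounded[OF rho(3) k C(2), of z] rho by simp
  then show ?thesis using that C(1) by blast
qed

lemma xi_bounds: "norm (xi z) \<le> 2 * (1 + norm z)" "\<bar>hpot \<gamma> z\<bar> \<le> 3 * wt z" "0 \<le> hpot \<gamma> z"
  "(norm (xi z))\<^sup>2 \<le> 2 * hpot \<gamma> z"
proof -
  have "norm ((1/\<gamma>) *\<^sub>R snd z) \<le> 1 * norm (snd z)"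
    using gam by (simp add: divide_le_eq mult_le_cancel_left1)
  then have 1: "norm (xi z) \<le> 2 * norm z"
    using norm_triangle_ineq[of "fst z" "(1/\<gamma>) *\<^sub>R snd z"] norm_fst_le'[of z] norm_snd_le'[of z] by simp
  then show "norm (xi z) \<le> 2 * (1 + norm z)" by simp
  have "(norm (xi z))\<^sup>2 \<le> (2 * (1 + norm z))\<^sup>2" using 1 by (intro power_mono) auto
  moreover have "(norm (snd z))\<^sup>2 \<le> (1 + norm z)\<^sup>2" using norm_snd_le'[of z] by (intro power_mono) auto
  moreover have "(2 * (1 + norm z))\<^sup>2 = 4 * (1 + norm z)\<^sup>2" unfolding power_mult_distrib by simp
  moreover define q where "q = (1 + norm z)\<^sup>2"
  ultimately have "(norm (xi z))\<^sup>2 \<le> 4 * q" "(norm (snd z))\<^sup>2 \<le> q" "0 \<le> q" by (simp_all only:) simp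
  then have "hpot \<gamma> z \<le> 3 * (1 + norm z)\<^sup>2" unfolding hpot_def q_def[symmetric] by argo
  then have 3: "hpot \<gamma> z \<le> 3 * wt z" using norm_le_wt(2)[of z] by linarith
  show 2: "0 \<le> hpot \<gamma> z" by (simp add: hpot_def)
  show "\<bar>hpot \<gamma> z\<bar> \<le> 3 * wt z" using 2 3 by simp
  show "(norm (xi z))\<^sup>2 \<le> 2 * hpot \<gamma> z" by (simp add: hpot_def)
qed

lemma hpot_has_derivative:
  "(hpot \<gamma> has_derivative (\<lambda>w. xi z \<bullet> (fst w + (1/\<gamma>) *\<^sub>R snd w) + snd z \<bullet> snd w)) (at z)"
  unfolding hpot_def[abs_def] power2_norm_eq_inner
  by (auto intro!: derivative_eq_intros simp: inner_commute)

lemma bb_wt: "\<bar>bb z\<bar> \<le> (2*c + c0) * (1 + norm z)"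
proof -
  have "bb z \<le> c * (2 * (1 + norm z)) + c0 * (1 + norm z)"
  proof -
    have "norm (fst z) \<le> 2 * norm z" using norm_fst_le'[of z] norm_ge_zero[of z] by linarith
    then have "2 + norm (fst z) \<le> 2 * (1 + norm z)" by simp
    then show ?thesis using cc mult_left_mono[of 1 "1 + norm z" c0] mult_left_mono[of "2 + norm (fst z)" "2 * (1 + norm z)" c] by auto
  qed
  then show ?thesis using bb_nonneg[of z] by (simp add: algebra_simps)
qed

end

section \<open>Entropy production at a fixed time, with shifted logarithm\<close>

context snapshot begin

context
  fixes \<kappa> :: real assumes \<kappa>: "0 < \<kappa>"
begin

abbreviation "S z \<equiv> f z + \<kappa>"
text \<open>The entropy variable: the derivative in s of the regularised s ln s plus potential times
  s, taken at the mollified density. \<open>Dpt w\<close> is its derivative in direction w.\<close>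

abbreviation "pt z \<equiv> ln (S z) + 1 + hpot \<gamma> z"
abbreviation "Dpt w z \<equiv> cv \<rho> (pd k w) z / S z + (xi z \<bullet> (fst w + (1/\<gamma>) *\<^sub>R snd w) + snd z \<bullet> snd w)"

lemma S_pos: "0 < S z" using f_nonneg[of z] \<kappa> by simp

lemma pt_has_derivative: "(pt has_derivative (\<lambda>w. Dpt w z)) (at z)"
proof -
  have "((\<lambda>z. ln (f z + \<kappa>)) has_derivative (\<lambda>w. cv \<rho> (pd k w) z / S z)) (at z)"
    using S_pos[of z] by (auto intro!: derivative_eq_intros cv_has_derivative[OF rho(3) k] simp: divide_inverse mult.commute)
  from has_derivative_add[OF has_derivative_add[OF this has_derivative_const[of 1]] hpot_has_derivative[of z]]
  show ?thesis by simp
qed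

lemma Dpt_continuous: "e \<in> Basis \<Longrightarrow> continuous_on UNIV (Dpt e)"
  using S_pos by (intro continuous_intros cv_continuous rho(3) test_fun_pd k) (auto simp: less_imp_neq[symmetric])

lemma ln_bounded: obtains C where "C \<ge> 0" "\<And>z. \<bar>ln (S z)\<bar> \<le> C"
proof -
  obtain m where m: "m > 0" "\<And>z. f z \<le> m" using f_bounded by metis
  have "\<bar>ln (S z)\<bar> \<le> \<bar>ln \<kappa>\<bar> + \<bar>ln (m + \<kappa>)\<bar>" for z
  proof -
    have "ln \<kappa> \<le> ln (S z)" using f_nonneg[of z] \<kappa> by simp
    moreover have "ln (S z) \<le> ln (m + \<kappa>)" using f_nonneg[of z] m(2)[of z] \<kappa> by simp
    ultimately show ?thesis by linarith
  qed
  then show ?thesis using that[of "\<bar>ln \<kappa>\<bar> + \<bar>ln (m + \<kappa>)\<bar>"] by simp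
qed

lemma pt_bound: obtains C where "\<And>z. \<bar>pt z\<bar> \<le> C * wt z"
proof -
  obtain C where C: "C \<ge> 0" "\<And>z. \<bar>ln (S z)\<bar> \<le> C" using ln_bounded by metis
  have "\<bar>pt z\<bar> \<le> (C + 1 + 3) * wt z" for z
  proof -
    have "\<bar>pt z\<bar> \<le> C + 1 + 3 * wt z" using C(2)[of z] xi_bounds(2)[of z] by linarith
    also have "\<dots> \<le> (C + 1) * wt z + 3 * wt z" using C(1) mult_left_mono[OF wt_ge1[of z], of "C + 1"] by simp
    finally show ?thesis by (simp add: algebra_simps)
  qed
  then show ?thesis using that by blast
qed

lemma Dpt_bound:
  assumes e: "e \<in> Basis" obtains C where "\<And>z. \<bar>Dpt e z\<bar> \<le> C * wt z"
proof -
  obtain C where C: "C > 0" "\<And>z. \<bar>pd k e z\<bar> \<le> C" using test_fun_bounded[OF test_fun_pd[OF k e]] by metis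
  have c: "\<bar>cv \<rho> (pd k e) z / S z\<bar> \<le> C / \<kappa>" for z
  proof -
    have "\<bar>cv \<rho> (pd k e) z\<bar> \<le> C" using cv_bounded[OF rho(3) test_fun_pd[OF k e] C(2), of z] rho by simp
    moreover have "\<kappa> \<le> S z" using f_nonneg[of z] by simp
    ultimately show ?thesis using \<kappa> C(1) S_pos[of z] by (simp add: abs_divide frac_le)
  qed
  have fs: "norm (fst e) \<le> 1" "norm (snd e) \<le> 1"
    using norm_fst_le'[of e] norm_snd_le'[of e] e by auto
  have i: "\<bar>xi z \<bullet> (fst e + (1/\<gamma>) *\<^sub>R snd e) + snd z \<bullet> snd e\<bar> \<le> 5 * wt z" for z
  proof -
    define n where "n = 1 + norm z"
    have "norm ((1/\<gamma>) *\<^sub>R snd e) \<le> 1" using gam fs(2) by (simp add: divide_le_eq)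
    then have "norm (fst e + (1/\<gamma>) *\<^sub>R snd e) \<le> 2" using fs(1) norm_triangle_ineq[of "fst e" "(1/\<gamma>) *\<^sub>R snd e"] by simp
    then have "\<bar>xi z \<bullet> (fst e + (1/\<gamma>) *\<^sub>R snd e)\<bar> \<le> (2 * n) * 2"
      unfolding n_def by (intro order_trans[OF Cauchy_Schwarz_ineq2] mult_mono xi_bounds(1)) auto
    moreover have "\<bar>snd z \<bullet> snd e\<bar> \<le> n * 1"
      unfolding n_def using norm_snd_le'[of z] fs(2) by (intro order_trans[OF Cauchy_Schwarz_ineq2] mult_mono) auto
    ultimately show ?thesis using norm_le_wt(1)[of z] unfolding n_def[symmetric] by linarith
  qed
  have "\<bar>Dpt e z\<bar> \<le> (C / \<kappa> + 5) * wt z" for z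
  proof -
    have "\<bar>Dpt e z\<bar> \<le> C / \<kappa> + 5 * wt z" using c[of z] i[of z] by linarith
    also have "\<dots> \<le> (C / \<kappa>) * wt z + 5 * wt z"
      using C(1) \<kappa> mult_left_mono[OF wt_ge1[of z], of "C / \<kappa>"] by simp
    finally show ?thesis by (simp add: algebra_simps)
  qed
  then show ?thesis using that by blast
qed

lemma pt_measurable: "pt \<in> borel_measurable borel"
  using pt_has_derivative by (intro borel_measurable_continuous_onI continuous_at_imp_continuous_on ballI has_derivative_continuous) blast

lemma Dpt_measurable: "e \<in> Basis \<Longrightarrow> Dpt e \<in> borel_measurable borel"
  by (intro borel_measurable_continuous_onI Dpt_continuous)

lemma pt_times_integrable:
  assumes "wint g" shows "integrable lborel (\<lambda>z. pt z * g z)"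
proof -
  obtain C where C: "\<And>z. \<bar>pt z\<bar> \<le> C * wt z" using pt_bound by metis
  show ?thesis by (rule wint_mult_real[OF assms pt_measurable C])
qed

lemma Dpt_times_integrable:
  assumes "wint g" "e \<in> Basis" shows "integrable lborel (\<lambda>z. Dpt e z * g z)"
proof -
  obtain C where C: "\<And>z. \<bar>Dpt e z\<bar> \<le> C * wt z" using Dpt_bound[OF assms(2)] by metis
  show ?thesis by (rule wint_mult_real[OF assms(1) Dpt_measurable[OF assms(2)] C])
qed

lemma pt_ibp:
  assumes "wint \<sigma>" "test_fun k'" "\<And>z. norm z > 2 \<Longrightarrow> k' z = 0" "e \<in> Basis"
  shows "(\<integral>z. pt z * cv \<sigma> (pd k' e) z \<partial>lborel) = - (\<integral>z. Dpt e z * cv \<sigma> k' z \<partial>lborel)"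
proof -
  obtain C where C: "\<And>z. \<bar>pt z\<bar> \<le> C * wt z" using pt_bound by metis
  obtain C' where C': "\<And>z. \<bar>Dpt e z\<bar> \<le> C' * wt z" using Dpt_bound[OF assms(4)] by metis
  show ?thesis
    by (rule integration_by_parts_cv[OF assms pt_has_derivative Dpt_continuous[OF assms(4)] C C'])
qed

abbreviation "gx z \<equiv> (\<Sum>i\<in>Basis. cv \<rho> (pd k (i, 0)) z *\<^sub>R i)"
abbreviation "gv z \<equiv> (\<Sum>i\<in>Basis. cv \<rho> (pd k (0, i)) z *\<^sub>R i)"

abbreviation "Rt z \<equiv> (\<Sum>i\<in>Basis. \<gamma> * (Dpt (i, 0) z * (A z \<bullet> i)) + Dpt (0, i) z * (\<gamma> * (B z \<bullet> i) - \<gamma>\<^sup>2 * (H z \<bullet> i)))"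

text \<open>In each term one integration by parts moves a derivative from the kernel to the entropy
  variable, whose growth the cubic weight admits. Diffusion and friction then combine into the flux
  H.\<close>

lemma rate_pairing:
  shows "integrable lborel (\<lambda>z. pt z * rate \<gamma> F k \<rho> z)" "integrable lborel Rt"
    "(\<integral>z. pt z * rate \<gamma> F k \<rho> z \<partial>lborel) = (\<integral>z. Rt z \<partial>lborel)"
proof -
  show "integrable lborel (\<lambda>z. pt z * rate \<gamma> F k \<rho> z)" by (rule pt_times_integrable[OF rate_wint])
  note wi = wint_kernels
  have Hi: "H z \<bullet> i = cv \<rho> (pd k (0, i)) z + A z \<bullet> i" if "i \<in> Basis" for z i
    using that by (simp add: fluxH_def inner_add_left inner_sum_left_Basis)
  have R: "Rt z = (\<Sum>i\<in>Basis. \<gamma> * (Dpt (i, 0) z * (A z \<bullet> i)) + \<gamma> * (Dpt (0, i) z * (B z \<bullet> i))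
      - \<gamma>\<^sup>2 * (Dpt (0, i) z * cv \<rho> (pd k (0, i)) z) - \<gamma>\<^sup>2 * (Dpt (0, i) z * (A z \<bullet> i)))" for z
    by (rule sum.cong[OF refl]) (simp add: Hi algebra_simps)
  have i: "integrable lborel (\<lambda>z. Dpt (i, 0) z * (A z \<bullet> i))" "integrable lborel (\<lambda>z. Dpt (0, i) z * (B z \<bullet> i))"
    "integrable lborel (\<lambda>z. Dpt (0, i) z * cv \<rho> (pd k (0, i)) z)" "integrable lborel (\<lambda>z. Dpt (0, i) z * (A z \<bullet> i))"
    if "i \<in> Basis" for i
    by (rule Dpt_times_integrable[OF wint_inner[OF wA]] Dpt_times_integrable[OF wint_inner[OF wB]]
        Dpt_times_integrable[OF wi(6)[OF that]], simp add: that)+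
  have R_int: "integrable lborel (\<lambda>z. \<gamma> * (Dpt (i, 0) z * (A z \<bullet> i)) + \<gamma> * (Dpt (0, i) z * (B z \<bullet> i))
      - \<gamma>\<^sup>2 * (Dpt (0, i) z * cv \<rho> (pd k (0, i)) z) - \<gamma>\<^sup>2 * (Dpt (0, i) z * (A z \<bullet> i)))" if "i \<in> Basis" for i
    by (intro Bochner_Integration.integrable_add Bochner_Integration.integrable_diff integrable_mult_right i that)
  show "integrable lborel Rt" unfolding R by (rule Bochner_Integration.integrable_sum[OF R_int])
  have j: "integrable lborel (\<lambda>z. pt z * cv (\<lambda>y. \<rho> y * (snd y \<bullet> i)) (pd k (i, 0)) z)"
     "integrable lborel (\<lambda>z. pt z * cv (\<lambda>y. \<rho> y * (F y \<bullet> i)) (pd k (0, i)) z)"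
     "integrable lborel (\<lambda>z. pt z * cv \<rho> (pd (pd k (0, i)) (0, i)) z)"
     "integrable lborel (\<lambda>z. pt z * cv (\<lambda>y. \<rho> y * (snd y \<bullet> i)) (pd k (0, i)) z)" if "i \<in> Basis" for i
    by (rule pt_times_integrable wi that)+
  have e: "(\<integral>z. pt z * cv (\<lambda>y. \<rho> y * (snd y \<bullet> i)) (pd k (i, 0)) z \<partial>lborel) = - (\<integral>z. Dpt (i, 0) z * (A z \<bullet> i) \<partial>lborel)"
     "(\<integral>z. pt z * cv (\<lambda>y. \<rho> y * (F y \<bullet> i)) (pd k (0, i)) z \<partial>lborel) = - (\<integral>z. Dpt (0, i) z * (B z \<bullet> i) \<partial>lborel)"
     "(\<integral>z. pt z * cv \<rho> (pd (pd k (0, i)) (0, i)) z \<partial>lborel) = - (\<integral>z. Dpt (0, i) z * cv \<rho> (pd k (0, i)) z \<partial>lborel)"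
     "(\<integral>z. pt z * cv (\<lambda>y. \<rho> y * (snd y \<bullet> i)) (pd k (0, i)) z \<partial>lborel) = - (\<integral>z. Dpt (0, i) z * (A z \<bullet> i) \<partial>lborel)"
    if "i \<in> Basis" for i
    unfolding A_inner B_inner
    by (rule pt_ibp[OF wsAi k k_supp] pt_ibp[OF wsBi k k_supp] pt_ibp[OF wrho test_fun_pd[OF k] pdk_supp];
        simp add: that)+
  have "(\<integral>z. pt z * rate \<gamma> F k \<rho> z \<partial>lborel) = (\<integral>z. (\<Sum>i\<in>Basis. - \<gamma> * (pt z * cv (\<lambda>y. \<rho> y * (snd y \<bullet> i)) (pd k (i, 0)) z)
     - \<gamma> * (pt z * cv (\<lambda>y. \<rho> y * (F y \<bullet> i)) (pd k (0, i)) z)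
     + \<gamma>\<^sup>2 * (pt z * cv \<rho> (pd (pd k (0, i)) (0, i)) z + pt z * cv (\<lambda>y. \<rho> y * (snd y \<bullet> i)) (pd k (0, i)) z)) \<partial>lborel)"
    unfolding rate_eq sum_distrib_left
    by (intro Bochner_Integration.integral_cong sum.cong refl) (simp add: algebra_simps)
  also have "\<dots> = (\<Sum>i\<in>Basis. \<integral>z. - \<gamma> * (pt z * cv (\<lambda>y. \<rho> y * (snd y \<bullet> i)) (pd k (i, 0)) z)
     - \<gamma> * (pt z * cv (\<lambda>y. \<rho> y * (F y \<bullet> i)) (pd k (0, i)) z)
     + \<gamma>\<^sup>2 * (pt z * cv \<rho> (pd (pd k (0, i)) (0, i)) z + pt z * cv (\<lambda>y. \<rho> y * (snd y \<bullet> i)) (pd k (0, i)) z) \<partial>lborel)"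
    by (rule Bochner_Integration.integral_sum)
      (intro Bochner_Integration.integrable_add Bochner_Integration.integrable_diff integrable_mult_right j)
  also have "\<dots> = (\<Sum>i\<in>Basis. \<integral>z. \<gamma> * (Dpt (i, 0) z * (A z \<bullet> i)) + \<gamma> * (Dpt (0, i) z * (B z \<bullet> i))
      - \<gamma>\<^sup>2 * (Dpt (0, i) z * cv \<rho> (pd k (0, i)) z) - \<gamma>\<^sup>2 * (Dpt (0, i) z * (A z \<bullet> i)) \<partial>lborel)"
  proof (rule sum.cong[OF refl])
    fix b :: "real^'d" assume b: "b \<in> Basis"
    define I1 where "I1 = (\<integral>z. Dpt (b, 0) z * (A z \<bullet> b) \<partial>lborel)"
    define I2 where "I2 = (\<integral>z. Dpt (0, b) z * (B z \<bullet> b) \<partial>lborel)"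
    define I3 where "I3 = (\<integral>z. Dpt (0, b) z * cv \<rho> (pd k (0, b)) z \<partial>lborel)"
    define I4 where "I4 = (\<integral>z. Dpt (0, b) z * (A z \<bullet> b) \<partial>lborel)"
    have "(\<integral>z. - \<gamma> * (pt z * cv (\<lambda>y. \<rho> y * (snd y \<bullet> b)) (pd k (b, 0)) z)
       - \<gamma> * (pt z * cv (\<lambda>y. \<rho> y * (F y \<bullet> b)) (pd k (0, b)) z)
       + \<gamma>\<^sup>2 * (pt z * cv \<rho> (pd (pd k (0, b)) (0, b)) z + pt z * cv (\<lambda>y. \<rho> y * (snd y \<bullet> b)) (pd k (0, b)) z) \<partial>lborel)
      = - \<gamma> * (- I1) - \<gamma> * (- I2) + \<gamma>\<^sup>2 * (- I3 + - I4)"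
      unfolding I1_def I2_def I3_def I4_def e[OF b, symmetric]
      by (simp only: j[OF b] Bochner_Integration.integral_add Bochner_Integration.integral_diff
        Bochner_Integration.integrable_add Bochner_Integration.integrable_diff integrable_mult_right integral_mult_right_zero)
    moreover have "(\<integral>z. \<gamma> * (Dpt (b, 0) z * (A z \<bullet> b)) + \<gamma> * (Dpt (0, b) z * (B z \<bullet> b))
      - \<gamma>\<^sup>2 * (Dpt (0, b) z * cv \<rho> (pd k (0, b)) z) - \<gamma>\<^sup>2 * (Dpt (0, b) z * (A z \<bullet> b)) \<partial>lborel)
      = \<gamma> * I1 + \<gamma> * I2 - \<gamma>\<^sup>2 * I3 - \<gamma>\<^sup>2 * I4"
      unfolding I1_def I2_def I3_def I4_def
      by (simp only: i[OF b] Bochner_Integration.integral_add Bochner_Integration.integral_diff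
        Bochner_Integration.integrable_add Bochner_Integration.integrable_diff integrable_mult_right integral_mult_right_zero)
    ultimately show "(\<integral>z. - \<gamma> * (pt z * cv (\<lambda>y. \<rho> y * (snd y \<bullet> b)) (pd k (b, 0)) z)
       - \<gamma> * (pt z * cv (\<lambda>y. \<rho> y * (F y \<bullet> b)) (pd k (0, b)) z)
       + \<gamma>\<^sup>2 * (pt z * cv \<rho> (pd (pd k (0, b)) (0, b)) z + pt z * cv (\<lambda>y. \<rho> y * (snd y \<bullet> b)) (pd k (0, b)) z) \<partial>lborel)
      = (\<integral>z. \<gamma> * (Dpt (b, 0) z * (A z \<bullet> b)) + \<gamma> * (Dpt (0, b) z * (B z \<bullet> b))
      - \<gamma>\<^sup>2 * (Dpt (0, b) z * cv \<rho> (pd k (0, b)) z) - \<gamma>\<^sup>2 * (Dpt (0, b) z * (A z \<bullet> b)) \<partial>lborel)"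
      by (simp add: algebra_simps)
  qed
  also have "\<dots> = (\<integral>z. Rt z \<partial>lborel)"
    unfolding R by (rule Bochner_Integration.integral_sum[symmetric, OF R_int])
  finally show "(\<integral>z. pt z * rate \<gamma> F k \<rho> z \<partial>lborel) = (\<integral>z. Rt z \<partial>lborel)" .
qed


text \<open>This component of x + v/\<gamma> has derivative 1/\<gamma> in its velocity direction,
  and the mollified density has mass 1. Multiplied by -\<gamma> and summed, these integrals give the
  dimension, whatever \<gamma> is.\<close>

lemma integral_xi_gv:
  assumes i: "i \<in> Basis"
  shows "integrable lborel (\<lambda>z. (xi z \<bullet> i) * cv \<rho> (pd k (0, i)) z)"
    and "(\<integral>z. (xi z \<bullet> i) * cv \<rho> (pd k (0, i)) z \<partial>lborel) = - 1 / \<gamma>"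
proof -
  have b: "\<bar>xi z \<bullet> i\<bar> \<le> 2 * wt z" for z
  proof -
    have "\<bar>xi z \<bullet> i\<bar> \<le> norm (xi z)" using i by (rule Basis_le_norm)
    also have "\<dots> \<le> 2 * (1 + norm z)" by (rule xi_bounds(1))
    also have "\<dots> \<le> 2 * wt z" using norm_le_wt(1)[of z] by simp
    finally show ?thesis .
  qed
  have d: "((\<lambda>z. xi z \<bullet> i) has_derivative (\<lambda>w. (fst w + (1/\<gamma>) *\<^sub>R snd w) \<bullet> i)) (at z)" for z :: "'d ps"
    by (auto intro!: derivative_eq_intros)
  then have [measurable]: "(\<lambda>z::'d ps. xi z \<bullet> i) \<in> borel_measurable borel"
    by (intro borel_measurable_continuous_onI continuous_at_imp_continuous_on ballI has_derivative_continuous) blast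
  show "integrable lborel (\<lambda>z. (xi z \<bullet> i) * cv \<rho> (pd k (0, i)) z)"
    by (rule wint_mult_real[OF wint_kernels(6)[OF i] _ b]) measurable
  have "\<bar>1 / \<gamma>\<bar> \<le> 1 * wt z" for z :: "'d ps" using gam wt_ge1[of z] by (simp add: divide_le_eq) (meson dual_order.trans mult_ge1_I wt_ge1)
  then have "(\<integral>z. (xi z \<bullet> i) * cv \<rho> (pd k (0, i)) z \<partial>lborel) = - (\<integral>z. ((fst (0::real^'d, i) + (1/\<gamma>) *\<^sub>R snd (0::real^'d, i)) \<bullet> i) * f z \<partial>lborel)"
    using i by (intro integration_by_parts_cv[OF wrho k k_supp _ d _ b, where C'=1]) (auto simp: inner_Basis)
  also have "\<dots> = - 1 / \<gamma>" using i f_integral by (simp add: inner_Basis)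
  finally show "(\<integral>z. (xi z \<bullet> i) * cv \<rho> (pd k (0, i)) z \<partial>lborel) = - 1 / \<gamma>" .
qed

text \<open>Transport does not change the entropy: the x-derivative of f times f/(f + \<kappa>) is
  the x-derivative of a function Q of f, and the factor v does not depend on x.\<close>

lemma integral_transport:
  assumes i: "i \<in> Basis"
  shows "integrable lborel (\<lambda>z. (snd z \<bullet> i) * (cv \<rho> (pd k (i, 0)) z * (f z / S z)))"
    and "(\<integral>z. (snd z \<bullet> i) * (cv \<rho> (pd k (i, 0)) z * (f z / S z)) \<partial>lborel) = 0"
proof -
  \<comment> \<open>The constant \<kappa> ln \<kappa> makes Q vanish where f does. Since Q then lies
    between 0 and f, it inherits the weighted integrability of f.\<close>
  define Q where "Q z = f z - \<kappa> * ln (S z) + \<kappa> * ln \<kappa>" for z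
  have Q: "0 \<le> Q z" "Q z \<le> f z" for z
  proof -
    have "\<kappa> * ln (S z) - \<kappa> * ln \<kappa> = \<kappa> * ln (S z / \<kappa>)"
      using S_pos[of z] \<kappa> by (simp add: ln_div right_diff_distrib)
    also have "\<dots> \<le> \<kappa> * (S z / \<kappa> - 1)"
      using S_pos[of z] \<kappa> by (intro mult_left_mono ln_le_minus_one) auto
    also have "\<dots> = f z" using \<kappa> by (simp add: field_simps)
    finally show "0 \<le> Q z" by (simp add: Q_def)
    have "\<kappa> * ln \<kappa> \<le> \<kappa> * ln (S z)" using \<kappa> f_nonneg[of z] by (intro mult_left_mono) auto
    then show "Q z \<le> f z" by (simp add: Q_def)
  qed
  have Qd: "(Q has_derivative (\<lambda>w. cv \<rho> (pd k w) z * (f z / S z))) (at z)" for z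
  proof -
    have "((\<lambda>z. ln (f z + \<kappa>)) has_derivative (\<lambda>w. cv \<rho> (pd k w) z / S z)) (at z)"
      using S_pos[of z] by (auto intro!: derivative_eq_intros cv_has_derivative[OF rho(3) k] simp: divide_inverse mult.commute)
    from has_derivative_add[OF has_derivative_diff[OF cv_has_derivative[OF rho(3) k] has_derivative_mult_right[OF this]] has_derivative_const]
    have "(Q has_derivative (\<lambda>w. cv \<rho> (pd k w) z - \<kappa> * (cv \<rho> (pd k w) z / S z) + 0)) (at z)" unfolding Q_def .
    moreover have "cv \<rho> (pd k w) z - \<kappa> * (cv \<rho> (pd k w) z / S z) + 0 = cv \<rho> (pd k w) z * (f z / S z)" for w
      using S_pos[of z] by (simp add: field_simps)
    ultimately show ?thesis by simp
  qed
  have Qc: "continuous_on UNIV Q"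
    using Qd by (intro continuous_at_imp_continuous_on ballI has_derivative_continuous) blast
  have e: "(i, 0) \<in> (Basis :: 'd ps set)" using i by simp
  have fS: "f z / S z \<le> 1" "0 \<le> f z / S z" for z using f_nonneg[of z] S_pos[of z] \<kappa> by auto
  have cont: "continuous_on UNIV (\<lambda>z. cv \<rho> (pd k (i, 0)) z * (f z / S z))"
    using S_pos by (intro continuous_intros cv_continuous rho(3) test_fun_pd k e) (auto simp: less_imp_neq[symmetric])
  have b: "\<bar>snd z \<bullet> i\<bar> \<le> 1 * wt z" for z :: "'d ps"
    using order_trans[OF Basis_le_norm[OF i] norm_snd_le', of z] norm_le_wt(1)[of z] by simp
  have [measurable]: "(\<lambda>z::'d ps. snd z \<bullet> i) \<in> borel_measurable borel"
    by (intro borel_measurable_continuous_onI continuous_intros)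
  have w1: "wint (\<lambda>z. cv \<rho> (pd k (i, 0)) z * (f z / S z))"
  proof (rule wint_le[OF wint_kernels(5)[OF i] borel_measurable_continuous_onI[OF cont], where C=1])
    show "norm (cv \<rho> (pd k (i, 0)) z * (f z / S z)) \<le> 1 * norm (cv \<rho> (pd k (i, 0)) z)" for z
      unfolding real_norm_def abs_mult abs_of_nonneg[OF fS(2)] mult_1 by (rule mult_left_le[OF fS(1) abs_ge_zero])
  qed
  show int: "integrable lborel (\<lambda>z. (snd z \<bullet> i) * (cv \<rho> (pd k (i, 0)) z * (f z / S z)))"
    by (rule wint_mult_real[OF w1 _ b]) measurable
  have w2: "wint Q"
    by (rule wint_le[OF wf borel_measurable_continuous_onI[OF Qc], where C=1]) (use Q f_nonneg in auto)
  have d: "((\<lambda>z. snd z \<bullet> i) has_derivative (\<lambda>w. snd w \<bullet> i)) (at z)" for z :: "'d ps"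
    by (auto intro!: derivative_eq_intros)
  have "(\<integral>z. (snd z \<bullet> i) * (cv \<rho> (pd k (i, 0)) z * (f z / S z)) \<partial>lborel) = - (\<integral>z. (snd (i, 0::real^'d) \<bullet> i) * Q z \<partial>lborel)"
    by (rule integration_by_parts[OF d Qd _ cont _ _ int])
      (use wint_mult_real[OF w2 _ b] in \<open>auto\<close>)
  then show "(\<integral>z. (snd z \<bullet> i) * (cv \<rho> (pd k (i, 0)) z * (f z / S z)) \<partial>lborel) = 0" by simp
qed

lemma integral_gx: "(\<Sum>i\<in>Basis. \<integral>z. \<bar>cv \<rho> (pd k (i, 0)) z\<bar> \<partial>lborel) \<le> (\<Sum>i\<in>Basis. \<integral>z. \<bar>pd k (i, 0) z\<bar> \<partial>lborel)"
proof (rule sum_mono)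
  fix i :: "real^'d" assume i: "i \<in> Basis"
  then have t: "test_fun (pd k (i, 0))" by (intro test_fun_pd k) simp
  have "(\<integral>z. 1 * norm (cv \<rho> (pd k (i, 0)) z) \<partial>lborel) \<le> 1 * (\<integral>z. \<bar>pd k (i, 0) z\<bar> \<partial>lborel) * (\<integral>z. 1 * norm (\<rho> z) \<partial>lborel)"
    by (rule cv_weighted(2)[OF rho(3) t]) (use rho(3) in auto)
  then show "(\<integral>z. \<bar>cv \<rho> (pd k (i, 0)) z\<bar> \<partial>lborel) \<le> (\<integral>z. \<bar>pd k (i, 0) z\<bar> \<partial>lborel)"
    using rho(2,4) by simp
qed

text \<open>What the shift leaves behind: the vector \<kappa> v paired with force and flux. The
  fraction \<kappa>/(f + \<kappa>) is at most 1, and the bracket vanishes where f does.\<close>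

abbreviation "errt z \<equiv> \<kappa> * (\<gamma>\<^sup>2 * norm (snd z) * norm (H z) + \<gamma> * bb z * norm (snd z) * f z) / S z"

lemma inner_as_sum: "x \<bullet> y = (\<Sum>i\<in>Basis. (x \<bullet> i) * (y \<bullet> i))" for x y :: "'b::euclidean_space"
  by (rule euclidean_inner)

lemma Rt_inner:
  "Rt z = \<gamma> * (((1 / S z) *\<^sub>R gx z + xi z) \<bullet> A z)
     + ((1 / S z) *\<^sub>R gv z + (1/\<gamma>) *\<^sub>R xi z + snd z) \<bullet> (\<gamma> *\<^sub>R B z - \<gamma>\<^sup>2 *\<^sub>R H z)"
proof -
  have g: "gx z \<bullet> i = cv \<rho> (pd k (i, 0)) z" "gv z \<bullet> i = cv \<rho> (pd k (0, i)) z" if "i \<in> Basis" for i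
    using that by simp_all
  show ?thesis
    unfolding inner_as_sum[of "(1 / S z) *\<^sub>R gx z + xi z" "A z"]
      inner_as_sum[of "(1 / S z) *\<^sub>R gv z + (1/\<gamma>) *\<^sub>R xi z + snd z" "\<gamma> *\<^sub>R B z - \<gamma>\<^sup>2 *\<^sub>R H z"]
      sum_distrib_left sum.distrib[symmetric]
  proof (rule sum.cong[OF refl])
    fix i :: "real^'d" assume i: "i \<in> Basis"
    have 1: "Dpt (i, 0) z = ((1 / S z) *\<^sub>R gx z + xi z) \<bullet> i"
      unfolding inner_add_left inner_scaleR_left g[OF i] by simp
    have 2: "Dpt (0, i) z = ((1 / S z) *\<^sub>R gv z + (1/\<gamma>) *\<^sub>R xi z + snd z) \<bullet> i"
      unfolding inner_add_left inner_scaleR_left g[OF i] by (simp add: algebra_simps)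
    show "\<gamma> * (Dpt (i, 0) z * (A z \<bullet> i)) + Dpt (0, i) z * (\<gamma> * (B z \<bullet> i) - \<gamma>\<^sup>2 * (H z \<bullet> i))
        = \<gamma> * ((((1 / S z) *\<^sub>R gx z + xi z) \<bullet> i) * (A z \<bullet> i))
        + (((1 / S z) *\<^sub>R gv z + (1/\<gamma>) *\<^sub>R xi z + snd z) \<bullet> i) * ((\<gamma> *\<^sub>R B z - \<gamma>\<^sup>2 *\<^sub>R H z) \<bullet> i)"
      unfolding 1 2 by (simp add: inner_diff_left)
  qed
qed

text \<open>The terms pairing xi with the momentum A cancel, since xi is moved by force and noise
  only. The first two sums have known integrals and the third is the transport commutator. The
  coefficient 5/2 is 2 from the flux estimate plus 1/2 from Young's inequality for xi . B, which
  also yields \<open>hpot\<close>.\<close>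

lemma Rt_le:
  "Rt z \<le> \<gamma> * (\<Sum>i\<in>Basis. (snd z \<bullet> i) * (cv \<rho> (pd k (i, 0)) z * (f z / S z)))
     - \<gamma> * (\<Sum>i\<in>Basis. (xi z \<bullet> i) * cv \<rho> (pd k (0, i)) z)
     + \<gamma> * s * (\<Sum>i\<in>Basis. \<bar>cv \<rho> (pd k (i, 0)) z\<bar>)
     - (\<gamma>\<^sup>2 / 2) * ((norm (H z))\<^sup>2 / S z) + f z * (3/2 + 5/2 * (bb z)\<^sup>2 + hpot \<gamma> z) + errt z"
proof -
  define X where "X = gx z"
  define V where "V = gv z"
  define e where "e = f z *\<^sub>R snd z - A z"
  define W where "W = \<gamma> *\<^sub>R B z - \<gamma>\<^sup>2 *\<^sub>R H z"
  have e: "norm e \<le> s * f z" unfolding e_def by (rule A_bound)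
  have Sp: "0 < S z" by (rule S_pos)
  have fS: "f z / S z \<le> 1" "0 \<le> f z / S z" using f_nonneg[of z] Sp \<kappa> by auto
  have H: "H z = V + A z" by (simp add: fluxH_def V_def)
  have g0: "\<gamma> \<noteq> 0" using gam by simp
  have "Rt z = \<gamma> * (((1 / S z) *\<^sub>R X + xi z) \<bullet> A z) + ((1 / S z) *\<^sub>R V + (1/\<gamma>) *\<^sub>R xi z + snd z) \<bullet> W"
    unfolding Rt_inner X_def V_def W_def ..
  also have "\<dots> = \<gamma> * (X \<bullet> A z) / S z + \<gamma> * (xi z \<bullet> A z) + (1/\<gamma>) * (xi z \<bullet> W) + ((1 / S z) *\<^sub>R V + snd z) \<bullet> W"
    by (simp add: inner_add_left algebra_simps)
  \<comment> \<open>Splitting the flux in W as V + A produces -\<gamma> xi . A, which cancels the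
    \<gamma> xi . A coming from transport.\<close>
  also have "(1/\<gamma>) * (xi z \<bullet> W) = xi z \<bullet> B z - \<gamma> * (xi z \<bullet> V) - \<gamma> * (xi z \<bullet> A z)"
    unfolding W_def H using g0 by (simp add: inner_diff_right inner_add_right power2_eq_square algebra_simps)
  also have "(1 / S z) *\<^sub>R V + snd z = (1 / S z) *\<^sub>R (H z + e + \<kappa> *\<^sub>R snd z)"
  proof -
    have "H z + e + \<kappa> *\<^sub>R snd z = V + S z *\<^sub>R snd z" unfolding H e_def by (simp add: algebra_simps)
    then show ?thesis using Sp by (simp add: scaleR_add_right)
  qed
  also have "\<gamma> * (X \<bullet> A z) / S z + \<gamma> * (xi z \<bullet> A z) + (xi z \<bullet> B z - \<gamma> * (xi z \<bullet> V) - \<gamma> * (xi z \<bullet> A z))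
      + ((1 / S z) *\<^sub>R (H z + e + \<kappa> *\<^sub>R snd z)) \<bullet> W
     = \<gamma> * (X \<bullet> A z) / S z + xi z \<bullet> B z - \<gamma> * (xi z \<bullet> V) + ((1 / S z) *\<^sub>R (H z + e + \<kappa> *\<^sub>R snd z)) \<bullet> W" by simp
  finally have R: "Rt z = \<dots>" .
  have 1: "\<gamma> * (X \<bullet> A z) / S z \<le> \<gamma> * (\<Sum>i\<in>Basis. (snd z \<bullet> i) * (cv \<rho> (pd k (i, 0)) z * (f z / S z)))
      + \<gamma> * s * (\<Sum>i\<in>Basis. \<bar>cv \<rho> (pd k (i, 0)) z\<bar>)"
  proof -
    have Xi: "X \<bullet> i = cv \<rho> (pd k (i, 0)) z" if "i \<in> Basis" for i using that by (simp add: X_def)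
    have nX: "norm X \<le> (\<Sum>i\<in>Basis. \<bar>cv \<rho> (pd k (i, 0)) z\<bar>)"
      using norm_le_l1[of X] Xi by simp
    have "A z = f z *\<^sub>R snd z - e" by (simp add: e_def)
    then have "X \<bullet> A z = f z * (X \<bullet> snd z) - X \<bullet> e" by (simp add: inner_diff_right)
    moreover have "g * (a * p - q) / S' = g * (p * (a / S')) + g * (- q / S')" for g a p q S' :: real
      by (simp add: diff_divide_distrib right_diff_distrib)
    ultimately have "\<gamma> * (X \<bullet> A z) / S z = \<gamma> * ((X \<bullet> snd z) * (f z / S z)) + \<gamma> * (- (X \<bullet> e) / S z)" by metis
    also have "(X \<bullet> snd z) * (f z / S z) = (\<Sum>i\<in>Basis. (snd z \<bullet> i) * (cv \<rho> (pd k (i, 0)) z * (f z / S z)))"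
      unfolding inner_as_sum[of X "snd z"] sum_distrib_right by (rule sum.cong[OF refl]) (simp add: Xi)
    \<comment> \<open>The fraction f/(f + \<kappa>) is at most 1, so the transport commutator is
      bounded independently of \<kappa>.\<close>
    also have "- (X \<bullet> e) / S z \<le> s * (\<Sum>i\<in>Basis. \<bar>cv \<rho> (pd k (i, 0)) z\<bar>)"
    proof -
      have "- (X \<bullet> e) \<le> norm X * norm e" using Cauchy_Schwarz_ineq2[of X e] by simp
      also have "\<dots> \<le> norm X * (s * f z)" by (intro mult_left_mono e) simp
      finally have "- (X \<bullet> e) / S z \<le> norm X * (s * f z) / S z" using Sp by (intro divide_right_mono) auto
      also have "\<dots> = (s * norm X) * (f z / S z)" by simp
      also have "\<dots> \<le> s * norm X" using fS s by (intro mult_left_le) auto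
      also have "\<dots> \<le> s * (\<Sum>i\<in>Basis. \<bar>cv \<rho> (pd k (i, 0)) z\<bar>)" using nX s by (intro mult_left_mono) auto
      finally show ?thesis .
    qed
    finally show ?thesis using gam by (simp add: mult_left_mono mult.assoc)
  qed
  have 2: "xi z \<bullet> B z \<le> f z * (hpot \<gamma> z + (bb z)\<^sup>2 / 2)"
  proof -
    have "xi z \<bullet> B z \<le> norm (xi z) * norm (B z)" by (rule norm_cauchy_schwarz)
    also have "\<dots> \<le> norm (xi z) * (bb z * f z)" by (intro mult_left_mono B_bound) simp
    also have "\<dots> = f z * (norm (xi z) * bb z)" by simp
    also have "\<dots> \<le> f z * (hpot \<gamma> z + (bb z)\<^sup>2 / 2)"
    proof (rule mult_left_mono[OF _ f_nonneg])
      have "2 * norm (xi z) * bb z \<le> (norm (xi z))\<^sup>2 + (bb z)\<^sup>2" by (rule sum_squares_bound)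
      then show "norm (xi z) * bb z \<le> hpot \<gamma> z + (bb z)\<^sup>2 / 2" using xi_bounds(4)[of z] by linarith
    qed
    finally show ?thesis .
  qed
  have 3: "xi z \<bullet> V = (\<Sum>i\<in>Basis. (xi z \<bullet> i) * cv \<rho> (pd k (0, i)) z)"
    unfolding inner_as_sum[of "xi z" V] by (rule sum.cong[OF refl]) (simp add: V_def)
  have gs: "\<gamma>\<^sup>2 * s \<le> 1"
  proof -
    have "0 \<le> (\<Sum>i\<in>Basis. \<integral>z. \<bar>pd k (i, 0) z\<bar> \<partial>lborel)" by (intro sum_nonneg) auto
    then have "\<gamma>\<^sup>2 * s * 1 \<le> \<gamma>\<^sup>2 * s * (1 + (\<Sum>i\<in>Basis. \<integral>z. \<bar>pd k (i, 0) z\<bar> \<partial>lborel))"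
      using s by (intro mult_left_mono) auto
    then show ?thesis using s(3) by simp
  qed
  have 4: "((1 / S z) *\<^sub>R (H z + e + \<kappa> *\<^sub>R snd z)) \<bullet> W \<le> - (\<gamma>\<^sup>2 / 2) * ((norm (H z))\<^sup>2 / S z) + f z * (3/2 + 2 * (bb z)\<^sup>2) + errt z"
    unfolding W_def by (rule flux_pointwise[OF f_nonneg \<kappa> _ s(2) gam gs bb_nonneg e B_bound]) (use s in simp)
  show ?thesis unfolding R 3[symmetric] using 1 2 4 by (simp add: algebra_simps)
qed

end
end

section \<open>Gaussian integrals and control of the potential by the entropy\<close>

lemma nn_integral_gaussian_finite:
  fixes c :: real assumes c: "c > 0"
  shows "(\<integral>\<^sup>+x. ennreal (exp (- c * x\<^sup>2)) \<partial>lborel) < \<infinity>"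
proof -
  have lim: "((\<lambda>x. - exp (- c * x) / c) \<longlongrightarrow> 0) at_top"
  proof -
    have "filterlim (\<lambda>x. c * x) at_top at_top"
      using c by (rule filterlim_tendsto_pos_mult_at_top[OF tendsto_const _ filterlim_ident])
    from filterlim_compose[OF exp_at_bot filterlim_compose[OF filterlim_uminus_at_bot_at_top this]]
    have "((\<lambda>x. exp (- c * x)) \<longlongrightarrow> 0) at_top" by simp
    from tendsto_divide[OF tendsto_minus[OF this] tendsto_const[of c]] show ?thesis using c by simp
  qed
  have h: "(\<integral>\<^sup>+x. ennreal (exp (- c * x)) * indicator {0..} x \<partial>lborel) = ennreal (1 / c)"
  proof -
    have "(\<integral>\<^sup>+x. ennreal (exp (- c * x)) * indicator {0..} x \<partial>lborel) = ennreal (0 - (- exp (- c * 0) / c))"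
      by (rule nn_integral_FTC_atLeast[OF _ _ _ lim]) (use c in \<open>auto intro!: derivative_eq_intros\<close>)
    then show ?thesis by simp
  qed
  have h': "(\<integral>\<^sup>+x. ennreal (exp (c * x)) * indicator {0..} (- x) \<partial>lborel) = ennreal (1 / c)"
    using nn_integral_lborel_minus[of "\<lambda>x::real. ennreal (exp (- c * x)) * indicator {0..} x" 0] h by simp
  have "(\<integral>\<^sup>+x. ennreal (exp (- c * x\<^sup>2)) \<partial>lborel)
      \<le> (\<integral>\<^sup>+x. ennreal (exp (c/4)) * (ennreal (exp (- c * x)) * indicator {0..} x + ennreal (exp (c * x)) * indicator {0..} (- x)) \<partial>lborel)"
  proof (rule nn_integral_mono)
    fix x :: real
    \<comment> \<open>Nonnegativity of c (|x| - 1/2)^2 compares the Gaussian with exp(-c |x|) at the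
      price of the factor exp(c/4).\<close>
    have sq: "- c * x\<^sup>2 \<le> c/4 + - c * \<bar>x\<bar>"
    proof -
      have "0 \<le> c * (\<bar>x\<bar> - 1/2)\<^sup>2" using c by simp
      also have "\<dots> = c * x\<^sup>2 - c * \<bar>x\<bar> + c/4" by (simp add: power2_diff algebra_simps power_divide)
      finally show ?thesis by simp
    qed
    have "ennreal (exp (- c * x\<^sup>2)) \<le> ennreal (exp (c/4) * exp (- c * \<bar>x\<bar>))"
      unfolding exp_add[symmetric] using sq by (intro ennreal_leI) simp
    also have "\<dots> = ennreal (exp (c/4)) * ennreal (exp (- c * \<bar>x\<bar>))" by (rule ennreal_mult) auto
    also have "\<dots> \<le> ennreal (exp (c/4)) * (ennreal (exp (- c * x)) * indicator {0..} x + ennreal (exp (c * x)) * indicator {0..} (- x))"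
      by (intro mult_left_mono) (auto simp: indicator_def)
    finally show "ennreal (exp (- c * x\<^sup>2)) \<le> \<dots>" .
  qed
  also have "\<dots> = ennreal (exp (c/4)) * (ennreal (1/c) + ennreal (1/c))"
    by (subst nn_integral_cmult, measurable) (subst nn_integral_add, auto simp: h[simplified] h'[simplified])
  also have "\<dots> < \<infinity>" by (simp add: ennreal_mult_less_top)
  finally show ?thesis .
qed

lemma integrable_gaussian:
  fixes c :: real assumes c: "c > 0"
  shows "integrable lborel (\<lambda>z::'a::euclidean_space. exp (- c * (norm z)\<^sup>2))"
proof (rule integrableI_bounded)
  have "exp (- c * (norm z)\<^sup>2) = (\<Prod>b\<in>Basis. exp (- c * (z \<bullet> b)\<^sup>2))" for z :: 'a
  proof -
    have "(norm z)\<^sup>2 = (\<Sum>b\<in>Basis. (z \<bullet> b)\<^sup>2)"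
      unfolding power2_norm_eq_inner by (subst euclidean_inner) (simp add: power2_eq_square)
    then show ?thesis by (simp add: exp_sum[symmetric] sum_distrib_left)
  qed
  then have "(\<integral>\<^sup>+z. ennreal (norm (exp (- c * (norm (z :: 'a))\<^sup>2))) \<partial>lborel) = (\<integral>\<^sup>+z. (\<Prod>b\<in>Basis. ennreal (exp (- c * ((z :: 'a) \<bullet> b)\<^sup>2))) \<partial>lborel)"
    by (simp add: prod_ennreal abs_prod)
  also have "\<dots> = (\<Prod>b\<in>(Basis::'a set). \<integral>\<^sup>+x. ennreal (exp (- c * x\<^sup>2)) \<partial>lborel)"
    by (rule nn_integral_lborel_prod) auto
  also have "\<dots> < \<infinity>" using nn_integral_gaussian_finite[OF c] by (simp add: power_less_top_ennreal)
  finally show "(\<integral>\<^sup>+z. ennreal (norm (exp (- c * (norm (z :: 'a))\<^sup>2))) \<partial>lborel) < \<infinity>" .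
qed measurable

text \<open>A regularisation of \<open>s * ln s\<close> that vanishes and is differentiable at \<open>s = 0\<close>.\<close>
definition Ureg :: "real \<Rightarrow> real \<Rightarrow> real" where
  "Ureg \<kappa> s = (s + \<kappa>) * ln (s + \<kappa>) - \<kappa> * ln \<kappa>"

lemma Ureg_0 [simp]: "Ureg \<kappa> 0 = 0" by (simp add: Ureg_def)

lemma xlnx_le_Ureg:
  assumes "0 \<le> s" "0 < \<kappa>" shows "s * ln s \<le> Ureg \<kappa> s"
proof (cases "s = 0")
  case False
  with assms have s: "s > 0" by simp
  have "s * ln s \<le> s * ln (s + \<kappa>)" using s assms by (intro mult_left_mono) auto
  moreover have "\<kappa> * ln \<kappa> \<le> \<kappa> * ln (s + \<kappa>)" using s assms by (intro mult_left_mono) auto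
  ultimately show ?thesis by (simp add: Ureg_def distrib_right)
qed simp

text \<open>The Fenchel-Young inequality for the conjugate pair s ln s - s and exp a. With a
  negative multiple of the potential as a, it gives lower bounds of the entropy.\<close>

lemma Young_entropy:
  fixes a s :: real assumes "0 \<le> s" shows "s + a * s - exp a \<le> s * ln s"
proof (cases "s = 0")
  case False
  with assms have s: "s > 0" by simp
  have "s * (1 + (a - ln s)) \<le> s * exp (a - ln s)" using s exp_ge_add_one_self[of "a - ln s"] by (intro mult_left_mono) auto
  also have "\<dots> = exp a" using s by (simp add: exp_diff)
  finally show ?thesis by (simp add: algebra_simps)
qed simp

text \<open>The bound is uniform in \<gamma>: with X = x + v/\<gamma>, |x|^2 is at most 2 |X|^2 + 2
  |v|^2, so |z|^2 is at most 2 |X|^2 + 3 |v|^2, hence at most 6 times the potential.\<close>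

lemma hpot_lower: assumes "1 \<le> \<gamma>" shows "(norm z)\<^sup>2 / 6 \<le> hpot \<gamma> z"
proof -
  define X where "X = fst z + (1/\<gamma>) *\<^sub>R snd z"
  have g: "norm ((1/\<gamma>) *\<^sub>R snd z) \<le> norm (snd z)"
    using assms by (simp add: divide_le_eq mult_le_cancel_left1)
  have "norm (fst z) \<le> norm X + norm ((1/\<gamma>) *\<^sub>R snd z)"
    using norm_triangle_ineq4[of X "(1/\<gamma>) *\<^sub>R snd z"] by (simp add: X_def)
  with g have "norm (fst z) \<le> norm X + norm (snd z)" by linarith
  then have "(norm (fst z))\<^sup>2 \<le> (norm X + norm (snd z))\<^sup>2" by (intro power_mono) auto
  also have "\<dots> \<le> 2 * (norm X)\<^sup>2 + 2 * (norm (snd z))\<^sup>2"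
    using sum_squares_bound[of "norm X" "norm (snd z)"] by (simp add: power2_sum)
  finally have 1: "(norm (fst z))\<^sup>2 \<le> 2 * (norm X)\<^sup>2 + 2 * (norm (snd z))\<^sup>2" .
  have "(norm z)\<^sup>2 = (norm (fst z))\<^sup>2 + (norm (snd z))\<^sup>2" by (cases z) (simp add: norm_Pair)
  then have "(norm z)\<^sup>2 \<le> 2 * (norm X)\<^sup>2 + 3 * (norm (snd z))\<^sup>2" using 1 by linarith
  moreover have "hpot \<gamma> z = ((norm X)\<^sup>2 + (norm (snd z))\<^sup>2) / 2" by (simp add: hpot_def X_def)
  ultimately show ?thesis using zero_le_power2[of "norm X"] by argo
qed

text \<open>The exponent is half of the 1/6 in the lower bound of the potential: for every \<gamma>
  at least 1 this number, which depends on the dimension alone, dominates the integral of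
  exp(-\<open>hpot\<close>/2).\<close>

definition gaussC :: "'d::finite itself \<Rightarrow> real" where
  "gaussC t = (\<integral>z. exp (- (1/12) * (norm (z :: 'd ps))\<^sup>2) \<partial>lborel)"

context snapshot begin

lemma hpot_measurable: "(hpot \<gamma> :: 'd ps \<Rightarrow> real) \<in> borel_measurable borel"
  by (intro borel_measurable_continuous_onI continuous_at_imp_continuous_on ballI)
    (rule has_derivative_continuous[OF hpot_has_derivative])

lemma hpot_f_integrable: "integrable lborel (\<lambda>z. hpot \<gamma> z * f z)"
  by (rule wint_mult_real[OF wf hpot_measurable xi_bounds(2)])

lemma Ureg_f_integrable:
  assumes \<kappa>: "0 < \<kappa>" shows "integrable lborel (\<lambda>z. Ureg \<kappa> (f z))"
proof -
  have [measurable]: "f \<in> borel_measurable borel" using wint_measurable[OF wf] .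
  obtain C where C: "C \<ge> 0" "\<And>z. \<bar>ln (f z + \<kappa>)\<bar> \<le> C" using ln_bounded[OF \<kappa>] by metis
  have b: "\<bar>Ureg \<kappa> (f z)\<bar> \<le> (C + 1) * f z" for z
  proof -
    have "Ureg \<kappa> (f z) = f z * ln (f z + \<kappa>) + \<kappa> * (ln (f z + \<kappa>) - ln \<kappa>)"
      by (simp add: Ureg_def algebra_simps)
    moreover have "\<bar>f z * ln (f z + \<kappa>)\<bar> \<le> f z * C"
      unfolding abs_mult using f_nonneg[of z] C(2)[of z] by (simp add: mult_left_mono)
    moreover have "0 \<le> \<kappa> * (ln (f z + \<kappa>) - ln \<kappa>)"
      using f_nonneg[of z] \<kappa> by (intro mult_nonneg_nonneg) auto
    moreover have "\<kappa> * (ln (f z + \<kappa>) - ln \<kappa>) \<le> f z"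
    proof -
      have "\<kappa> * (ln (f z + \<kappa>) - ln \<kappa>) = \<kappa> * ln ((f z + \<kappa>) / \<kappa>)"
        using f_nonneg[of z] \<kappa> by (simp add: ln_div)
      also have "\<dots> \<le> \<kappa> * ((f z + \<kappa>) / \<kappa> - 1)"
        using f_nonneg[of z] \<kappa> by (intro mult_left_mono ln_le_minus_one) auto
      also have "\<dots> = f z" using \<kappa> by (simp add: field_simps)
      finally show ?thesis .
    qed
    ultimately have "\<bar>Ureg \<kappa> (f z)\<bar> \<le> f z * C + f z" by linarith
    then show ?thesis by (simp add: algebra_simps)
  qed
  show ?thesis
    by (rule integrable_le[where g="\<lambda>z. (C + 1) * f z"])
      (use b wint_integrable[OF wf] in \<open>auto simp: Ureg_def[abs_def]\<close>)
qed

text \<open>Fenchel-Young with minus half of the potential: that half is lost, and the other half is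
  bounded by the entropy plus a Gaussian integral. Multiplying by 2 gives both constants.\<close>

lemma hpot_le_entropy:
  assumes \<kappa>: "0 < \<kappa>"
  shows "(\<integral>z. hpot \<gamma> z * f z \<partial>lborel) \<le> 2 * (\<integral>z. Ureg \<kappa> (f z) + hpot \<gamma> z * f z \<partial>lborel) + 2 * gaussC TYPE('d)"
proof -
  have i: "integrable lborel (\<lambda>z::'d ps. exp (- (1/12) * (norm z)\<^sup>2))" by (rule integrable_gaussian) simp
  have "(\<integral>z. hpot \<gamma> z * f z \<partial>lborel) \<le> (\<integral>z. 2 * (Ureg \<kappa> (f z) + hpot \<gamma> z * f z) + 2 * exp (- (1/12) * (norm z)\<^sup>2) \<partial>lborel)"
  proof (rule integral_mono)
    show "integrable lborel (\<lambda>z. 2 * (Ureg \<kappa> (f z) + hpot \<gamma> z * f z) + 2 * exp (- (1/12) * (norm z)\<^sup>2))"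
      by (intro Bochner_Integration.integrable_add integrable_mult_right Ureg_f_integrable[OF \<kappa>] hpot_f_integrable i)
    fix z :: "'d ps"
    have "f z + (- hpot \<gamma> z / 2) * f z - exp (- hpot \<gamma> z / 2) \<le> f z * ln (f z)" by (rule Young_entropy[OF f_nonneg])
    moreover have "exp (- hpot \<gamma> z / 2) \<le> exp (- (1/12) * (norm z)\<^sup>2)" using hpot_lower[OF gam, of z] by simp
    moreover have "f z * ln (f z) \<le> Ureg \<kappa> (f z)" by (rule xlnx_le_Ureg[OF f_nonneg \<kappa>])
    moreover have "(- hpot \<gamma> z / 2) * f z = - (hpot \<gamma> z * f z) / 2" by simp
    ultimately show "hpot \<gamma> z * f z \<le> 2 * (Ureg \<kappa> (f z) + hpot \<gamma> z * f z) + 2 * exp (- (1/12) * (norm z)\<^sup>2)"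
      using f_nonneg[of z] by argo
  qed (rule hpot_f_integrable)
  also have "\<dots> = 2 * (\<integral>z. Ureg \<kappa> (f z) + hpot \<gamma> z * f z \<partial>lborel) + 2 * gaussC TYPE('d)"
    unfolding gaussC_def
    by (subst Bochner_Integration.integral_add[OF integrable_mult_right[OF Bochner_Integration.integrable_add[OF Ureg_f_integrable[OF \<kappa>] hpot_f_integrable]] integrable_mult_right[OF i]])
      (simp only: integral_mult_right_zero)
  finally show ?thesis .
qed

lemma H_bounded: obtains C where "C \<ge> 0" "\<And>z. norm (H z) \<le> C"
proof -
  have "\<exists>C. \<forall>z. \<bar>cv \<rho> (pd k (0, i)) z\<bar> \<le> C" if i: "i \<in> Basis" for i :: "real^'d"
  proof -
    have t: "test_fun (pd k (0, i))" using i by (intro test_fun_pd k) simp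
    obtain C where "\<And>z. \<bar>pd k (0, i) z\<bar> \<le> C" using test_fun_bounded[OF t] by metis
    from cv_bounded[OF rho(3) t this] show ?thesis by auto
  qed
  then obtain Ci where Ci: "\<And>i z. i \<in> Basis \<Longrightarrow> \<bar>cv \<rho> (pd k (0, i)) z\<bar> \<le> Ci i" by metis
  obtain C where "\<And>z. \<bar>k z\<bar> \<le> C" using test_fun_bounded[OF k] by metis
  note CA = cv_bounded[OF wint_integrable[OF wsA] k this]
  have b: "norm (H z) \<le> (\<Sum>i\<in>Basis. Ci i) + C * (\<integral>y. norm (\<rho> y *\<^sub>R snd y) \<partial>lborel)" for z
  proof -
    have "norm (\<Sum>i\<in>Basis. cv \<rho> (pd k (0, i)) z *\<^sub>R i) \<le> (\<Sum>i\<in>Basis. Ci i)"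
      by (rule sum_norm_le) (use Ci in auto)
    then show ?thesis unfolding fluxH_def using CA[of z] by (intro norm_triangle_le add_mono)
  qed
  have "0 \<le> (\<Sum>i\<in>Basis. Ci i) + C * (\<integral>y. norm (\<rho> y *\<^sub>R snd y) \<partial>lborel)"
    using order_trans[OF norm_ge_zero b] .
  then show ?thesis using that b by blast
qed

lemma fisher_integrable:
  assumes \<kappa>: "0 < \<kappa>" shows "integrable lborel (\<lambda>z. (norm (H z))\<^sup>2 / (f z + \<kappa>))"
proof -
  obtain C where C: "C \<ge> 0" "\<And>z. norm (H z) \<le> C" using H_bounded by metis
  have [measurable]: "H \<in> borel_measurable borel" "f \<in> borel_measurable borel" using wint_measurable[OF wH] wint_measurable[OF wf] .
  show ?thesis
  proof (rule integrable_le[where g="\<lambda>z. (C / \<kappa>) * norm (H z)"])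
    show "integrable lborel (\<lambda>z. (C / \<kappa>) * norm (H z))" using wint_integrable[OF wH] by auto
    fix z
    have "(norm (H z))\<^sup>2 / (f z + \<kappa>) \<le> (C * norm (H z)) / \<kappa>"
      using C(1) C(2)[of z] \<kappa> f_nonneg[of z] by (intro frac_le) (auto simp: power2_eq_square mult_right_mono)
    then show "norm ((norm (H z))\<^sup>2 / (f z + \<kappa>)) \<le> (C / \<kappa>) * norm (H z)"
      using f_nonneg[of z] \<kappa> by simp
  qed measurable
qed

lemma err_dominator_integrable:
  "integrable lborel (\<lambda>z. \<gamma>\<^sup>2 * norm (snd z) * norm (H z) + \<gamma> * bb z * norm (snd z) * f z)"
proof -
  have [measurable]: "(\<lambda>z::'d ps. snd z) \<in> borel_measurable borel" "(\<lambda>z::'d ps. fst z) \<in> borel_measurable borel"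
    by (intro borel_measurable_continuous_onI continuous_intros)+
  have n: "norm (snd z) \<le> wt z" for z :: "'d ps" using norm_snd_le'[of z] norm_le_wt(1)[of z] by linarith
  have b1: "\<bar>\<gamma>\<^sup>2 * norm (snd z)\<bar> \<le> \<gamma>\<^sup>2 * wt z" for z :: "'d ps"
    using n[of z] by (simp add: abs_mult mult_left_mono)
  have b2: "\<bar>\<gamma> * bb z * norm (snd z)\<bar> \<le> (\<gamma> * (2*c + c0)) * wt z" for z :: "'d ps"
  proof -
    have "\<bar>bb z\<bar> * norm (snd z) \<le> ((2*c + c0) * (1 + norm z)) * (1 + norm z)"
      using bb_wt[of z] norm_snd_le'[of z] cc by (intro mult_mono) auto
    also have "\<dots> \<le> (2*c + c0) * wt z"
      using mult_left_mono[OF norm_le_wt(2)[of z], of "2*c + c0"] cc by (simp add: power2_eq_square mult.assoc)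
    finally have "\<gamma> * (\<bar>bb z\<bar> * norm (snd z)) \<le> \<gamma> * ((2*c + c0) * wt z)"
      using gam by (intro mult_left_mono) auto
    then show ?thesis using gam by (simp add: abs_mult mult.assoc)
  qed
  have "integrable lborel (\<lambda>z. (\<gamma>\<^sup>2 * norm (snd z)) *\<^sub>R H z)"
    by (rule wint_mult[OF wH _ b1]) measurable
  then have i1: "integrable lborel (\<lambda>z. norm ((\<gamma>\<^sup>2 * norm (snd z)) *\<^sub>R H z))" by (rule integrable_norm)
  have i2: "integrable lborel (\<lambda>z. (\<gamma> * bb z * norm (snd z)) * f z)"
    by (rule wint_mult_real[OF wf _ b2]) measurable
  from i1 i2 show ?thesis by (simp add: abs_mult)
qed

lemma err_integrable:
  assumes \<kappa>: "0 < \<kappa>"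
  shows "integrable lborel (\<lambda>z. \<kappa> * (\<gamma>\<^sup>2 * norm (snd z) * norm (H z) + \<gamma> * bb z * norm (snd z) * f z) / (f z + \<kappa>))"
    and "0 \<le> \<kappa> * (\<gamma>\<^sup>2 * norm (snd z) * norm (H z) + \<gamma> * bb z * norm (snd z) * f z) / (f z + \<kappa>)"
    and "\<kappa> * (\<gamma>\<^sup>2 * norm (snd z) * norm (H z) + \<gamma> * bb z * norm (snd z) * f z) / (f z + \<kappa>)
      \<le> \<gamma>\<^sup>2 * norm (snd z) * norm (H z) + \<gamma> * bb z * norm (snd z) * f z"
proof -
  define q where "q z = \<gamma>\<^sup>2 * norm (snd z) * norm (H z) + \<gamma> * bb z * norm (snd z) * f z" for z
  have q0: "0 \<le> q z" for z
    unfolding q_def using gam cc bb_nonneg[of z] f_nonneg[of z] by (intro add_nonneg_nonneg mult_nonneg_nonneg) auto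
  have le: "\<kappa> * q z / (f z + \<kappa>) \<le> q z" for z
    using q0[of z] f_nonneg[of z] \<kappa> by (simp add: divide_le_eq distrib_left mult.commute)
  have n: "0 \<le> \<kappa> * q z / (f z + \<kappa>)" for z using q0[of z] f_nonneg[of z] \<kappa> by simp
  have i: "integrable lborel q" unfolding q_def[abs_def] by (rule err_dominator_integrable)
  have [measurable]: "q \<in> borel_measurable borel" "f \<in> borel_measurable borel" using i wint_measurable[OF wf] by auto
  have "integrable lborel (\<lambda>z. \<kappa> * q z / (f z + \<kappa>))"
  proof (rule integrable_le[OF i])
    show "norm (\<kappa> * q z / (f z + \<kappa>)) \<le> q z" for z
      unfolding real_norm_def abs_of_nonneg[OF n] by (rule le)
  qed measurable
  then show "integrable lborel (\<lambda>z. \<kappa> * (\<gamma>\<^sup>2 * norm (snd z) * norm (H z) + \<gamma> * bb z * norm (snd z) * f z) / (f z + \<kappa>))"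
    unfolding q_def .
  show "0 \<le> \<kappa> * (\<gamma>\<^sup>2 * norm (snd z) * norm (H z) + \<gamma> * bb z * norm (snd z) * f z) / (f z + \<kappa>)"
    using n[of z] unfolding q_def .
  show "\<kappa> * (\<gamma>\<^sup>2 * norm (snd z) * norm (H z) + \<gamma> * bb z * norm (snd z) * f z) / (f z + \<kappa>)
      \<le> \<gamma>\<^sup>2 * norm (snd z) * norm (H z) + \<gamma> * bb z * norm (snd z) * f z"
    using le[of z] unfolding q_def .
qed

text \<open>Here \<open>bb\<close> is (2c + c0) + c |x|, and |x|^2 is at most 4 times the potential.
  Squaring the sum costs a factor 2, so 5/2 becomes 5 and 5/2 times 2 times 4 becomes 20.\<close>

lemma bb_hpot: "5/2 * (bb z)\<^sup>2 \<le> 5 * (2*c + c0)\<^sup>2 + 20 * c\<^sup>2 * hpot \<gamma> z"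
proof -
  define n where "n = norm (fst z)"
  have g: "norm ((1/\<gamma>) *\<^sub>R snd z) \<le> norm (snd z)"
    using gam by (simp add: divide_le_eq mult_le_cancel_left1)
  have "n \<le> norm (xi z) + norm ((1/\<gamma>) *\<^sub>R snd z)"
    using norm_triangle_ineq4[of "xi z" "(1/\<gamma>) *\<^sub>R snd z"] by (simp add: n_def)
  with g have "n \<le> norm (xi z) + norm (snd z)" by linarith
  then have "n\<^sup>2 \<le> (norm (xi z) + norm (snd z))\<^sup>2" by (intro power_mono) (auto simp: n_def)
  also have "\<dots> \<le> 2 * (norm (xi z))\<^sup>2 + 2 * (norm (snd z))\<^sup>2"
    using sum_squares_bound[of "norm (xi z)" "norm (snd z)"] by (simp add: power2_sum)
  also have "\<dots> = 4 * hpot \<gamma> z" by (simp add: hpot_def)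
  finally have n2: "n\<^sup>2 \<le> 4 * hpot \<gamma> z" .
  have sq: "(a + b)\<^sup>2 \<le> 2 * a\<^sup>2 + 2 * b\<^sup>2" for a b :: real
    using sum_squares_bound[of a b] by (simp add: power2_sum)
  have "bb z = (2*c + c0) + c * n" by (simp add: n_def algebra_simps)
  then have 1: "(bb z)\<^sup>2 \<le> 2 * (2*c + c0)\<^sup>2 + 2 * (c * n)\<^sup>2"
    using sq[of "2*c + c0" "c * n"] by (simp only:)
  have 2: "(c * n)\<^sup>2 \<le> 4 * (c\<^sup>2 * hpot \<gamma> z)"
    using mult_left_mono[OF n2 zero_le_power2[of c]] by (simp add: power_mult_distrib)
  have "20 * c\<^sup>2 * hpot \<gamma> z = 20 * (c\<^sup>2 * hpot \<gamma> z)" by simp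
  with 1 2 show ?thesis by argo
qed

text \<open>The constant 5/2 is 1 from the transport commutator plus 3/2 from the flux estimate, and
  the dimension is the noise term. In the coefficient of the potential, 1 comes from Young's
  inequality for xi . B and 20 c^2 from the growth of the force.\<close>

lemma dissipation:
  assumes \<kappa>: "0 < \<kappa>"
  shows "(\<integral>z. (ln (f z + \<kappa>) + 1 + hpot \<gamma> z) * rate \<gamma> F k \<rho> z \<partial>lborel)
    \<le> (CARD('d) + 5/2 + 5 * (2*c + c0)\<^sup>2) + (1 + 20 * c\<^sup>2) * (\<integral>z. hpot \<gamma> z * f z \<partial>lborel)
      + (\<integral>z. \<kappa> * (\<gamma>\<^sup>2 * norm (snd z) * norm (H z) + \<gamma> * bb z * norm (snd z) * f z) / (f z + \<kappa>) \<partial>lborel)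
      - (\<gamma>\<^sup>2 / 2) * (\<integral>z. (norm (H z))\<^sup>2 / (f z + \<kappa>) \<partial>lborel)"
proof -
  define t1 where "t1 z = (\<Sum>i\<in>Basis. (snd z \<bullet> i) * (cv \<rho> (pd k (i, 0)) z * (f z / (f z + \<kappa>))))" for z
  define t2 where "t2 z = (\<Sum>i\<in>Basis. (xi z \<bullet> i) * cv \<rho> (pd k (0, i)) z)" for z
  define t3 where "t3 z = (\<Sum>i\<in>Basis. \<bar>cv \<rho> (pd k (i, 0)) z\<bar>)" for z
  define t4 where "t4 z = (norm (H z))\<^sup>2 / (f z + \<kappa>)" for z
  define t6 where "t6 z = \<kappa> * (\<gamma>\<^sup>2 * norm (snd z) * norm (H z) + \<gamma> * bb z * norm (snd z) * f z) / (f z + \<kappa>)" for z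
  define K where "K = 3/2 + 5 * (2*c + c0)\<^sup>2"
  have i1: "integrable lborel t1" unfolding t1_def[abs_def]
    by (rule Bochner_Integration.integrable_sum) (rule integral_transport(1)[OF \<kappa>])
  have I1: "(\<integral>z. t1 z \<partial>lborel) = 0" unfolding t1_def
    by (subst Bochner_Integration.integral_sum) (use integral_transport[OF \<kappa>] in auto)
  have i2: "integrable lborel t2" unfolding t2_def[abs_def]
    by (rule Bochner_Integration.integrable_sum) (rule integral_xi_gv(1)[OF \<kappa>])
  have I2: "(\<integral>z. t2 z \<partial>lborel) = - CARD('d) / \<gamma>" unfolding t2_def
    by (subst Bochner_Integration.integral_sum) (use integral_xi_gv[OF \<kappa>] in auto)
  have i3: "integrable lborel t3" unfolding t3_def[abs_def]
    by (intro Bochner_Integration.integrable_sum integrable_abs wint_integrable wint_kernels)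
  have I3: "(\<integral>z. t3 z \<partial>lborel) \<le> (\<Sum>i\<in>Basis. \<integral>z. \<bar>pd k (i, 0) z\<bar> \<partial>lborel)"
  proof -
    have "(\<integral>z. t3 z \<partial>lborel) = (\<Sum>i\<in>Basis. \<integral>z. \<bar>cv \<rho> (pd k (i, 0)) z\<bar> \<partial>lborel)"
      unfolding t3_def by (rule Bochner_Integration.integral_sum) (intro integrable_abs wint_integrable wint_kernels)
    then show ?thesis using integral_gx[OF \<kappa>] by simp
  qed
  \<comment> \<open>As \<gamma> is at least 1, the smallness condition with \<gamma>^2 covers the
    single \<gamma> here.\<close>
  have gs3: "\<gamma> * s * (\<integral>z. t3 z \<partial>lborel) \<le> 1"
  proof -
    let ?S = "\<Sum>i\<in>Basis. \<integral>z. \<bar>pd k (i, 0) z\<bar> \<partial>lborel"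
    have S0: "0 \<le> ?S" by (intro sum_nonneg) auto
    have "\<gamma> * s * (\<integral>z. t3 z \<partial>lborel) \<le> \<gamma> * s * (1 + ?S)" using I3 gam s by (intro mult_left_mono) auto
    also have "\<dots> \<le> \<gamma>\<^sup>2 * s * (1 + ?S)"
      using gam s S0 by (intro mult_right_mono) (auto simp: power2_eq_square)
    finally show ?thesis using s(3) by linarith
  qed
  have i4: "integrable lborel t4" unfolding t4_def[abs_def] by (rule fisher_integrable[OF \<kappa>])
  have i6: "integrable lborel t6" unfolding t6_def[abs_def] by (rule err_integrable(1)[OF \<kappa>])
  note if' = wint_integrable[OF wf]
  have le: "f z * (3/2 + 5/2 * (bb z)\<^sup>2 + hpot \<gamma> z) \<le> K * f z + (1 + 20 * c\<^sup>2) * (hpot \<gamma> z * f z)" for z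
  proof -
    have "3/2 + 5/2 * (bb z)\<^sup>2 + hpot \<gamma> z \<le> K + (1 + 20 * c\<^sup>2) * hpot \<gamma> z"
      using bb_hpot[of z] unfolding K_def distrib_right mult_1 by linarith
    from mult_left_mono[OF this f_nonneg[of z]] show ?thesis by (simp add: algebra_simps)
  qed
  note rp = rate_pairing[OF \<kappa>]
  have int: "integrable lborel (\<lambda>z. \<gamma> * t1 z - \<gamma> * t2 z + \<gamma> * s * t3 z - (\<gamma>\<^sup>2 / 2) * t4 z
      + (K * f z + (1 + 20 * c\<^sup>2) * (hpot \<gamma> z * f z)) + t6 z)"
    by (intro Bochner_Integration.integrable_add Bochner_Integration.integrable_diff integrable_mult_right i1 i2 i3 i4 i6 if' hpot_f_integrable)
  have "(\<integral>z. (ln (f z + \<kappa>) + 1 + hpot \<gamma> z) * rate \<gamma> F k \<rho> z \<partial>lborel)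
    \<le> (\<integral>z. \<gamma> * t1 z - \<gamma> * t2 z + \<gamma> * s * t3 z - (\<gamma>\<^sup>2 / 2) * t4 z
      + (K * f z + (1 + 20 * c\<^sup>2) * (hpot \<gamma> z * f z)) + t6 z \<partial>lborel)"
    unfolding rp(3)
  proof (rule integral_mono[OF rp(2) int])
    fix z
    show "(\<Sum>i\<in>Basis. \<gamma> * ((cv \<rho> (pd k (i, 0)) z / (f z + \<kappa>) + (xi z \<bullet> (fst (i, 0::real^'d) + (1 / \<gamma>) *\<^sub>R snd (i, 0::real^'d)) + snd z \<bullet> snd (i, 0::real^'d))) * (A z \<bullet> i)) +
        (cv \<rho> (pd k (0, i)) z / (f z + \<kappa>) + (xi z \<bullet> (fst (0::real^'d, i) + (1 / \<gamma>) *\<^sub>R snd (0::real^'d, i)) + snd z \<bullet> snd (0::real^'d, i))) *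
          (\<gamma> * (B z \<bullet> i) - \<gamma>\<^sup>2 * (H z \<bullet> i)))
      \<le> \<gamma> * t1 z - \<gamma> * t2 z + \<gamma> * s * t3 z - (\<gamma>\<^sup>2 / 2) * t4 z + (K * f z + (1 + 20 * c\<^sup>2) * (hpot \<gamma> z * f z)) + t6 z"
      using Rt_le[OF \<kappa>, of z] le[of z] unfolding t1_def t2_def t3_def t4_def t6_def by linarith
  qed
  also have "\<dots> = \<gamma> * (\<integral>z. t1 z \<partial>lborel) - \<gamma> * (\<integral>z. t2 z \<partial>lborel) + \<gamma> * s * (\<integral>z. t3 z \<partial>lborel) - (\<gamma>\<^sup>2 / 2) * (\<integral>z. t4 z \<partial>lborel)
      + (K * (\<integral>z. f z \<partial>lborel) + (1 + 20 * c\<^sup>2) * (\<integral>z. hpot \<gamma> z * f z \<partial>lborel)) + (\<integral>z. t6 z \<partial>lborel)"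
    by (simp only: Bochner_Integration.integral_add Bochner_Integration.integral_diff
        Bochner_Integration.integrable_add Bochner_Integration.integrable_diff integrable_mult_right integral_mult_right_zero
        i1 i2 i3 i4 i6 if' hpot_f_integrable)
  also have "\<dots> \<le> CARD('d) + 1 - (\<gamma>\<^sup>2 / 2) * (\<integral>z. t4 z \<partial>lborel)
      + (K + (1 + 20 * c\<^sup>2) * (\<integral>z. hpot \<gamma> z * f z \<partial>lborel)) + (\<integral>z. t6 z \<partial>lborel)"
  proof -
    have "\<gamma> * (- CARD('d) / \<gamma>) = - CARD('d)" using gam by simp
    then show ?thesis unfolding I1 I2 f_integral using gs3 by simp
  qed
  finally show ?thesis unfolding K_def t4_def t6_def by simp
qed

end

section \<open>Fourth moments\<close>

text \<open>As \<open>R\<close> tends to infinity, \<open>R * (1 - cutoff R z)\<close> tends to \<open>(1 + (norm z)\<^sup>2)\<^sup>2\<close>: testing the equation with cutoffs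
  therefore controls fourth moments, with no regularity of the solution needed.\<close>
definition cutoff :: "real \<Rightarrow> 'a::euclidean_space \<Rightarrow> real" where
  "cutoff R z = exp 1 * expinv 0 (1 - (1 + (norm z)\<^sup>2)\<^sup>2 / R)"

lemma one_plus_norm2_smooth: "smooth (\<lambda>z :: 'a::euclidean_space. 1 + (norm z)\<^sup>2)"
  by (intro smooth_add smooth_const smooth_norm2 bounded_linear_ident)

lemma W_smooth: "smooth (\<lambda>z :: 'a::euclidean_space. 1 - (1 + (norm z)\<^sup>2)\<^sup>2 / R)"
proof -
  have "smooth (\<lambda>z :: 'a. 1 - (1/R) * (1 + (norm z)\<^sup>2)\<^sup>2)"
    by (intro smooth_diff smooth_mult smooth_const smooth_power one_plus_norm2_smooth)
  then show ?thesis by simp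
qed

lemma cutoff_smooth: "smooth (cutoff R :: 'a::euclidean_space \<Rightarrow> real)"
  unfolding cutoff_def[abs_def] by (intro smooth_mult smooth_const smooth_expinv W_smooth)

lemma norm_le_one_plus: "norm z \<le> 1 + (norm z)\<^sup>2"
proof -
  have "2 * norm z \<le> (norm z)\<^sup>2 + 1" using sum_squares_bound[of "norm z" 1] by simp
  then show ?thesis using norm_ge_zero[of z] by linarith
qed

lemma norm_le_W: "norm z \<le> (1 + (norm z)\<^sup>2)\<^sup>2"
proof -
  have "norm z \<le> 1 + (norm z)\<^sup>2" by (rule norm_le_one_plus)
  also have "\<dots> \<le> (1 + (norm z)\<^sup>2)\<^sup>2" by (rule self_le_power) auto
  finally show ?thesis .
qed

lemma cutoff_test_fun:
  assumes "R > 0" shows "test_fun (cutoff R :: 'a::euclidean_space \<Rightarrow> real)"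
proof (rule test_funI[OF cutoff_smooth, of R])
  fix z :: 'a assume "norm z > R"
  then have "(1 + (norm z)\<^sup>2)\<^sup>2 / R \<ge> 1" using norm_le_W[of z] assms by (simp add: le_divide_eq)
  then show "cutoff R z = 0" by (simp add: cutoff_def expinv_def)
qed

lemma norm2_deriv: "((\<lambda>z :: 'a::euclidean_space. 1 + (norm z)\<^sup>2) has_derivative (\<lambda>h. 2 * (z \<bullet> h))) (at z)"
  unfolding power2_norm_eq_inner by (auto intro!: derivative_eq_intros simp: inner_commute)

lemma W_deriv: "((\<lambda>z :: 'a::euclidean_space. 1 - (1 + (norm z)\<^sup>2)\<^sup>2 / R) has_derivative
    (\<lambda>h. - (4 * (1 + (norm z)\<^sup>2) / R) * (z \<bullet> h))) (at z)"
proof -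
  have "((\<lambda>z :: 'a. 1 - (1/R) * ((1 + (norm z)\<^sup>2) * (1 + (norm z)\<^sup>2))) has_derivative
    (\<lambda>h. 0 - (1/R) * ((1 + (norm z)\<^sup>2) * (2 * (z \<bullet> h)) + (2 * (z \<bullet> h)) * (1 + (norm z)\<^sup>2)))) (at z)"
    by (intro has_derivative_diff has_derivative_const has_derivative_mult_right has_derivative_mult norm2_deriv)
  then show ?thesis by (simp add: power2_eq_square algebra_simps add_divide_distrib)
qed

lemma expinv_W_deriv: "((\<lambda>z :: 'a::euclidean_space. expinv n (1 - (1 + (norm z)\<^sup>2)\<^sup>2 / R)) has_derivative
    (\<lambda>h. (expinv (n+2) (1 - (1 + (norm z)\<^sup>2)\<^sup>2 / R) - real n * expinv (n+1) (1 - (1 + (norm z)\<^sup>2)\<^sup>2 / R))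
       * (- (4 * (1 + (norm z)\<^sup>2) / R) * (z \<bullet> h)))) (at z)"
  using has_derivative_compose[OF W_deriv expinv_deriv[unfolded has_field_derivative_def]] .

text \<open>The cutoff is radial, so its gradient is this scalar times z; \<open>cutB\<close> plays
  the same role for \<open>cutA\<close>.\<close>

definition cutA :: "real \<Rightarrow> 'a::euclidean_space \<Rightarrow> real" where
  "cutA R z = - (4 * exp 1 / R) * (expinv 2 (1 - (1 + (norm z)\<^sup>2)\<^sup>2 / R) * (1 + (norm z)\<^sup>2))"

lemma cutoff_deriv: "((cutoff R :: 'a::euclidean_space \<Rightarrow> real) has_derivative (\<lambda>h. cutA R z * (z \<bullet> h))) (at z)"
proof -
  have aux: "e1 * ((E - real 0 * E') * (- (4 * p / R) * q)) = - (4 * e1 / R) * (E * p) * q" for e1 E E' p q :: real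
    by simp
  show ?thesis
    using has_derivative_mult_right[OF expinv_W_deriv[of 0 R z], of "exp 1"]
    unfolding cutoff_def[abs_def] cutA_def aux add_0 .
qed

lemma pd_cutoff: "pd (cutoff R) h z = cutA R z * (z \<bullet> h)"
  by (rule pd_eq[OF cutoff_deriv])

definition cutB :: "real \<Rightarrow> 'a::euclidean_space \<Rightarrow> real" where
  "cutB R z = - (4 * exp 1 / R) * ((expinv 4 (1 - (1 + (norm z)\<^sup>2)\<^sup>2 / R) - 2 * expinv 3 (1 - (1 + (norm z)\<^sup>2)\<^sup>2 / R))
       * (- (4 * (1 + (norm z)\<^sup>2) / R)) * (1 + (norm z)\<^sup>2) + 2 * expinv 2 (1 - (1 + (norm z)\<^sup>2)\<^sup>2 / R))"

lemma cutA_deriv: "((cutA R :: 'a::euclidean_space \<Rightarrow> real) has_derivative (\<lambda>h. cutB R z * (z \<bullet> h))) (at z)"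
proof -
  have "(cutA R has_derivative (\<lambda>h. - (4 * exp 1 / R) *
     (expinv 2 (1 - (1 + (norm z)\<^sup>2)\<^sup>2 / R) * (2 * (z \<bullet> h)) +
       ((expinv (2+2) (1 - (1 + (norm z)\<^sup>2)\<^sup>2 / R) - real 2 * expinv (2+1) (1 - (1 + (norm z)\<^sup>2)\<^sup>2 / R))
       * (- (4 * (1 + (norm z)\<^sup>2) / R) * (z \<bullet> h))) * (1 + (norm z)\<^sup>2)))) (at z)"
    unfolding cutA_def[abs_def] by (intro has_derivative_mult_right has_derivative_mult expinv_W_deriv norm2_deriv)
  moreover have "K * (E2 * (2 * q) + ((E4 - real 2 * E3) * (- (4 * p / R) * q)) * p)
      = K * ((E4 - 2 * E3) * (- (4 * p / R)) * p + 2 * E2) * q" for K E2 E3 E4 p q :: real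
    by (simp add: algebra_simps)
  moreover have "(2::nat) + 2 = 4" "(2::nat) + 1 = 3" by simp_all
  ultimately show ?thesis unfolding cutB_def by (simp only:)
qed

lemma lap_cutoff: "pd (pd (cutoff R) e) e z = cutB R z * (z \<bullet> e)\<^sup>2 + cutA R z * (e \<bullet> e)"
proof -
  have eq: "pd (cutoff R) e = (\<lambda>z. cutA R z * (z \<bullet> e))" by (rule ext) (rule pd_cutoff)
  have "((\<lambda>z. cutA R z * (z \<bullet> e)) has_derivative (\<lambda>h. cutA R z * (h \<bullet> e) + (cutB R z * (z \<bullet> h)) * (z \<bullet> e))) (at z)"
    by (intro has_derivative_mult cutA_deriv) (auto intro!: derivative_eq_intros)
  from pd_eq[OF this] show ?thesis unfolding eq by (simp add: power2_eq_square algebra_simps)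
qed

section \<open>The kinetic operator applied to cutoffs\<close>

lemma kgen_cutoff:
  fixes z :: "'d::finite ps"
  shows "kgen \<gamma> F (cutoff R) z = cutA R z * (\<gamma> * (snd z \<bullet> fst z) + \<gamma> * (F z \<bullet> snd z) - \<gamma>\<^sup>2 * (norm (snd z))\<^sup>2 + \<gamma>\<^sup>2 * CARD('d))
    + \<gamma>\<^sup>2 * cutB R z * (norm (snd z))\<^sup>2"
proof -
  have gx: "grad_x (cutoff R) z = cutA R z *\<^sub>R fst z"
  proof -
    have "grad_x (cutoff R) z = (\<Sum>i\<in>Basis. cutA R z *\<^sub>R ((fst z \<bullet> i) *\<^sub>R i))"
      unfolding grad_x_def by (rule sum.cong[OF refl]) (simp add: pd_cutoff inner_prod_def)
    then show ?thesis by (simp only: scaleR_sum_right[symmetric] euclidean_representation)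
  qed
  have gv: "grad_v (cutoff R) z = cutA R z *\<^sub>R snd z"
  proof -
    have "grad_v (cutoff R) z = (\<Sum>i\<in>Basis. cutA R z *\<^sub>R ((snd z \<bullet> i) *\<^sub>R i))"
      unfolding grad_v_def by (rule sum.cong[OF refl]) (simp add: pd_cutoff inner_prod_def)
    then show ?thesis by (simp only: scaleR_sum_right[symmetric] euclidean_representation)
  qed
  have "lap_v (cutoff R) z = (\<Sum>i\<in>Basis. cutB R z * (snd z \<bullet> i)\<^sup>2 + cutA R z)"
    unfolding lap_v_def by (rule sum.cong[OF refl]) (simp add: lap_cutoff inner_prod_def inner_Basis)
  also have "\<dots> = cutB R z * (norm (snd z))\<^sup>2 + CARD('d) * cutA R z"
    unfolding power2_norm_eq_inner euclidean_inner[of "snd z" "snd z"]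
    by (simp add: sum.distrib sum_distrib_left power2_eq_square)
  finally show ?thesis unfolding kgen_def gx gv
    by (simp add: algebra_simps power2_norm_eq_inner)
qed

text \<open>With u the quotient of (1 + |z|^2)^2 by R, the factor exp 1 normalises the cutoff to
  exp(-u/(1 - u)). For u below 1 this is at most exp(-u), hence at most 1/(1 + u), hence at most 1 -
  u/2.\<close>

lemma cutoff_lower:
  assumes R: "R > 0" and le: "(1 + (norm z)\<^sup>2)\<^sup>2 < R"
  shows "(1 + (norm z)\<^sup>2)\<^sup>2 / 2 \<le> R * (1 - cutoff R z)"
proof -
  define u where "u = (1 + (norm z)\<^sup>2)\<^sup>2 / R"
  have u: "0 \<le> u" "u < 1" using assms by (auto simp: u_def)
  have "cutoff R z = exp (1 - 1 / (1 - u))"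
    using u by (simp add: cutoff_def u_def[symmetric] expinv_def exp_add[symmetric])
  also have "\<dots> \<le> exp (- u)"
  proof -
    have "1 + u \<le> 1 / (1 - u)" using u by (simp add: le_divide_eq algebra_simps)
    then show ?thesis by simp
  qed
  also have "\<dots> \<le> 1 - u / 2"
  proof -
    have "(1 + u) * exp (- u) \<le> 1" using exp_ge_add_one_self[of u] by (simp add: exp_minus field_simps)
    then have "exp (- u) \<le> 1 / (1 + u)" using u by (simp add: le_divide_eq mult.commute)
    also have "\<dots> \<le> 1 - u / 2"
    proof -
      have "1 \<le> (1 - u/2) * (1 + u)" using u mult_left_mono[of u 1 u] by (simp add: algebra_simps)
      then show ?thesis using u by (simp add: divide_le_eq)
    qed
    finally show ?thesis .
  qed
  finally have "u / 2 \<le> 1 - cutoff R z" by simp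
  from mult_left_mono[OF this, of R] show ?thesis using R by (simp add: u_def)
qed

lemma cutoff_range: "0 \<le> cutoff R z" "R > 0 \<Longrightarrow> cutoff R z \<le> 1"
proof -
  show "0 \<le> cutoff R z" by (simp add: cutoff_def expinv_nonneg)
  show "cutoff R z \<le> 1" if "R > 0"
  proof (cases "(1 + (norm z)\<^sup>2)\<^sup>2 < R")
    case True
    have "0 \<le> R * (1 - cutoff R z)" using cutoff_lower[OF that True] by (rule order_trans[rotated]) simp
    then show ?thesis using that by (simp add: zero_le_mult_iff)
  next
    case False
    then have "1 - (1 + (norm z)\<^sup>2)\<^sup>2 / R \<le> 0" using that by (simp add: le_divide_eq)
    then show ?thesis by (simp add: cutoff_def expinv_def)
  qed
qed

text \<open>For u at most 1/2, the inequality exp y >= 1 + y bounds 1 minus the cutoff by u/(1 - u),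
  hence by 2u. For larger u the trivial bound 1 is below 2u.\<close>

lemma cutoff_upper:
  assumes R: "R > 0" shows "R * (1 - cutoff R z) \<le> 2 * (1 + (norm z)\<^sup>2)\<^sup>2"
proof -
  define u where "u = (1 + (norm z)\<^sup>2)\<^sup>2 / R"
  have u: "0 \<le> u" using assms by (auto simp: u_def)
  have "1 - cutoff R z \<le> 2 * u"
  proof (cases "u \<le> 1/2")
    case True
    have "1 - 2 * u \<le> 1 + (1 - 1 / (1 - u))"
    proof -
      have "1 / (1 - u) \<le> 1 + 2 * u"
        using u True mult_left_mono[of u "1/2" "2 * u"] by (simp add: divide_le_eq algebra_simps)
      then show ?thesis by simp
    qed
    also have "\<dots> \<le> exp (1 - 1 / (1 - u))" by (rule exp_ge_add_one_self)
    also have "\<dots> = cutoff R z"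
      using u True by (simp add: cutoff_def u_def[symmetric] expinv_def exp_add[symmetric])
    finally show ?thesis by simp
  next
    case False
    then show ?thesis using cutoff_range(1)[of R z] by linarith
  qed
  from mult_left_mono[OF this, of R] show ?thesis using R by (simp add: u_def)
qed

text \<open>R times 1 minus the cutoff is a Lyapunov function with a rate independent of R. With p =
  1 + |z|^2, the scalars \<open>cutA\<close> and \<open>cutB\<close>, times R, are of order p and 1,
  and the coefficients that they multiply are of order p. The resulting p^2 is controlled by the
  lower bound of the Lyapunov function where the cutoff is positive; elsewhere the derivatives of
  the cutoff vanish.\<close>

lemma kgen_cutoff_bound:
  fixes c c0 \<gamma> :: real
  assumes cc: "0 \<le> c" "0 \<le> c0" and g: "1 \<le> \<gamma>"
  obtains C where "C > 0" "\<And>R F (z :: 'd::finite ps). R \<ge> 1 \<Longrightarrow> norm (F z) \<le> c * (1 + norm (fst z)) + c0 \<Longrightarrow>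
     \<bar>R * kgen \<gamma> F (cutoff R) z\<bar> \<le> C * (R * (1 - cutoff R z))"
proof -
  define K where "K = \<gamma> + \<gamma> * (2 * (c + c0)) + \<gamma>\<^sup>2 + \<gamma>\<^sup>2 * CARD('d)"
  define C where "C = 2 * (24 * K + \<gamma>\<^sup>2 * 12 * 148)"
  have K: "K \<ge> 0" using cc g by (simp add: K_def)
  have bnd: "\<bar>R * kgen \<gamma> F (cutoff R) z\<bar> \<le> C * (R * (1 - cutoff R z))"
    if R: "R \<ge> 1" and F: "norm (F z) \<le> c * (1 + norm (fst z)) + c0" for R F and z :: "'d ps"
  proof (cases "(1 + (norm z)\<^sup>2)\<^sup>2 < R")
    case False
    then have "1 - (1 + (norm z)\<^sup>2)\<^sup>2 / R \<le> 0" using R by (simp add: le_divide_eq)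
    then have "cutA R z = 0" "cutB R z = 0" by (simp_all add: cutA_def cutB_def expinv_def)
    then have "kgen \<gamma> F (cutoff R) z = 0" unfolding kgen_cutoff by simp
    moreover have "0 \<le> C" using K g by (simp add: C_def)
    moreover have "0 \<le> R * (1 - cutoff R z)" using cutoff_range(2)[of R z] R by simp
    ultimately show ?thesis by simp
  next
    case True
    define p where "p = 1 + (norm z)\<^sup>2"
    define w where "w = 1 - p\<^sup>2 / R"
    have p: "1 \<le> p" "p\<^sup>2 < R" "norm z \<le> p" "(norm z)\<^sup>2 \<le> p" "norm z * norm z \<le> p" "0 \<le> p"
      using True norm_le_one_plus[of z] by (auto simp: p_def power2_eq_square)
    have e: "exp 1 \<le> (3::real)" by (rule exp_le)
    \<comment> \<open>The bounds are factorials: 2! = 2, and 4! + 2 * 3! = 36.\<close>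
    have E: "0 \<le> expinv 2 w" "expinv 2 w \<le> 2" "\<bar>expinv 4 w - 2 * expinv 3 w\<bar> \<le> 36"
      using expinv_le_fact[of 2 w] expinv_le_fact[of 3 w] expinv_le_fact[of 4 w] expinv_nonneg[of 2 w] expinv_nonneg[of 3 w] expinv_nonneg[of 4 w]
      by (auto simp: fact_numeral)
    have RA: "\<bar>R * cutA R z\<bar> \<le> 24 * p"
    proof -
      have "R * cutA R z = - (4 * (exp 1 * (expinv 2 w * p)))" using R by (simp add: cutA_def p_def[symmetric] w_def[symmetric])
      then have "\<bar>R * cutA R z\<bar> = 4 * (exp 1 * (expinv 2 w * p))" using E p by simp
      also have "exp 1 * (expinv 2 w * p) \<le> 3 * (2 * p)" using e E p by (intro mult_mono) auto
      finally show ?thesis by simp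
    qed
    have RB: "\<bar>R * cutB R z\<bar> \<le> 12 * 148"
    proof -
      define X where "X = (expinv 4 w - 2 * expinv 3 w) * (- (4 * p / R)) * p + 2 * expinv 2 w"
      have "R * cutB R z = - (4 * (exp 1 * X))"
        using R by (simp add: cutB_def X_def p_def[symmetric] w_def[symmetric])
      then have "\<bar>R * cutB R z\<bar> = 4 * (exp 1 * \<bar>X\<bar>)" by (simp add: abs_mult)
      \<comment> \<open>148 is 4 * 36 + 2 * 2; the two factors p are absorbed by 1/R, as p^2 is
        below R.\<close>
      moreover have "\<bar>X\<bar> \<le> 148"
      proof -
        have "(expinv 4 w - 2 * expinv 3 w) * (- (4 * p / R)) * p = - (4 * ((expinv 4 w - 2 * expinv 3 w) * (p\<^sup>2 / R)))"
          by (simp add: power2_eq_square)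
        moreover have "\<bar>(expinv 4 w - 2 * expinv 3 w) * (p\<^sup>2 / R)\<bar> \<le> 36 * 1"
          unfolding abs_mult using E p R by (intro mult_mono) (auto simp: divide_le_eq)
        ultimately show ?thesis unfolding X_def using E(1,2) by linarith
      qed
      moreover have "exp 1 * \<bar>X\<bar> \<le> 3 * 148" using e \<open>\<bar>X\<bar> \<le> 148\<close> by (intro mult_mono) auto
      ultimately show ?thesis by linarith
    qed
    have vv: "(norm (snd z))\<^sup>2 \<le> p" by (rule order_trans[OF power_mono[OF norm_snd_le' norm_ge_zero] p(4)])
    define G where "G = \<gamma> * (snd z \<bullet> fst z) + \<gamma> * (F z \<bullet> snd z) - \<gamma>\<^sup>2 * (norm (snd z))\<^sup>2 + \<gamma>\<^sup>2 * CARD('d)"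
    have "\<bar>G\<bar> \<le> \<gamma> * p + \<gamma> * (2 * (c + c0) * p) + \<gamma>\<^sup>2 * p + \<gamma>\<^sup>2 * (CARD('d) * p)"
    proof -
      have 1: "\<bar>snd z \<bullet> fst z\<bar> \<le> p"
      proof -
        have "\<bar>snd z \<bullet> fst z\<bar> \<le> norm (snd z) * norm (fst z)" by (rule Cauchy_Schwarz_ineq2)
        also have "\<dots> \<le> norm z * norm z" by (intro mult_mono norm_fst_le' norm_snd_le') auto
        finally show ?thesis using p by simp
      qed
      have 2: "\<bar>F z \<bullet> snd z\<bar> \<le> 2 * (c + c0) * p"
      proof -
        have "c * (1 + norm (fst z)) + c0 \<le> (c + c0) * (1 + norm z)"
        proof -
          have "c * (1 + norm (fst z)) + c0 * 1 \<le> c * (1 + norm z) + c0 * (1 + norm z)"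
            using norm_fst_le'[of z] cc by (intro add_mono mult_left_mono) auto
          then show ?thesis by (simp add: algebra_simps)
        qed
        with F have Fn: "norm (F z) \<le> (c + c0) * (1 + norm z)" by linarith
        have "\<bar>F z \<bullet> snd z\<bar> \<le> norm (F z) * norm (snd z)" by (rule Cauchy_Schwarz_ineq2)
        also have "\<dots> \<le> ((c + c0) * (1 + norm z)) * norm z" using Fn cc by (intro mult_mono norm_snd_le') auto
        also have "\<dots> = (c + c0) * (norm z + norm z * norm z)" by (simp add: algebra_simps)
        also have "\<dots> \<le> (c + c0) * (2 * p)" using p cc by (intro mult_left_mono) auto
        finally show ?thesis by (simp only: mult_ac)
      qed
      have "\<bar>G\<bar> \<le> \<gamma> * \<bar>snd z \<bullet> fst z\<bar> + \<gamma> * \<bar>F z \<bullet> snd z\<bar> + \<gamma>\<^sup>2 * (norm (snd z))\<^sup>2 + \<gamma>\<^sup>2 * CARD('d)"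
      proof -
        have "\<bar>\<gamma> * (snd z \<bullet> fst z)\<bar> = \<gamma> * \<bar>snd z \<bullet> fst z\<bar>" "\<bar>\<gamma> * (F z \<bullet> snd z)\<bar> = \<gamma> * \<bar>F z \<bullet> snd z\<bar>"
          using g by (auto simp: abs_mult)
        moreover have "0 \<le> \<gamma>\<^sup>2 * (norm (snd z))\<^sup>2" "0 \<le> \<gamma>\<^sup>2 * real CARD('d)" by auto
        ultimately show ?thesis unfolding G_def by linarith
      qed
      also have "\<dots> \<le> \<gamma> * p + \<gamma> * (2 * (c + c0) * p) + \<gamma>\<^sup>2 * p + \<gamma>\<^sup>2 * (CARD('d) * p)"
        using 1 2 vv g p by (intro add_mono mult_left_mono) auto
      finally show ?thesis .
    qed
    also have "\<dots> = K * p" by (simp add: K_def algebra_simps)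
    finally have G: "\<bar>G\<bar> \<le> K * p" .
    have "R * kgen \<gamma> F (cutoff R) z = (R * cutA R z) * G + \<gamma>\<^sup>2 * (R * cutB R z) * (norm (snd z))\<^sup>2"
      unfolding kgen_cutoff G_def by (simp add: algebra_simps)
    also have "\<bar>\<dots>\<bar> \<le> \<bar>R * cutA R z\<bar> * \<bar>G\<bar> + \<gamma>\<^sup>2 * \<bar>R * cutB R z\<bar> * (norm (snd z))\<^sup>2"
      by (rule order_trans[OF abs_triangle_ineq]) (simp add: abs_mult)
    also have "\<dots> \<le> (24 * p) * (K * p) + \<gamma>\<^sup>2 * (12 * 148) * p"
      using RA RB G vv p by (intro add_mono mult_mono mult_left_mono) auto
    also have "\<dots> \<le> (24 * p) * (K * p) + \<gamma>\<^sup>2 * (12 * 148) * p\<^sup>2"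
      using p self_le_power[of p 2] by (intro add_left_mono mult_left_mono) auto
    also have "\<dots> = C * (p\<^sup>2 / 2)" by (simp add: C_def power2_eq_square algebra_simps)
    also have "\<dots> \<le> C * (R * (1 - cutoff R z))"
      using cutoff_lower[OF _ True] R K unfolding p_def by (intro mult_left_mono) (auto simp: C_def)
    finally show ?thesis .
  qed
  have "C > 0" using K g by (simp add: C_def add_nonneg_pos)
  then show ?thesis using that bnd by blast
qed

text \<open>Growth of the force and the weak equation are retained, and the dependence of F on the
  solution is forgotten. The integrability in \<open>weak_int\<close> is also the source of
  measurability of the force.\<close>

locale kinetic =
  fixes \<gamma> c c0 T :: real and \<mu> :: "real \<Rightarrow> 'd::finite ps \<Rightarrow> real" and F :: "real \<Rightarrow> 'd ps \<Rightarrow> real^'d"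
  assumes gam: "1 \<le> \<gamma>" and cc: "0 \<le> c" "0 \<le> c0" and T: "0 < T"
    and dens: "\<And>t. t \<in> {0..T} \<Longrightarrow> prob_dens (\<mu> t)" and init: "test_fun (\<mu> 0)"
    and Fb: "\<And>t z. t \<in> {0..T} \<Longrightarrow> norm (F t z) \<le> c * (1 + norm (fst z)) + c0"
    and weak_int: "\<And>\<phi> t. test_fun \<phi> \<Longrightarrow> t \<in> {0..T} \<Longrightarrow> integrable lborel (\<lambda>z. \<mu> t z * kgen \<gamma> (F t) \<phi> z)"
    and weak_time: "\<And>\<phi>. test_fun \<phi> \<Longrightarrow> set_integrable lborel {0..T} (\<lambda>r. \<integral>z. \<mu> r z * kgen \<gamma> (F r) \<phi> z \<partial>lborel)"
    and weak: "\<And>\<phi> t. test_fun \<phi> \<Longrightarrow> t \<in> {0..T} \<Longrightarrow> (\<integral>z. \<phi> z * \<mu> t z \<partial>lborel)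
        = (\<integral>z. \<phi> z * \<mu> 0 z \<partial>lborel) + (LINT r:{0..t}|lborel. \<integral>z. \<mu> r z * kgen \<gamma> (F r) \<phi> z \<partial>lborel)"
begin

lemma mu:
  assumes "t \<in> {0..T}"
  shows "\<mu> t \<in> borel_measurable borel" "\<And>z. 0 \<le> \<mu> t z" "integrable lborel (\<mu> t)" "(\<integral>z. \<mu> t z \<partial>lborel) = 1"
  using dens[OF assms] by (auto simp: prob_dens_def)

lemma test_integrable:
  assumes \<phi>: "test_fun \<phi>" and t: "t \<in> {0..T}" shows "integrable lborel (\<lambda>z. \<phi> z * \<mu> t z)"
proof -
  obtain C where C: "\<And>z. \<bar>\<phi> z\<bar> \<le> C" using test_fun_bounded[OF \<phi>] by metis
  have [measurable]: "\<phi> \<in> borel_measurable borel" "\<mu> t \<in> borel_measurable borel" using \<phi> mu[OF t] by auto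
  show ?thesis
    by (rule integrable_le[where g="\<lambda>z. C * \<mu> t z"]) (use mu[OF t] C in \<open>auto simp: abs_mult intro!: mult_right_mono\<close>)
qed

text \<open>The equation is tested with a cutoff, and mass conservation turns this into an equation
  for R times 1 minus the cutoff. Gronwall's inequality has a rate independent of R, the initial
  value is finite by compact support of the datum, and Fatou's lemma in R gives the moment.\<close>

lemma fourth_moment_bound:
  "\<exists>M. \<forall>t\<in>{0..T}. integrable lborel (\<lambda>z. (1 + norm z)^4 * \<mu> t z) \<and> (\<integral>z. (1 + norm z)^4 * \<mu> t z \<partial>lborel) \<le> M"
proof -
  define W :: "'d ps \<Rightarrow> real" where "W z = (1 + (norm z)\<^sup>2)\<^sup>2" for z
  have Ws: "smooth W" unfolding W_def[abs_def] by (intro smooth_power one_plus_norm2_smooth)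
  have [measurable]: "W \<in> borel_measurable borel" by (rule smooth_borel_measurable[OF Ws])
  have W0: "0 \<le> W z" for z by (simp add: W_def)
  define I0 where "I0 = (\<integral>z. W z * \<mu> 0 z \<partial>lborel)"
  have i0: "integrable lborel (\<lambda>z. W z * \<mu> 0 z)"
    by (rule test_fun_integrable[OF test_fun_mult[OF init Ws]])
  obtain C where C: "C > 0" "\<And>R F (z :: 'd ps). R \<ge> 1 \<Longrightarrow> norm (F z) \<le> c * (1 + norm (fst z)) + c0 \<Longrightarrow>
     \<bar>R * kgen \<gamma> F (cutoff R) z\<bar> \<le> C * (R * (1 - cutoff R z))"
    using kgen_cutoff_bound[OF cc gam] by blast
  have T0: "0 \<in> {0..T}" using T by simp
  have main: "integrable lborel (\<lambda>z. R * (1 - cutoff R z) * \<mu> t z) \<and>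
      (\<integral>z. R * (1 - cutoff R z) * \<mu> t z \<partial>lborel) \<le> 2 * I0 * exp (C * T)" if R: "R \<ge> 1" and t: "t \<in> {0..T}" for R t
  proof -
    define Y where "Y t = (\<integral>z. R * (1 - cutoff R z) * \<mu> t z \<partial>lborel)" for t
    define S where "S r = - R * (\<integral>z. \<mu> r z * kgen \<gamma> (F r) (cutoff R) z \<partial>lborel)" for r
    have tc: "test_fun (cutoff R :: 'd ps \<Rightarrow> real)" using R by (intro cutoff_test_fun) simp
    have Yi: "integrable lborel (\<lambda>z. R * (1 - cutoff R z) * \<mu> t z)" if t: "t \<in> {0..T}" for t
    proof -
      have "integrable lborel (\<lambda>z. R * \<mu> t z - R * (cutoff R z * \<mu> t z))"
        using mu[OF t] test_integrable[OF tc t] by auto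
      then show ?thesis by (simp add: algebra_simps)
    qed
    have Yeq: "Y t = R - R * (\<integral>z. cutoff R z * \<mu> t z \<partial>lborel)" if t: "t \<in> {0..T}" for t
    proof -
      have "Y t = (\<integral>z. R * \<mu> t z - R * (cutoff R z * \<mu> t z) \<partial>lborel)" unfolding Y_def by (simp add: algebra_simps)
      also have "\<dots> = R * (\<integral>z. \<mu> t z \<partial>lborel) - R * (\<integral>z. cutoff R z * \<mu> t z \<partial>lborel)"
        using mu[OF t] test_integrable[OF tc t] by (subst Bochner_Integration.integral_diff) auto
      finally show ?thesis using mu(4)[OF t] by simp
    qed
    \<comment> \<open>Gronwall's inequality with dissipation, error and constant forcing all
      0.\<close>
    have "Y t + (LINT r:{0..t}|lborel. 0) \<le> (Y 0 + (LINT r:{0..T}|lborel. 0)) * exp (C * t) + 0 / C * (exp (C * t) - 1)"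
    proof (rule Gronwall_dissipation[OF C(1) t])
      show "Y t = Y 0 + (LINT r:{0..t}|lborel. S r)" if t: "t \<in> {0..T}" for t
        unfolding Yeq[OF t] Yeq[OF T0] S_def weak[OF tc t] set_integral_mult_right by (simp add: algebra_simps)
      show "set_integrable lborel {0..T} S" unfolding S_def[abs_def]
        by (rule set_integrable_mult_right) (use weak_time[OF tc] in auto)
      fix r assume r: "r \<in> {0..T}"
      have "S r \<le> norm (\<integral>z. R * (\<mu> r z * kgen \<gamma> (F r) (cutoff R) z) \<partial>lborel)" unfolding S_def by simp
      also have "\<dots> \<le> (\<integral>z. C * (R * (1 - cutoff R z) * \<mu> r z) \<partial>lborel)"
      proof (rule norm_integral_le)
        show "integrable lborel (\<lambda>z. C * (R * (1 - cutoff R z) * \<mu> r z))" using Yi[OF r] by simp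
        fix z
        have "\<bar>R * (\<mu> r z * kgen \<gamma> (F r) (cutoff R) z)\<bar> = \<bar>R * kgen \<gamma> (F r) (cutoff R) z\<bar> * \<mu> r z"
          using mu(2)[OF r] by (simp add: abs_mult)
        also have "\<dots> \<le> (C * (R * (1 - cutoff R z))) * \<mu> r z"
          using mu(2)[OF r] by (intro mult_right_mono C(2) R Fb[OF r])
        finally show "norm (R * (\<mu> r z * kgen \<gamma> (F r) (cutoff R) z)) \<le> C * (R * (1 - cutoff R z) * \<mu> r z)"
          by (simp add: mult.assoc)
      qed
      also have "\<dots> = C * Y r" by (simp add: Y_def)
      finally show "S r \<le> C * Y r + 0 + 0 - 0" by simp
    qed (auto simp: set_integrable_def)
    then have "Y t \<le> Y 0 * exp (C * t)" by (simp add: set_lebesgue_integral_def)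
    also have "\<dots> \<le> (2 * I0) * exp (C * T)"
    proof (rule mult_mono)
      have "Y 0 \<le> (\<integral>z. 2 * (W z * \<mu> 0 z) \<partial>lborel)" unfolding Y_def
      proof (rule integral_mono[OF Yi[OF T0]])
        show "integrable lborel (\<lambda>z. 2 * (W z * \<mu> 0 z))" using i0 by simp
        fix z
        have "R * (1 - cutoff R z) \<le> 2 * W z" unfolding W_def using R by (intro cutoff_upper) simp
        from mult_right_mono[OF this mu(2)[OF T0, of z]] show "R * (1 - cutoff R z) * \<mu> 0 z \<le> 2 * (W z * \<mu> 0 z)" by simp
      qed
      then show "Y 0 \<le> 2 * I0" by (simp add: I0_def)
      show "exp (C * t) \<le> exp (C * T)" using C(1) t by simp
      show "0 \<le> 2 * I0" unfolding I0_def using W0 mu(2)[OF T0] by simp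
    qed simp
    finally show ?thesis using Yi[OF t] by (simp add: Y_def)
  qed
  define M where "M = 4 * I0 * exp (C * T)"
  have I00: "0 \<le> I0" unfolding I0_def using W0 mu(2)[OF T0] by simp
  have "integrable lborel (\<lambda>z. (1 + norm z)^4 * \<mu> t z) \<and> (\<integral>z. (1 + norm z)^4 * \<mu> t z \<partial>lborel) \<le> 4 * M" if t: "t \<in> {0..T}" for t
  proof -
    have [measurable]: "\<mu> t \<in> borel_measurable borel" using mu[OF t] by simp
    have cm[measurable]: "(cutoff R :: 'd ps \<Rightarrow> real) \<in> borel_measurable borel" for R
      by (rule smooth_borel_measurable[OF cutoff_smooth])
    \<comment> \<open>The factor 2 undoes the 1/2 in the lower bound of the cutoff, so that
      \<open>u n z\<close> eventually exceeds \<open>W z * \<mu> t z\<close>.\<close>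
    define u where "u n z = ennreal (2 * (real (Suc n) * (1 - cutoff (real (Suc n)) z) * \<mu> t z))" for n z
    have "(\<integral>\<^sup>+z. ennreal (W z * \<mu> t z) \<partial>lborel) \<le> (\<integral>\<^sup>+z. liminf (\<lambda>n. u n z) \<partial>lborel)"
    proof (rule nn_integral_mono)
      fix z
      obtain N where N: "W z < real N" using reals_Archimedean2 by blast
      show "ennreal (W z * \<mu> t z) \<le> liminf (\<lambda>n. u n z)"
      proof (rule Liminf_bounded, rule eventually_sequentiallyI[of N])
        fix n assume n: "N \<le> n"
        have "W z / 2 \<le> real (Suc n) * (1 - cutoff (real (Suc n)) z)"
          unfolding W_def using N n by (intro cutoff_lower) (auto simp: W_def)
        then have "(W z / 2) * \<mu> t z \<le> real (Suc n) * (1 - cutoff (real (Suc n)) z) * \<mu> t z"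
          using mu(2)[OF t] by (rule mult_right_mono)
        then show "ennreal (W z * \<mu> t z) \<le> u n z" unfolding u_def by (intro ennreal_leI) simp
      qed
    qed
    also have "\<dots> \<le> liminf (\<lambda>n. \<integral>\<^sup>+z. u n z \<partial>lborel)"
      by (rule nn_integral_liminf) (simp add: u_def[abs_def])
    also have "\<dots> \<le> liminf (\<lambda>n. ennreal M)"
    proof (rule Liminf_mono, rule always_eventually, rule allI)
      fix n
      have n: "1 \<le> real (Suc n)" by simp
      note m = main[OF n t]
      have "(\<integral>\<^sup>+z. u n z \<partial>lborel) = ennreal (\<integral>z. 2 * (real (Suc n) * (1 - cutoff (real (Suc n)) z) * \<mu> t z) \<partial>lborel)"
        unfolding u_def
      proof (rule nn_integral_eq_integral)
        show "integrable lborel (\<lambda>z. 2 * (real (Suc n) * (1 - cutoff (real (Suc n)) z) * \<mu> t z))" using m by (intro integrable_mult_right) auto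
        show "AE z in lborel. 0 \<le> 2 * (real (Suc n) * (1 - cutoff (real (Suc n)) z) * \<mu> t z)"
          using cutoff_range(2)[of "real (Suc n)"] mu(2)[OF t] by (intro AE_I2 mult_nonneg_nonneg) auto
      qed
      also have "\<dots> \<le> ennreal M" unfolding M_def using m by (intro ennreal_leI) simp
      finally show "(\<integral>\<^sup>+z. u n z \<partial>lborel) \<le> ennreal M" .
    qed
    also have "\<dots> = ennreal M" by (simp add: Liminf_const)
    finally have nn: "(\<integral>\<^sup>+z. ennreal (W z * \<mu> t z) \<partial>lborel) \<le> ennreal M" .
    have iW: "integrable lborel (\<lambda>z. W z * \<mu> t z)"
    proof (rule integrableI_bounded)
      have "(\<integral>\<^sup>+z. ennreal (norm (W z * \<mu> t z)) \<partial>lborel) = (\<integral>\<^sup>+z. ennreal (W z * \<mu> t z) \<partial>lborel)"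
        using W0 mu(2)[OF t] by (simp add: abs_mult)
      also have "\<dots> < \<infinity>" using nn by (rule le_less_trans) simp
      finally show "(\<integral>\<^sup>+z. ennreal (norm (W z * \<mu> t z)) \<partial>lborel) < \<infinity>" .
    qed measurable
    have M0: "0 \<le> M" using I00 by (simp add: M_def)
    have WM: "(\<integral>z. W z * \<mu> t z \<partial>lborel) \<le> M"
      using nn nn_integral_eq_integral[OF iW] W0 mu(2)[OF t] M0 by (simp add: ennreal_le_iff)
    have le: "(1 + norm z)^4 * \<mu> t z \<le> 4 * (W z * \<mu> t z)" for z
    proof -
      have "(1 + norm z)\<^sup>2 \<le> 2 * (1 + (norm z)\<^sup>2)" using sum_squares_bound[of 1 "norm z"] by (simp add: power2_sum)
      then have "((1 + norm z)\<^sup>2)\<^sup>2 \<le> (2 * (1 + (norm z)\<^sup>2))\<^sup>2" by (rule power_mono) simp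
      moreover have "((1 + norm z)\<^sup>2)\<^sup>2 = (1 + norm z)^4" by simp
      moreover have "(2 * (1 + (norm z)\<^sup>2))\<^sup>2 = 4 * W z" unfolding W_def power_mult_distrib by simp
      ultimately have "(1 + norm z)^4 \<le> 4 * W z" by (simp only:)
      from mult_right_mono[OF this mu(2)[OF t, of z]] show ?thesis by simp
    qed
    have i4: "integrable lborel (\<lambda>z. (1 + norm z)^4 * \<mu> t z)"
    proof (rule integrable_le)
      show "integrable lborel (\<lambda>z. 4 * (W z * \<mu> t z))" using iW by simp
      show "norm ((1 + norm z)^4 * \<mu> t z) \<le> 4 * (W z * \<mu> t z)" for z using le[of z] mu(2)[OF t] by (simp add: abs_mult)
    qed measurable
    have "(\<integral>z. (1 + norm z)^4 * \<mu> t z \<partial>lborel) \<le> (\<integral>z. 4 * (W z * \<mu> t z) \<partial>lborel)"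
      by (rule integral_mono[OF i4 _ le]) (use iW in simp)
    then show ?thesis using i4 WM by simp
  qed
  then show ?thesis by blast
qed

text \<open>The weak formulation makes the density times the operator applied to a test function
  measurable. Subtracting the part without force leaves the density times F . grad_v \<phi>. With
  \<phi> equal to the i-th velocity component times a cutoff, sending the radius to infinity
  isolates the i-th component of the force, since the gradient of the cutoff tends to 0.\<close>

lemma force_measurable:
  assumes t: "t \<in> {0..T}" shows "(\<lambda>z. \<mu> t z *\<^sub>R F t z) \<in> borel_measurable borel"
proof (subst borel_measurable_euclidean_space, rule ballI)
  fix i :: "real^'d" assume i: "i \<in> Basis"
  have [measurable]: "\<mu> t \<in> borel_measurable borel" using mu[OF t] by simp
  define \<phi> where "\<phi> n z = (snd z \<bullet> i) * cutoff (real (Suc n)) z" for n and z :: "'d ps"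
  have sl: "smooth (\<lambda>z :: 'd ps. snd z \<bullet> i)"
    by (rule smooth_linear) (rule bounded_linear_compose[OF bounded_linear_inner_left bounded_linear_snd])
  have \<phi>: "test_fun (\<phi> n)" for n
    unfolding \<phi>_def[abs_def] by (rule test_fun_mult[OF cutoff_test_fun sl]) simp
  have gv: "grad_v (\<phi> n) z = cutoff (real (Suc n)) z *\<^sub>R i + ((snd z \<bullet> i) * cutA (real (Suc n)) z) *\<^sub>R snd z" for n z
  proof -
    have "((\<lambda>z. (snd z \<bullet> i) * cutoff (real (Suc n)) z) has_derivative
        (\<lambda>h. (snd z \<bullet> i) * (cutA (real (Suc n)) z * (z \<bullet> h)) + (snd h \<bullet> i) * cutoff (real (Suc n)) z)) (at z)"
      by (intro has_derivative_mult cutoff_deriv) (auto intro!: derivative_eq_intros)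
    then have p: "pd (\<phi> n) h z = (snd z \<bullet> i) * (cutA (real (Suc n)) z * (z \<bullet> h)) + (snd h \<bullet> i) * cutoff (real (Suc n)) z" for h
      unfolding \<phi>_def[abs_def] by (rule pd_eq)
    have "grad_v (\<phi> n) z = (\<Sum>j\<in>Basis. ((snd z \<bullet> i) * cutA (real (Suc n)) z) *\<^sub>R ((snd z \<bullet> j) *\<^sub>R j)
        + cutoff (real (Suc n)) z *\<^sub>R ((i \<bullet> j) *\<^sub>R j))"
      unfolding grad_v_def by (rule sum.cong[OF refl]) (simp add: p inner_prod_def algebra_simps inner_commute)
    also have "\<dots> = ((snd z \<bullet> i) * cutA (real (Suc n)) z) *\<^sub>R snd z + cutoff (real (Suc n)) z *\<^sub>R i"
      unfolding sum.distrib scaleR_sum_right[symmetric] euclidean_representation ..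
    finally show ?thesis by simp
  qed
  have "(\<lambda>z. \<mu> t z * kgen \<gamma> (F t) (\<phi> n) z) \<in> borel_measurable borel" for n
    using weak_int[OF \<phi> t, of n] by auto
  moreover have "(\<lambda>z. kgen \<gamma> (\<lambda>_. 0) (\<phi> n) z) \<in> borel_measurable borel" for n
  proof -
    have s: "smooth (\<phi> n)" by (rule test_fun_smooth[OF \<phi>])
    have [measurable]: "pd (\<phi> n) (j, 0) \<in> borel_measurable borel" "pd (\<phi> n) (0, j) \<in> borel_measurable borel"
      "pd (pd (\<phi> n) (0, j)) (0, j) \<in> borel_measurable borel" if "j \<in> Basis" for j
      using that by (auto intro!: smooth_borel_measurable smooth_pd s)
    have [measurable]: "(\<lambda>z::'d ps. snd z) \<in> borel_measurable borel"
      by (intro borel_measurable_continuous_onI continuous_intros)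
    show ?thesis unfolding kgen_def grad_x_def grad_v_def lap_v_def by measurable
  qed
  ultimately have "(\<lambda>z. (1/\<gamma>) * (\<mu> t z * kgen \<gamma> (F t) (\<phi> n) z - \<mu> t z * kgen \<gamma> (\<lambda>_. 0) (\<phi> n) z)) \<in> borel_measurable borel" for n
    by measurable
  moreover have "(1/\<gamma>) * (\<mu> t z * kgen \<gamma> (F t) (\<phi> n) z - \<mu> t z * kgen \<gamma> (\<lambda>_. 0) (\<phi> n) z) = \<mu> t z * (F t z \<bullet> grad_v (\<phi> n) z)" for n z
    using gam by (simp add: kgen_def algebra_simps)
  ultimately have m: "(\<lambda>z. \<mu> t z * (F t z \<bullet> grad_v (\<phi> n) z)) \<in> borel_measurable borel" for n
    by simp
  show "(\<lambda>z. \<mu> t z *\<^sub>R F t z \<bullet> i) \<in> borel_measurable borel"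
  proof (rule borel_measurable_LIMSEQ_real[OF _ m])
    fix z :: "'d ps"
    have lim0: "(\<lambda>n. a / real (Suc n)) \<longlonglongrightarrow> 0" for a
      using tendsto_mult_right_zero[OF lim_1_over_n[THEN LIMSEQ_Suc], of a] by simp
    have "isCont (expinv n) 1" for n using DERIV_isCont[OF expinv_deriv] .
    moreover have "(\<lambda>n. 1 - (1 + (norm z)\<^sup>2)\<^sup>2 / real (Suc n)) \<longlonglongrightarrow> 1"
      using tendsto_diff[OF tendsto_const[of 1] lim0] by simp
    ultimately have E: "(\<lambda>n. expinv m (1 - (1 + (norm z)\<^sup>2)\<^sup>2 / real (Suc n))) \<longlonglongrightarrow> expinv m 1" for m
      using isCont_tendsto_compose by blast
    have c1: "(\<lambda>n. cutoff (real (Suc n)) z) \<longlonglongrightarrow> 1"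
      using tendsto_mult_left[OF E[of 0], of "exp 1"] by (simp add: cutoff_def expinv_def exp_add[symmetric])
    have c2: "(\<lambda>n. cutA (real (Suc n)) z) \<longlonglongrightarrow> 0"
      using tendsto_mult[OF tendsto_minus[OF lim0[of "4 * exp 1"]] tendsto_mult_right[OF E[of 2], of "1 + (norm z)\<^sup>2"]]
      by (simp add: cutA_def)
    have "(\<lambda>n. \<mu> t z * (F t z \<bullet> grad_v (\<phi> n) z)) \<longlonglongrightarrow> \<mu> t z * (F t z \<bullet> (1 *\<^sub>R i + ((snd z \<bullet> i) * 0) *\<^sub>R snd z))"
      unfolding gv by (intro tendsto_intros c1 c2)
    then show "(\<lambda>n. \<mu> t z * (F t z \<bullet> grad_v (\<phi> n) z)) \<longlonglongrightarrow> \<mu> t z *\<^sub>R F t z \<bullet> i" by simp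
  qed
qed

end

section \<open>The mollified entropy inequality\<close>

locale kinetic_mollified = kinetic \<gamma> c c0 T \<mu> F
  for \<gamma> c c0 T :: real and \<mu> :: "real \<Rightarrow> 'a::finite ps \<Rightarrow> real" and F :: "real \<Rightarrow> 'a ps \<Rightarrow> real^'a" +
  fixes M s :: real and k :: "'a ps \<Rightarrow> real"
  assumes mom: "\<And>t. t \<in> {0..T} \<Longrightarrow> integrable lborel (\<lambda>z. (1 + norm z)^4 * \<mu> t z)"
      "\<And>t. t \<in> {0..T} \<Longrightarrow> (\<integral>z. (1 + norm z)^4 * \<mu> t z \<partial>lborel) \<le> M"
    and k: "test_fun k" and k0: "\<And>z. 0 \<le> k z" and k1: "(\<integral>z. k z \<partial>lborel) = 1"
    and ks: "\<And>z. k z \<noteq> 0 \<Longrightarrow> norm (fst z) \<le> 1 \<and> norm (snd z) \<le> s"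
    and s: "0 < s" "s \<le> 1/2" "\<gamma>\<^sup>2 * s * (1 + (\<Sum>i\<in>Basis. \<integral>z. \<bar>pd k (i, 0) z\<bar> \<partial>lborel)) \<le> 1"
begin

lemma snap: "t \<in> {0..T} \<Longrightarrow> snapshot \<gamma> c c0 s M (\<mu> t) (F t) k"
  by unfold_locales (use gam cc mu Fb mom force_measurable k k0 k1 ks s in auto)

abbreviation "ft \<equiv> \<lambda>t. cv (\<mu> t) k"
abbreviation "Ht \<equiv> \<lambda>t. fluxH k (\<mu> t)"
abbreviation "rt \<equiv> \<lambda>t. rate \<gamma> (F t) k (\<mu> t)"

text \<open>Bounds uniform in time, pointwise and in weighted L1. The pointwise ones feed the chain
  rule at single points, the weighted ones the exchange of time and space integrals.\<close>

definition unif_wint :: "(real \<Rightarrow> 'a ps \<Rightarrow> 'b::euclidean_space) \<Rightarrow> bool" where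
  "unif_wint g \<longleftrightarrow> (\<forall>t\<in>{0..T}. wint (g t)) \<and>
     (\<exists>C. \<forall>t\<in>{0..T}. (\<forall>z. norm (g t z) \<le> C) \<and> (\<integral>z. wt z * norm (g t z) \<partial>lborel) \<le> C)"

lemma unif_wint_wint: "unif_wint g \<Longrightarrow> t \<in> {0..T} \<Longrightarrow> wint (g t)" by (simp add: unif_wint_def)

lemma unif_wint_E:
  assumes "unif_wint g"
  obtains C where "\<And>t z. t \<in> {0..T} \<Longrightarrow> norm (g t z) \<le> C"
    "\<And>t. t \<in> {0..T} \<Longrightarrow> (\<integral>z. wt z * norm (g t z) \<partial>lborel) \<le> C"
  using assms unfolding unif_wint_def by blast

lemma unif_wint_cong:
  assumes "unif_wint g" "\<And>t. t \<in> {0..T} \<Longrightarrow> g' t = g t" shows "unif_wint g'"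
  using assms by (simp add: unif_wint_def)

lemma unif_wint_add:
  assumes "unif_wint g" "unif_wint g'" shows "unif_wint (\<lambda>t z. g t z + g' t z)"
proof -
  obtain C where Cs: "\<And>t z. t \<in> {0..T} \<Longrightarrow> norm (g t z) \<le> C" "\<And>t. t \<in> {0..T} \<Longrightarrow> (\<integral>z. wt z * norm (g t z) \<partial>lborel) \<le> C"
    using unif_wint_E[OF assms(1)] by blast
  obtain C' where C2: "\<And>t z. t \<in> {0..T} \<Longrightarrow> norm (g' t z) \<le> C'" "\<And>t. t \<in> {0..T} \<Longrightarrow> (\<integral>z. wt z * norm (g' t z) \<partial>lborel) \<le> C'"
    using unif_wint_E[OF assms(2)] by blast
  note C = Cs C2
  have w: "wint (g t)" "wint (g' t)" "wint (\<lambda>z. g t z + g' t z)" if "t \<in> {0..T}" for t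
    using unif_wint_wint[OF assms(1) that] unif_wint_wint[OF assms(2) that] wint_add by blast+
  have "norm (g t z + g' t z) \<le> C + C' \<and> (\<integral>z. wt z * norm (g t z + g' t z) \<partial>lborel) \<le> C + C'" if t: "t \<in> {0..T}" for t z
  proof
    show "norm (g t z + g' t z) \<le> C + C'" using C(1,3)[OF t] by (rule norm_triangle_mono)
    have "(\<integral>z. wt z * norm (g t z + g' t z) \<partial>lborel) \<le> (\<integral>z. wt z * norm (g t z) + wt z * norm (g' t z) \<partial>lborel)"
    proof (rule integral_mono)
      show "wt z * norm (g t z + g' t z) \<le> wt z * norm (g t z) + wt z * norm (g' t z)" for z
        using mult_left_mono[OF norm_triangle_ineq[of "g t z" "g' t z"] wt_nonneg[of z]] by (simp add: distrib_left)
    qed (use w[OF t] in \<open>auto simp: wint_def\<close>)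
    also have "\<dots> = (\<integral>z. wt z * norm (g t z) \<partial>lborel) + (\<integral>z. wt z * norm (g' t z) \<partial>lborel)"
      using w[OF t] by (intro Bochner_Integration.integral_add) (auto simp: wint_def)
    finally show "(\<integral>z. wt z * norm (g t z + g' t z) \<partial>lborel) \<le> C + C'" using C(2,4)[OF t] by linarith
  qed
  then show ?thesis using w unfolding unif_wint_def by blast
qed

lemma unif_wint_le:
  fixes g :: "real \<Rightarrow> 'a ps \<Rightarrow> 'b::euclidean_space" and g' :: "real \<Rightarrow> 'a ps \<Rightarrow> 'c::euclidean_space"
  assumes g: "unif_wint g" and m: "\<And>t. t \<in> {0..T} \<Longrightarrow> g' t \<in> borel_measurable borel"
    and le: "\<And>t z. t \<in> {0..T} \<Longrightarrow> norm (g' t z) \<le> c' * norm (g t z)" and c': "0 \<le> c'"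
  shows "unif_wint g'"
proof -
  obtain C where C: "\<And>t z. t \<in> {0..T} \<Longrightarrow> norm (g t z) \<le> C" "\<And>t. t \<in> {0..T} \<Longrightarrow> (\<integral>z. wt z * norm (g t z) \<partial>lborel) \<le> C"
    using unif_wint_E[OF g] by blast
  have w: "wint (g t)" "wint (g' t)" if t: "t \<in> {0..T}" for t
    using unif_wint_wint[OF g t] wint_le[OF unif_wint_wint[OF g t] m[OF t] le[OF t]] by blast+
  have "norm (g' t z) \<le> c' * C \<and> (\<integral>z. wt z * norm (g' t z) \<partial>lborel) \<le> c' * C" if t: "t \<in> {0..T}" for t z
  proof
    show "norm (g' t z) \<le> c' * C" using le[OF t, of z] mult_left_mono[OF C(1)[OF t, of z] c'] by linarith
    have "(\<integral>z. wt z * norm (g' t z) \<partial>lborel) \<le> (\<integral>z. c' * (wt z * norm (g t z)) \<partial>lborel)"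
    proof (rule integral_mono)
      show "wt z * norm (g' t z) \<le> c' * (wt z * norm (g t z))" for z
        using mult_left_mono[OF le[OF t, of z] wt_nonneg[of z]] by (simp add: mult_ac)
    qed (use w[OF t] in \<open>auto simp: wint_def\<close>)
    also have "\<dots> \<le> c' * C" using mult_left_mono[OF C(2)[OF t] c'] by simp
    finally show "(\<integral>z. wt z * norm (g' t z) \<partial>lborel) \<le> c' * C" .
  qed
  then show ?thesis using w unfolding unif_wint_def by blast
qed

lemma unif_wint_scale:
  fixes g :: "real \<Rightarrow> 'a ps \<Rightarrow> real"
  assumes "unif_wint g" shows "unif_wint (\<lambda>t z. c' * g t z)"
proof (rule unif_wint_le[OF assms, where c'="\<bar>c'\<bar>"])
  show "(\<lambda>z. c' * g t z) \<in> borel_measurable borel" if "t \<in> {0..T}" for t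
    using wint_measurable[OF unif_wint_wint[OF assms that]] by measurable
qed (auto simp: abs_mult)

lemma unif_wint_sum:
  fixes g :: "'i \<Rightarrow> real \<Rightarrow> 'a ps \<Rightarrow> 'b::euclidean_space"
  assumes "\<And>i. i \<in> I \<Longrightarrow> unif_wint (g i)" shows "unif_wint (\<lambda>t z. \<Sum>i\<in>I. g i t z)"
  using assms
proof (induction I rule: infinite_finite_induct)
  case (insert i I)
  then have "unif_wint (\<lambda>t z. g i t z + (\<Sum>i\<in>I. g i t z))" by (intro unif_wint_add) auto
  then show ?case using insert by simp
qed (auto simp: unif_wint_def wint_def)

text \<open>The sources are dominated by (1 + |z|) times the density, so the cubic weight meets the
  fourth moment, whose bound M does not depend on time.\<close>

lemma unif_wint_cv:
  fixes \<sigma> :: "real \<Rightarrow> 'a ps \<Rightarrow> 'b::euclidean_space"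
  assumes m: "\<And>t. t \<in> {0..T} \<Longrightarrow> \<sigma> t \<in> borel_measurable borel"
    and b: "\<And>t z. t \<in> {0..T} \<Longrightarrow> norm (\<sigma> t z) \<le> Cs * ((1 + norm z) * \<mu> t z)" and Cs: "0 \<le> Cs"
    and k': "test_fun k'" and supp: "\<And>z. norm z > 2 \<Longrightarrow> k' z = 0"
  shows "unif_wint (\<lambda>t. cv (\<sigma> t) k')"
proof -
  obtain Ck where Ck: "Ck > 0" "\<And>z. \<bar>k' z\<bar> \<le> Ck" using test_fun_bounded[OF k'] by metis
  define Ik where "Ik = (\<integral>z. \<bar>k' z\<bar> \<partial>lborel)"
  have Ik: "0 \<le> Ik" by (simp add: Ik_def)
  have w: "wint (\<sigma> t)" if t: "t \<in> {0..T}" for t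
    using snapshot.wint_dom(1)[OF snap[OF t] m[OF t] b[OF t]] .
  have ws: "(\<integral>z. wt z * norm (\<sigma> t z) \<partial>lborel) \<le> Cs * M" if t: "t \<in> {0..T}" for t
    using snapshot.wint_dom(2)[OF snap[OF t] m[OF t] b[OF t]] mult_left_mono[OF mom(2)[OF t] Cs] by linarith
  have "0 \<in> {0..T}" using T by simp
  have "norm (cv (\<sigma> t) k' z) \<le> Ck * (Cs * M) + 27 * Ik * (Cs * M) \<and> (\<integral>z. wt z * norm (cv (\<sigma> t) k' z) \<partial>lborel) \<le> Ck * (Cs * M) + 27 * Ik * (Cs * M)"
    if t: "t \<in> {0..T}" for t z
  proof -
    have CM: "0 \<le> Cs * M"
    proof -
      have "0 \<le> (\<integral>z. wt z * norm (\<sigma> t z) \<partial>lborel)" by (intro Bochner_Integration.integral_nonneg mult_nonneg_nonneg wt_nonneg norm_ge_zero)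
      then show ?thesis using ws[OF t] by linarith
    qed
    have "norm (cv (\<sigma> t) k' z) \<le> Ck * (\<integral>z. norm (\<sigma> t z) \<partial>lborel)"
      by (rule cv_bounded[OF wint_integrable[OF w[OF t]] k' Ck(2)])
    also have "\<dots> \<le> Ck * (\<integral>z. wt z * norm (\<sigma> t z) \<partial>lborel)"
    proof (intro mult_left_mono integral_mono)
      show "norm (\<sigma> t z) \<le> wt z * norm (\<sigma> t z)" for z using mult_right_mono[OF wt_ge1[of z] norm_ge_zero[of "\<sigma> t z"]] by simp
    qed (use w[OF t] wint_integrable[OF w[OF t]] Ck in \<open>auto simp: wint_def\<close>)
    also have "\<dots> \<le> Ck * (Cs * M)" using ws[OF t] Ck by (intro mult_left_mono) auto
    finally have 1: "norm (cv (\<sigma> t) k' z) \<le> Ck * (Cs * M)" .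
    have "(\<integral>z. wt z * norm (cv (\<sigma> t) k' z) \<partial>lborel) \<le> 27 * Ik * (\<integral>z. wt z * norm (\<sigma> t z) \<partial>lborel)"
      using wint_cv(2)[OF w[OF t] k' supp] by (simp add: Ik_def)
    also have "\<dots> \<le> 27 * Ik * (Cs * M)" using ws[OF t] Ik by (intro mult_left_mono) auto
    finally have 2: "(\<integral>z. wt z * norm (cv (\<sigma> t) k' z) \<partial>lborel) \<le> 27 * Ik * (Cs * M)" .
    have "0 \<le> Ck * (Cs * M)" "0 \<le> 27 * Ik * (Cs * M)" using CM Ck Ik by auto
    with 1 2 show ?thesis by linarith
  qed
  then show ?thesis using wint_cv(1)[OF w k' supp] unfolding unif_wint_def by blast
qed

lemma k_supp: "norm z > 2 \<Longrightarrow> k z = 0"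
  using ks[of z] s norm_Pair_le[of "fst z" "snd z"] by (cases "k z = 0") auto
lemma pdk_supp: "norm z > 2 \<Longrightarrow> pd k e z = 0"
  by (rule pd_zero_outside[OF k_supp])

lemma unif_wint_mu: assumes "test_fun k'" "\<And>z. norm z > 2 \<Longrightarrow> k' z = 0" shows "unif_wint (\<lambda>t. cv (\<mu> t) k')"
proof (rule unif_wint_cv[OF _ _ _ assms, where Cs=1])
  show "norm (\<mu> t z) \<le> 1 * ((1 + norm z) * \<mu> t z)" if t: "t \<in> {0..T}" for t z
    using mult_right_mono[of 1 "1 + norm z" "\<mu> t z"] mu(2)[OF t, of z] by simp
qed (auto intro: mu)

lemma unif_wint_mu_inner:
  assumes "i \<in> Basis" "test_fun k'" "\<And>z. norm z > 2 \<Longrightarrow> k' z = 0"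
  shows "unif_wint (\<lambda>t. cv (\<lambda>y. \<mu> t y * (snd y \<bullet> i)) k')"
proof (rule unif_wint_cv[OF _ _ _ assms(2,3), where Cs=1])
  fix t assume t: "t \<in> {0..T}"
  show "(\<lambda>y. \<mu> t y * (snd y \<bullet> i)) \<in> borel_measurable borel"
    by (rule wint_measurable[OF snapshot.wsAi[OF snap[OF t]]])
  show "norm (\<mu> t z * (snd z \<bullet> i)) \<le> 1 * ((1 + norm z) * \<mu> t z)" for z
    using mult_right_mono[of "\<bar>snd z \<bullet> i\<bar>" "1 + norm z" "\<mu> t z"] mu(2)[OF t, of z] Basis_le_norm[OF assms(1), of "snd z"] norm_snd_le'[of z]
    by (simp add: abs_mult mult.commute)
qed simp

lemma unif_wint_force_inner:
  assumes "i \<in> Basis" "test_fun k'" "\<And>z. norm z > 2 \<Longrightarrow> k' z = 0"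
  shows "unif_wint (\<lambda>t. cv (\<lambda>y. \<mu> t y * (F t y \<bullet> i)) k')"
proof (rule unif_wint_cv[OF _ _ _ assms(2,3), where Cs="c + c0"])
  fix t assume t: "t \<in> {0..T}"
  show "(\<lambda>y. \<mu> t y * (F t y \<bullet> i)) \<in> borel_measurable borel"
    by (rule wint_measurable[OF snapshot.wsBi[OF snap[OF t]]])
  show "norm (\<mu> t z * (F t z \<bullet> i)) \<le> (c + c0) * ((1 + norm z) * \<mu> t z)" for z
  proof -
    have "\<bar>F t z \<bullet> i\<bar> \<le> norm (F t z)" by (rule Basis_le_norm[OF assms(1)])
    from mult_left_mono[OF this mu(2)[OF t, of z]] show ?thesis
      using snapshot.sB_bound[OF snap[OF t], of z] mu(2)[OF t, of z] by (simp add: abs_mult)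
  qed
qed (use cc in simp)

lemma unif_wint_f: "unif_wint ft" by (rule unif_wint_mu[OF k k_supp])

lemma unif_wint_rate: "unif_wint rt"
proof -
  have "unif_wint (\<lambda>t z. \<Sum>i\<in>Basis. - \<gamma> * cv (\<lambda>y. \<mu> t y * (snd y \<bullet> i)) (pd k (i, 0)) z
     + (- \<gamma>) * cv (\<lambda>y. \<mu> t y * (F t y \<bullet> i)) (pd k (0, i)) z
     + \<gamma>\<^sup>2 * (cv (\<mu> t) (pd (pd k (0, i)) (0, i)) z + cv (\<lambda>y. \<mu> t y * (snd y \<bullet> i)) (pd k (0, i)) z))"
    by (intro unif_wint_sum unif_wint_add unif_wint_scale unif_wint_mu unif_wint_mu_inner unif_wint_force_inner test_fun_pd k pdk_supp pd_zero_outside[OF pdk_supp]) auto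
  then show ?thesis
  proof (rule unif_wint_cong)
    fix t assume t: "t \<in> {0..T}"
    show "rt t = (\<lambda>z. \<Sum>i\<in>Basis. - \<gamma> * cv (\<lambda>y. \<mu> t y * (snd y \<bullet> i)) (pd k (i, 0)) z
     + (- \<gamma>) * cv (\<lambda>y. \<mu> t y * (F t y \<bullet> i)) (pd k (0, i)) z
     + \<gamma>\<^sup>2 * (cv (\<mu> t) (pd (pd k (0, i)) (0, i)) z + cv (\<lambda>y. \<mu> t y * (snd y \<bullet> i)) (pd k (0, i)) z))"
      by (rule ext) (simp add: snapshot.rate_eq[OF snap[OF t]])
  qed
qed

lemma unif_wint_H: "unif_wint Ht"
  unfolding fluxH_def[abs_def]
proof (intro unif_wint_add unif_wint_sum)
  fix i :: "real^'a" assume i: "i \<in> Basis"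
  have u: "unif_wint (\<lambda>t. cv (\<mu> t) (pd k (0, i)))" using i by (intro unif_wint_mu test_fun_pd k pdk_supp) auto
  show "unif_wint (\<lambda>t z. cv (\<mu> t) (pd k (0, i)) z *\<^sub>R i)"
  proof (rule unif_wint_le[OF u, where c'=1])
    fix t assume "t \<in> {0..T}"
    then have "cv (\<mu> t) (pd k (0, i)) \<in> borel_measurable borel" using u wint_measurable unfolding unif_wint_def by blast
    then show "(\<lambda>z. cv (\<mu> t) (pd k (0, i)) z *\<^sub>R i) \<in> borel_measurable borel" by measurable
  qed (use i in auto)
next
  show "unif_wint (\<lambda>t. cv (\<lambda>y. \<mu> t y *\<^sub>R snd y) k)"
    by (rule unif_wint_cv[where Cs=1, OF _ _ _ k k_supp])
      (use snapshot.sA_measurable[OF snap] snapshot.sA_bound[OF snap] in auto)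
qed

section \<open>Joint measurability and evolution of the mollified density\<close>

lemma test_pairing_continuous:
  assumes "test_fun \<phi>" shows "continuous_on {0..T} (\<lambda>t. \<integral>z. \<phi> z * \<mu> t z \<partial>lborel)"
proof -
  note w = weak_time[OF assms]
  have "continuous_on {0..T} (\<lambda>t. (\<integral>z. \<phi> z * \<mu> 0 z \<partial>lborel) + integral {0..t} (\<lambda>r. \<integral>z. \<mu> r z * kgen \<gamma> (F r) \<phi> z \<partial>lborel))"
    by (intro continuous_on_add continuous_on_const indefinite_integral_continuous_1 set_borel_integral_eq_integral(1) w)
  moreover have "(\<integral>z. \<phi> z * \<mu> t z \<partial>lborel) = (\<integral>z. \<phi> z * \<mu> 0 z \<partial>lborel) + integral {0..t} (\<lambda>r. \<integral>z. \<mu> r z * kgen \<gamma> (F r) \<phi> z \<partial>lborel)"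
    if "t \<in> {0..T}" for t
    using weak[OF assms that] integral_initial_eq[OF w, of t] that by simp
  ultimately show ?thesis using continuous_on_cong[OF refl] by (metis (no_types, lifting))
qed

text \<open>Truncation to [0,T] is built in because nothing is assumed at other times, while the
  product measure refers to the whole time line.\<close>

definition joint_meas :: "(real \<Rightarrow> 'a ps \<Rightarrow> 'b::euclidean_space) \<Rightarrow> bool" where
  "joint_meas g \<longleftrightarrow> (\<lambda>p. indicator {0..T} (fst p) *\<^sub>R g (fst p) (snd p)) \<in> borel_measurable (lborel \<Otimes>\<^sub>M lborel)"

lemma joint_meas_I:
  fixes g :: "real \<Rightarrow> 'a ps \<Rightarrow> real"
  assumes m: "\<And>z. (\<lambda>r. indicator {0..T} r *\<^sub>R g r z) \<in> borel_measurable lborel"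
    and c: "\<And>r. r \<in> {0..T} \<Longrightarrow> continuous_on UNIV (g r)"
  shows "joint_meas g"
proof -
  have "(\<lambda>(r, z). indicator {0..T} r *\<^sub>R g r z) \<in> borel_measurable (lborel \<Otimes>\<^sub>M borel)"
  proof (rule Caratheodory_measurable[OF m])
    show "continuous_on UNIV (\<lambda>z. indicator {0..T} r *\<^sub>R g r z)" for r
      using c[of r] by (cases "r \<in> {0..T}") auto
  qed
  moreover have "sets (lborel \<Otimes>\<^sub>M (borel :: 'a ps measure)) = sets (lborel \<Otimes>\<^sub>M (lborel :: 'a ps measure))"
    by (intro sets_pair_measure_cong) auto
  ultimately show ?thesis unfolding joint_meas_def case_prod_unfold by (simp cong: measurable_cong_sets)
qed

lemma joint_meas_cv:
  fixes \<sigma> :: "real \<Rightarrow> 'a ps \<Rightarrow> real"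
  assumes "\<And>t z. t \<in> {0..T} \<Longrightarrow> g t z = (\<integral>y. \<phi> z y * \<mu> t y \<partial>lborel)" "\<And>z. test_fun (\<phi> z)"
    and c: "\<And>t. t \<in> {0..T} \<Longrightarrow> continuous_on UNIV (g t)"
  shows "joint_meas g"
proof (rule joint_meas_I[OF _ c])
  fix z
  have "(\<lambda>r. indicator {0..T} r *\<^sub>R (\<integral>y. \<phi> z y * \<mu> r y \<partial>lborel)) \<in> borel_measurable borel"
    by (rule borel_measurable_continuous_on_indicator[OF _ test_pairing_continuous[OF assms(2)]]) simp
  moreover have "(\<lambda>r. indicator {0..T} r *\<^sub>R (\<integral>y. \<phi> z y * \<mu> r y \<partial>lborel)) = (\<lambda>r. indicator {0..T} r *\<^sub>R g r z)"
  proof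
    show "indicator {0..T} r *\<^sub>R (\<integral>y. \<phi> z y * \<mu> r y \<partial>lborel) = indicator {0..T} r *\<^sub>R g r z" for r
      using assms(1)[of r z] by (cases "r \<in> {0..T}") auto
  qed
  ultimately show "(\<lambda>r. indicator {0..T} r *\<^sub>R g r z) \<in> borel_measurable lborel" by simp
qed

lemma joint_meas_f: "joint_meas ft"
proof (rule joint_meas_cv[where \<phi>="\<lambda>z y. k (z - y)"])
  show "cv (\<mu> t) k z = (\<integral>y. k (z - y) * \<mu> t y \<partial>lborel)" for t z by (simp add: cv_def)
  show "continuous_on UNIV (cv (\<mu> t) k)" if "t \<in> {0..T}" for t by (rule cv_continuous[OF mu(3)[OF that] k])
qed (rule test_fun_reflect[OF k])

lemma H_inner:
  assumes t: "t \<in> {0..T}" and i: "i \<in> Basis"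
  shows "Ht t z \<bullet> i = (\<integral>y. (pd k (0, i) (z - y) + (snd y \<bullet> i) * k (z - y)) * \<mu> t y \<partial>lborel)"
    and "continuous_on UNIV (\<lambda>z. Ht t z \<bullet> i)"
proof -
  interpret sn: snapshot \<gamma> c c0 s M "\<mu> t" "F t" k by (rule snap[OF t])
  have tp: "test_fun (pd k (0, i))" using i by (intro test_fun_pd k) simp
  have e: "Ht t z \<bullet> i = cv (\<mu> t) (pd k (0, i)) z + cv (\<lambda>y. \<mu> t y * (snd y \<bullet> i)) k z" for z
    using i sn.A_inner by (simp add: fluxH_def inner_add_left inner_sum_left_Basis)
  have i1: "integrable lborel (\<lambda>y. pd k (0, i) (z - y) * \<mu> t y)" using cv_test_integrable[OF mu(3)[OF t] tp] by simp
  have i2: "integrable lborel (\<lambda>y. k (z - y) * (\<mu> t y * (snd y \<bullet> i)))" using cv_test_integrable[OF wint_integrable[OF sn.wsAi] k] by simp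
  show "Ht t z \<bullet> i = (\<integral>y. (pd k (0, i) (z - y) + (snd y \<bullet> i) * k (z - y)) * \<mu> t y \<partial>lborel)"
    unfolding e cv_def real_scaleR_def Bochner_Integration.integral_add[OF i1 i2, symmetric] by (simp add: algebra_simps)
  show "continuous_on UNIV (\<lambda>z. Ht t z \<bullet> i)"
    unfolding e by (intro continuous_on_add cv_continuous mu(3)[OF t] tp wint_integrable sn.wsAi k)
qed

text \<open>Each component of the flux at a point is the pairing of the density with one test
  function, hence continuous in time by the weak equation.\<close>

lemma joint_meas_H: "joint_meas Ht"
  unfolding joint_meas_def
proof (subst borel_measurable_euclidean_space, rule ballI)
  fix i :: "real^'a" assume i: "i \<in> Basis"
  have "joint_meas (\<lambda>t z. Ht t z \<bullet> i)"
  proof (rule joint_meas_cv[where \<phi>="\<lambda>z y. pd k (0, i) (z - y) + (snd y \<bullet> i) * k (z - y)"])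
    show "test_fun (\<lambda>y. pd k (0, i) (z - y) + (snd y \<bullet> i) * k (z - y))" for z
    proof (rule test_funI[where R="2 + norm z"])
      have sl: "smooth (\<lambda>z :: 'a ps. snd z \<bullet> i)"
        by (rule smooth_linear) (rule bounded_linear_compose[OF bounded_linear_inner_left bounded_linear_snd])
      show "smooth (\<lambda>y. pd k (0, i) (z - y) + (snd y \<bullet> i) * k (z - y))"
        by (intro smooth_add smooth_mult sl smooth_reflect smooth_pd test_fun_smooth k) (use i in simp)
      show "pd k (0, i) (z - y) + (snd y \<bullet> i) * k (z - y) = 0" if "2 + norm z < norm y" for y
      proof -
        have "norm (z - y) > 2" using that norm_triangle_sub[of y z] norm_minus_commute[of y z] by linarith
        then show ?thesis using k_supp pdk_supp by simp
      qed
    qed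
  qed (use H_inner i in auto)
  then show "(\<lambda>p. indicator {0..T} (fst p) *\<^sub>R Ht (fst p) (snd p) \<bullet> i) \<in> borel_measurable (lborel \<Otimes>\<^sub>M lborel)"
    by (simp add: joint_meas_def)
qed

lemma rate_as_pairing: "rt t z = (\<integral>y. \<mu> t y * kgen \<gamma> (F t) (\<lambda>w. k (z - w)) y \<partial>lborel)"
  by (simp add: rate_def)

lemma rate_continuous:
  assumes t: "t \<in> {0..T}" shows "continuous_on UNIV (rt t)"
proof -
  interpret sn: snapshot \<gamma> c c0 s M "\<mu> t" "F t" k by (rule snap[OF t])
  show ?thesis unfolding sn.rate_eq[abs_def]
    by (intro continuous_intros cv_continuous wint_integrable sn.wsAi sn.wsBi sn.wrho test_fun_pd k) auto
qed

text \<open>No continuity in time of the force is known. Measurability in time at fixed z is read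
  off from the weak formulation tested with the kernel centred at z, and continuity in z comes from
  the convolution.\<close>

lemma joint_meas_rate: "joint_meas rt"
proof (rule joint_meas_I[OF _ rate_continuous])
  fix z
  have "set_integrable lborel {0..T} (\<lambda>r. rt r z)"
    unfolding rate_as_pairing by (rule weak_time[OF test_fun_reflect[OF k]])
  then show "(\<lambda>r. indicator {0..T} r *\<^sub>R rt r z) \<in> borel_measurable lborel"
    unfolding set_integrable_def by auto
qed

text \<open>Testing with the kernel centred at z makes the weak equation an integral equation in
  time at each single point, to which a chain rule for real paths can be applied.\<close>

lemma f_evolution:
  assumes t: "t \<in> {0..T}"
  shows "ft t z = ft 0 z + (LINT r:{0..t}|lborel. rt r z)"
  using weak[OF test_fun_reflect[OF k] t, of z] by (simp add: cv_def rate_def)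

lemma time_space_integrable:
  fixes q :: "real \<Rightarrow> 'a ps \<Rightarrow> real"
  assumes J: "joint_meas q" and i: "\<And>r. r \<in> {0..T} \<Longrightarrow> integrable lborel (q r)"
    and b: "\<And>r. r \<in> {0..T} \<Longrightarrow> (\<integral>z. \<bar>q r z\<bar> \<partial>lborel) \<le> C"
  shows "integrable (lborel \<Otimes>\<^sub>M lborel) (\<lambda>p. indicator {0..T} (fst p) * q (fst p) (snd p))"
    and "set_integrable lborel {0..T} (\<lambda>r. \<integral>z. q r z \<partial>lborel)"
proof -
  note Jm = J[unfolded joint_meas_def real_scaleR_def]
  show int: "integrable (lborel \<Otimes>\<^sub>M lborel) (\<lambda>p. indicator {0..T} (fst p) * q (fst p) (snd p))"
  proof (rule lborel_pair.Fubini_integrable[OF Jm])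
    show "AE r in lborel. integrable lborel (\<lambda>z. indicator {0..T} (fst (r, z)) * q (fst (r, z)) (snd (r, z)))"
      using i by (auto simp: indicator_def)
    show "integrable lborel (\<lambda>r. \<integral>z. norm (indicator {0..T} (fst (r, z)) * q (fst (r, z)) (snd (r, z))) \<partial>lborel)"
    proof (rule integrable_le)
      have "integrable lborel (indicator {0..T} :: real \<Rightarrow> real)" by (rule integrable_real_indicator) (use T in auto)
      then show "integrable lborel (\<lambda>r. indicator {0..T} r * C)" by simp
      show "(\<lambda>r. \<integral>z. norm (indicator {0..T} (fst (r, z)) * q (fst (r, z)) (snd (r, z))) \<partial>lborel) \<in> borel_measurable lborel"
        by (rule lborel.borel_measurable_lebesgue_integral) (use Jm in \<open>simp add: case_prod_unfold\<close>)
      show "norm (\<integral>z. norm (indicator {0..T} (fst (r, z)) * q (fst (r, z)) (snd (r, z))) \<partial>lborel) \<le> indicator {0..T} r * C" for r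
        using b[of r] by (auto simp: indicator_def)
    qed
  qed
  from lborel_pair.integrable_fst'[OF int]
  show "set_integrable lborel {0..T} (\<lambda>r. \<integral>z. q r z \<partial>lborel)"
    unfolding set_integrable_def by simp
qed

end

text \<open>The growth rate: 1 + 20 c^2 is the coefficient of the potential in the dissipation
  estimate, and 2 is the price of bounding the potential by the entropy.\<close>

definition lamK :: "real \<Rightarrow> real" where "lamK c = 2 * (1 + 20 * c\<^sup>2)"

lemma Ureg_deriv:
  assumes "0 \<le> s" "0 < \<kappa>" shows "(Ureg \<kappa> has_real_derivative (ln (s + \<kappa>) + 1)) (at s)"
  unfolding Ureg_def[abs_def] using assms by (auto intro!: derivative_eq_intros)

lemma ln_shift_Lipschitz:
  fixes \<kappa> x y :: real
  assumes "0 < \<kappa>" "0 \<le> x" "0 \<le> y" shows "\<bar>ln (x + \<kappa>) - ln (y + \<kappa>)\<bar> \<le> (1 / \<kappa>) * \<bar>x - y\<bar>"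
proof -
  have le: "ln (x + \<kappa>) - ln (y + \<kappa>) \<le> (1 / \<kappa>) * \<bar>x - y\<bar>" if "0 \<le> x" "0 \<le> y" for x y
  proof -
    have "ln (x + \<kappa>) - ln (y + \<kappa>) = ln ((x + \<kappa>) / (y + \<kappa>))" using assms(1) that by (simp add: ln_div)
    also have "\<dots> \<le> (x + \<kappa>) / (y + \<kappa>) - 1" using assms(1) that by (intro ln_le_minus_one) auto
    also have "\<dots> = (x - y) / (y + \<kappa>)"
    proof -
      have "y + \<kappa> \<noteq> 0" using assms(1) that by simp
      then show ?thesis by (simp add: field_simps)
    qed
    also have "\<dots> \<le> \<bar>x - y\<bar> / \<kappa>" using assms(1) that by (intro frac_le) auto
    finally show ?thesis by simp
  qed
  show ?thesis using le[OF assms(2,3)] le[OF assms(3,2)] by (simp add: abs_minus_commute abs_le_iff)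
qed

section \<open>Entropy balance of the mollified density\<close>

context kinetic_mollified begin

abbreviation "bb (z :: 'a ps) \<equiv> c * (2 + norm (fst z)) + c0"

text \<open>The constant part of the dissipation estimate, plus the Gaussian term that remains when
  the potential is bounded by the entropy. Neither involves \<gamma>, the kernel or the
  shift.\<close>

definition betaK :: real where
  "betaK = CARD('a) + 5/2 + 5 * (2*c + c0)\<^sup>2 + lamK c * gaussC TYPE('a)"

text \<open>The shifted relative entropy. The additive constant is minus the logarithm of the
  normalisation of the Gaussian, times the unit mass.\<close>

definition Yk :: "real \<Rightarrow> real \<Rightarrow> real" where
  "Yk \<kappa> t = (\<integral>z. Ureg \<kappa> (ft t z) + hpot \<gamma> z * ft t z \<partial>lborel) + CARD('a) * ln (2 * pi)"
definition Dk :: "real \<Rightarrow> real \<Rightarrow> real" where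
  "Dk \<kappa> t = (\<integral>z. (norm (Ht t z))\<^sup>2 / (ft t z + \<kappa>) \<partial>lborel)"
definition errd :: "real \<Rightarrow> 'a ps \<Rightarrow> real" where
  "errd t z = \<gamma>\<^sup>2 * norm (snd z) * norm (Ht t z) + \<gamma> * bb z * norm (snd z) * ft t z"
definition Ek :: "real \<Rightarrow> real \<Rightarrow> real" where
  "Ek \<kappa> t = (\<integral>z. \<kappa> * errd t z / (ft t z + \<kappa>) \<partial>lborel)"

lemma f_nonneg: "t \<in> {0..T} \<Longrightarrow> 0 \<le> ft t z"
  by (rule snapshot.f_nonneg[OF snap])

lemma joint_meas_f_m: "(\<lambda>p. indicator {0..T} (fst p) * ft (fst p) (snd p)) \<in> borel_measurable (lborel \<Otimes>\<^sub>M lborel)"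
  using joint_meas_f by (simp add: joint_meas_def)
lemma joint_meas_H_m: "(\<lambda>p. indicator {0..T} (fst p) *\<^sub>R Ht (fst p) (snd p)) \<in> borel_measurable (lborel \<Otimes>\<^sub>M lborel)"
  using joint_meas_H by (simp add: joint_meas_def)
lemma joint_meas_rate_m: "(\<lambda>p. indicator {0..T} (fst p) * rt (fst p) (snd p)) \<in> borel_measurable (lborel \<Otimes>\<^sub>M lborel)"
  using joint_meas_rate by (simp add: joint_meas_def)

lemma hpot_m[measurable]: "(hpot \<gamma> :: 'a ps \<Rightarrow> real) \<in> borel_measurable borel"
  using snapshot.hpot_measurable[OF snap[of 0]] T by simp

lemma fst_snd_m[measurable]: "(\<lambda>z :: 'a ps. fst z) \<in> borel_measurable borel" "(\<lambda>z :: 'a ps. snd z) \<in> borel_measurable borel"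
  by (intro borel_measurable_continuous_onI continuous_intros)+

lemma errd_facts:
  assumes t: "t \<in> {0..T}"
  shows "integrable lborel (errd t)" "0 \<le> errd t z" "ft t z = 0 \<Longrightarrow> errd t z = 0"
    and "\<kappa> > 0 \<Longrightarrow> integrable lborel (\<lambda>z. \<kappa> * errd t z / (ft t z + \<kappa>))"
    and "\<kappa> > 0 \<Longrightarrow> 0 \<le> \<kappa> * errd t z / (ft t z + \<kappa>)" "\<kappa> > 0 \<Longrightarrow> \<kappa> * errd t z / (ft t z + \<kappa>) \<le> errd t z"
proof -
  interpret sn: snapshot \<gamma> c c0 s M "\<mu> t" "F t" k by (rule snap[OF t])
  show "integrable lborel (errd t)" unfolding errd_def[abs_def] by (rule sn.err_dominator_integrable)
  show "0 \<le> errd t z" unfolding errd_def using gam sn.bb_nonneg[of z] f_nonneg[OF t, of z] by (intro add_nonneg_nonneg mult_nonneg_nonneg) (use cc in auto)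
  show "errd t z = 0" if "ft t z = 0" unfolding errd_def using that sn.H_zero by simp
  show "integrable lborel (\<lambda>z. \<kappa> * errd t z / (ft t z + \<kappa>))" "0 \<le> \<kappa> * errd t z / (ft t z + \<kappa>)"
    "\<kappa> * errd t z / (ft t z + \<kappa>) \<le> errd t z" if "\<kappa> > 0"
    unfolding errd_def using sn.err_integrable[OF that] by auto
qed

lemma joint_meas_errd: "joint_meas errd"
proof -
  note [measurable] = joint_meas_f_m joint_meas_H_m
  have "(\<lambda>p. \<gamma>\<^sup>2 * norm (snd (snd p)) * norm (indicator {0..T} (fst p) *\<^sub>R Ht (fst p) (snd p)) + \<gamma> * bb (snd p) * norm (snd (snd p)) * (indicator {0..T} (fst p) * ft (fst p) (snd p)))
    \<in> borel_measurable (lborel \<Otimes>\<^sub>M lborel)" by measurable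
  moreover have "(\<lambda>p. \<gamma>\<^sup>2 * norm (snd (snd p)) * norm (indicator {0..T} (fst p) *\<^sub>R Ht (fst p) (snd p)) + \<gamma> * bb (snd p) * norm (snd (snd p)) * (indicator {0..T} (fst p) * ft (fst p) (snd p)))
    = (\<lambda>p. indicator {0..T} (fst p) *\<^sub>R errd (fst p) (snd p))"
    by (auto simp: indicator_def errd_def)
  ultimately show ?thesis unfolding joint_meas_def by simp
qed

lemma joint_meas_quotient:
  fixes q :: "real \<Rightarrow> 'a ps \<Rightarrow> real"
  assumes "joint_meas q" shows "joint_meas (\<lambda>t z. \<kappa> * q t z / (ft t z + \<kappa>))"
proof -
  note [measurable] = joint_meas_f_m assms[unfolded joint_meas_def real_scaleR_def]
  have "(\<lambda>p. \<kappa> * (indicator {0..T} (fst p) * q (fst p) (snd p)) / (indicator {0..T} (fst p) * ft (fst p) (snd p) + \<kappa>))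
    \<in> borel_measurable (lborel \<Otimes>\<^sub>M lborel)" by measurable
  moreover have "(\<lambda>p. \<kappa> * (indicator {0..T} (fst p) * q (fst p) (snd p)) / (indicator {0..T} (fst p) * ft (fst p) (snd p) + \<kappa>))
    = (\<lambda>p. indicator {0..T} (fst p) *\<^sub>R (\<kappa> * q (fst p) (snd p) / (ft (fst p) (snd p) + \<kappa>)))"
    by (auto simp: indicator_def)
  ultimately show ?thesis unfolding joint_meas_def by simp
qed

lemma errd_bound: "\<exists>C. \<forall>r\<in>{0..T}. (\<integral>z. \<bar>errd r z\<bar> \<partial>lborel) \<le> C"
proof -
  obtain C1 where C1: "\<And>t. t \<in> {0..T} \<Longrightarrow> (\<integral>z. wt z * norm (Ht t z) \<partial>lborel) \<le> C1" using unif_wint_E[OF unif_wint_H] by metis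
  obtain C2 where C2: "\<And>t. t \<in> {0..T} \<Longrightarrow> (\<integral>z. wt z * norm (ft t z) \<partial>lborel) \<le> C2" using unif_wint_E[OF unif_wint_f] by metis
  have "(\<integral>z. \<bar>errd r z\<bar> \<partial>lborel) \<le> \<gamma>\<^sup>2 * C1 + (\<gamma> * (2*c + c0)) * C2" if r: "r \<in> {0..T}" for r
  proof -
    interpret sn: snapshot \<gamma> c c0 s M "\<mu> r" "F r" k by (rule snap[OF r])
    have w: "wint (Ht r)" "wint (ft r)" using unif_wint_wint[OF unif_wint_H r] unif_wint_wint[OF unif_wint_f r] .
    have "(\<integral>z. \<bar>errd r z\<bar> \<partial>lborel) \<le> (\<integral>z. \<gamma>\<^sup>2 * (wt z * norm (Ht r z)) + (\<gamma> * (2*c + c0)) * (wt z * norm (ft r z)) \<partial>lborel)"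
    proof (rule integral_mono)
      show "integrable lborel (\<lambda>z. \<gamma>\<^sup>2 * (wt z * norm (Ht r z)) + (\<gamma> * (2*c + c0)) * (wt z * norm (ft r z)))"
        using w by (intro Bochner_Integration.integrable_add integrable_mult_right) (auto simp: wint_def)
      fix z :: "'a ps"
      have n: "norm (snd z) \<le> wt z" using norm_snd_le'[of z] norm_le_wt(1)[of z] by linarith
      have b: "bb z * norm (snd z) \<le> (2*c + c0) * wt z"
      proof -
        have "bb z * norm (snd z) \<le> ((2*c + c0) * (1 + norm z)) * (1 + norm z)"
          using sn.bb_wt[of z] norm_snd_le'[of z] cc by (intro mult_mono) auto
        also have "\<dots> \<le> (2*c + c0) * wt z"
          using mult_left_mono[OF norm_le_wt(2)[of z], of "2*c + c0"] cc by (simp add: power2_eq_square mult.assoc)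
        finally show ?thesis .
      qed
      have "\<gamma>\<^sup>2 * norm (snd z) * norm (Ht r z) \<le> \<gamma>\<^sup>2 * (wt z * norm (Ht r z))"
        using mult_right_mono[OF n norm_ge_zero[of "Ht r z"]] by (simp add: mult_left_mono mult.assoc)
      moreover have "\<gamma> * bb z * norm (snd z) * ft r z \<le> (\<gamma> * (2*c + c0)) * (wt z * norm (ft r z))"
        using mult_left_mono[OF mult_right_mono[OF b f_nonneg[OF r, of z]], of \<gamma>] gam f_nonneg[OF r, of z] by (simp add: mult.assoc)
      ultimately show "\<bar>errd r z\<bar> \<le> \<gamma>\<^sup>2 * (wt z * norm (Ht r z)) + (\<gamma> * (2*c + c0)) * (wt z * norm (ft r z))"
        using errd_facts(2)[OF r, of z] by (simp add: errd_def)
    qed (use errd_facts(1)[OF r] in auto)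
    also have "\<dots> = \<gamma>\<^sup>2 * (\<integral>z. wt z * norm (Ht r z) \<partial>lborel) + (\<gamma> * (2*c + c0)) * (\<integral>z. wt z * norm (ft r z) \<partial>lborel)"
      using w by (subst Bochner_Integration.integral_add) (auto simp: wint_def)
    also have "\<dots> \<le> \<gamma>\<^sup>2 * C1 + (\<gamma> * (2*c + c0)) * C2"
      using C1[OF r] C2[OF r] gam cc by (intro add_mono mult_left_mono) auto
    finally show ?thesis .
  qed
  then show ?thesis by blast
qed

lemma Ek_integrable:
  assumes \<kappa>: "\<kappa> > 0"
  shows "set_integrable lborel {0..T} (Ek \<kappa>)"
    and "(LINT r:{0..T}|lborel. Ek \<kappa> r) = (\<integral>p. indicator {0..T} (fst p) * (\<kappa> * errd (fst p) (snd p) / (ft (fst p) (snd p) + \<kappa>)) \<partial>(lborel \<Otimes>\<^sub>M lborel))"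
proof -
  obtain C where C: "\<And>r. r \<in> {0..T} \<Longrightarrow> (\<integral>z. \<bar>errd r z\<bar> \<partial>lborel) \<le> C" using errd_bound by metis
  have b: "(\<integral>z. \<bar>\<kappa> * errd r z / (ft r z + \<kappa>)\<bar> \<partial>lborel) \<le> C" if r: "r \<in> {0..T}" for r
  proof (rule order_trans[OF _ C[OF r]], rule integral_mono)
    show "\<bar>\<kappa> * errd r z / (ft r z + \<kappa>)\<bar> \<le> \<bar>errd r z\<bar>" for z
      using errd_facts(5,6)[OF r \<kappa>, of z] by linarith
  qed (rule integrable_abs errd_facts(1)[OF r] errd_facts(4)[OF r \<kappa>])+
  note tsi = time_space_integrable[OF joint_meas_quotient[OF joint_meas_errd] errd_facts(4)[OF _ \<kappa>] b]
  show "set_integrable lborel {0..T} (Ek \<kappa>)" unfolding Ek_def[abs_def] by (rule tsi(2))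
  show "(LINT r:{0..T}|lborel. Ek \<kappa> r) = (\<integral>p. indicator {0..T} (fst p) * (\<kappa> * errd (fst p) (snd p) / (ft (fst p) (snd p) + \<kappa>)) \<partial>(lborel \<Otimes>\<^sub>M lborel))"
    using lborel_pair.integral_fst'[OF tsi(1)]
    by (simp only: set_lebesgue_integral_def Ek_def real_scaleR_def integral_mult_right_zero fst_conv snd_conv)
qed

text \<open>Dominated convergence in time and space together: the fraction \<kappa>/(f + \<kappa>)
  is at most 1 and tends to 0 where f is positive; where f vanishes, \<open>errd\<close> vanishes
  with it.\<close>

lemma Ek_tendsto:
  assumes \<kappa>: "\<And>n. \<kappa> n > 0" and lim: "\<kappa> \<longlonglongrightarrow> 0"
  shows "(\<lambda>n. LINT r:{0..T}|lborel. Ek (\<kappa> n) r) \<longlonglongrightarrow> 0"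
proof -
  obtain C where C: "\<And>r. r \<in> {0..T} \<Longrightarrow> (\<integral>z. \<bar>errd r z\<bar> \<partial>lborel) \<le> C" using errd_bound by metis
  have "(\<lambda>n. \<integral>p. indicator {0..T} (fst p) * (\<kappa> n * errd (fst p) (snd p) / (ft (fst p) (snd p) + \<kappa> n)) \<partial>(lborel \<Otimes>\<^sub>M lborel))
     \<longlonglongrightarrow> (\<integral>p. 0 \<partial>((lborel :: real measure) \<Otimes>\<^sub>M (lborel :: 'a ps measure)))"
  proof (rule integral_dominated_convergence[where w="\<lambda>p. indicator {0..T} (fst p) * errd (fst p) (snd p)"])
    show "integrable (lborel \<Otimes>\<^sub>M lborel) (\<lambda>p. indicator {0..T} (fst p) * errd (fst p) (snd p))"
      by (rule time_space_integrable(1)[OF joint_meas_errd errd_facts(1) C])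
    show "(\<lambda>p. indicator {0..T} (fst p) * (\<kappa> n * errd (fst p) (snd p) / (ft (fst p) (snd p) + \<kappa> n))) \<in> borel_measurable (lborel \<Otimes>\<^sub>M lborel)" for n
      using joint_meas_quotient[OF joint_meas_errd, of "\<kappa> n"] by (simp add: joint_meas_def)
    show "AE p in lborel \<Otimes>\<^sub>M lborel. norm (indicator {0..T} (fst p) * (\<kappa> n * errd (fst p) (snd p) / (ft (fst p) (snd p) + \<kappa> n)))
       \<le> indicator {0..T} (fst p) * errd (fst p) (snd p)" for n
    proof (rule AE_I2)
      fix p :: "real \<times> 'a ps"
      show "norm (indicator {0..T} (fst p) * (\<kappa> n * errd (fst p) (snd p) / (ft (fst p) (snd p) + \<kappa> n))) \<le> indicator {0..T} (fst p) * errd (fst p) (snd p)"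
      proof (cases "fst p \<in> {0..T}")
        case True
        have "indicator {0..T} (fst p) = (1::real)" using True by simp
        then show ?thesis
          unfolding real_norm_def by (simp only: mult_1 abs_of_nonneg[OF errd_facts(5)[OF True \<kappa>]] errd_facts(6)[OF True \<kappa>])
      qed simp
    qed
    show "AE p in lborel \<Otimes>\<^sub>M lborel. (\<lambda>n. indicator {0..T} (fst p) * (\<kappa> n * errd (fst p) (snd p) / (ft (fst p) (snd p) + \<kappa> n))) \<longlonglongrightarrow> 0"
    proof (rule AE_I2)
      fix p :: "real \<times> 'a ps"
      show "(\<lambda>n. indicator {0..T} (fst p) * (\<kappa> n * errd (fst p) (snd p) / (ft (fst p) (snd p) + \<kappa> n))) \<longlonglongrightarrow> 0"
      proof (cases "fst p \<in> {0..T} \<and> ft (fst p) (snd p) \<noteq> 0")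
        case True
        then have "(\<lambda>n. \<kappa> n * errd (fst p) (snd p) / (ft (fst p) (snd p) + \<kappa> n)) \<longlonglongrightarrow> 0 * errd (fst p) (snd p) / (ft (fst p) (snd p) + 0)"
          by (intro tendsto_intros lim) auto
        then show ?thesis by (intro tendsto_mult_right_zero) simp
      next
        case False
        then show ?thesis using errd_facts(3)[of "fst p" "snd p"] by (cases "fst p \<in> {0..T}") auto
      qed
    qed
  qed simp
  then show ?thesis using Ek_integrable(2)[OF \<kappa>] by simp
qed

lemma joint_meas_fisher: "joint_meas (\<lambda>t z. (norm (Ht t z))\<^sup>2 / (ft t z + \<kappa>))"
proof -
  note [measurable] = joint_meas_f_m joint_meas_H_m
  have "(\<lambda>p. (norm (indicator {0..T} (fst p) *\<^sub>R Ht (fst p) (snd p)))\<^sup>2 / (indicator {0..T} (fst p) * ft (fst p) (snd p) + \<kappa>))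
    \<in> borel_measurable (lborel \<Otimes>\<^sub>M lborel)" by measurable
  moreover have "(\<lambda>p. (norm (indicator {0..T} (fst p) *\<^sub>R Ht (fst p) (snd p)))\<^sup>2 / (indicator {0..T} (fst p) * ft (fst p) (snd p) + \<kappa>))
    = (\<lambda>p. indicator {0..T} (fst p) *\<^sub>R ((norm (Ht (fst p) (snd p)))\<^sup>2 / (ft (fst p) (snd p) + \<kappa>)))"
    by (auto simp: indicator_def)
  ultimately show ?thesis unfolding joint_meas_def by simp
qed

lemma Dk_integrable:
  assumes \<kappa>: "\<kappa> > 0" shows "set_integrable lborel {0..T} (Dk \<kappa>)"
proof -
  obtain C where C: "\<And>t z. t \<in> {0..T} \<Longrightarrow> norm (Ht t z) \<le> C" "\<And>t. t \<in> {0..T} \<Longrightarrow> (\<integral>z. wt z * norm (Ht t z) \<partial>lborel) \<le> C"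
    using unif_wint_E[OF unif_wint_H] by blast
  have i: "integrable lborel (\<lambda>z. (norm (Ht t z))\<^sup>2 / (ft t z + \<kappa>))" if t: "t \<in> {0..T}" for t
    by (rule snapshot.fisher_integrable[OF snap[OF t] \<kappa>])
  have b: "(\<integral>z. \<bar>(norm (Ht t z))\<^sup>2 / (ft t z + \<kappa>)\<bar> \<partial>lborel) \<le> (C / \<kappa>) * C" if t: "t \<in> {0..T}" for t
  proof -
    have C0: "0 \<le> C" using order_trans[OF norm_ge_zero C(1)[OF t]] .
    have "(\<integral>z. \<bar>(norm (Ht t z))\<^sup>2 / (ft t z + \<kappa>)\<bar> \<partial>lborel) \<le> (\<integral>z. (C / \<kappa>) * (wt z * norm (Ht t z)) \<partial>lborel)"
    proof (rule integral_mono)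
      show "integrable lborel (\<lambda>z. (C / \<kappa>) * (wt z * norm (Ht t z)))" using unif_wint_wint[OF unif_wint_H t] by (auto simp: wint_def)
      fix z
      have "(norm (Ht t z))\<^sup>2 / (ft t z + \<kappa>) \<le> (C * norm (Ht t z)) / \<kappa>"
        using C(1)[OF t, of z] C0 \<kappa> f_nonneg[OF t, of z] by (intro frac_le) (auto simp: power2_eq_square mult_right_mono)
      also have "\<dots> = (C / \<kappa>) * (1 * norm (Ht t z))" by simp
      also have "\<dots> \<le> (C / \<kappa>) * (wt z * norm (Ht t z))"
        using C0 \<kappa> wt_ge1[of z] by (intro mult_left_mono mult_right_mono) auto
      finally show "\<bar>(norm (Ht t z))\<^sup>2 / (ft t z + \<kappa>)\<bar> \<le> (C / \<kappa>) * (wt z * norm (Ht t z))"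
        using \<kappa> f_nonneg[OF t, of z] by simp
    qed (rule integrable_abs i[OF t])+
    also have "\<dots> \<le> (C / \<kappa>) * C" using C(2)[OF t] C0 \<kappa> by (auto intro!: divide_right_mono mult_left_mono)
    finally show ?thesis .
  qed
  from time_space_integrable(2)[OF joint_meas_fisher i b] show ?thesis unfolding Dk_def[abs_def] .
qed

text \<open>At each fixed z the mollified density is an absolutely continuous path with bounded
  derivative, so the chain rule applies to \<open>Ureg \<kappa> s\<close> plus potential times s.
  The shift makes the derivative of this function Lipschitz with constant 1/\<kappa> down to s = 0.
  Fubini's theorem then integrates in z.\<close>

lemma entropy_identity:
  assumes \<kappa>: "\<kappa> > 0" and t: "t \<in> {0..T}"
  shows "set_integrable lborel {0..T} (\<lambda>r. \<integral>z. (ln (ft r z + \<kappa>) + 1 + hpot \<gamma> z) * rt r z \<partial>lborel)"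
    and "Yk \<kappa> t = Yk \<kappa> 0 + (LINT r:{0..t}|lborel. \<integral>z. (ln (ft r z + \<kappa>) + 1 + hpot \<gamma> z) * rt r z \<partial>lborel)"
proof -
  have T0: "0 \<in> {0..T}" using T by simp
  define q where "q r z = (ln (ft r z + \<kappa>) + 1 + hpot \<gamma> z) * rt r z" for r z
  obtain Cr where Cr: "\<And>t z. t \<in> {0..T} \<Longrightarrow> norm (rt t z) \<le> Cr" "\<And>t. t \<in> {0..T} \<Longrightarrow> (\<integral>z. wt z * norm (rt t z) \<partial>lborel) \<le> Cr"
    using unif_wint_E[OF unif_wint_rate] by blast
  obtain m where m: "\<And>t z. t \<in> {0..T} \<Longrightarrow> norm (ft t z) \<le> m"
    "\<And>t. t \<in> {0..T} \<Longrightarrow> (\<integral>z. wt z * norm (ft t z) \<partial>lborel) \<le> m"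
    using unif_wint_E[OF unif_wint_f] by blast
  define L0 where "L0 = \<bar>ln \<kappa>\<bar> + \<bar>ln (m + \<kappa>)\<bar>"
  have L0: "\<bar>ln (ft r z + \<kappa>) + 1 + hpot \<gamma> z\<bar> \<le> (L0 + 1 + 3) * wt z" if r: "r \<in> {0..T}" for r z
  proof -
    have "ln \<kappa> \<le> ln (ft r z + \<kappa>)" using f_nonneg[OF r, of z] \<kappa> by simp
    moreover have "ln (ft r z + \<kappa>) \<le> ln (m + \<kappa>)" using f_nonneg[OF r, of z] m(1)[OF r, of z] \<kappa> by simp
    moreover have "\<bar>hpot \<gamma> z\<bar> \<le> 3 * wt z" by (rule snapshot.xi_bounds(2)[OF snap[OF r]])
    ultimately have "\<bar>ln (ft r z + \<kappa>) + 1 + hpot \<gamma> z\<bar> \<le> L0 + 1 + 3 * wt z" unfolding L0_def by linarith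
    also have "\<dots> \<le> (L0 + 1) * wt z + 3 * wt z"
      using mult_left_mono[OF wt_ge1[of z], of "L0 + 1"] by (simp add: L0_def)
    finally show ?thesis by (simp add: algebra_simps)
  qed
  have qi: "integrable lborel (q r)" if r: "r \<in> {0..T}" for r
    unfolding q_def[abs_def] by (rule snapshot.rate_pairing(1)[OF snap[OF r] \<kappa>])
  have qb: "(\<integral>z. \<bar>q r z\<bar> \<partial>lborel) \<le> (L0 + 1 + 3) * Cr" if r: "r \<in> {0..T}" for r
  proof -
    have "(\<integral>z. \<bar>q r z\<bar> \<partial>lborel) \<le> (\<integral>z. (L0 + 1 + 3) * (wt z * norm (rt r z)) \<partial>lborel)"
    proof (rule integral_mono)
      show "integrable lborel (\<lambda>z. (L0 + 1 + 3) * (wt z * norm (rt r z)))"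
        using unif_wint_wint[OF unif_wint_rate r] by (auto simp: wint_def)
      show "\<bar>q r z\<bar> \<le> (L0 + 1 + 3) * (wt z * norm (rt r z))" for z
        using mult_right_mono[OF L0[OF r, of z] abs_ge_zero[of "rt r z"]] by (simp add: q_def abs_mult mult.assoc)
    qed (rule integrable_abs qi[OF r])+
    also have "\<dots> \<le> (L0 + 1 + 3) * Cr" using mult_left_mono[OF Cr(2)[OF r], of "L0 + 1 + 3"] by (simp add: L0_def)
    finally show ?thesis .
  qed
  have Jq: "joint_meas q"
  proof -
    note [measurable] = joint_meas_f_m joint_meas_rate_m
    have "(\<lambda>p. (ln (indicator {0..T} (fst p) * ft (fst p) (snd p) + \<kappa>) + 1 + hpot \<gamma> (snd p)) * (indicator {0..T} (fst p) * rt (fst p) (snd p)))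
      \<in> borel_measurable (lborel \<Otimes>\<^sub>M lborel)" by measurable
    moreover have "(\<lambda>p. (ln (indicator {0..T} (fst p) * ft (fst p) (snd p) + \<kappa>) + 1 + hpot \<gamma> (snd p)) * (indicator {0..T} (fst p) * rt (fst p) (snd p)))
      = (\<lambda>p. indicator {0..T} (fst p) *\<^sub>R q (fst p) (snd p))"
      by (auto simp: indicator_def q_def)
    ultimately show ?thesis unfolding joint_meas_def by simp
  qed
  note tsi = time_space_integrable[OF Jq qi qb]
  from tsi(2) show "set_integrable lborel {0..T} (\<lambda>r. \<integral>z. (ln (ft r z + \<kappa>) + 1 + hpot \<gamma> z) * rt r z \<partial>lborel)"
    unfolding q_def .
  have point: "(Ureg \<kappa> (ft t z) + hpot \<gamma> z * ft t z) - (Ureg \<kappa> (ft 0 z) + hpot \<gamma> z * ft 0 z) = (LINT r:{0..t}|lborel. q r z)" for z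
    unfolding q_def
  proof (rule integral_chain_rule(2)[where a="\<lambda>r. rt r z" and y="\<lambda>r. ft r z" and G="\<lambda>s. Ureg \<kappa> s + hpot \<gamma> z * s"
        and G'="\<lambda>s. ln (s + \<kappa>) + 1 + hpot \<gamma> z" and L="1 / \<kappa>" and C=Cr and T=T])
    show "set_integrable lborel {0..T} (\<lambda>r. rt r z)"
      unfolding rate_as_pairing by (rule weak_time[OF test_fun_reflect[OF k]])
    show "((\<lambda>s. Ureg \<kappa> s + hpot \<gamma> z * s) has_real_derivative ln (s + \<kappa>) + 1 + hpot \<gamma> z) (at s)" if "0 \<le> s" for s
      using Ureg_deriv[OF that \<kappa>] by (auto intro!: derivative_eq_intros)
    show "\<bar>ln (s + \<kappa>) + 1 + hpot \<gamma> z - (ln (s' + \<kappa>) + 1 + hpot \<gamma> z)\<bar> \<le> (1 / \<kappa>) * \<bar>s - s'\<bar>" if "0 \<le> s" "0 \<le> s'" for s s'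
      using ln_shift_Lipschitz[OF \<kappa> that] by simp
    show "\<bar>rt r z\<bar> \<le> Cr" if "r \<in> {0..T}" for r using Cr(1)[OF that, of z] by simp
    show "ft t z = ft 0 z + (LINT r:{0..t}|lborel. rt r z)" if "t \<in> {0..T}" for t by (rule f_evolution[OF that])
    show "0 \<le> ft t z" if "t \<in> {0..T}" for t by (rule f_nonneg[OF that])
  qed (use T t in auto)
  have it: "integrable (lborel \<Otimes>\<^sub>M lborel) (\<lambda>(r, z). indicator {0..t} r * q r z)"
  proof -
    have "integrable (lborel \<Otimes>\<^sub>M lborel) (\<lambda>p. indicator ({0..t} \<times> UNIV) p *\<^sub>R (indicator {0..T} (fst p) * q (fst p) (snd p)))"
    proof (rule integrable_mult_indicator[OF _ tsi(1)])
      have "{0..t} \<times> (UNIV :: 'a ps set) = {0..t} \<times> space lborel" by simp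
      then show "{0..t} \<times> (UNIV :: 'a ps set) \<in> sets (lborel \<Otimes>\<^sub>M lborel)" by (metis pair_measureI atLeastAtMost_borel sets.top sets_lborel)
    qed
    moreover have "(\<lambda>p. indicator ({0..t} \<times> UNIV) p *\<^sub>R (indicator {0..T} (fst p) * q (fst p) (snd p))) = (\<lambda>(r, z). indicator {0..t} r * q r z)"
      using t by (auto simp: indicator_def fun_eq_iff)
    ultimately show ?thesis by simp
  qed
  have iY: "integrable lborel (\<lambda>z. Ureg \<kappa> (ft t z) + hpot \<gamma> z * ft t z)" if t: "t \<in> {0..T}" for t
    by (intro Bochner_Integration.integrable_add snapshot.Ureg_f_integrable[OF snap[OF t] \<kappa>] snapshot.hpot_f_integrable[OF snap[OF t]])
  have "Yk \<kappa> t - Yk \<kappa> 0 = (\<integral>z. (Ureg \<kappa> (ft t z) + hpot \<gamma> z * ft t z) - (Ureg \<kappa> (ft 0 z) + hpot \<gamma> z * ft 0 z) \<partial>lborel)"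
    unfolding Yk_def using Bochner_Integration.integral_diff[OF iY[OF t] iY[OF T0]] by simp
  also have "\<dots> = (\<integral>z. \<integral>r. indicator {0..t} r * q r z \<partial>lborel \<partial>lborel)"
    unfolding point by (simp add: set_lebesgue_integral_def)
  also have "\<dots> = (\<integral>r. \<integral>z. indicator {0..t} r * q r z \<partial>lborel \<partial>lborel)"
    by (rule lborel_pair.Fubini_integral[OF it])
  also have "\<dots> = (LINT r:{0..t}|lborel. \<integral>z. q r z \<partial>lborel)" by (simp add: set_lebesgue_integral_def)
  finally show "Yk \<kappa> t = Yk \<kappa> 0 + (LINT r:{0..t}|lborel. \<integral>z. (ln (ft r z + \<kappa>) + 1 + hpot \<gamma> z) * rt r z \<partial>lborel)"
    unfolding q_def by simp
qed

lemma mollified_entropy_inequality: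
  assumes \<kappa>: "\<kappa> > 0" and t: "t \<in> {0..T}"
  shows "Yk \<kappa> t + (\<gamma>\<^sup>2 / 2) * (LINT r:{0..t}|lborel. Dk \<kappa> r)
    \<le> (Yk \<kappa> 0 + (LINT r:{0..T}|lborel. Ek \<kappa> r)) * exp (lamK c * t) + betaK / lamK c * (exp (lamK c * t) - 1)"
proof -
  have lam: "lamK c > 0" by (simp add: lamK_def add_pos_nonneg)
  have "Yk \<kappa> t + (LINT r:{0..t}|lborel. (\<gamma>\<^sup>2 / 2) * Dk \<kappa> r)
    \<le> (Yk \<kappa> 0 + (LINT r:{0..T}|lborel. Ek \<kappa> r)) * exp (lamK c * t) + betaK / lamK c * (exp (lamK c * t) - 1)"
  proof (rule Gronwall_dissipation[OF lam t entropy_identity(2)[OF \<kappa>] entropy_identity(1)[OF \<kappa> t] _ Ek_integrable(1)[OF \<kappa>]])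
    show "set_integrable lborel {0..T} (\<lambda>r. (\<gamma>\<^sup>2 / 2) * Dk \<kappa> r)"
      by (rule set_integrable_mult_right) (use Dk_integrable[OF \<kappa>] in auto)
    fix r assume r: "r \<in> {0..T}"
    interpret sn: snapshot \<gamma> c c0 s M "\<mu> r" "F r" k by (rule snap[OF r])
    show "0 \<le> (\<gamma>\<^sup>2 / 2) * Dk \<kappa> r" unfolding Dk_def using \<kappa> f_nonneg[OF r]
      by (intro mult_nonneg_nonneg Bochner_Integration.integral_nonneg) (auto intro!: divide_nonneg_nonneg add_nonneg_nonneg)
    show "0 \<le> Ek \<kappa> r" unfolding Ek_def using errd_facts(5)[OF r \<kappa>] by (intro Bochner_Integration.integral_nonneg) auto
    define Ih where "Ih = (\<integral>z. hpot \<gamma> z * ft r z \<partial>lborel)"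
    define Ph where "Ph = (\<integral>z. Ureg \<kappa> (ft r z) + hpot \<gamma> z * ft r z \<partial>lborel)"
    have 1: "(\<integral>z. (ln (ft r z + \<kappa>) + 1 + hpot \<gamma> z) * rt r z \<partial>lborel)
      \<le> (CARD('a) + 5/2 + 5 * (2*c + c0)\<^sup>2) + (1 + 20 * c\<^sup>2) * Ih + Ek \<kappa> r - (\<gamma>\<^sup>2 / 2) * Dk \<kappa> r"
      using sn.dissipation[OF \<kappa>] unfolding Ih_def Ek_def Dk_def errd_def .
    have "Ih \<le> 2 * Ph + 2 * gaussC TYPE('a)" unfolding Ih_def Ph_def by (rule sn.hpot_le_entropy[OF \<kappa>])
    then have "(1 + 20 * c\<^sup>2) * Ih \<le> (1 + 20 * c\<^sup>2) * (2 * Ph + 2 * gaussC TYPE('a))"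
      by (intro mult_left_mono) auto
    also have "\<dots> = lamK c * Ph + lamK c * gaussC TYPE('a)" by (simp add: lamK_def algebra_simps)
    \<comment> \<open>The constant d ln(2 pi) in \<open>Yk\<close> is nonnegative, so adding it only
      weakens the bound.\<close>
    also have "lamK c * Ph \<le> lamK c * Yk \<kappa> r"
    proof (rule mult_left_mono)
      have "1 \<le> 2 * pi" using pi_ge_two by linarith
      then show "Ph \<le> Yk \<kappa> r" unfolding Yk_def Ph_def by simp
    qed (use lam in simp)
    finally have 2: "(1 + 20 * c\<^sup>2) * Ih \<le> lamK c * Yk \<kappa> r + lamK c * gaussC TYPE('a)" by simp
    show "(\<integral>z. (ln (ft r z + \<kappa>) + 1 + hpot \<gamma> z) * rt r z \<partial>lborel) \<le> lamK c * Yk \<kappa> r + betaK + Ek \<kappa> r - (\<gamma>\<^sup>2 / 2) * Dk \<kappa> r"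
      using 1 2 unfolding betaK_def by linarith
  qed
  then show ?thesis by (simp only: set_integral_mult_right)
qed

end

section \<open>Entropy and flux of a density\<close>

text \<open>For fixed velocity the map is a translation in position, so the shear preserves Lebesgue
  measure.\<close>

lemma nn_integral_shear:
  fixes g :: "'d::finite ps \<Rightarrow> ennreal"
  assumes [measurable]: "g \<in> borel_measurable borel"
  shows "(\<integral>\<^sup>+z. g (fst z + a *\<^sub>R snd z, snd z) \<partial>lborel) = (\<integral>\<^sup>+z. g z \<partial>lborel)"
proof -
  have [measurable]: "g \<in> borel_measurable (borel \<Otimes>\<^sub>M borel)" using assms by (simp add: borel_prod)
  have "(\<integral>\<^sup>+z. g (fst z + a *\<^sub>R snd z, snd z) \<partial>lborel) = (\<integral>\<^sup>+z. g (fst z + a *\<^sub>R snd z, snd z) \<partial>(lborel \<Otimes>\<^sub>M lborel))"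
    by (simp add: lborel_prod)
  also have "\<dots> = (\<integral>\<^sup>+v. \<integral>\<^sup>+x. g (x + a *\<^sub>R v, v) \<partial>lborel \<partial>lborel)"
    by (subst lborel_pair.nn_integral_snd[symmetric]) (auto simp: case_prod_unfold)
  also have "\<dots> = (\<integral>\<^sup>+v. \<integral>\<^sup>+x. g (x, v) \<partial>lborel \<partial>lborel)"
    by (intro nn_integral_cong nn_integral_lborel_translate[of "\<lambda>x. g (x, v)" for v]) measurable
  also have "\<dots> = (\<integral>\<^sup>+z. g z \<partial>(lborel \<Otimes>\<^sub>M lborel))"
    by (subst lborel_pair.nn_integral_snd[symmetric]) (auto simp: case_prod_unfold)
  finally show ?thesis by (simp add: lborel_prod)
qed

definition refd :: "real \<Rightarrow> 'd::finite ps \<Rightarrow> real" where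
  "refd \<gamma> z = (2*pi) powr (- real CARD('d)) * exp (- hpot \<gamma> z)"

lemma refd_pos: "0 < refd \<gamma> z" by (simp add: refd_def)

lemma ps_fst_snd_measurable[measurable]:
  "(\<lambda>z :: 'd::finite ps. fst z) \<in> borel_measurable borel" "(\<lambda>z :: 'd ps. snd z) \<in> borel_measurable borel"
  by (intro borel_measurable_continuous_onI continuous_intros)+

lemma hpot_borel[measurable]: "(hpot \<gamma> :: 'd::finite ps \<Rightarrow> real) \<in> borel_measurable borel"
  unfolding hpot_def[abs_def] by measurable

lemma refd_measurable[measurable]: "(refd \<gamma> :: 'd::finite ps \<Rightarrow> real) \<in> borel_measurable borel"
  unfolding refd_def[abs_def] by measurable

lemma Gamma_minus_measurable[measurable]: "(Gamma_minus \<gamma> :: 'd::finite ps \<Rightarrow> 'd ps) \<in> borel_measurable borel"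
  unfolding Gamma_minus_def[abs_def] by (intro borel_measurable_continuous_onI continuous_intros)

lemma distr_gauss_eq_density:
  "distr (gauss2d :: 'd::finite ps measure) lborel (Gamma_minus \<gamma>) = density lborel (\<lambda>z. ennreal (refd \<gamma> z))"
proof (rule measure_eqI)
  fix A assume "A \<in> sets (distr (gauss2d :: 'd ps measure) lborel (Gamma_minus \<gamma>))"
  then have [measurable]: "A \<in> sets borel" by simp
  define g where "g z = ennreal ((2*pi) powr (- real CARD('d)) * exp (- (norm z)\<^sup>2 / 2)) * indicator A (Gamma_minus \<gamma> z)" for z :: "'d ps"
  have [measurable]: "g \<in> borel_measurable borel" unfolding g_def[abs_def] by measurable
  have "emeasure (distr gauss2d lborel (Gamma_minus \<gamma>)) A = emeasure gauss2d (Gamma_minus \<gamma> -` A \<inter> space gauss2d)"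
    by (rule emeasure_distr) (auto simp: gauss2d_def)
  also have "\<dots> = (\<integral>\<^sup>+z. g z \<partial>lborel)"
    using measurable_sets[OF Gamma_minus_measurable[of \<gamma>, where 'd='d], of A]
    unfolding gauss2d_def by (subst emeasure_density) (auto simp: g_def indicator_def intro!: nn_integral_cong)
  also have "\<dots> = (\<integral>\<^sup>+z. g (fst z + (1/\<gamma>) *\<^sub>R snd z, snd z) \<partial>lborel)"
    by (rule nn_integral_shear[symmetric]) measurable
  also have "\<dots> = (\<integral>\<^sup>+z. ennreal (refd \<gamma> z) * indicator A z \<partial>lborel)"
  proof (rule nn_integral_cong)
    fix z :: "'d ps"
    have "(norm (fst z + (1/\<gamma>) *\<^sub>R snd z, snd z))\<^sup>2 / 2 = hpot \<gamma> z" by (simp add: norm_Pair hpot_def)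
    moreover have "Gamma_minus \<gamma> (fst z + (1/\<gamma>) *\<^sub>R snd z, snd z) = z" by (simp add: Gamma_minus_def)
    ultimately show "g (fst z + (1/\<gamma>) *\<^sub>R snd z, snd z) = ennreal (refd \<gamma> z) * indicator A z"
      by (simp add: g_def refd_def)
  qed
  also have "\<dots> = emeasure (density lborel (\<lambda>z. ennreal (refd \<gamma> z))) A" by (simp add: emeasure_density)
  finally show "emeasure (distr gauss2d lborel (Gamma_minus \<gamma>)) A = \<dots>" .
qed simp

text \<open>The integrand f ln(f / \<open>refd \<gamma>\<close>) of the relative entropy against
  Lebesgue measure, expanded into its three terms.\<close>

definition entd :: "real \<Rightarrow> ('d::finite ps \<Rightarrow> real) \<Rightarrow> 'd ps \<Rightarrow> real" where
  "entd \<gamma> f z = f z * ln (f z) + hpot \<gamma> z * f z + CARD('d) * ln (2 * pi) * f z"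

text \<open>The reference density is positive, so f divided by it is a version of the Radon-Nikodym
  derivative. Integrability makes both the positive and the negative part finite, which excludes a
  difference of infinities in the definition of \<open>Ent\<close>.\<close>

lemma Ent_formula:
  fixes f :: "'d::finite ps \<Rightarrow> real"
  assumes f: "prob_dens f" and i: "integrable lborel (entd \<gamma> f)"
  shows "Ent (dens f) (distr gauss2d lborel (Gamma_minus \<gamma>)) = ereal (\<integral>z. entd \<gamma> f z \<partial>lborel)"
proof -
  define N where "N = density lborel (\<lambda>z :: 'd ps. ennreal (refd \<gamma> z))"
  have [measurable]: "f \<in> borel_measurable borel" and f0: "\<And>z. 0 \<le> f z" and fi: "integrable lborel f" "(\<integral>z. f z \<partial>lborel) = 1"
    using f by (auto simp: prob_dens_def)
  define q where "q z = f z / refd \<gamma> z" for z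
  have [measurable]: "q \<in> borel_measurable borel" unfolding q_def[abs_def] by measurable
  have q0: "0 \<le> q z" for z using f0 refd_pos[of \<gamma> z] by (simp add: q_def)
  have qr: "refd \<gamma> z * q z = f z" for z using refd_pos[of \<gamma> z] by (simp add: q_def)
  have d: "density N (\<lambda>z. ennreal (q z)) = dens f"
    unfolding N_def dens_def
  proof (subst density_density_eq)
    have "ennreal (refd \<gamma> z) * ennreal (q z) = ennreal (f z)" for z
      using q0[of z] less_imp_le[OF refd_pos[of \<gamma> z]] by (simp add: ennreal_mult[symmetric] qr)
    then show "density lborel (\<lambda>z. ennreal (refd \<gamma> z) * ennreal (q z)) = density lborel (\<lambda>z. ennreal (f z))"
      by simp
  qed auto
  have sN: "sets N = sets borel" by (simp add: N_def)
  have ac: "absolutely_continuous N (dens f)"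
    unfolding d[symmetric] by (rule absolutely_continuousI_density) (simp add: N_def)
  have sf: "sigma_finite_measure (dens f)"
  proof -
    have "emeasure (dens f) (space (dens f)) = (\<integral>\<^sup>+z. ennreal (f z) \<partial>lborel)"
      unfolding dens_def by (simp add: emeasure_density)
    also have "\<dots> = 1" using nn_integral_eq_integral[OF fi(1)] f0 fi(2) by simp
    finally have "finite_measure (dens f)" by (intro finite_measureI) simp
    then show ?thesis by (simp add: finite_measure_def)
  qed
  have rn: "AE z in N. ennreal (q z) = RN_deriv N (dens f) z"
    by (rule RN_deriv_unique_sigma_finite[OF _ d sf]) (simp add: N_def)
  have rn': "AE z in N. enn2real (RN_deriv N (dens f) z) = q z"
    using rn by eventually_elim (metis enn2real_ennreal q0)
  have e: "refd \<gamma> z * (q z * ln (q z)) = entd \<gamma> f z" for z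
  proof (cases "f z = 0")
    case True
    then show ?thesis by (simp add: q_def entd_def)
  next
    case False
    then have fp: "f z > 0" using f0[of z] by simp
    have lr: "ln (refd \<gamma> z) = - (CARD('d) * ln (2 * pi)) - hpot \<gamma> z"
      unfolding refd_def by (subst ln_mult) (auto simp: ln_powr)
    have "ln (q z) = ln (f z) - ln (refd \<gamma> z)" unfolding q_def using fp refd_pos[of \<gamma> z] by (simp add: ln_div)
    then have "ln (q z) = ln (f z) + CARD('d) * ln (2 * pi) + hpot \<gamma> z" using lr by simp
    moreover have "refd \<gamma> z * (q z * ln (q z)) = f z * ln (q z)" using qr[of z] by (simp add: mult.assoc[symmetric])
    ultimately show ?thesis by (simp add: entd_def algebra_simps)
  qed
  have em: "ennreal (refd \<gamma> z) * ennreal x = ennreal (refd \<gamma> z * x)" for x z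
    by (rule ennreal_mult'[symmetric, OF less_imp_le[OF refd_pos]])
  have p: "(\<integral>\<^sup>+z. ennreal (enn2real (RN_deriv N (dens f) z) * ln (enn2real (RN_deriv N (dens f) z))) \<partial>N) = (\<integral>\<^sup>+z. ennreal (entd \<gamma> f z) \<partial>lborel)"
  proof -
    have "(\<integral>\<^sup>+z. ennreal (enn2real (RN_deriv N (dens f) z) * ln (enn2real (RN_deriv N (dens f) z))) \<partial>N) = (\<integral>\<^sup>+z. ennreal (q z * ln (q z)) \<partial>N)"
      by (rule nn_integral_cong_AE) (use rn' in eventually_elim, simp)
    also have "\<dots> = (\<integral>\<^sup>+z. ennreal (refd \<gamma> z) * ennreal (q z * ln (q z)) \<partial>lborel)"
      unfolding N_def by (rule nn_integral_density) auto
    also have "\<dots> = (\<integral>\<^sup>+z. ennreal (entd \<gamma> f z) \<partial>lborel)"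
      by (intro nn_integral_cong) (simp only: em e)
    finally show ?thesis .
  qed
  have n: "(\<integral>\<^sup>+z. ennreal (- (enn2real (RN_deriv N (dens f) z) * ln (enn2real (RN_deriv N (dens f) z)))) \<partial>N) = (\<integral>\<^sup>+z. ennreal (- entd \<gamma> f z) \<partial>lborel)"
  proof -
    have "(\<integral>\<^sup>+z. ennreal (- (enn2real (RN_deriv N (dens f) z) * ln (enn2real (RN_deriv N (dens f) z)))) \<partial>N) = (\<integral>\<^sup>+z. ennreal (- (q z * ln (q z))) \<partial>N)"
      by (rule nn_integral_cong_AE) (use rn' in eventually_elim, simp)
    also have "\<dots> = (\<integral>\<^sup>+z. ennreal (refd \<gamma> z) * ennreal (- (q z * ln (q z))) \<partial>lborel)"
      unfolding N_def by (rule nn_integral_density) auto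
    also have "\<dots> = (\<integral>\<^sup>+z. ennreal (- entd \<gamma> f z) \<partial>lborel)"
      by (intro nn_integral_cong) (simp only: em e mult_minus_right)
    finally show ?thesis .
  qed
  have fin: "(\<integral>\<^sup>+z. ennreal (entd \<gamma> f z) \<partial>lborel) < \<infinity>" "(\<integral>\<^sup>+z. ennreal (- entd \<gamma> f z) \<partial>lborel) < \<infinity>"
    using i unfolding real_integrable_def by (auto simp: less_top)
  define a where "a = enn2real (\<integral>\<^sup>+z. ennreal (entd \<gamma> f z) \<partial>lborel)"
  define b where "b = enn2real (\<integral>\<^sup>+z. ennreal (- entd \<gamma> f z) \<partial>lborel)"
  have ab: "(\<integral>\<^sup>+z. ennreal (entd \<gamma> f z) \<partial>lborel) = ennreal a" "0 \<le> a"
      "(\<integral>\<^sup>+z. ennreal (- entd \<gamma> f z) \<partial>lborel) = ennreal b" "0 \<le> b"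
    using fin by (simp_all add: a_def b_def less_top)
  have sd: "sets (dens f) = sets N" by (simp add: dens_def sN)
  have "Ent (dens f) N = enn2ereal (ennreal a) - enn2ereal (ennreal b)"
    using ac sd by (simp only: Ent_def Let_def p n ab if_True simp_thms)
  also have "\<dots> = ereal (a - b)" using ab by (simp add: enn2ereal_ennreal)
  also have "a - b = (\<integral>z. entd \<gamma> f z \<partial>lborel)"
    using real_lebesgue_integral_def[OF i] ab by simp
  finally show ?thesis unfolding N_def distr_gauss_eq_density .
qed

lemma xlnx_lower: "0 \<le> x \<Longrightarrow> - 1 \<le> x * ln (x :: real)"
  using Young_entropy[of x 0] by simp

text \<open>Continuity at 0 comes from |y ln y| <= 2 sqrt y for y below 1, which is the inequality
  ln r <= r - 1 at r = 1/sqrt y.\<close>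

lemma tendsto_xlnx:
  fixes u :: "nat \<Rightarrow> real"
  assumes lim: "u \<longlonglongrightarrow> x" and u: "\<And>n. 0 \<le> u n" shows "(\<lambda>n. u n * ln (u n)) \<longlonglongrightarrow> x * ln x"
proof (cases "x = 0")
  case False
  then show ?thesis by (intro tendsto_intros lim) auto
next
  case True
  have b: "\<bar>y * ln y\<bar> \<le> 2 * sqrt y" if y: "0 \<le> y" "y < 1" for y :: real
  proof (cases "y = 0")
    case False
    then have yp: "y > 0" using y by simp
    have "ln (1 / sqrt y) \<le> 1 / sqrt y - 1" using yp by (intro ln_le_minus_one) auto
    moreover have "ln (1 / sqrt y) = - ln y / 2" using yp by (simp add: ln_div ln_sqrt)
    ultimately have "- ln y \<le> 2 / sqrt y" by simp
    from mult_left_mono[OF this, of y] have "- (y * ln y) \<le> 2 * (y / sqrt y)" using yp by (simp add: mult.commute)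
    also have "y / sqrt y = sqrt y" using yp by (simp add: real_div_sqrt)
    finally have "- (y * ln y) \<le> 2 * sqrt y" .
    moreover have "y * ln y \<le> 0" using yp y by (simp add: mult_nonneg_nonpos)
    ultimately show ?thesis by simp
  qed simp
  have "(\<lambda>n. u n * ln (u n)) \<longlonglongrightarrow> 0"
  proof (rule Lim_null_comparison)
    have "eventually (\<lambda>n. u n < 1) sequentially" using lim True by (intro order_tendstoD(2)[OF lim]) simp
    then show "eventually (\<lambda>n. norm (u n * ln (u n)) \<le> 2 * sqrt (u n)) sequentially"
      by eventually_elim (use b u in auto)
    have "(\<lambda>n. 2 * sqrt (u n)) \<longlonglongrightarrow> 2 * sqrt x" by (intro tendsto_intros lim)
    then show "(\<lambda>n. 2 * sqrt (u n)) \<longlonglongrightarrow> 0" using True by simp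
  qed
  then show ?thesis using True by simp
qed

section \<open>Weak flux of a density and its mollification\<close>

lemma weak_grad_flux:
  fixes m :: "'d::finite ps \<Rightarrow> real" and G :: "'d ps \<Rightarrow> 'd ps"
  assumes m: "prob_dens m" and wg: "weak_grad m G"
    and i: "integrable lborel (\<lambda>z. (1 + (norm (fst z))\<^sup>2 + (norm (snd z))\<^sup>2) * (\<bar>m z\<bar> + norm (G z)))"
  defines "h \<equiv> \<lambda>z. snd (G z) + m z *\<^sub>R snd z"
  shows "integrable lborel h" "fp_flux m h"
proof -
  have [measurable]: "m \<in> borel_measurable borel" and m0: "\<And>z. 0 \<le> m z" and mi: "integrable lborel m"
    using m by (auto simp: prob_dens_def)
  \<comment> \<open>A weak gradient is locally integrable by definition; measurability on the whole
    space is recovered from its truncations to growing balls.\<close>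
  have Gm[measurable]: "G \<in> borel_measurable borel"
  proof (rule borel_measurable_LIMSEQ_metric)
    show "(\<lambda>z. indicator (cball 0 (real n)) z *\<^sub>R G z) \<in> borel_measurable borel" for n
    proof -
      have "set_integrable lborel (cball 0 (real n)) G"
        using wg by (simp add: weak_grad_def loc_int_def)
      then have "integrable lborel (\<lambda>z. indicator (cball 0 (real n)) z *\<^sub>R G z)"
        by (simp only: set_integrable_def)
      from borel_measurable_integrable[OF this] show ?thesis by simp
    qed
    fix z :: "'d ps"
    obtain N where N: "norm z < real N" using reals_Archimedean2 by blast
    have "eventually (\<lambda>n. indicator (cball 0 (real n)) z *\<^sub>R G z = G z) sequentially"
      by (rule eventually_sequentiallyI[of N]) (use N in auto)
    then show "(\<lambda>n. indicator (cball 0 (real n)) z *\<^sub>R G z) \<longlonglongrightarrow> G z" by (rule tendsto_eventually)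
  qed
  define w where "w z = (1 + (norm (fst z))\<^sup>2 + (norm (snd z))\<^sup>2) * (\<bar>m z\<bar> + norm (G z))" for z
  have iw: "integrable lborel w" using i unfolding w_def .
  have w1: "norm (G z) \<le> w z" "norm (m z *\<^sub>R snd z) \<le> w z" for z
  proof -
    have p: "1 \<le> 1 + (norm (fst z))\<^sup>2 + (norm (snd z))\<^sup>2" by simp
    have "1 * (\<bar>m z\<bar> + norm (G z)) \<le> w z" unfolding w_def using p by (intro mult_right_mono) auto
    then show "norm (G z) \<le> w z" by simp
    have "norm (snd z) \<le> 1 + (norm (fst z))\<^sup>2 + (norm (snd z))\<^sup>2"
      using norm_le_one_plus[of "snd z"] zero_le_power2[of "norm (fst z)"] by linarith
    then have "norm (snd z) * \<bar>m z\<bar> \<le> w z" unfolding w_def by (intro mult_mono) auto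
    then show "norm (m z *\<^sub>R snd z) \<le> w z" by (simp add: mult.commute)
  qed
  have iG: "integrable lborel G" by (rule integrable_le[OF iw _ w1(1)]) measurable
  have iv: "integrable lborel (\<lambda>z. m z *\<^sub>R snd z)" by (rule integrable_le[OF iw _ w1(2)]) measurable
  have isG: "integrable lborel (\<lambda>z. snd (G z))" by (rule integrable_snd[OF iG])
  show ih: "integrable lborel h" unfolding h_def by (rule Bochner_Integration.integrable_add[OF isG iv])
  show "fp_flux m h" unfolding fp_flux_def
  proof (intro conjI allI impI ballI)
    show "loc_int h" unfolding loc_int_def set_integrable_def
      using integrable_mult_indicator[OF _ ih] borel_compact by auto
    fix \<phi> :: "'d ps \<Rightarrow> real" and j :: "real^'d" assume \<phi>: "test_fun \<phi>" and j: "j \<in> Basis"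
    have bt: "integrable lborel (\<lambda>z. g z * \<psi> z)" if g: "integrable lborel g" and \<psi>: "test_fun \<psi>" for g \<psi> :: "'d ps \<Rightarrow> real"
    proof -
      obtain C where C: "C > 0" "\<And>z. \<bar>\<psi> z\<bar> \<le> C" using test_fun_bounded[OF \<psi>] by metis
      have [measurable]: "g \<in> borel_measurable borel" "\<psi> \<in> borel_measurable borel" using g \<psi> by auto
      show ?thesis
      proof (rule integrable_le)
        show "integrable lborel (\<lambda>z. C * \<bar>g z\<bar>)" using g by simp
        show "norm (g z * \<psi> z) \<le> C * \<bar>g z\<bar>" for z
          using mult_left_mono[OF C(2)[of z] abs_ge_zero[of "g z"]] by (simp add: abs_mult mult.commute)
      qed measurable
    qed
    have tp: "test_fun (pd \<phi> (0, j))" using j by (intro test_fun_pd \<phi>) simp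
    have b1: "integrable lborel (\<lambda>z. (G z \<bullet> (0, j)) * \<phi> z)" by (rule bt[OF integrable_inner_left[OF iG] \<phi>])
    have b2: "integrable lborel (\<lambda>z. ((m z *\<^sub>R snd z) \<bullet> j) * \<phi> z)" by (rule bt[OF integrable_inner_left[OF iv] \<phi>])
    have b3: "integrable lborel (\<lambda>z. m z * pd \<phi> (0, j) z)" by (rule bt[OF mi tp])
    have "(\<integral>z. (h z \<bullet> j) * \<phi> z \<partial>lborel) = (\<integral>z. (G z \<bullet> (0, j)) * \<phi> z + ((m z *\<^sub>R snd z) \<bullet> j) * \<phi> z \<partial>lborel)"
      unfolding h_def by (simp add: inner_add_left distrib_right inner_prod_def)
    also have "\<dots> = (\<integral>z. (G z \<bullet> (0, j)) * \<phi> z \<partial>lborel) + (\<integral>z. ((m z *\<^sub>R snd z) \<bullet> j) * \<phi> z \<partial>lborel)"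
      by (rule Bochner_Integration.integral_add[OF b1 b2])
    \<comment> \<open>The basis vector (0, j) selects the velocity part of the weak
      gradient.\<close>
    also have "(\<integral>z. (G z \<bullet> (0, j)) * \<phi> z \<partial>lborel) = - (\<integral>z. m z * pd \<phi> (0, j) z \<partial>lborel)"
    proof -
      have "(0, j) \<in> (Basis :: 'd ps set)" using j by simp
      then show ?thesis using wg \<phi> unfolding weak_grad_def by simp
    qed
    also have "- (\<integral>z. m z * pd \<phi> (0, j) z \<partial>lborel) + (\<integral>z. ((m z *\<^sub>R snd z) \<bullet> j) * \<phi> z \<partial>lborel)
        = (\<integral>z. ((m z *\<^sub>R snd z) \<bullet> j) * \<phi> z - m z * pd \<phi> (0, j) z \<partial>lborel)"
      using Bochner_Integration.integral_diff[OF b2 b3] by simp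
    also have "\<dots> = (\<integral>z. m z * (- pd \<phi> (0, j) z + (snd z \<bullet> j) * \<phi> z) \<partial>lborel)"
      by (rule Bochner_Integration.integral_cong) (simp_all add: algebra_simps)
    finally show "(\<integral>z. (h z \<bullet> j) * \<phi> z \<partial>lborel) = (\<integral>z. m z * (- pd \<phi> (0, j) z + (snd z \<bullet> j) * \<phi> z) \<partial>lborel)" .
  qed
qed

text \<open>The difference of two fluxes is weakly zero. Uniqueness matters because
  \<open>Dfish\<close> picks its flux by a choice operator; it allows any explicit flux to be used
  for estimating it.\<close>

lemma fp_flux_unique:
  assumes "fp_flux m h" "fp_flux m h'" shows "AE z in lborel. h z = h' z"
proof -
  have l: "loc_int h" "loc_int h'" using assms by (auto simp: fp_flux_def)
  have ld: "loc_int (\<lambda>z. h z - h' z)"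
    unfolding loc_int_def using set_integral_diff(1) l unfolding loc_int_def by blast
  have "AE z in lborel. h z - h' z = 0"
  proof (rule AE_zero_if_weakly_zero[OF ld])
    fix \<phi> :: "'a ps \<Rightarrow> real" and i :: "real^'a" assume \<phi>: "test_fun \<phi>" and i: "i \<in> Basis"
    have b: "integrable lborel (\<lambda>z. (g z \<bullet> i) * \<phi> z)" if "loc_int g" for g :: "'a ps \<Rightarrow> real^'a"
      using integrable_inner_left[OF integrable_test_mult[OF that \<phi>], where c=i] by (simp add: mult.commute)
    have "(\<integral>z. (h z - h' z) \<bullet> i * \<phi> z \<partial>lborel) = (\<integral>z. (h z \<bullet> i) * \<phi> z \<partial>lborel) - (\<integral>z. (h' z \<bullet> i) * \<phi> z \<partial>lborel)"
      using Bochner_Integration.integral_diff[OF b[OF l(1)] b[OF l(2)]] by (simp add: inner_diff_left left_diff_distrib)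
    also have "\<dots> = 0" using assms \<phi> i unfolding fp_flux_def by simp
    finally show "(\<integral>z. (h z - h' z) \<bullet> i * \<phi> z \<partial>lborel) = 0" .
  qed
  then show ?thesis by simp
qed

text \<open>The reflected kernel is itself a test function, so the definition of the weak flux, used
  with it, moves the derivative from the kernel to the density.\<close>

lemma fluxH_eq_cv:
  fixes m :: "'d::finite ps \<Rightarrow> real"
  assumes m: "integrable lborel m" "integrable lborel (\<lambda>z. m z *\<^sub>R snd z)" and k: "test_fun k"
    and h: "fp_flux m h" "integrable lborel h"
  shows "fluxH k m z = cv h k z"
proof (rule euclidean_eqI)
  fix i :: "real^'d" assume i: "i \<in> Basis"
  have tp: "test_fun (pd k (0, i))" using i by (intro test_fun_pd k) simp
  have i1: "integrable lborel (\<lambda>y. pd k (0, i) (z - y) * m y)" using cv_test_integrable[OF m(1) tp] by simp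
  have i2: "integrable lborel (\<lambda>y. k (z - y) * (m y * (snd y \<bullet> i)))"
    using integrable_inner_left[OF cv_test_integrable[OF m(2) k, where z=z], where c=i] by (simp add: mult.assoc)
  have "cv h k z \<bullet> i = (\<integral>y. (h y \<bullet> i) * k (z - y) \<partial>lborel)"
    by (subst cv_inner[OF h(2) k]) (simp add: cv_def mult.commute)
  also have "\<dots> = (\<integral>y. m y * (- pd (\<lambda>w. k (z - w)) (0, i) y + (snd y \<bullet> i) * k (z - y)) \<partial>lborel)"
    using h(1) test_fun_reflect[OF k] i unfolding fp_flux_def by blast
  also have "\<dots> = (\<integral>y. pd k (0, i) (z - y) * m y + k (z - y) * (m y * (snd y \<bullet> i)) \<partial>lborel)"
    by (rule Bochner_Integration.integral_cong) (simp_all add: smooth_pd_reflect[OF test_fun_smooth[OF k]] algebra_simps)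
  also have "\<dots> = cv m (pd k (0, i)) z + cv (\<lambda>y. m y * (snd y \<bullet> i)) k z"
    using Bochner_Integration.integral_add[OF i1 i2] by (simp add: cv_def)
  also have "\<dots> = fluxH k m z \<bullet> i"
    using i cv_inner[OF m(2) k, where z=z and i=i] by (simp add: fluxH_def inner_add_left inner_sum_left_Basis)
  finally show "fluxH k m z \<bullet> i = cv h k z \<bullet> i" by simp
qed

section \<open>Removal of the mollification\<close>

text \<open>A subsequence realises the liminf of a, a further one the liminf of b along it, and l
  converges along both. Entropy and dissipation can thus be bounded below separately although only
  their sum is controlled.\<close>

lemma liminf_add_le_lim:
  fixes a b l :: "nat \<Rightarrow> ennreal"
  assumes le: "\<And>n. a n + b n \<le> l n" and l: "l \<longlonglongrightarrow> L"
  shows "liminf a + liminf b \<le> L"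
proof -
  obtain r where r: "strict_mono r" "(a \<circ> r) \<longlonglongrightarrow> liminf a" using liminf_subseq_lim by blast
  obtain q where q: "strict_mono q" "(b \<circ> r \<circ> q) \<longlonglongrightarrow> liminf (b \<circ> r)" using liminf_subseq_lim by blast
  have 1: "(a \<circ> r \<circ> q) \<longlonglongrightarrow> liminf a" using LIMSEQ_subseq_LIMSEQ[OF r(2) q(1)] .
  have 2: "(l \<circ> r \<circ> q) \<longlonglongrightarrow> L" using LIMSEQ_subseq_LIMSEQ[OF LIMSEQ_subseq_LIMSEQ[OF l r(1)] q(1)] .
  have "liminf a + liminf (b \<circ> r) \<le> L"
    by (rule LIMSEQ_le[OF tendsto_add[OF 1 q(2)] 2]) (use le in auto)
  moreover have "liminf b \<le> liminf (b \<circ> r)" by (rule liminf_subseq_mono[OF r(1)])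
  ultimately show ?thesis using add_left_mono order_trans by blast
qed

text \<open>L1 convergence gives pointwise convergence only along a subsequence, which is extracted
  from one that realises the liminf of the integrals. For this reason semicontinuity is demanded
  along subsequences. The bound passes through a measurable v because \<Theta> is not assumed
  measurable.\<close>

lemma Fatou_along_L1:
  fixes u :: "nat \<Rightarrow> 'a \<Rightarrow> 'b::{banach, second_countable_topology}" and \<Psi> :: "nat \<Rightarrow> 'a \<Rightarrow> ennreal"
  assumes L1: "\<And>n. integrable M (u n)" "(\<lambda>n. \<integral>x. norm (u n x) \<partial>M) \<longlonglongrightarrow> 0"
    and m: "\<And>n. \<Psi> n \<in> borel_measurable M"
    and lsc: "\<And>x r. strict_mono r \<Longrightarrow> (\<lambda>n. u (r n) x) \<longlonglongrightarrow> 0 \<Longrightarrow> \<Theta> x \<le> liminf (\<lambda>n. \<Psi> (r n) x)"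
  shows "\<exists>v\<in>borel_measurable M. (AE x in M. \<Theta> x \<le> v x) \<and> (\<integral>\<^sup>+x. v x \<partial>M) \<le> liminf (\<lambda>n. \<integral>\<^sup>+x. \<Psi> n x \<partial>M)"
proof -
  define I where "I n = (\<integral>\<^sup>+x. \<Psi> n x \<partial>M)" for n
  obtain r where r: "strict_mono r" "(I \<circ> r) \<longlonglongrightarrow> liminf I" using liminf_subseq_lim by blast
  have "(\<lambda>n. \<integral>x. norm (u (r n) x) \<partial>M) \<longlonglongrightarrow> 0" using LIMSEQ_subseq_LIMSEQ[OF L1(2) r(1)] by (simp add: o_def)
  from tendsto_L1_AE_subseq[OF L1(1) this] obtain q where q: "strict_mono q" "AE x in M. (\<lambda>n. u (r (q n)) x) \<longlonglongrightarrow> 0" by auto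
  have rq: "strict_mono (r \<circ> q)" using r(1) q(1) by (rule strict_mono_o)
  define v where "v x = liminf (\<lambda>n. \<Psi> (r (q n)) x)" for x
  have "v \<in> borel_measurable M" unfolding v_def[abs_def] using m by measurable
  moreover have "AE x in M. \<Theta> x \<le> v x"
    using q(2) by eventually_elim (use lsc[OF rq] in \<open>simp add: v_def\<close>)
  moreover have "(\<integral>\<^sup>+x. v x \<partial>M) \<le> liminf I"
  proof -
    have "(\<integral>\<^sup>+x. v x \<partial>M) \<le> liminf (\<lambda>n. \<integral>\<^sup>+x. \<Psi> (r (q n)) x \<partial>M)"
      unfolding v_def by (rule nn_integral_liminf) (rule m)
    also have "\<dots> = liminf (I \<circ> r \<circ> q)" by (simp add: I_def o_def)
    also have "\<dots> = liminf I"
      using LIMSEQ_subseq_LIMSEQ[OF r(2) q(1)] by (intro lim_imp_Liminf) auto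
    finally show ?thesis .
  qed
  ultimately show ?thesis unfolding I_def by blast
qed

definition Ymoll :: "real \<Rightarrow> real \<Rightarrow> ('d::finite ps \<Rightarrow> real) \<Rightarrow> real" where
  "Ymoll \<gamma> \<kappa> f = (\<integral>z. Ureg \<kappa> (f z) + hpot \<gamma> z * f z \<partial>lborel) + CARD('d) * ln (2 * pi)"

definition Dmoll :: "real \<Rightarrow> ('d::finite ps \<Rightarrow> real) \<Rightarrow> ('d ps \<Rightarrow> real) \<Rightarrow> real" where
  "Dmoll \<kappa> k m = (\<integral>z. (norm (fluxH k m z))\<^sup>2 / (cv m k z + \<kappa>) \<partial>lborel)"

text \<open>The constant \<open>betaK\<close> outside its locale: it depends on c, c0 and the
  dimension alone, as independence of \<epsilon> and \<gamma> demands.\<close>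

definition betaG :: "real \<Rightarrow> real \<Rightarrow> 'd::finite itself \<Rightarrow> real" where
  "betaG c c0 t = CARD('d) + 5/2 + 5 * (2*c + c0)\<^sup>2 + lamK c * gaussC TYPE('d)"

text \<open>Adding this integrable Gaussian makes the entropy density nonnegative, so that Fatou applies to it.\<close>
definition W6 :: "'a::euclidean_space \<Rightarrow> real" where "W6 z = exp (- (1/6) * (norm z)\<^sup>2)"

lemma W6_integrable: "integrable lborel (W6 :: 'a::euclidean_space \<Rightarrow> real)"
  unfolding W6_def[abs_def] by (rule integrable_gaussian) simp

definition G6 :: "'d::finite itself \<Rightarrow> real" where "G6 t = (\<integral>z. W6 (z :: 'd ps) \<partial>lborel)"

text \<open>Fenchel-Young with minus the potential; the exponent 1/6 of \<open>W6\<close> is that of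
  the lower bound of the potential. The normalising term is nonnegative because 2 pi exceeds
  1.\<close>

lemma entd_lower:
  assumes "1 \<le> \<gamma>" "0 \<le> f z" shows "0 \<le> entd \<gamma> f z + W6 z"
proof -
  have "f z + (- hpot \<gamma> z) * f z - exp (- hpot \<gamma> z) \<le> f z * ln (f z)" by (rule Young_entropy[OF assms(2)])
  moreover have "exp (- hpot \<gamma> z) \<le> W6 z" using hpot_lower[OF assms(1), of z] by (simp add: W6_def)
  moreover have "0 \<le> CARD('a) * ln (2 * pi) * f z"
  proof -
    have "1 \<le> 2 * pi" using pi_ge_two by linarith
    then show ?thesis using assms(2) by simp
  qed
  ultimately show ?thesis using assms(2) unfolding entd_def by linarith
qed

context kinetic_mollified begin

text \<open>The shift is chosen for a given kernel, small enough that the accumulated error of the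
  logarithm is below e. In this order no uniformity in the kernel is asked of the
  convergence.\<close>

lemma mollified_inequality:
  assumes e: "e > 0"
  shows "\<exists>\<kappa>>0. \<kappa> \<le> e \<and> set_integrable lborel {0..T} (\<lambda>r. Dmoll \<kappa> k (\<mu> r)) \<and>
     (\<forall>t\<in>{0..T}. Ymoll \<gamma> \<kappa> (cv (\<mu> t) k) + (\<gamma>\<^sup>2 / 2) * (LINT r:{0..t}|lborel. Dmoll \<kappa> k (\<mu> r))
       \<le> (Ymoll \<gamma> \<kappa> (cv (\<mu> 0) k) + e) * exp (lamK c * t) + betaG c c0 TYPE('a) / lamK c * (exp (lamK c * t) - 1))"
proof -
  define K where "K n = e / real (Suc n)" for n
  have K: "K n > 0" "K n \<le> e" for n using e by (auto simp: K_def divide_le_eq mult_le_cancel_left1)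
  have "K \<longlonglongrightarrow> 0" unfolding K_def[abs_def] using tendsto_mult_right_zero[OF lim_1_over_n[THEN LIMSEQ_Suc], of e] by simp
  from LIMSEQ_D[OF Ek_tendsto[OF K(1) this] e] obtain n where n: "\<bar>LINT r:{0..T}|lborel. Ek (K n) r\<bar> < e" by auto
  have Y: "Yk \<kappa> t = Ymoll \<gamma> \<kappa> (cv (\<mu> t) k)" for \<kappa> t by (simp add: Yk_def Ymoll_def)
  have D: "Dk \<kappa> = (\<lambda>r. Dmoll \<kappa> k (\<mu> r))" for \<kappa> by (simp add: Dk_def Dmoll_def fun_eq_iff)
  have b: "betaK = betaG c c0 TYPE('a)" by (simp add: betaK_def betaG_def)
  have "Ymoll \<gamma> (K n) (cv (\<mu> t) k) + (\<gamma>\<^sup>2 / 2) * (LINT r:{0..t}|lborel. Dmoll (K n) k (\<mu> r))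
       \<le> (Ymoll \<gamma> (K n) (cv (\<mu> 0) k) + e) * exp (lamK c * t) + betaG c c0 TYPE('a) / lamK c * (exp (lamK c * t) - 1)"
    if t: "t \<in> {0..T}" for t
  proof -
    note mollified_entropy_inequality[OF K(1) t, of n, unfolded Y D b]
    also have "(Ymoll \<gamma> (K n) (cv (\<mu> 0) k) + (LINT r:{0..T}|lborel. Ek (K n) r)) * exp (lamK c * t) \<le> (Ymoll \<gamma> (K n) (cv (\<mu> 0) k) + e) * exp (lamK c * t)"
      using n by (intro mult_right_mono) auto
    finally show ?thesis by simp
  qed
  then show ?thesis using K[of n] Dk_integrable[OF K(1), of n, unfolded D] by (intro exI[of _ "K n"]) auto
qed

text \<open>Replacing s ln s by its regularisation only increases the integrand, and the added
  Gaussian compensates the negative part, so the limit can be taken among nonnegative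
  integrals.\<close>

lemma mollified_entropy_nn:
  assumes t: "t \<in> {0..T}" and \<kappa>: "\<kappa> > 0"
  shows "(\<integral>\<^sup>+z. ennreal (entd \<gamma> (cv (\<mu> t) k) z + W6 z) \<partial>lborel) \<le> ennreal (Ymoll \<gamma> \<kappa> (cv (\<mu> t) k) + G6 TYPE('a))"
    and "0 \<le> Ymoll \<gamma> \<kappa> (cv (\<mu> t) k) + G6 TYPE('a)"
proof -
  interpret sn: snapshot \<gamma> c c0 s M "\<mu> t" "F t" k by (rule snap[OF t])
  define g where "g z = (Ureg \<kappa> (ft t z) + hpot \<gamma> z * ft t z) + CARD('a) * ln (2 * pi) * ft t z + W6 z" for z
  have i1: "integrable lborel (\<lambda>z. Ureg \<kappa> (ft t z) + hpot \<gamma> z * ft t z)"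
    by (intro Bochner_Integration.integrable_add sn.Ureg_f_integrable[OF \<kappa>] sn.hpot_f_integrable)
  have i2: "integrable lborel (\<lambda>z. CARD('a) * ln (2 * pi) * ft t z)" by (intro integrable_mult_right wint_integrable sn.wf)
  have ig: "integrable lborel g"
    unfolding g_def[abs_def] by (intro Bochner_Integration.integrable_add i1 i2 W6_integrable)
  have Ig: "(\<integral>z. g z \<partial>lborel) = Ymoll \<gamma> \<kappa> (ft t) + G6 TYPE('a)"
    unfolding g_def Ymoll_def G6_def
    by (simp only: Bochner_Integration.integral_add Bochner_Integration.integrable_add i1 i2 W6_integrable integral_mult_right_zero sn.f_integral mult_1_right)
  have le: "entd \<gamma> (ft t) z + W6 z \<le> g z" for z
    using xlnx_le_Ureg[OF f_nonneg[OF t, of z] \<kappa>] by (simp add: entd_def g_def)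
  have g0: "0 \<le> g z" for z using entd_lower[where f="ft t" and z=z, OF gam f_nonneg[OF t, of z]] le[of z] by linarith
  have "(\<integral>\<^sup>+z. ennreal (entd \<gamma> (ft t) z + W6 z) \<partial>lborel) \<le> (\<integral>\<^sup>+z. ennreal (g z) \<partial>lborel)"
    by (intro nn_integral_mono ennreal_leI le)
  also have "\<dots> = ennreal (\<integral>z. g z \<partial>lborel)" using ig g0 by (intro nn_integral_eq_integral) auto
  finally show "(\<integral>\<^sup>+z. ennreal (entd \<gamma> (ft t) z + W6 z) \<partial>lborel) \<le> ennreal (Ymoll \<gamma> \<kappa> (ft t) + G6 TYPE('a))" unfolding Ig .
  show "0 \<le> Ymoll \<gamma> \<kappa> (ft t) + G6 TYPE('a)" unfolding Ig[symmetric] using g0 by (intro Bochner_Integration.integral_nonneg) auto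
qed

lemma mollified_fisher_nn:
  assumes t: "t \<in> {0..T}" and \<kappa>: "\<kappa> > 0"
  shows "(\<integral>\<^sup>+z. ennreal ((norm (fluxH k (\<mu> t) z))\<^sup>2 / (cv (\<mu> t) k z + \<kappa>)) \<partial>lborel) = ennreal (Dmoll \<kappa> k (\<mu> t))"
    and "(\<lambda>z. ennreal ((norm (fluxH k (\<mu> t) z))\<^sup>2 / (cv (\<mu> t) k z + \<kappa>))) \<in> borel_measurable lborel"
    and "0 \<le> Dmoll \<kappa> k (\<mu> t)"
proof -
  interpret sn: snapshot \<gamma> c c0 s M "\<mu> t" "F t" k by (rule snap[OF t])
  have n: "0 \<le> (norm (fluxH k (\<mu> t) z))\<^sup>2 / (cv (\<mu> t) k z + \<kappa>)" for z using f_nonneg[OF t, of z] \<kappa> by simp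
  note i = sn.fisher_integrable[OF \<kappa>]
  show "(\<integral>\<^sup>+z. ennreal ((norm (fluxH k (\<mu> t) z))\<^sup>2 / (cv (\<mu> t) k z + \<kappa>)) \<partial>lborel) = ennreal (Dmoll \<kappa> k (\<mu> t))"
    unfolding Dmoll_def using i n by (intro nn_integral_eq_integral) auto
  show "(\<lambda>z. ennreal ((norm (fluxH k (\<mu> t) z))\<^sup>2 / (cv (\<mu> t) k z + \<kappa>))) \<in> borel_measurable lborel"
    by (intro measurable_compose[OF borel_measurable_integrable[OF i] measurable_ennreal])
  show "0 \<le> Dmoll \<kappa> k (\<mu> t)" unfolding Dmoll_def using n by (intro Bochner_Integration.integral_nonneg) auto
qed

end

text \<open>Lower semicontinuity of |h|^2/x, extended by infinity at x = 0 when h is not 0. This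
  infinite value is what later forces the flux to vanish where the density does.\<close>

lemma fisher_lsc:
  fixes f :: "nat \<Rightarrow> real" and H :: "nat \<Rightarrow> 'b::euclidean_space"
  assumes f: "f \<longlonglongrightarrow> x" "\<And>n. 0 \<le> f n" and H: "H \<longlonglongrightarrow> h" and \<kappa>: "\<And>n. \<kappa> n > 0" "\<kappa> \<longlonglongrightarrow> 0"
  shows "(if x > 0 then ennreal ((norm h)\<^sup>2 / x) else if h = 0 then 0 else \<infinity>) \<le> liminf (\<lambda>n. ennreal ((norm (H n))\<^sup>2 / (f n + \<kappa> n)))"
proof -
  have x0: "0 \<le> x" using f by (intro LIMSEQ_le_const) auto
  have fk: "(\<lambda>n. f n + \<kappa> n) \<longlonglongrightarrow> x" using tendsto_add[OF f(1) \<kappa>(2)] by simp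
  have Hn: "(\<lambda>n. (norm (H n))\<^sup>2) \<longlonglongrightarrow> (norm h)\<^sup>2" by (intro tendsto_intros H)
  have pos: "f n + \<kappa> n > 0" for n using f(2)[of n] \<kappa>(1)[of n] by simp
  consider "x > 0" | "x = 0" "h = 0" | "x = 0" "h \<noteq> 0" using x0 by fastforce
  then show ?thesis
  proof cases
    case 1
    then have "(\<lambda>n. (norm (H n))\<^sup>2 / (f n + \<kappa> n)) \<longlonglongrightarrow> (norm h)\<^sup>2 / x" by (intro tendsto_intros Hn fk) auto
    then have "(\<lambda>n. ennreal ((norm (H n))\<^sup>2 / (f n + \<kappa> n))) \<longlonglongrightarrow> ennreal ((norm h)\<^sup>2 / x)" by (rule tendsto_ennrealI)
    then have "liminf (\<lambda>n. ennreal ((norm (H n))\<^sup>2 / (f n + \<kappa> n))) = ennreal ((norm h)\<^sup>2 / x)" by (intro lim_imp_Liminf) auto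
    then show ?thesis using 1 by simp
  next
    case 3
    have "filterlim (\<lambda>n. (norm (H n))\<^sup>2 / (f n + \<kappa> n)) at_top sequentially"
    proof -
      have "filterlim (\<lambda>n. inverse (f n + \<kappa> n)) at_top sequentially"
        using fk 3 pos by (intro filterlim_inverse_at_top) auto
      moreover have "(norm h)\<^sup>2 > 0" using 3 by simp
      ultimately show ?thesis unfolding divide_inverse using filterlim_tendsto_pos_mult_at_top[OF Hn] by blast
    qed
    then have ev: "eventually (\<lambda>n. real B \<le> (norm (H n))\<^sup>2 / (f n + \<kappa> n)) sequentially" for B :: nat
      by (simp add: filterlim_at_top)
    have "of_nat B \<le> liminf (\<lambda>n. ennreal ((norm (H n))\<^sup>2 / (f n + \<kappa> n)))" for B :: nat
    proof (rule Liminf_bounded)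
      show "eventually (\<lambda>n. of_nat B \<le> ennreal ((norm (H n))\<^sup>2 / (f n + \<kappa> n))) sequentially"
        using ev[of B] by eventually_elim (simp add: ennreal_of_nat_eq_real_of_nat ennreal_leI)
    qed
    then have "liminf (\<lambda>n. ennreal ((norm (H n))\<^sup>2 / (f n + \<kappa> n))) = top"
      by (metis ennreal_Ex_less_of_nat leD top.not_eq_extremum)
    then show ?thesis by simp
  qed simp
qed

text \<open>A finite integral of v excludes the value infinity almost everywhere, so h vanishes
  where m does. The flux chosen in \<open>Dfish\<close> then agrees with h almost everywhere by
  uniqueness.\<close>

lemma Dfish_le:
  fixes m :: "'d::finite ps \<Rightarrow> real"
  assumes h: "fp_flux m h" and m0: "\<And>z. 0 \<le> m z"
    and v: "v \<in> borel_measurable lborel" "AE z in lborel. (if m z > 0 then ennreal ((norm (h z))\<^sup>2 / m z) else if h z = 0 then 0 else \<infinity>) \<le> v z"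
  shows "Dfish m \<le> (\<integral>\<^sup>+z. v z \<partial>lborel) \<or> (\<integral>\<^sup>+z. v z \<partial>lborel) = \<infinity>"
    and "(\<integral>\<^sup>+z. v z \<partial>lborel) \<noteq> \<infinity> \<Longrightarrow> flux_ac m"
proof -
  have ac: "flux_ac m" if fin: "(\<integral>\<^sup>+z. v z \<partial>lborel) \<noteq> \<infinity>"
  proof -
    have "AE z in lborel. v z \<noteq> \<infinity>" by (rule nn_integral_PInf_AE[OF v(1) fin])
    with v(2) have "AE z in lborel. m z = 0 \<longrightarrow> h z = 0"
      by eventually_elim (auto split: if_splits simp: top_unique)
    then show ?thesis unfolding flux_ac_def using h by blast
  qed
  show "flux_ac m" if "(\<integral>\<^sup>+z. v z \<partial>lborel) \<noteq> \<infinity>" using ac[OF that] .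
  show "Dfish m \<le> (\<integral>\<^sup>+z. v z \<partial>lborel) \<or> (\<integral>\<^sup>+z. v z \<partial>lborel) = \<infinity>"
  proof (cases "(\<integral>\<^sup>+z. v z \<partial>lborel) = \<infinity>")
    case False
    note a = ac[OF False]
    define h' where "h' = (SOME h. fp_flux m h \<and> (AE z in lborel. m z = 0 \<longrightarrow> h z = 0))"
    have "fp_flux m h' \<and> (AE z in lborel. m z = 0 \<longrightarrow> h' z = 0)"
      unfolding h'_def using a unfolding flux_ac_def by (rule someI_ex)
    then have "AE z in lborel. h z = h' z" using fp_flux_unique[OF h] by blast
    with v(2) have "AE z in lborel. ennreal ((norm (h' z))\<^sup>2 / m z) * indicator {z. m z > 0} z \<le> v z"
      by eventually_elim (auto split: if_splits simp: indicator_def)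
    then have "(\<integral>\<^sup>+z\<in>{z. m z > 0}. ennreal ((norm (h' z))\<^sup>2 / m z) \<partial>lborel) \<le> (\<integral>\<^sup>+z. v z \<partial>lborel)"
      by (rule nn_integral_mono_AE)
    then show ?thesis unfolding Dfish_def using a by (simp add: h'_def Let_def)
  qed simp
qed

lemma ennreal_mult_liminf_le:
  fixes X :: "nat \<Rightarrow> ennreal"
  shows "a * liminf X \<le> liminf (\<lambda>n. a * X n)"
  unfolding liminf_SUP_INF SUP_mult_left_ennreal
  by (intro SUP_mono' INF_greatest mult_left_mono INF_lower) auto

lemma cv_close:
  fixes \<sigma> :: "'a::euclidean_space \<Rightarrow> real"
  assumes \<sigma>: "integrable lborel \<sigma>" and k: "test_fun k" "\<And>z. 0 \<le> k z" "(\<integral>z. k z \<partial>lborel) = 1"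
    and e: "\<And>y. k (z - y) \<noteq> 0 \<Longrightarrow> \<bar>\<sigma> y - \<sigma> z\<bar> \<le> e"
  shows "\<bar>cv \<sigma> k z - \<sigma> z\<bar> \<le> e"
proof -
  have ik: "integrable lborel (\<lambda>y. k (z - y))" "(\<integral>y. k (z - y) \<partial>lborel) = 1"
    using integrable_lborel_minus[OF test_fun_integrable[OF k(1)], of z] integral_lborel_minus[of k z]
      test_fun_measurable[OF k(1)] k(3) by auto
  have i1: "integrable lborel (\<lambda>y. k (z - y) * \<sigma> y)" using cv_test_integrable[OF \<sigma> k(1)] by simp
  have i2: "integrable lborel (\<lambda>y. k (z - y) * \<sigma> z)" using ik(1) by simp
  have "cv \<sigma> k z - \<sigma> z = (\<integral>y. k (z - y) * \<sigma> y \<partial>lborel) - (\<integral>y. k (z - y) * \<sigma> z \<partial>lborel)"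
    using ik(2) by (simp add: cv_def)
  also have "\<dots> = (\<integral>y. k (z - y) * \<sigma> y - k (z - y) * \<sigma> z \<partial>lborel)"
    by (rule Bochner_Integration.integral_diff[OF i1 i2, symmetric])
  finally have eq: "cv \<sigma> k z - \<sigma> z = (\<integral>y. k (z - y) * \<sigma> y - k (z - y) * \<sigma> z \<partial>lborel)" .
  have "norm (\<integral>y. k (z - y) * \<sigma> y - k (z - y) * \<sigma> z \<partial>lborel) \<le> (\<integral>y. k (z - y) * e \<partial>lborel)"
  proof (rule Bochner_Integration.integral_norm_bound_integral)
    show "norm (k (z - y) * \<sigma> y - k (z - y) * \<sigma> z) \<le> k (z - y) * e" for y
    proof (cases "k (z - y) = 0")
      case False
      have "norm (k (z - y) * \<sigma> y - k (z - y) * \<sigma> z) = k (z - y) * \<bar>\<sigma> y - \<sigma> z\<bar>"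
        using k(2)[of "z - y"] by (simp add: right_diff_distrib[symmetric] abs_mult)
      also have "\<dots> \<le> k (z - y) * e" by (intro mult_left_mono e False k(2))
      finally show ?thesis .
    qed simp
  qed (use i1 i2 ik in auto)
  then show ?thesis using ik(2) by (simp add: eq)
qed

lemma abs_xlnx_le:
  fixes y :: real
  assumes "0 \<le> y" shows "\<bar>y * ln y\<bar> \<le> 1 + y\<^sup>2"
proof (cases "y = 0")
  case False
  then have "ln y \<le> y - 1" using assms by (intro ln_le_minus_one) simp
  from mult_left_mono[OF this assms] have "y * ln y \<le> y\<^sup>2 - y" by (simp add: power2_eq_square right_diff_distrib)
  then show ?thesis using xlnx_lower[OF assms] assms zero_le_power2[of y] by linarith
qed simp

lemma abs_Ureg_le:
  assumes "0 \<le> x" "x \<le> C" "0 < \<kappa>" "\<kappa> \<le> 1" shows "\<bar>Ureg \<kappa> x\<bar> \<le> 3 + (C + 1)\<^sup>2"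
proof -
  have "\<bar>(x + \<kappa>) * ln (x + \<kappa>)\<bar> \<le> 1 + (x + \<kappa>)\<^sup>2" using assms by (intro abs_xlnx_le) simp
  moreover have "(x + \<kappa>)\<^sup>2 \<le> (C + 1)\<^sup>2" using assms by (intro power_mono) auto
  moreover have "\<bar>\<kappa> * ln \<kappa>\<bar> \<le> 1 + \<kappa>\<^sup>2" using assms by (intro abs_xlnx_le) simp
  moreover have "\<kappa>\<^sup>2 \<le> 1" using assms by (simp add: power_le_one)
  ultimately show ?thesis unfolding Ureg_def by linarith
qed

lemma hpot_continuous: "continuous_on S (hpot \<gamma> :: 'd::finite ps \<Rightarrow> real)"
  unfolding hpot_def[abs_def] by (intro continuous_intros) auto

text \<open>For a smooth compactly supported datum the mollifications converge uniformly and stay in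
  one ball, so dominated convergence gives the exact limit. At time 0 the entropy must be bounded
  from above, which lower semicontinuity cannot provide.\<close>

lemma mollified_initial_entropy:
  fixes \<sigma> :: "'d::finite ps \<Rightarrow> real" and k :: "nat \<Rightarrow> 'd ps \<Rightarrow> real"
  assumes \<sigma>: "test_fun \<sigma>" "\<And>z. 0 \<le> \<sigma> z" "(\<integral>z. \<sigma> z \<partial>lborel) = 1"
    and k: "\<And>n. test_fun (k n)" "\<And>n z. 0 \<le> k n z" "\<And>n. (\<integral>z. k n z \<partial>lborel) = 1"
    and supp: "\<And>n z. k n z \<noteq> 0 \<Longrightarrow> norm z \<le> r n" and r: "r \<longlonglongrightarrow> 0" "\<And>n. r n \<le> 1"
    and \<kappa>: "\<And>n. 0 < \<kappa> n" "\<And>n. \<kappa> n \<le> 1" "\<kappa> \<longlonglongrightarrow> 0"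
  shows "(\<lambda>n. Ymoll \<gamma> (\<kappa> n) (cv \<sigma> (k n))) \<longlonglongrightarrow> (\<integral>z. entd \<gamma> \<sigma> z \<partial>lborel)"
    and "integrable lborel (entd \<gamma> \<sigma>)"
proof -
  note i\<sigma> = test_fun_integrable[OF \<sigma>(1)]
  obtain L where L: "L > 0" "\<And>x y. \<bar>\<sigma> x - \<sigma> y\<bar> \<le> L * norm (x - y)" using test_fun_Lipschitz[OF \<sigma>(1)] by blast
  obtain R where R: "R > 0" "\<And>z. norm z > R \<Longrightarrow> \<sigma> z = 0" using test_fun_support[OF \<sigma>(1)] by blast
  obtain C where C: "C > 0" "\<And>z. \<bar>\<sigma> z\<bar> \<le> C" using test_fun_bounded[OF \<sigma>(1)] by blast
  have "bounded (hpot \<gamma> ` (cball 0 (R + 1) :: 'd ps set))"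
    by (intro compact_imp_bounded compact_continuous_image hpot_continuous compact_cball)
  then obtain B where B: "\<And>z :: 'd ps. norm z \<le> R + 1 \<Longrightarrow> \<bar>hpot \<gamma> z\<bar> \<le> B" unfolding bounded_iff ball_simps(9) by (metis mem_cball_0 real_norm_def)
  define f where "f n = cv \<sigma> (k n)" for n
  have [measurable]: "f n \<in> borel_measurable borel" for n unfolding f_def by (rule cv_measurable[OF i\<sigma> k(1)])
  have [measurable]: "\<sigma> \<in> borel_measurable borel" by (rule test_fun_measurable[OF \<sigma>(1)])
  have f0: "0 \<le> f n z" for n z
    unfolding f_def cv_def by (intro Bochner_Integration.integral_nonneg) (simp add: k(2) \<sigma>(2))
  have r0: "0 \<le> r n" for n
  proof (rule ccontr)
    assume "\<not> 0 \<le> r n"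
    then have "k n z = 0" for z using supp[of n z] norm_ge_zero[of z] by linarith
    then show False using k(3)[of n] by simp
  qed
  have close: "\<bar>f n z - \<sigma> z\<bar> \<le> L * r n" for n z
    unfolding f_def
  proof (rule cv_close[OF i\<sigma> k])
    fix y assume "k n (z - y) \<noteq> 0"
    then have "norm (y - z) \<le> r n" using supp[of n "z - y"] by (simp add: norm_minus_commute)
    then show "\<bar>\<sigma> y - \<sigma> z\<bar> \<le> L * r n" using L(2)[of y z] mult_left_mono[of "norm (y - z)" "r n" L] L(1) by linarith
  qed
  have out: "f n z = 0" if z: "norm z > R + 1" for n z
  proof -
    have "\<bar>f n z - \<sigma> z\<bar> \<le> 0" unfolding f_def
    proof (rule cv_close[OF i\<sigma> k])
      fix y assume "k n (z - y) \<noteq> 0"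
      then have "norm (z - y) \<le> 1" using supp[of n "z - y"] r(2)[of n] by linarith
      then have "norm y > R" using z norm_triangle_ineq2[of z y] by linarith
      then show "\<bar>\<sigma> y - \<sigma> z\<bar> \<le> 0" using R(2)[of y] R(2)[of z] z by simp
    qed
    then show ?thesis using R(2)[of z] z by simp
  qed
  have fC: "f n z \<le> C + L" for n z
  proof -
    have "L * r n \<le> L" using mult_left_mono[OF r(2)[of n], of L] L(1) by simp
    then show ?thesis using close[of n z] C(2)[of z] by linarith
  qed
  define g where "g n z = Ureg (\<kappa> n) (f n z) + hpot \<gamma> z * f n z" for n z
  \<comment> \<open>On the enlarged ball the regularised entropy is bounded by 3 + (C + L + 1)^2
    uniformly in the shift, and B bounds the potential.\<close>
  define w where "w z = indicator (cball 0 (R + 1)) z * (3 + (C + L + 1)\<^sup>2 + B * (C + L))" for z :: "'d ps"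
  have wi: "integrable lborel w"
    unfolding w_def[abs_def]
    by (intro integrable_mult_left integrable_real_indicator emeasure_lborel_cball_finite) simp
  have gw: "norm (g n z) \<le> w z" for n z
  proof (cases "norm z \<le> R + 1")
    case True
    have "\<bar>hpot \<gamma> z * f n z\<bar> \<le> B * (C + L)"
      unfolding abs_mult using B[OF True] fC[of n z] f0[of n z] by (intro mult_mono) auto
    moreover have "\<bar>Ureg (\<kappa> n) (f n z)\<bar> \<le> 3 + (C + L + 1)\<^sup>2" by (rule abs_Ureg_le[OF f0 fC \<kappa>(1,2)])
    moreover have "w z = 3 + (C + L + 1)\<^sup>2 + B * (C + L)" using True by (simp add: w_def)
    ultimately show ?thesis unfolding g_def real_norm_def by linarith
  next
    case False
    then show ?thesis using out[of z n] by (simp add: g_def w_def)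
  qed
  have flim: "(\<lambda>n. f n z) \<longlonglongrightarrow> \<sigma> z" for z
  proof (rule LIM_zero_cancel, rule Lim_null_comparison)
    show "(\<lambda>n. L * r n) \<longlonglongrightarrow> 0" using tendsto_mult_right_zero[OF r(1)] by simp
  qed (use close in auto)
  have glim: "(\<lambda>n. g n z) \<longlonglongrightarrow> \<sigma> z * ln (\<sigma> z) + hpot \<gamma> z * \<sigma> z" for z
  proof -
    have "(\<lambda>n. f n z + \<kappa> n) \<longlonglongrightarrow> \<sigma> z" using tendsto_add[OF flim \<kappa>(3)] by simp
    then have x1: "(\<lambda>n. (f n z + \<kappa> n) * ln (f n z + \<kappa> n)) \<longlonglongrightarrow> \<sigma> z * ln (\<sigma> z)"
      by (rule tendsto_xlnx) (intro add_nonneg_nonneg f0 less_imp_le \<kappa>(1))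
    have x2: "(\<lambda>n. \<kappa> n * ln (\<kappa> n)) \<longlonglongrightarrow> 0 * ln 0"
      by (rule tendsto_xlnx[OF \<kappa>(3)]) (intro less_imp_le \<kappa>(1))
    have "(\<lambda>n. (f n z + \<kappa> n) * ln (f n z + \<kappa> n) - \<kappa> n * ln (\<kappa> n) + hpot \<gamma> z * f n z) \<longlonglongrightarrow> \<sigma> z * ln (\<sigma> z) - 0 * ln 0 + hpot \<gamma> z * \<sigma> z"
      by (rule tendsto_add[OF tendsto_diff[OF x1 x2] tendsto_mult[OF tendsto_const flim]])
    then show ?thesis by (simp add: g_def Ureg_def)
  qed
  have gm: "g n \<in> borel_measurable lborel" for n unfolding g_def[abs_def] Ureg_def by measurable
  have lm: "(\<lambda>z. \<sigma> z * ln (\<sigma> z) + hpot \<gamma> z * \<sigma> z) \<in> borel_measurable lborel" by measurable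
  have dl: "integrable lborel (\<lambda>z. \<sigma> z * ln (\<sigma> z) + hpot \<gamma> z * \<sigma> z)"
    by (rule integrable_dominated_convergence[where s=g, OF lm gm wi AE_I2[OF glim] AE_I2[OF gw]])
  have il: "(\<lambda>n. \<integral>z. g n z \<partial>lborel) \<longlonglongrightarrow> (\<integral>z. \<sigma> z * ln (\<sigma> z) + hpot \<gamma> z * \<sigma> z \<partial>lborel)"
    by (rule integral_dominated_convergence[where s=g, OF lm gm wi AE_I2[OF glim] AE_I2[OF gw]])
  have i2: "integrable lborel (\<lambda>z. CARD('d) * ln (2 * pi) * \<sigma> z)" using i\<sigma> by simp
  have e: "entd \<gamma> \<sigma> = (\<lambda>z. (\<sigma> z * ln (\<sigma> z) + hpot \<gamma> z * \<sigma> z) + CARD('d) * ln (2 * pi) * \<sigma> z)"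
    by (simp add: entd_def fun_eq_iff)
  show "integrable lborel (entd \<gamma> \<sigma>)" unfolding e by (rule Bochner_Integration.integrable_add[OF dl i2])
  have "(\<integral>z. entd \<gamma> \<sigma> z \<partial>lborel) = (\<integral>z. \<sigma> z * ln (\<sigma> z) + hpot \<gamma> z * \<sigma> z \<partial>lborel) + CARD('d) * ln (2 * pi)"
    unfolding e by (subst Bochner_Integration.integral_add[OF dl i2]) (simp add: \<sigma>(3))
  then show "(\<lambda>n. Ymoll \<gamma> (\<kappa> n) (cv \<sigma> (k n))) \<longlonglongrightarrow> (\<integral>z. entd \<gamma> \<sigma> z \<partial>lborel)"
    unfolding Ymoll_def using tendsto_add[OF il tendsto_const] by (simp add: g_def f_def)
qed

section \<open>The limit of vanishing mollification\<close>

locale kinetic_sequence = kinetic \<gamma> c c0 T \<mu> F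
  for \<gamma> c c0 T :: real and \<mu> :: "real \<Rightarrow> 'a::finite ps \<Rightarrow> real" and F :: "real \<Rightarrow> 'a ps \<Rightarrow> real^'a" +
  fixes M :: real and s \<kappa> :: "nat \<Rightarrow> real" and k :: "nat \<Rightarrow> 'a ps \<Rightarrow> real"
  assumes km: "\<And>n. kinetic_mollified \<gamma> c c0 T \<mu> F M (s n) (k n)"
    and supp: "\<And>n z. k n z \<noteq> 0 \<Longrightarrow> norm z \<le> 1 / real (Suc n)"
    and kap: "\<And>n. 0 < \<kappa> n" "\<And>n. \<kappa> n \<le> 1 / real (Suc n)"
    and Di: "\<And>n. set_integrable lborel {0..T} (\<lambda>r. Dmoll (\<kappa> n) (k n) (\<mu> r))"
    and ineq: "\<And>n t. t \<in> {0..T} \<Longrightarrow>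
      Ymoll \<gamma> (\<kappa> n) (cv (\<mu> t) (k n)) + (\<gamma>\<^sup>2 / 2) * (LINT r:{0..t}|lborel. Dmoll (\<kappa> n) (k n) (\<mu> r))
       \<le> (Ymoll \<gamma> (\<kappa> n) (cv (\<mu> 0) (k n)) + 1 / real (Suc n)) * exp (lamK c * t) + betaG c c0 TYPE('a) / lamK c * (exp (lamK c * t) - 1)"
    and wgrad: "\<And>t. t \<in> {0..T} \<Longrightarrow> \<exists>G. weak_grad (\<mu> t) G \<and>
      integrable lborel (\<lambda>z. (1 + (norm (fst z))\<^sup>2 + (norm (snd z))\<^sup>2) * (\<bar>\<mu> t z\<bar> + norm (G z)))"
begin

lemma kernel: "test_fun (k n)" "0 \<le> k n z" "(\<integral>z. k n z \<partial>lborel) = 1"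
  using kinetic_mollified.k[OF km] kinetic_mollified.k0[OF km] kinetic_mollified.k1[OF km] by auto

lemma inverse_Suc_tendsto: "(\<lambda>n. 1 / real (Suc n)) \<longlonglongrightarrow> 0"
  by (rule lim_1_over_n[THEN LIMSEQ_Suc])

lemma kap_tendsto: "\<kappa> \<longlonglongrightarrow> 0"
  by (rule real_tendsto_sandwich[OF _ _ tendsto_const inverse_Suc_tendsto])
    (use kap in \<open>auto intro!: always_eventually less_imp_le\<close>)

lemma kap_le_1: "\<kappa> n \<le> 1"
  using kap(2)[of n] by (rule order_trans) simp

lemma moll_L1:
  fixes \<sigma> :: "'a ps \<Rightarrow> 'b::euclidean_space"
  assumes "integrable lborel \<sigma>" shows "(\<lambda>n. \<integral>z. norm (cv \<sigma> (k n) z - \<sigma> z) \<partial>lborel) \<longlonglongrightarrow> 0"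
  by (rule mollify_L1[OF assms kernel supp inverse_Suc_tendsto])

lemma T0: "0 \<in> {0..T}" using T by simp

definition E0 :: real where "E0 = (\<integral>z. entd \<gamma> (\<mu> 0) z \<partial>lborel)"

lemma initial:
  "(\<lambda>n. Ymoll \<gamma> (\<kappa> n) (cv (\<mu> 0) (k n))) \<longlonglongrightarrow> E0" "integrable lborel (entd \<gamma> (\<mu> 0))"
  unfolding E0_def
  by (rule mollified_initial_entropy[OF init mu(2,4)[OF T0] kernel supp inverse_Suc_tendsto _ kap(1) kap_le_1 kap_tendsto]; simp)+

definition Rb :: "nat \<Rightarrow> real \<Rightarrow> real" where
  "Rb n t = (Ymoll \<gamma> (\<kappa> n) (cv (\<mu> 0) (k n)) + 1 / real (Suc n)) * exp (lamK c * t) + betaG c c0 TYPE('a) / lamK c * (exp (lamK c * t) - 1)"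

definition Rl :: "real \<Rightarrow> real" where
  "Rl t = E0 * exp (lamK c * t) + betaG c c0 TYPE('a) / lamK c * (exp (lamK c * t) - 1)"

lemma Rb_tendsto: "(\<lambda>n. Rb n t) \<longlonglongrightarrow> Rl t"
proof -
  have "(\<lambda>n. Rb n t) \<longlonglongrightarrow> (E0 + 0) * exp (lamK c * t) + betaG c c0 TYPE('a) / lamK c * (exp (lamK c * t) - 1)"
    unfolding Rb_def by (intro tendsto_intros initial(1) inverse_Suc_tendsto)
  then show ?thesis by (simp add: Rl_def)
qed

lemma cv_mu_nonneg: "t \<in> {0..T} \<Longrightarrow> 0 \<le> cv (\<mu> t) (k n) z"
  by (rule kinetic_mollified.f_nonneg[OF km])

text \<open>With the Gaussian added the entropy densities are nonnegative, and s ln s is continuous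
  up to 0, so Fatou's lemma applies along the L1 convergence of the mollifications.\<close>

lemma entropy_liminf:
  assumes t: "t \<in> {0..T}"
  shows "(\<integral>\<^sup>+z. ennreal (entd \<gamma> (\<mu> t) z + W6 z) \<partial>lborel) \<le> liminf (\<lambda>n. ennreal (Ymoll \<gamma> (\<kappa> n) (cv (\<mu> t) (k n)) + G6 TYPE('a)))"
proof -
  note i = mu(3)[OF t]
  have [measurable]: "cv (\<mu> t) (k n) \<in> borel_measurable borel" for n by (rule cv_measurable[OF i kernel(1)])
  have [measurable]: "(W6 :: 'a ps \<Rightarrow> real) \<in> borel_measurable borel" using W6_integrable by auto
  obtain v where v: "AE z in lborel. ennreal (entd \<gamma> (\<mu> t) z + W6 z) \<le> v z"
      "(\<integral>\<^sup>+z. v z \<partial>lborel) \<le> liminf (\<lambda>n. \<integral>\<^sup>+z. ennreal (entd \<gamma> (cv (\<mu> t) (k n)) z + W6 z) \<partial>lborel)"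
  proof -
    have "\<exists>v\<in>borel_measurable lborel. (AE z in lborel. ennreal (entd \<gamma> (\<mu> t) z + W6 z) \<le> v z) \<and>
      (\<integral>\<^sup>+z. v z \<partial>lborel) \<le> liminf (\<lambda>n. \<integral>\<^sup>+z. ennreal (entd \<gamma> (cv (\<mu> t) (k n)) z + W6 z) \<partial>lborel)"
    proof (rule Fatou_along_L1[where u="\<lambda>n z. cv (\<mu> t) (k n) z - \<mu> t z"])
      show "integrable lborel (\<lambda>z. cv (\<mu> t) (k n) z - \<mu> t z)" for n
        by (rule Bochner_Integration.integrable_diff[OF cv_integrable[OF i kernel(1)] i])
      show "(\<lambda>n. \<integral>z. norm (cv (\<mu> t) (k n) z - \<mu> t z) \<partial>lborel) \<longlonglongrightarrow> 0" by (rule moll_L1[OF i])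
      show "(\<lambda>z. ennreal (entd \<gamma> (cv (\<mu> t) (k n)) z + W6 z)) \<in> borel_measurable lborel" for n
        unfolding entd_def by measurable
      fix z :: "'a ps" and r :: "nat \<Rightarrow> nat"
      assume "(\<lambda>n. cv (\<mu> t) (k (r n)) z - \<mu> t z) \<longlonglongrightarrow> 0"
      then have l: "(\<lambda>n. cv (\<mu> t) (k (r n)) z) \<longlonglongrightarrow> \<mu> t z" by (rule LIM_zero_cancel)
      have "(\<lambda>n. entd \<gamma> (cv (\<mu> t) (k (r n))) z + W6 z) \<longlonglongrightarrow> entd \<gamma> (\<mu> t) z + W6 z"
        unfolding entd_def by (intro tendsto_intros l tendsto_xlnx cv_mu_nonneg[OF t])
      then have "(\<lambda>n. ennreal (entd \<gamma> (cv (\<mu> t) (k (r n))) z + W6 z)) \<longlonglongrightarrow> ennreal (entd \<gamma> (\<mu> t) z + W6 z)"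
        by (rule tendsto_ennrealI)
      then show "ennreal (entd \<gamma> (\<mu> t) z + W6 z) \<le> liminf (\<lambda>n. ennreal (entd \<gamma> (cv (\<mu> t) (k (r n))) z + W6 z))"
        by (subst lim_imp_Liminf) auto
    qed
    then show ?thesis using that by blast
  qed
  have "(\<integral>\<^sup>+z. ennreal (entd \<gamma> (\<mu> t) z + W6 z) \<partial>lborel) \<le> (\<integral>\<^sup>+z. v z \<partial>lborel)" by (rule nn_integral_mono_AE[OF v(1)])
  also note v(2)
  also have "liminf (\<lambda>n. \<integral>\<^sup>+z. ennreal (entd \<gamma> (cv (\<mu> t) (k n)) z + W6 z) \<partial>lborel)
      \<le> liminf (\<lambda>n. ennreal (Ymoll \<gamma> (\<kappa> n) (cv (\<mu> t) (k n)) + G6 TYPE('a)))"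
    by (intro Liminf_mono always_eventually allI kinetic_mollified.mollified_entropy_nn(1)[OF km t kap(1)])
  finally show ?thesis .
qed

text \<open>The weak gradient provides an integrable flux h, so the mollified flux is a convolution
  of h and converges in L1, and Fatou's lemma applies to the semicontinuous integrand. Its infinite
  value turns finiteness of the liminf into absolute continuity of the flux.\<close>

lemma fisher_liminf:
  assumes t: "t \<in> {0..T}"
  shows "Dfish (\<mu> t) \<le> liminf (\<lambda>n. ennreal (Dmoll (\<kappa> n) (k n) (\<mu> t)))"
    and "liminf (\<lambda>n. ennreal (Dmoll (\<kappa> n) (k n) (\<mu> t))) \<noteq> \<infinity> \<Longrightarrow> flux_ac (\<mu> t)"
proof -
  note i = mu(3)[OF t]
  obtain G where G: "weak_grad (\<mu> t) G"
      "integrable lborel (\<lambda>z. (1 + (norm (fst z))\<^sup>2 + (norm (snd z))\<^sup>2) * (\<bar>\<mu> t z\<bar> + norm (G z)))"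
    using wgrad[OF t] by blast
  define h where "h z = snd (G z) + \<mu> t z *\<^sub>R snd z" for z
  have h: "integrable lborel h" "fp_flux (\<mu> t) h"
    unfolding h_def[abs_def] by (rule weak_grad_flux[OF dens[OF t] G])+
  have iv: "integrable lborel (\<lambda>z. \<mu> t z *\<^sub>R snd z)"
  proof (rule integrable_le[OF G(2)])
    have [measurable]: "\<mu> t \<in> borel_measurable borel" by (rule mu(1)[OF t])
    show "(\<lambda>z. \<mu> t z *\<^sub>R snd z) \<in> borel_measurable lborel" by measurable
    fix z :: "'a ps"
    have "norm (snd z) \<le> 1 + (norm (fst z))\<^sup>2 + (norm (snd z))\<^sup>2"
      using norm_le_one_plus[of "snd z"] zero_le_power2[of "norm (fst z)"] by linarith
    then have "norm (snd z) * \<bar>\<mu> t z\<bar> \<le> (1 + (norm (fst z))\<^sup>2 + (norm (snd z))\<^sup>2) * (\<bar>\<mu> t z\<bar> + norm (G z))"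
      by (intro mult_mono) auto
    then show "norm (\<mu> t z *\<^sub>R snd z) \<le> (1 + (norm (fst z))\<^sup>2 + (norm (snd z))\<^sup>2) * (\<bar>\<mu> t z\<bar> + norm (G z))"
      by (simp add: mult.commute)
  qed
  have H: "fluxH (k n) (\<mu> t) z = cv h (k n) z" for n z by (rule fluxH_eq_cv[OF i iv kernel(1) h(2,1)])
  \<comment> \<open>Density and flux are paired into one sequence so that a single subsequence
    serves for both.\<close>
  define u where "u n z = (cv (\<mu> t) (k n) z - \<mu> t z, cv h (k n) z - h z)" for n z
  have d1: "integrable lborel (\<lambda>z. cv (\<mu> t) (k n) z - \<mu> t z)" for n
    by (rule Bochner_Integration.integrable_diff[OF cv_integrable[OF i kernel(1)] i])
  have d2: "integrable lborel (\<lambda>z. cv h (k n) z - h z)" for n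
    by (rule Bochner_Integration.integrable_diff[OF cv_integrable[OF h(1) kernel(1)] h(1)])
  have um: "(\<lambda>z. u n z) \<in> borel_measurable lborel" for n
    unfolding u_def using d1[of n] d2[of n] by (intro borel_measurable_Pair) auto
  have un: "norm (u n z) \<le> norm (cv (\<mu> t) (k n) z - \<mu> t z) + norm (cv h (k n) z - h z)" for n z
    unfolding u_def by (rule norm_Pair_le)
  have sI: "integrable lborel (\<lambda>z. norm (cv (\<mu> t) (k n) z - \<mu> t z) + norm (cv h (k n) z - h z))" for n
    using d1[of n] d2[of n] by (intro Bochner_Integration.integrable_add integrable_norm)
  have ui: "integrable lborel (u n)" for n by (rule integrable_le[OF sI um un])
  have ul: "(\<lambda>n. \<integral>z. norm (u n z) \<partial>lborel) \<longlonglongrightarrow> 0"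
  proof (rule real_tendsto_sandwich[OF _ _ tendsto_const])
    show "(\<lambda>n. (\<integral>z. norm (cv (\<mu> t) (k n) z - \<mu> t z) \<partial>lborel) + (\<integral>z. norm (cv h (k n) z - h z) \<partial>lborel)) \<longlonglongrightarrow> 0"
      using tendsto_add[OF moll_L1[OF i] moll_L1[OF h(1)]] by simp
    have "(\<integral>z. norm (u n z) \<partial>lborel) \<le> (\<integral>z. norm (cv (\<mu> t) (k n) z - \<mu> t z) \<partial>lborel) + (\<integral>z. norm (cv h (k n) z - h z) \<partial>lborel)" for n
    proof -
      have "(\<integral>z. norm (u n z) \<partial>lborel) \<le> (\<integral>z. norm (cv (\<mu> t) (k n) z - \<mu> t z) + norm (cv h (k n) z - h z) \<partial>lborel)"
        by (rule integral_mono[OF integrable_norm[OF ui] sI un])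
      also have "\<dots> = (\<integral>z. norm (cv (\<mu> t) (k n) z - \<mu> t z) \<partial>lborel) + (\<integral>z. norm (cv h (k n) z - h z) \<partial>lborel)"
        by (rule Bochner_Integration.integral_add[OF integrable_norm[OF d1] integrable_norm[OF d2]])
      finally show ?thesis .
    qed
    then show "eventually (\<lambda>n. (\<integral>z. norm (u n z) \<partial>lborel) \<le> (\<integral>z. norm (cv (\<mu> t) (k n) z - \<mu> t z) \<partial>lborel) + (\<integral>z. norm (cv h (k n) z - h z) \<partial>lborel)) sequentially"
      by (intro always_eventually allI)
  qed (auto intro!: always_eventually)
  have D: "(\<integral>\<^sup>+z. ennreal ((norm (cv h (k n) z))\<^sup>2 / (cv (\<mu> t) (k n) z + \<kappa> n)) \<partial>lborel) = ennreal (Dmoll (\<kappa> n) (k n) (\<mu> t))" for n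
    using kinetic_mollified.mollified_fisher_nn(1)[OF km t kap(1), of n n] unfolding H .
  have "\<exists>v\<in>borel_measurable lborel. (AE z in lborel. (if \<mu> t z > 0 then ennreal ((norm (h z))\<^sup>2 / \<mu> t z) else if h z = 0 then 0 else \<infinity>) \<le> v z) \<and>
      (\<integral>\<^sup>+z. v z \<partial>lborel) \<le> liminf (\<lambda>n. \<integral>\<^sup>+z. ennreal ((norm (cv h (k n) z))\<^sup>2 / (cv (\<mu> t) (k n) z + \<kappa> n)) \<partial>lborel)"
  proof (rule Fatou_along_L1[OF ui ul])
    show "(\<lambda>z. ennreal ((norm (cv h (k n) z))\<^sup>2 / (cv (\<mu> t) (k n) z + \<kappa> n))) \<in> borel_measurable lborel" for n
      using kinetic_mollified.mollified_fisher_nn(2)[OF km t kap(1), of n n] unfolding H .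
    fix z :: "'a ps" and r :: "nat \<Rightarrow> nat"
    assume r: "strict_mono r" and l: "(\<lambda>n. u (r n) z) \<longlonglongrightarrow> 0"
    have l1: "(\<lambda>n. cv (\<mu> t) (k (r n)) z) \<longlonglongrightarrow> \<mu> t z"
      by (rule LIM_zero_cancel) (use tendsto_fst[OF l] in \<open>simp add: u_def\<close>)
    have l2: "(\<lambda>n. cv h (k (r n)) z) \<longlonglongrightarrow> h z"
      by (rule LIM_zero_cancel) (use tendsto_snd[OF l] in \<open>simp add: u_def\<close>)
    have l3: "(\<lambda>n. \<kappa> (r n)) \<longlonglongrightarrow> 0" using LIMSEQ_subseq_LIMSEQ[OF kap_tendsto r] by (simp add: o_def)
    show "(if \<mu> t z > 0 then ennreal ((norm (h z))\<^sup>2 / \<mu> t z) else if h z = 0 then 0 else \<infinity>)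
       \<le> liminf (\<lambda>n. ennreal ((norm (cv h (k (r n)) z))\<^sup>2 / (cv (\<mu> t) (k (r n)) z + \<kappa> (r n))))"
      by (rule fisher_lsc[OF l1 cv_mu_nonneg[OF t] l2 kap(1) l3])
  qed
  then obtain v where v: "v \<in> borel_measurable lborel"
      "AE z in lborel. (if \<mu> t z > 0 then ennreal ((norm (h z))\<^sup>2 / \<mu> t z) else if h z = 0 then 0 else \<infinity>) \<le> v z"
      "(\<integral>\<^sup>+z. v z \<partial>lborel) \<le> liminf (\<lambda>n. ennreal (Dmoll (\<kappa> n) (k n) (\<mu> t)))"
    unfolding D by blast
  note dl = Dfish_le[OF h(2) mu(2)[OF t] v(1,2)]
  show "Dfish (\<mu> t) \<le> liminf (\<lambda>n. ennreal (Dmoll (\<kappa> n) (k n) (\<mu> t)))"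
    using dl(1)
  proof
    assume "Dfish (\<mu> t) \<le> (\<integral>\<^sup>+z. v z \<partial>lborel)"
    then show ?thesis using v(3) by (rule order_trans)
  next
    assume "(\<integral>\<^sup>+z. v z \<partial>lborel) = \<infinity>"
    then show ?thesis using v(3) by (simp add: top_unique)
  qed
  show "flux_ac (\<mu> t)" if "liminf (\<lambda>n. ennreal (Dmoll (\<kappa> n) (k n) (\<mu> t))) \<noteq> \<infinity>"
    by (rule dl(2)) (use that v(3) in \<open>auto simp: top_unique\<close>)
qed

text \<open>Being a liminf of measurable functions of time, this is measurable, which is not
  established for \<open>Dfish\<close>. It stands in for the limiting dissipation and carries the
  finiteness from which absolute continuity of the flux follows at almost every time.\<close>

definition Dlim :: "real \<Rightarrow> real \<Rightarrow> ennreal" where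
  "Dlim t r = liminf (\<lambda>n. ennreal (indicator {0..t} r * Dmoll (\<kappa> n) (k n) (\<mu> r)))"

lemma Dmoll_indicator:
  assumes t: "t \<in> {0..T}"
  shows "integrable lborel (\<lambda>r. indicator {0..t} r * Dmoll (\<kappa> n) (k n) (\<mu> r))"
    and "0 \<le> indicator {0..t} r * Dmoll (\<kappa> n) (k n) (\<mu> r)"
proof -
  have "set_integrable lborel {0..t} (\<lambda>r. Dmoll (\<kappa> n) (k n) (\<mu> r))"
    by (rule set_integrable_subset[OF Di]) (use t in auto)
  then show "integrable lborel (\<lambda>r. indicator {0..t} r * Dmoll (\<kappa> n) (k n) (\<mu> r))" by (simp add: set_integrable_def)
  show "0 \<le> indicator {0..t} r * Dmoll (\<kappa> n) (k n) (\<mu> r)"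
    using kinetic_mollified.mollified_fisher_nn(3)[OF km _ kap(1), of r n n] t by (auto simp: indicator_def)
qed

lemma Dlim_measurable: "t \<in> {0..T} \<Longrightarrow> Dlim t \<in> borel_measurable lborel"
  unfolding Dlim_def[abs_def]
  by (intro borel_measurable_liminf measurable_compose[OF borel_measurable_integrable[OF Dmoll_indicator(1)] measurable_ennreal])

text \<open>The constant \<open>G6\<close> on both sides keeps all quantities nonnegative. Entropy
  and dissipation pass to the limit separately by Fatou's lemma, superadditivity of the liminf joins
  them, and the right-hand side converges because the initial entropy does.\<close>

lemma limit_inequality:
  assumes t: "t \<in> {0..T}"
  shows "(\<integral>\<^sup>+z. ennreal (entd \<gamma> (\<mu> t) z + W6 z) \<partial>lborel) + ennreal (\<gamma>\<^sup>2 / 2) * (\<integral>\<^sup>+r. Dlim t r \<partial>lborel) \<le> ennreal (Rl t + G6 TYPE('a))"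
    and "0 \<le> Rl t + G6 TYPE('a)"
proof -
  define I where "I n = (LINT r:{0..t}|lborel. Dmoll (\<kappa> n) (k n) (\<mu> r))" for n
  have I: "(\<integral>\<^sup>+r. ennreal (indicator {0..t} r * Dmoll (\<kappa> n) (k n) (\<mu> r)) \<partial>lborel) = ennreal (I n)" and I0: "0 \<le> I n" for n
    unfolding I_def set_lebesgue_integral_def real_scaleR_def
    using Dmoll_indicator[OF t] by (auto intro!: nn_integral_eq_integral Bochner_Integration.integral_nonneg)
  have a0: "0 \<le> Ymoll \<gamma> (\<kappa> n) (cv (\<mu> t) (k n)) + G6 TYPE('a)" for n
    by (rule kinetic_mollified.mollified_entropy_nn(2)[OF km t kap(1)])
  have g2: "0 \<le> \<gamma>\<^sup>2 / 2" by simp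
  have g: "0 \<le> \<gamma>\<^sup>2 / 2 * I n" for n using I0[of n] by simp
  have le: "(Ymoll \<gamma> (\<kappa> n) (cv (\<mu> t) (k n)) + G6 TYPE('a)) + \<gamma>\<^sup>2 / 2 * I n \<le> Rb n t + G6 TYPE('a)" for n
    using ineq[OF t, of n] unfolding Rb_def I_def by linarith
  have "0 \<le> Rb n t + G6 TYPE('a)" for n using le[of n] a0[of n] g[of n] by linarith
  moreover have Rt: "(\<lambda>n. Rb n t + G6 TYPE('a)) \<longlonglongrightarrow> Rl t + G6 TYPE('a)" by (intro tendsto_intros Rb_tendsto)
  ultimately show "0 \<le> Rl t + G6 TYPE('a)" by (intro LIMSEQ_le_const[OF Rt]) auto
  have en: "ennreal (Ymoll \<gamma> (\<kappa> n) (cv (\<mu> t) (k n)) + G6 TYPE('a)) + ennreal (\<gamma>\<^sup>2 / 2) * ennreal (I n) \<le> ennreal (Rb n t + G6 TYPE('a))" for n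
  proof -
    have "ennreal (Ymoll \<gamma> (\<kappa> n) (cv (\<mu> t) (k n)) + G6 TYPE('a)) + ennreal (\<gamma>\<^sup>2 / 2) * ennreal (I n)
        = ennreal (Ymoll \<gamma> (\<kappa> n) (cv (\<mu> t) (k n)) + G6 TYPE('a) + \<gamma>\<^sup>2 / 2 * I n)"
      unfolding ennreal_mult[OF g2 I0, symmetric] by (rule ennreal_plus[OF a0 g, symmetric])
    also have "\<dots> \<le> ennreal (Rb n t + G6 TYPE('a))" by (rule ennreal_leI[OF le])
    finally show ?thesis .
  qed
  have "(\<integral>\<^sup>+r. Dlim t r \<partial>lborel) \<le> liminf (\<lambda>n. ennreal (I n))"
    unfolding Dlim_def I[symmetric]
    by (rule nn_integral_liminf) (intro measurable_compose[OF borel_measurable_integrable[OF Dmoll_indicator(1)[OF t]] measurable_ennreal])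
  then have "ennreal (\<gamma>\<^sup>2 / 2) * (\<integral>\<^sup>+r. Dlim t r \<partial>lborel) \<le> ennreal (\<gamma>\<^sup>2 / 2) * liminf (\<lambda>n. ennreal (I n))"
    by (rule mult_left_mono) simp
  also note ennreal_mult_liminf_le
  finally have 1: "ennreal (\<gamma>\<^sup>2 / 2) * (\<integral>\<^sup>+r. Dlim t r \<partial>lborel) \<le> liminf (\<lambda>n. ennreal (\<gamma>\<^sup>2 / 2) * ennreal (I n))" .
  have "liminf (\<lambda>n. ennreal (Ymoll \<gamma> (\<kappa> n) (cv (\<mu> t) (k n)) + G6 TYPE('a))) + liminf (\<lambda>n. ennreal (\<gamma>\<^sup>2 / 2) * ennreal (I n))
      \<le> ennreal (Rl t + G6 TYPE('a))"
    by (rule liminf_add_le_lim[OF en tendsto_ennrealI[OF Rt]])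
  with add_mono[OF entropy_liminf[OF t] 1]
  show "(\<integral>\<^sup>+z. ennreal (entd \<gamma> (\<mu> t) z + W6 z) \<partial>lborel) + ennreal (\<gamma>\<^sup>2 / 2) * (\<integral>\<^sup>+r. Dlim t r \<partial>lborel) \<le> ennreal (Rl t + G6 TYPE('a))"
    by (rule order_trans)
qed

lemma Dlim_finite:
  assumes t: "t \<in> {0..T}" shows "(\<integral>\<^sup>+r. Dlim t r \<partial>lborel) \<noteq> \<infinity>"
proof
  assume a: "(\<integral>\<^sup>+r. Dlim t r \<partial>lborel) = \<infinity>"
  have "\<gamma>\<^sup>2 > 0" using gam by simp
  then have "ennreal (\<gamma>\<^sup>2 / 2) * (\<integral>\<^sup>+r. Dlim t r \<partial>lborel) = \<infinity>" using a by (simp add: ennreal_mult_top)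
  then show False using limit_inequality(1)[OF t] by (simp add: top_unique)
qed

lemma Dlim_eq: "r \<in> {0..t} \<Longrightarrow> Dlim t r = liminf (\<lambda>n. ennreal (Dmoll (\<kappa> n) (k n) (\<mu> r)))"
  by (simp add: Dlim_def)

text \<open>The bound at time T makes \<open>Dlim T\<close> finite at almost every time, and at each
  such time in the interval the flux is absolutely continuous.\<close>

lemma flux_ac_AE: "AE t in lborel. t \<in> {0<..<T} \<longrightarrow> flux_ac (\<mu> t)"
proof -
  have T1: "T \<in> {0..T}" using T by simp
  have "AE r in lborel. Dlim T r \<noteq> \<infinity>" by (rule nn_integral_PInf_AE[OF Dlim_measurable[OF T1] Dlim_finite[OF T1]])
  then show ?thesis
  proof eventually_elim
    case (elim r)
    then show ?case using fisher_liminf(2)[of r] Dlim_eq[of r T] by auto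
  qed
qed

lemma entropy_dissipation_inequality:
  assumes t: "t \<in> {0..T}"
  shows "Ent (dens (\<mu> t)) (distr gauss2d lborel (Gamma_minus \<gamma>))
      + ereal (1/2 * \<gamma>\<^sup>2) * enn2ereal (\<integral>\<^sup>+r\<in>{0..t}. Dfish (\<mu> r) \<partial>lborel)
    \<le> Ent (dens (\<mu> 0)) (distr gauss2d lborel (Gamma_minus \<gamma>)) * ereal (exp (lamK c * t))
      + ereal (betaG c c0 TYPE('a) / lamK c * (exp (lamK c * t) - 1))"
proof -
  have [measurable]: "\<mu> t \<in> borel_measurable borel" by (rule mu(1)[OF t])
  have [measurable]: "(W6 :: 'a ps \<Rightarrow> real) \<in> borel_measurable borel" using W6_integrable by auto
  define J where "J = (\<integral>\<^sup>+r\<in>{0..t}. Dfish (\<mu> r) \<partial>lborel)"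
  \<comment> \<open>Monotonicity of the nonnegative integral holds also for an integrand whose
    measurability in time is unknown, as here for \<open>Dfish\<close>.\<close>
  have JD: "J \<le> (\<integral>\<^sup>+r. Dlim t r \<partial>lborel)"
    unfolding J_def
  proof (rule nn_integral_mono)
    fix r
    show "Dfish (\<mu> r) * indicator {0..t} r \<le> Dlim t r"
      using fisher_liminf(1)[of r] Dlim_eq[of r t] t by (auto simp: indicator_def)
  qed
  define j where "j = enn2real J"
  have "J \<noteq> \<infinity>" using JD Dlim_finite[OF t] by (auto simp: top_unique)
  then have j: "J = ennreal j" "0 \<le> j" by (simp_all add: j_def less_top)
  have e0: "0 \<le> entd \<gamma> (\<mu> t) z + W6 z" for z by (rule entd_lower[OF gam mu(2)[OF t]])
  have "(\<integral>\<^sup>+z. ennreal (entd \<gamma> (\<mu> t) z + W6 z) \<partial>lborel) \<le> ennreal (Rl t + G6 TYPE('a))"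
    by (rule order_trans[OF add_increasing2 limit_inequality(1)[OF t]]) auto
  then have Zf: "(\<integral>\<^sup>+z. ennreal (entd \<gamma> (\<mu> t) z + W6 z) \<partial>lborel) < \<infinity>"
    by (simp add: le_less_trans[OF _ ennreal_less_top])
  \<comment> \<open>Finiteness of the integral with the Gaussian makes the entropy density
    integrable, which the formula for \<open>Ent\<close> requires. The extended inequality can then
    be read in the reals and the Gaussian cancelled.\<close>
  have ig: "integrable lborel (\<lambda>z. entd \<gamma> (\<mu> t) z + W6 z)"
    by (rule integrableI_nonneg[OF _ _ Zf]) (use e0 in \<open>auto simp: entd_def\<close>)
  have ie: "integrable lborel (entd \<gamma> (\<mu> t))"
    using Bochner_Integration.integrable_diff[OF ig W6_integrable] by simp
  define E where "E = (\<integral>z. entd \<gamma> (\<mu> t) z \<partial>lborel)"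
  have EG: "(\<integral>z. entd \<gamma> (\<mu> t) z + W6 z \<partial>lborel) = E + G6 TYPE('a)"
    unfolding E_def G6_def by (rule Bochner_Integration.integral_add[OF ie W6_integrable])
  have E0': "0 \<le> E + G6 TYPE('a)" unfolding EG[symmetric] using e0 by (intro Bochner_Integration.integral_nonneg) auto
  have Z: "(\<integral>\<^sup>+z. ennreal (entd \<gamma> (\<mu> t) z + W6 z) \<partial>lborel) = ennreal (E + G6 TYPE('a))"
    unfolding EG[symmetric] using ig e0 by (intro nn_integral_eq_integral) auto
  have gj: "0 \<le> \<gamma>\<^sup>2 / 2 * j" using j by simp
  have "ennreal (E + G6 TYPE('a)) + ennreal (\<gamma>\<^sup>2 / 2) * J \<le> ennreal (Rl t + G6 TYPE('a))"
    by (rule order_trans[OF add_left_mono[OF mult_left_mono[OF JD]] limit_inequality(1)[OF t, unfolded Z]]) simp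
  moreover have "ennreal (\<gamma>\<^sup>2 / 2) * J = ennreal (\<gamma>\<^sup>2 / 2 * j)" unfolding j(1) using j(2) by (intro ennreal_mult[symmetric]) auto
  ultimately have "ennreal (E + G6 TYPE('a) + \<gamma>\<^sup>2 / 2 * j) \<le> ennreal (Rl t + G6 TYPE('a))"
    using E0' gj by (simp only: ennreal_plus)
  then have "E + G6 TYPE('a) + \<gamma>\<^sup>2 / 2 * j \<le> Rl t + G6 TYPE('a)" using limit_inequality(2)[OF t] by (simp only: ennreal_le_iff)
  then have fin: "E + \<gamma>\<^sup>2 / 2 * j \<le> Rl t" by linarith
  have "Ent (dens (\<mu> t)) (distr gauss2d lborel (Gamma_minus \<gamma>)) = ereal E" unfolding E_def by (rule Ent_formula[OF dens[OF t] ie])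
  moreover have "Ent (dens (\<mu> 0)) (distr gauss2d lborel (Gamma_minus \<gamma>)) = ereal E0" unfolding E0_def by (rule Ent_formula[OF dens[OF T0] initial(2)])
  moreover have "enn2ereal J = ereal j" unfolding j(1) by (rule enn2ereal_ennreal[OF j(2)])
  ultimately show ?thesis using fin unfolding J_def[symmetric] by (simp add: Rl_def)
qed

end

context kinetic begin

lemma kinetic_sequence_exists:
  assumes wg: "\<And>t. t \<in> {0..T} \<Longrightarrow> \<exists>G. weak_grad (\<mu> t) G \<and>
      integrable lborel (\<lambda>z. (1 + (norm (fst z))\<^sup>2 + (norm (snd z))\<^sup>2) * (\<bar>\<mu> t z\<bar> + norm (G z)))"
  shows "\<exists>M s \<kappa> k. kinetic_sequence \<gamma> c c0 T \<mu> F M s \<kappa> k"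
proof -
  obtain M where M: "\<And>t. t \<in> {0..T} \<Longrightarrow> integrable lborel (\<lambda>z. (1 + norm z)^4 * \<mu> t z)"
      "\<And>t. t \<in> {0..T} \<Longrightarrow> (\<integral>z. (1 + norm z)^4 * \<mu> t z \<partial>lborel) \<le> M"
    using fourth_moment_bound by blast
  define P where "P n s k \<longleftrightarrow> kinetic_mollified \<gamma> c c0 T \<mu> F M s k \<and> (\<forall>z. k z \<noteq> 0 \<longrightarrow> norm z \<le> 1 / real (Suc n))" for n s k
  have "\<exists>s k. P n s k" for n
  proof -
    \<comment> \<open>Half of 1/(n+1), since position and velocity radii add up and the velocity
      radius is at most d because \<gamma> is at least 1.\<close>
    define d where "d = 1 / (2 * real (Suc n))"
    have d: "d > 0" "d \<le> 1/2" by (auto simp: d_def field_simps)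
    have g2: "1 \<le> \<gamma>\<^sup>2" and g0: "0 < \<gamma>\<^sup>2" using gam by auto
    obtain k :: "'d ps \<Rightarrow> real" and s where k: "test_fun k" "\<And>z. 0 \<le> k z" "(\<integral>z. k z \<partial>lborel) = 1"
        "\<And>z. k z \<noteq> 0 \<Longrightarrow> norm (fst z) \<le> d \<and> norm (snd z) \<le> s" "0 < s"
        "\<gamma>\<^sup>2 * s * (1 + (\<Sum>i\<in>Basis. \<integral>z. \<bar>pd k (i, 0) z\<bar> \<partial>lborel)) \<le> d"
      using product_kernel_exists[OF d(1) g0, where 'a="real^'d" and 'b="real^'d"] by blast
    have S: "0 \<le> (\<Sum>i\<in>Basis. \<integral>z. \<bar>pd k (i, 0) z\<bar> \<partial>lborel)" by (intro sum_nonneg Bochner_Integration.integral_nonneg) auto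
    have "1 * s * 1 \<le> \<gamma>\<^sup>2 * s * (1 + (\<Sum>i\<in>Basis. \<integral>z. \<bar>pd k (i, 0) z\<bar> \<partial>lborel))"
      using g2 k(5) S by (intro mult_mono) auto
    then have sd: "s \<le> d" using k(6) by simp
    have "norm z \<le> 1 / real (Suc n)" if "k z \<noteq> 0" for z
    proof -
      have "norm z \<le> norm (fst z) + norm (snd z)" using norm_Pair_le[of "fst z" "snd z"] by simp
      also have "\<dots> \<le> d + d" using k(4)[OF that] sd by linarith
      also have "d + d = 1 / real (Suc n)" by (simp add: d_def field_simps)
      finally show ?thesis .
    qed
    moreover have "kinetic_mollified \<gamma> c c0 T \<mu> F M s k"
    proof unfold_locales
      show "norm (fst z) \<le> 1 \<and> norm (snd z) \<le> s" if "k z \<noteq> 0" for z using k(4)[OF that] d by linarith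
      show "s \<le> 1 / 2" using sd d(2) by linarith
      show "\<gamma>\<^sup>2 * s * (1 + (\<Sum>i\<in>Basis. \<integral>z. \<bar>pd k (i, 0) z\<bar> \<partial>lborel)) \<le> 1" using k(6) d(2) by linarith
    qed (fact M k)+
    ultimately show ?thesis unfolding P_def by blast
  qed
  then obtain s k where sk: "\<And>n. P n (s n) (k n)" by metis
  have km: "kinetic_mollified \<gamma> c c0 T \<mu> F M (s n) (k n)" and sp: "k n z \<noteq> 0 \<Longrightarrow> norm z \<le> 1 / real (Suc n)" for n z
    using sk[of n] unfolding P_def by blast+
  define Q where "Q n \<kappa> \<longleftrightarrow> 0 < \<kappa> \<and> \<kappa> \<le> 1 / real (Suc n) \<and> set_integrable lborel {0..T} (\<lambda>r. Dmoll \<kappa> (k n) (\<mu> r)) \<and>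
     (\<forall>t\<in>{0..T}. Ymoll \<gamma> \<kappa> (cv (\<mu> t) (k n)) + (\<gamma>\<^sup>2 / 2) * (LINT r:{0..t}|lborel. Dmoll \<kappa> (k n) (\<mu> r))
       \<le> (Ymoll \<gamma> \<kappa> (cv (\<mu> 0) (k n)) + 1 / real (Suc n)) * exp (lamK c * t) + betaG c c0 TYPE('d) / lamK c * (exp (lamK c * t) - 1))" for n \<kappa>
  have "\<exists>\<kappa>. Q n \<kappa>" for n
    unfolding Q_def by (rule kinetic_mollified.mollified_inequality[OF km]) simp
  then obtain \<kappa> where \<kappa>: "\<And>n. Q n (\<kappa> n)" by metis
  have "kinetic_sequence \<gamma> c c0 T \<mu> F M s \<kappa> k"
  proof (intro kinetic_sequence.intro kinetic_sequence_axioms.intro kinetic_axioms)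
    show "0 < \<kappa> n" "\<kappa> n \<le> 1 / real (Suc n)" "set_integrable lborel {0..T} (\<lambda>r. Dmoll (\<kappa> n) (k n) (\<mu> r))" for n
      using \<kappa>[of n] unfolding Q_def by simp_all
    show "Ymoll \<gamma> (\<kappa> n) (cv (\<mu> t) (k n)) + (\<gamma>\<^sup>2 / 2) * (LINT r:{0..t}|lborel. Dmoll (\<kappa> n) (k n) (\<mu> r))
       \<le> (Ymoll \<gamma> (\<kappa> n) (cv (\<mu> 0) (k n)) + 1 / real (Suc n)) * exp (lamK c * t) + betaG c c0 TYPE('d) / lamK c * (exp (lamK c * t) - 1)"
      if t: "t \<in> {0..T}" for n t
      using \<kappa>[of n] t unfolding Q_def by blast
  qed (fact km sp wg)+
  then show ?thesis by blast
qed

end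

lemma gaussC_nonneg: "0 \<le> gaussC TYPE('d::finite)"
  unfolding gaussC_def by (intro Bochner_Integration.integral_nonneg) auto

theorem theoremA4:
  fixes \<Phi> K :: "real^'d::finite \<Rightarrow> real" and c\<^sub>\<Phi> c\<^sub>0 T :: real
  assumes Phi_nonneg: "\<forall>x. \<Phi> x \<ge> 0"
    and Phi_loclip: "\<forall>x. \<exists>r>0. \<exists>L. L-lipschitz_on (ball x r) \<Phi>"
    and Phi_diff: "\<forall>x. \<Phi> differentiable (at x)"
    and Phi_grad_growth: "\<forall>x. norm (grad \<Phi> x) \<le> c\<^sub>\<Phi> * (1 + norm x)"
    and Phi_grad_lip: "\<exists>L. L-lipschitz_on UNIV (grad \<Phi>)"
    and Phi_moment: "\<forall>r\<ge>1. \<exists>C. \<forall>x. norm (grad \<Phi> x) powr r * exp (- \<Phi> x) \<le> C"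
    and c_pos: "c\<^sub>\<Phi> > 0" "c\<^sub>0 > 0"
    and T_pos: "T > 0"
  shows "\<exists>\<alpha> \<beta> lam. \<alpha> > 0 \<and> \<beta> > 0 \<and> lam > 0 \<and>
    (\<forall>\<epsilon> \<gamma> \<mu>0 \<mu>. \<epsilon> > 0 \<longrightarrow> \<gamma> \<ge> 1 \<longrightarrow>
      test_fun \<mu>0 \<longrightarrow> prob_dens \<mu>0 \<longrightarrow>
      Ent (dens \<mu>0) (distr gauss2d lborel (Gamma_minus \<gamma>)) < \<infinity> \<longrightarrow>
      kfp_solution \<epsilon> \<gamma> \<Phi> K T \<mu>0 \<mu> \<longrightarrow>
      (\<forall>t\<in>{0..T}. \<exists>G. weak_grad (\<mu> t) G \<and>
         integrable lborel (\<lambda>z. (1 + (norm (fst z))\<^sup>2 + (norm (snd z))\<^sup>2) * (\<bar>\<mu> t z\<bar> + norm (G z))) \<and>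
         (\<exists>C. AE z in lborel. (1 + (norm (fst z))\<^sup>2 + (norm (snd z))\<^sup>2) * (\<bar>\<mu> t z\<bar> + norm (G z)) \<le> C)) \<longrightarrow>
      (\<forall>x. \<forall>t\<in>{0..T}. norm (Feps \<epsilon> \<Phi> K x (distr (dens (\<mu> t)) lborel fst)) \<le> c\<^sub>\<Phi> * (1 + norm x) + c\<^sub>0) \<longrightarrow>
      ((\<forall>t\<in>{0..T}.
         Ent (dens (\<mu> t)) (distr gauss2d lborel (Gamma_minus \<gamma>))
           + ereal (\<alpha> * \<gamma>\<^sup>2) * enn2ereal (\<integral>\<^sup>+r\<in>{0..t}. Dfish (\<mu> r) \<partial>lborel)
         \<le> Ent (dens \<mu>0) (distr gauss2d lborel (Gamma_minus \<gamma>)) * ereal (exp (lam * t))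
           + ereal (\<beta> / lam * (exp (lam * t) - 1)))
      \<and> (AE t in lborel. t \<in> {0<..<T} \<longrightarrow> flux_ac (\<mu> t))))"
\<comment> \<open>The value 1/2 is the share of the dissipation left after Young's inequality has
  absorbed force and commutator. The other two witnesses are built from the growth constants of the
  force and the dimension.\<close>
proof (rule exI[of _ "1/2"], rule exI[of _ "betaG c\<^sub>\<Phi> c\<^sub>0 TYPE('d)"], rule exI[of _ "lamK c\<^sub>\<Phi>"], intro conjI allI impI)
  show lam: "lamK c\<^sub>\<Phi> > 0" by (simp add: lamK_def add_pos_nonneg)
  have "0 \<le> lamK c\<^sub>\<Phi> * gaussC TYPE('d)" by (intro mult_nonneg_nonneg gaussC_nonneg less_imp_le lam)
  moreover have "0 \<le> 5 * (2 * c\<^sub>\<Phi> + c\<^sub>0)\<^sup>2" by simp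
  ultimately show "betaG c\<^sub>\<Phi> c\<^sub>0 TYPE('d) > 0" unfolding betaG_def by linarith
  show "(1/2 :: real) > 0" by simp
  fix \<epsilon> \<gamma> :: real and \<mu>0 :: "'d ps \<Rightarrow> real" and \<mu> :: "real \<Rightarrow> 'd ps \<Rightarrow> real"
  assume g: "\<gamma> \<ge> 1" and tf: "test_fun \<mu>0" and sol: "kfp_solution \<epsilon> \<gamma> \<Phi> K T \<mu>0 \<mu>"
    and wg: "\<forall>t\<in>{0..T}. \<exists>G. weak_grad (\<mu> t) G \<and>
         integrable lborel (\<lambda>z. (1 + (norm (fst z))\<^sup>2 + (norm (snd z))\<^sup>2) * (\<bar>\<mu> t z\<bar> + norm (G z))) \<and>
         (\<exists>C. AE z in lborel. (1 + (norm (fst z))\<^sup>2 + (norm (snd z))\<^sup>2) * (\<bar>\<mu> t z\<bar> + norm (G z)) \<le> C)"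
    and Fb: "\<forall>x. \<forall>t\<in>{0..T}. norm (Feps \<epsilon> \<Phi> K x (distr (dens (\<mu> t)) lborel fst)) \<le> c\<^sub>\<Phi> * (1 + norm x) + c\<^sub>0"
  \<comment> \<open>The nonlinear force is frozen along the given solution into a field on phase
    space; its assumed growth bound and the weak equation are passed on.\<close>
  define F where "F t z = Feps \<epsilon> \<Phi> K (fst z) (distr (dens (\<mu> t)) lborel fst)" for t and z :: "'d ps"
  have mu0: "\<mu> 0 = \<mu>0" and dn: "\<And>t. t \<in> {0..T} \<Longrightarrow> prob_dens (\<mu> t)"
    and wk: "\<And>\<phi> t. test_fun \<phi> \<Longrightarrow> t \<in> {0..T} \<Longrightarrow>
        (\<forall>r\<in>{0..T}. integrable lborel (\<lambda>z. \<mu> r z * kgen \<gamma> (F r) \<phi> z)) \<and>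
        set_integrable lborel {0..t} (\<lambda>r. \<integral>z. \<mu> r z * kgen \<gamma> (F r) \<phi> z \<partial>lborel) \<and>
        (\<integral>z. \<phi> z * \<mu> t z \<partial>lborel) = (\<integral>z. \<phi> z * \<mu>0 z \<partial>lborel) + (LINT r:{0..t}|lborel. \<integral>z. \<mu> r z * kgen \<gamma> (F r) \<phi> z \<partial>lborel)"
    using sol unfolding kfp_solution_def Let_def kgen_def F_def by blast+
  have T1: "T \<in> {0..T}" using T_pos by simp
  have "kinetic \<gamma> c\<^sub>\<Phi> c\<^sub>0 T \<mu> F"
  proof unfold_locales
    show "norm (F t z) \<le> c\<^sub>\<Phi> * (1 + norm (fst z)) + c\<^sub>0" if "t \<in> {0..T}" for t z using Fb that by (simp add: F_def)
  qed (use g c_pos T_pos dn tf mu0 wk T1 in auto)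
  then interpret kinetic \<gamma> c\<^sub>\<Phi> c\<^sub>0 T \<mu> F .
  obtain M s \<kappa> k where "kinetic_sequence \<gamma> c\<^sub>\<Phi> c\<^sub>0 T \<mu> F M s \<kappa> k" using kinetic_sequence_exists wg by blast
  then interpret kinetic_sequence \<gamma> c\<^sub>\<Phi> c\<^sub>0 T \<mu> F M s \<kappa> k .
  show "AE t in lborel. t \<in> {0<..<T} \<longrightarrow> flux_ac (\<mu> t)" by (rule flux_ac_AE)
  show "\<forall>t\<in>{0..T}. Ent (dens (\<mu> t)) (distr gauss2d lborel (Gamma_minus \<gamma>))
           + ereal (1/2 * \<gamma>\<^sup>2) * enn2ereal (\<integral>\<^sup>+r\<in>{0..t}. Dfish (\<mu> r) \<partial>lborel)
         \<le> Ent (dens \<mu>0) (distr gauss2d lborel (Gamma_minus \<gamma>)) * ereal (exp (lamK c\<^sub>\<Phi> * t))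
           + ereal (betaG c\<^sub>\<Phi> c\<^sub>0 TYPE('d) / lamK c\<^sub>\<Phi> * (exp (lamK c\<^sub>\<Phi> * t) - 1))"
    using entropy_dissipation_inequality unfolding mu0 by blast
qed

end
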